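(* Let $\phi:X\to X$ be a local homeomorphism on a locally compact second countable Hausdorff space $X$, let $c:\Gamma_\phi\to\mathbb R$ be a continuous homomorphism, and let $\beta\in\mathbb R$. There is a bijective correspondence between the $(\Gamma_\phi,c)$-conformal measures $m$ on $X$ with exponent $\beta$ and the gauge-invariant $\beta$-KMS weights for the action $\sigma^c$ on $C^*_r(\Gamma_\phi)$. The gauge-invariant $\beta$-KMS weight $\varphi_m$ associated to $m$ is $$\varphi_m(\cdot)=\int_XP(\cdot)\,dm.$$
   Context: **The groupoid $\Gamma_\phi$.** $\Gamma_\phi=\{(x,k,y)\in X\times\mathbb Z\times X:\exists n,m\in\mathbb N,\ k=n-m,\ \phi^n(x)=\phi^m(y)\}$ with $(x,k,y)(y,k',y')=(x,k+k',y')$, $(x,k,y)^{-1}=(y,-k,x)$, $r(x,k,y)=x$, $s(x,k,y)=y$, unit space identified with $X$ via $x\mapsto(x,0,x)$. The set $\Gamma_\phi(k,n)=\{(x,k,y):\phi^{k+n}(x)=\phi^n(y)\}$ ($n\ge0$, $n+k\ge0$) has the relative topology from $X\times\mathbb Z\times X$, $\Gamma_\phi(k)=\bigcup_n\Gamma_\phi(k,n)$ the inductive limit topology, and each $\Gamma_\phi(k)$ is open and closed in $\Gamma_\phi=\bigcup_k\Gamma_\phi(k)$. This makes $\Gamma_\phi$ an étale second countable locally compact Hausdorff groupoid. **Groupoid algebras.** For an étale second countable locally compact Hausdorff groupoid $\mathcal G$, $C^*_r(\mathcal G)$ is the reduced groupoid $C^*$-algebra (the completion of the convolution $*$-algebra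 $C_c(\mathcal G)$ in the norm given by the regular representations on $l^2(s^{-1}(x))$, $x\in\mathcal G^{(0)}$), and $P:C^*_r(\mathcal G)\to C_0(\mathcal G^{(0)})$ is the conditional expectation extending restriction of functions from $C_c(\mathcal G)$ to $\mathcal G^{(0)}$. A continuous homomorphism $c:\mathcal G\to\mathbb R$ satisfies $c(gh)=c(g)+c(h)$ when $s(g)=r(h)$, and gives a continuous one-parameter group $\sigma^c$ on $C^*_r(\mathcal G)$ with $\sigma^c_t(f)(g)=e^{itc(g)}f(g)$, $f\in C_c(\mathcal G)$. The gauge action on $C^*_r(\Gamma_\phi)$ is $\gamma=\sigma^{c_0}$ with $c_0(x,k,y)=k$; gauge-invariant means $\psi\circ\gamma_t=\psi$ for all $t$. **Conformal measures.** All measures are non-zero regular Borel measures (finite on compact sets). $m$ on $\mathcal G^{(0)}$ is $(\mathcal G,c)$-conformal with exponent $\beta$ when $m(s(W))=\int_{r(W)}e^{\beta c(r_W^{-1}(x))}\,dm(x)$ for every open bi-section $W\subseteq\mathcal G$ (an open set on which $r$ and $s$ are injective), where $r_W^{-1}$ is the inverse of $r:W\to r(W)$. **KMS weights.** A weight on a $C^*$-algebra $A$ is a map $\psi:A_+\to[0,\infty]$ with $\psi(a+b)=\psi(a)+\psi(b)$, $\psi(\lambda a)=\lambda\psi(a)$ for $\lambda>0$. It is proper when it is non-zero, densely defined ($\{a\in A_+:\psi(a)<\infty\}$ is dense in $A_+$) and lower semi-continuous ($\{a\in A_+:\psi(a)\le\alpha\}$ is closed for all $\alpha\ge0$). For proper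 $\psi$ put $\mathcal N_\psi=\{a\in A:\psi(a^*a)<\infty\}$; $\psi$ extends uniquely to a linear functional, also denoted $\psi$, on $\mathrm{Span}\{a^*b:a,b\in\mathcal N_\psi\}$. For a point-wise norm-continuous one-parameter group $\alpha$ of automorphisms of $A$ and $\beta\in\mathbb R$, a proper weight $\psi$ is a $\beta$-KMS weight for $\alpha$ when (i) $\psi\circ\alpha_t=\psi$ for all $t\in\mathbb R$, and (ii) for all $a,b\in\mathcal N_\psi\cap\mathcal N_\psi^*$ there is a continuous bounded function $F$ on the closed strip $D_\beta$ of complex numbers with imaginary part between $0$ and $\beta$, holomorphic in its interior, with $F(t)=\psi(a\alpha_t(b))$ and $F(t+i\beta)=\psi(\alpha_t(b)a)$ for all $t\in\mathbb R$. *)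

theory Defs
  imports "HOL-Analysis.Analysis"
begin

section \<open>The Hilbert space of square-summable families\<close>

typedef 'a l2 = "{\<xi> :: 'a \<Rightarrow> complex. (\<lambda>g. (cmod (\<xi> g))\<^sup>2) summable_on UNIV}"
  morphisms l2_fun Abs_l2
  by (intro exI[of _ "\<lambda>_. 0"]) auto

setup_lifting type_definition_l2

lemma l2_summable_mult:
  assumes "(\<lambda>g. (cmod (x g))\<^sup>2) summable_on UNIV" "(\<lambda>g. (cmod (y g))\<^sup>2) summable_on UNIV"
  shows "(\<lambda>g. cnj (x g) * y g) summable_on UNIV"
proof -
  have "(\<lambda>g. cmod (cnj (x g) * y g)) summable_on UNIV"
  proof (rule summable_on_comparison_test[OF summable_on_add[OF assms]])
    fix g
    have "0 \<le> (cmod (x g) - cmod (y g))\<^sup>2" by simp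
    then have "2 * (cmod (x g) * cmod (y g)) \<le> (cmod (x g))\<^sup>2 + (cmod (y g))\<^sup>2"
      by (simp add: power2_diff)
    moreover have "0 \<le> cmod (x g) * cmod (y g)" by simp
    ultimately show "cmod (cnj (x g) * y g) \<le> (cmod (x g))\<^sup>2 + (cmod (y g))\<^sup>2"
      unfolding norm_mult complex_mod_cnj by linarith
  qed auto
  then show ?thesis by (rule abs_summable_summable)
qed

lemma l2_summable_add:
  assumes "(\<lambda>g. (cmod (x g))\<^sup>2) summable_on UNIV" "(\<lambda>g. (cmod (y g))\<^sup>2) summable_on UNIV"
  shows "(\<lambda>g. (cmod (x g + y g))\<^sup>2) summable_on UNIV"
proof (rule summable_on_comparison_test)
  show "(\<lambda>g. 2 * ((cmod (x g))\<^sup>2 + (cmod (y g))\<^sup>2)) summable_on UNIV"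
    by (intro summable_on_cmult_right summable_on_add assms)
  fix g
  have "(cmod (x g + y g))\<^sup>2 \<le> (cmod (x g) + cmod (y g))\<^sup>2"
    by (intro power_mono norm_triangle_ineq) auto
  also have "\<dots> \<le> 2 * ((cmod (x g))\<^sup>2 + (cmod (y g))\<^sup>2)"
    using sum_squares_bound[of "cmod (x g)" "cmod (y g)"] by (simp add: power2_sum)
  finally show "(cmod (x g + y g))\<^sup>2 \<le> 2 * ((cmod (x g))\<^sup>2 + (cmod (y g))\<^sup>2)" .
qed auto

lift_definition l2_scale :: "complex \<Rightarrow> 'a l2 \<Rightarrow> 'a l2" is "\<lambda>z \<xi> g. z * \<xi> g"
  by (simp add: norm_mult power_mult_distrib summable_on_cmult_right)

lift_definition l2_cinner :: "'a l2 \<Rightarrow> 'a l2 \<Rightarrow> complex" is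
  "\<lambda>\<xi> \<eta>. \<Sum>\<^sub>\<infinity>g. cnj (\<xi> g) * \<eta> g" .

instantiation l2 :: (type) real_inner
begin

lift_definition zero_l2 :: "'a l2" is "\<lambda>_. 0" by simp
lift_definition plus_l2 :: "'a l2 \<Rightarrow> 'a l2 \<Rightarrow> 'a l2" is "\<lambda>\<xi> \<eta> g. \<xi> g + \<eta> g"
  by (rule l2_summable_add)
lift_definition uminus_l2 :: "'a l2 \<Rightarrow> 'a l2" is "\<lambda>\<xi> g. - \<xi> g" by simp
lift_definition minus_l2 :: "'a l2 \<Rightarrow> 'a l2 \<Rightarrow> 'a l2" is "\<lambda>\<xi> \<eta> g. \<xi> g - \<eta> g"
  using l2_summable_add[of _ "\<lambda>g. - _ g"] by fastforce
lift_definition scaleR_l2 :: "real \<Rightarrow> 'a l2 \<Rightarrow> 'a l2" is "\<lambda>r \<xi> g. r *\<^sub>R \<xi> g"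
  by (simp add: power_mult_distrib summable_on_cmult_right)

definition inner_l2 :: "'a l2 \<Rightarrow> 'a l2 \<Rightarrow> real" where "inner_l2 \<xi> \<eta> = Re (l2_cinner \<xi> \<eta>)"
definition norm_l2 :: "'a l2 \<Rightarrow> real" where "norm_l2 \<xi> = sqrt (inner \<xi> \<xi>)"
definition sgn_l2 :: "'a l2 \<Rightarrow> 'a l2" where "sgn_l2 \<xi> = inverse (norm \<xi>) *\<^sub>R \<xi>"
definition dist_l2 :: "'a l2 \<Rightarrow> 'a l2 \<Rightarrow> real" where "dist_l2 \<xi> \<eta> = norm (\<xi> - \<eta>)"
definition uniformity_l2 :: "('a l2 \<times> 'a l2) filter" where
  "uniformity_l2 = (INF e\<in>{0<..}. principal {(x, y). dist x y < e})"
definition open_l2 :: "'a l2 set \<Rightarrow> bool" where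
  "open_l2 U = (\<forall>x\<in>U. eventually (\<lambda>(x', y). x' = x \<longrightarrow> y \<in> U) uniformity)"

lemma inner_l2_infsum:
  "inner \<xi> \<eta> = (\<Sum>\<^sub>\<infinity>g. Re (cnj (l2_fun \<xi> g) * l2_fun \<eta> g))"
  "(\<lambda>g. Re (cnj (l2_fun \<xi> g) * l2_fun \<eta> g)) summable_on UNIV"
proof -
  have *: "(\<lambda>g. cnj (l2_fun \<xi> g) * l2_fun \<eta> g) summable_on UNIV"
    using l2_fun[of \<xi>] l2_fun[of \<eta>] by (intro l2_summable_mult) auto
  show "(\<lambda>g. Re (cnj (l2_fun \<xi> g) * l2_fun \<eta> g)) summable_on UNIV"
    by (rule summable_on_Re[OF *])
  show "inner \<xi> \<eta> = (\<Sum>\<^sub>\<infinity>g. Re (cnj (l2_fun \<xi> g) * l2_fun \<eta> g))"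
    unfolding inner_l2_def l2_cinner.rep_eq by (rule infsum_Re[OF *, symmetric])
qed

instance
proof
  fix x y z :: "'a l2" and r s :: real
  show "x + y + z = x + (y + z)" "x + y = y + x" "0 + x = x" "- x + x = 0" "x - y = x + - y"
    by (transfer; auto simp: algebra_simps)+
  show "r *\<^sub>R (x + y) = r *\<^sub>R x + r *\<^sub>R y" "(r + s) *\<^sub>R x = r *\<^sub>R x + s *\<^sub>R x"
    "r *\<^sub>R s *\<^sub>R x = (r * s) *\<^sub>R x" "1 *\<^sub>R x = x"
    by (transfer; auto simp: algebra_simps)+
  show "sgn x = inverse (norm x) *\<^sub>R x" by (rule sgn_l2_def)
  show "dist x y = norm (x - y)" by (rule dist_l2_def)
  show "uniformity = (INF e\<in>{0<..}. principal {(x :: 'a l2, y). dist x y < e})"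
    by (rule uniformity_l2_def)
  show "open U = (\<forall>x\<in>U. eventually (\<lambda>(x', y). x' = x \<longrightarrow> y \<in> U) uniformity)"
    for U :: "'a l2 set"
    by (rule open_l2_def)
  show "norm x = sqrt (inner x x)" by (rule norm_l2_def)
  show "inner x y = inner y x"
    unfolding inner_l2_infsum(1) by (intro infsum_cong) (auto simp: algebra_simps)
  show "inner (x + y) z = inner x z + inner y z"
    unfolding inner_l2_infsum(1) infsum_add[OF inner_l2_infsum(2) inner_l2_infsum(2), symmetric]
    by (intro infsum_cong) (auto simp: plus_l2.rep_eq algebra_simps)
  show "inner (r *\<^sub>R x) y = r * inner x y"
    unfolding inner_l2_infsum(1) infsum_cmult_right'[symmetric]
    by (intro infsum_cong) (auto simp: scaleR_l2.rep_eq algebra_simps)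
  have sq: "Re (cnj w * w) = (cmod w)\<^sup>2" for w
    by (simp add: cmod_def power2_eq_square)
  show "0 \<le> inner x x"
    unfolding inner_l2_infsum(1) sq by (intro infsum_nonneg) auto
  show "inner x x = 0 \<longleftrightarrow> x = 0"
  proof
    assume 0: "inner x x = 0"
    have le: "(\<Sum>\<^sub>\<infinity>g. (cmod (l2_fun x g))\<^sup>2) \<le> 0"
      using 0 unfolding inner_l2_infsum(1) sq by (rule eq_refl)
    have "(cmod (l2_fun x g))\<^sup>2 = 0" for g
      by (rule nonneg_infsum_le_0D[OF le inner_l2_infsum(2)[of x x, unfolded sq]]) simp_all
    then show "x = 0"
      by (simp add: l2_fun_inject[symmetric] zero_l2.rep_eq fun_eq_iff)
  next
    assume "x = 0"
    then show "inner x x = 0" by (simp add: inner_l2_infsum(1) zero_l2.rep_eq)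
  qed
qed

end

type_synonym 'a l2op = "'a l2 \<Rightarrow>\<^sub>L 'a l2"

text \<open>
  \<open>'a l2op\<close> consists of the bounded real-linear operators, because the library's operator type is
  a real one. The C*-algebras below are sets of complex-linear operators. \<open>op_adj\<close> is the Hilbert
  space adjoint with respect to the complex inner product, hence is meaningful exactly for
  complex-linear operators.
\<close>

definition op_scale :: "complex \<Rightarrow> 'a l2op \<Rightarrow> 'a l2op" where
  "op_scale z a = Blinfun (\<lambda>\<xi>. l2_scale z (blinfun_apply a \<xi>))"

definition op_adj :: "'a l2op \<Rightarrow> 'a l2op" where
  "op_adj a = (THE b. \<forall>\<xi> \<eta>. l2_cinner (blinfun_apply a \<xi>) \<eta> = l2_cinner \<xi> (blinfun_apply b \<eta>))"


section \<open>Weights and KMS weights on a C*-algebra of operators\<close>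

definition pos_cone :: "'a l2op set \<Rightarrow> 'a l2op set" where
  "pos_cone A = {op_adj a o\<^sub>L a | a. a \<in> A}"

text \<open>
  Weights are functions on the positive cone; they are taken to be \<open>undefined\<close> elsewhere, so that
  two weights are equal as soon as they agree on the positive cone.
\<close>

definition weight :: "'a l2op set \<Rightarrow> ('a l2op \<Rightarrow> ennreal) \<Rightarrow> bool" where
  "weight A \<psi> \<longleftrightarrow>
     \<psi> \<in> extensional (pos_cone A) \<and>
     (\<forall>a\<in>pos_cone A. \<forall>b\<in>pos_cone A. \<psi> (a + b) = \<psi> a + \<psi> b) \<and>
     (\<forall>a\<in>pos_cone A. \<forall>r>0. \<psi> (r *\<^sub>R a) = ennreal r * \<psi> a)"

definition proper_weight :: "'a l2op set \<Rightarrow> ('a l2op \<Rightarrow> ennreal) \<Rightarrow> bool" where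
  "proper_weight A \<psi> \<longleftrightarrow>
     weight A \<psi> \<and>
     (\<exists>a\<in>pos_cone A. \<psi> a \<noteq> 0) \<and>
     pos_cone A \<subseteq> closure {a \<in> pos_cone A. \<psi> a < \<infinity>} \<and>
     (\<forall>r\<ge>0. closedin (top_of_set (pos_cone A)) {a \<in> pos_cone A. \<psi> a \<le> ennreal r})"

definition weight_N :: "'a l2op set \<Rightarrow> ('a l2op \<Rightarrow> ennreal) \<Rightarrow> 'a l2op set" where
  "weight_N A \<psi> = {a \<in> A. \<psi> (op_adj a o\<^sub>L a) < \<infinity>}"

definition weight_M :: "'a l2op set \<Rightarrow> ('a l2op \<Rightarrow> ennreal) \<Rightarrow> 'a l2op set" where
  "weight_M A \<psi> = module.span op_scale {op_adj a o\<^sub>L b | a b. a \<in> weight_N A \<psi> \<and> b \<in> weight_N A \<psi>}"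

definition weight_ext :: "'a l2op set \<Rightarrow> ('a l2op \<Rightarrow> ennreal) \<Rightarrow> 'a l2op \<Rightarrow> complex" where
  "weight_ext A \<psi> = (THE L.
     L \<in> extensional (weight_M A \<psi>) \<and>
     (\<forall>a\<in>weight_M A \<psi>. \<forall>b\<in>weight_M A \<psi>. L (a + b) = L a + L b) \<and>
     (\<forall>z. \<forall>a\<in>weight_M A \<psi>. L (op_scale z a) = z * L a) \<and>
     (\<forall>a\<in>pos_cone A. \<psi> a < \<infinity> \<longrightarrow> L a = complex_of_real (enn2real (\<psi> a))))"

definition weight_invariant ::
  "'a l2op set \<Rightarrow> (real \<Rightarrow> 'a l2op \<Rightarrow> 'a l2op) \<Rightarrow> ('a l2op \<Rightarrow> ennreal) \<Rightarrow> bool" where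
  "weight_invariant A \<alpha> \<psi> \<longleftrightarrow> (\<forall>t. \<forall>a\<in>pos_cone A. \<psi> (\<alpha> t a) = \<psi> a)"

text \<open>The exponent may be negative or zero.\<close>

definition strip :: "real \<Rightarrow> complex set" where
  "strip \<beta> = {z. min 0 \<beta> \<le> Im z \<and> Im z \<le> max 0 \<beta>}"

definition KMS_weight ::
  "'a l2op set \<Rightarrow> (real \<Rightarrow> 'a l2op \<Rightarrow> 'a l2op) \<Rightarrow> real \<Rightarrow> ('a l2op \<Rightarrow> ennreal) \<Rightarrow> bool" where
  "KMS_weight A \<alpha> \<beta> \<psi> \<longleftrightarrow>
     proper_weight A \<psi> \<and>
     weight_invariant A \<alpha> \<psi> \<and>
     (\<forall>a\<in>weight_N A \<psi> \<inter> op_adj ` weight_N A \<psi>. \<forall>b\<in>weight_N A \<psi> \<inter> op_adj ` weight_N A \<psi>.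
        \<exists>F :: complex \<Rightarrow> complex.
          continuous_on (strip \<beta>) F \<and> bounded (F ` strip \<beta>) \<and>
          F holomorphic_on interior (strip \<beta>) \<and>
          (\<forall>t::real. F (complex_of_real t) = weight_ext A \<psi> (a o\<^sub>L \<alpha> t b)) \<and>
          (\<forall>t::real. F (complex_of_real t + \<i> * complex_of_real \<beta>) =
             weight_ext A \<psi> (\<alpha> t b o\<^sub>L a)))"


section \<open>Etale groupoids and their reduced C*-algebras\<close>

text \<open>
  The arrows are the points of the space \<open>arrows\<close>. The unit space is identified with the type
  \<open>'x\<close> by means of \<open>unit_at\<close>. The product \<open>mul g h\<close> is only meaningful if
  \<open>src g = rng h\<close>.
\<close>

record ('g, 'x) tgroupoid =
  arrows :: "'g topology"
  rng :: "'g \<Rightarrow> 'x"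
  src :: "'g \<Rightarrow> 'x"
  mul :: "'g \<Rightarrow> 'g \<Rightarrow> 'g"
  ginv :: "'g \<Rightarrow> 'g"
  unit_at :: "'x \<Rightarrow> 'g"

definition Cc :: "('g, 'x) tgroupoid \<Rightarrow> ('g \<Rightarrow> complex) set" where
  "Cc G = {f. continuous_map (arrows G) euclidean f \<and>
              (\<forall>g. g \<notin> topspace (arrows G) \<longrightarrow> f g = 0) \<and>
              compactin (arrows G) (arrows G closure_of {g \<in> topspace (arrows G). f g \<noteq> 0})}"

definition conv :: "('g, 'x) tgroupoid \<Rightarrow> ('g \<Rightarrow> complex) \<Rightarrow> ('g \<Rightarrow> complex) \<Rightarrow> 'g \<Rightarrow> complex" where
  "conv G f f' g =
     (\<Sum>\<^sub>\<infinity>h\<in>{h \<in> topspace (arrows G). rng G h = rng G g}. f h * f' (mul G (ginv G h) g))"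

definition src_fibre :: "('g, 'x) tgroupoid \<Rightarrow> 'x \<Rightarrow> 'g set" where
  "src_fibre G x = {g \<in> topspace (arrows G). src G g = x}"

text \<open>
  The regular representation of \<open>f\<close> on \<open>l\<^sup>2(s\<^sup>-\<^sup>1(x))\<close>, where the
  vectors of that space are the square-summable functions vanishing off \<open>s\<^sup>-\<^sup>1(x)\<close>.
\<close>

definition reg_rep :: "('g, 'x) tgroupoid \<Rightarrow> 'x \<Rightarrow> ('g \<Rightarrow> complex) \<Rightarrow> ('g \<Rightarrow> complex) \<Rightarrow> 'g \<Rightarrow> complex" where
  "reg_rep G x f \<xi> = (\<lambda>g. if g \<in> src_fibre G x then conv G f \<xi> g else 0)"

text \<open>
  The direct sum of the regular representations over all units \<open>x\<close>: the arrows are the disjoint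
  union of the fibres \<open>s\<^sup>-\<^sup>1(x)\<close>, so the direct sum of the spaces
  \<open>l\<^sup>2(s\<^sup>-\<^sup>1(x))\<close> is the space of square-summable functions on the arrows. (Elements of \<open>'g\<close>
  which are not arrows contribute a summand on which everything acts as zero.) The operator norm
  of \<open>reg_sum G f\<close> is the supremum over \<open>x\<close> of the norms of the regular representations, i.e. the
  reduced norm of \<open>f\<close>; as the bounded operators are complete, the completion of \<open>Cc G\<close> in the
  reduced norm is the norm closure of the image of \<open>Cc G\<close>.
\<close>

definition reg_sum :: "('g, 'x) tgroupoid \<Rightarrow> ('g \<Rightarrow> complex) \<Rightarrow> 'g l2op" where
  "reg_sum G f = Blinfun (\<lambda>\<xi>. Abs_l2 (\<lambda>g.
     if g \<in> topspace (arrows G)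
     then reg_rep G (src G g) f (\<lambda>h. if h \<in> src_fibre G (src G g) then l2_fun \<xi> h else 0) g
     else 0))"

definition Cred :: "('g, 'x) tgroupoid \<Rightarrow> 'g l2op set" where
  "Cred G = closure (reg_sum G ` Cc G)"

text \<open>
  Extension by continuity to \<open>Cred G\<close> of a map given on the dense subalgebra \<open>Cc G\<close>: the value
  at \<open>a\<close> is the limit of \<open>T f\<close> as \<open>f\<close> runs in \<open>Cc G\<close> such that its image in
  \<open>Cred G\<close> tends to \<open>a\<close>.
\<close>

definition extend_Cc :: "('g, 'x) tgroupoid \<Rightarrow> (('g \<Rightarrow> complex) \<Rightarrow> 'b::t2_space) \<Rightarrow> 'g l2op \<Rightarrow> 'b" where
  "extend_Cc G T a = Lim (inf (filtercomap (reg_sum G) (nhds a)) (principal (Cc G))) T"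

definition cond_exp :: "('g, 'x::topological_space) tgroupoid \<Rightarrow> 'g l2op \<Rightarrow> ('x \<Rightarrow>\<^sub>C complex)" where
  "cond_exp G = extend_Cc G (\<lambda>f. Bcontfun (\<lambda>x. f (unit_at G x)))"

definition continuous_hom :: "('g, 'x) tgroupoid \<Rightarrow> ('g \<Rightarrow> real) \<Rightarrow> bool" where
  "continuous_hom G c \<longleftrightarrow>
     continuous_map (arrows G) euclideanreal c \<and>
     (\<forall>g\<in>topspace (arrows G). \<forall>h\<in>topspace (arrows G).
        src G g = rng G h \<longrightarrow> c (mul G g h) = c g + c h)"

definition dyn :: "('g, 'x) tgroupoid \<Rightarrow> ('g \<Rightarrow> real) \<Rightarrow> real \<Rightarrow> 'g l2op \<Rightarrow> 'g l2op" where
  "dyn G c t = extend_Cc G (\<lambda>f. reg_sum G (\<lambda>g. cis (t * c g) * f g))"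


section \<open>Conformal measures\<close>

definition regular_measure :: "'x::t2_space measure \<Rightarrow> bool" where
  "regular_measure m \<longleftrightarrow>
     sets m = sets borel \<and>
     (\<forall>K. compact K \<longrightarrow> emeasure m K < \<infinity>) \<and>
     (\<forall>B\<in>sets m. emeasure m B = (INF U\<in>{U. open U \<and> B \<subseteq> U}. emeasure m U)) \<and>
     (\<forall>B\<in>sets m. emeasure m B = (SUP K\<in>{K. compact K \<and> K \<subseteq> B}. emeasure m K))"

definition open_bisection :: "('g, 'x) tgroupoid \<Rightarrow> 'g set \<Rightarrow> bool" where
  "open_bisection G W \<longleftrightarrow> openin (arrows G) W \<and> inj_on (rng G) W \<and> inj_on (src G) W"

definition conformal_measure ::
  "('g, 'x::t2_space) tgroupoid \<Rightarrow> ('g \<Rightarrow> real) \<Rightarrow> real \<Rightarrow> 'x measure \<Rightarrow> bool" where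
  "conformal_measure G c \<beta> m \<longleftrightarrow>
     regular_measure m \<and> emeasure m UNIV \<noteq> 0 \<and>
     (\<forall>W. open_bisection G W \<longrightarrow>
        emeasure m (src G ` W) =
          (\<integral>\<^sup>+x\<in>rng G ` W. ennreal (exp (\<beta> * c (the_inv_into W (rng G) x))) \<partial>m))"


section \<open>The groupoid of a local homeomorphism\<close>

definition local_homeo :: "('x::topological_space \<Rightarrow> 'x) \<Rightarrow> bool" where
  "local_homeo \<phi> \<longleftrightarrow>
     (\<forall>x. \<exists>U \<theta>. open U \<and> x \<in> U \<and> open (\<phi> ` U) \<and> homeomorphism U (\<phi> ` U) \<phi> \<theta>)"

definition Gam_arrows :: "('x \<Rightarrow> 'x) \<Rightarrow> ('x \<times> int \<times> 'x) set" where
  "Gam_arrows \<phi> = {(x, k, y). \<exists>n m. k = int n - int m \<and> (\<phi> ^^ n) x = (\<phi> ^^ m) y}"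

text \<open>The set \<open>Gam_piece \<phi> k n\<close> is only used for \<open>k + n \<ge> 0\<close>.\<close>

definition Gam_piece :: "('x \<Rightarrow> 'x) \<Rightarrow> int \<Rightarrow> nat \<Rightarrow> ('x \<times> int \<times> 'x) set" where
  "Gam_piece \<phi> k n = {(x, l, y). l = k \<and> (\<phi> ^^ nat (k + int n)) x = (\<phi> ^^ n) y}"

text \<open>
  The disjoint union over \<open>k\<close> of the inductive limits over \<open>n\<close> of the spaces
  \<open>Gam_piece \<phi> k n\<close>: a set is open iff its trace on each of these is open in the topology
  inherited from the product (with the discrete topology on \<open>int\<close>).
\<close>

definition Gam_top :: "('x::topological_space \<Rightarrow> 'x) \<Rightarrow> ('x \<times> int \<times> 'x) topology" where
  "Gam_top \<phi> = topology (\<lambda>U. U \<subseteq> Gam_arrows \<phi> \<and>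
     (\<forall>k n. 0 \<le> k + int n \<longrightarrow> openin (top_of_set (Gam_piece \<phi> k n)) (U \<inter> Gam_piece \<phi> k n)))"

lemma openin_Gam_top:
  "openin (Gam_top \<phi>) U \<longleftrightarrow> U \<subseteq> Gam_arrows \<phi> \<and>
     (\<forall>k n. 0 \<le> k + int n \<longrightarrow> openin (top_of_set (Gam_piece \<phi> k n)) (U \<inter> Gam_piece \<phi> k n))"
proof -
  let ?P = "\<lambda>U. U \<subseteq> Gam_arrows \<phi> \<and>
     (\<forall>k n. 0 \<le> k + int n \<longrightarrow> openin (top_of_set (Gam_piece \<phi> k n)) (U \<inter> Gam_piece \<phi> k n))"
  have "?P (S \<inter> T)" if S: "?P S" and T: "?P T" for S T
  proof (intro conjI allI impI)
    show "S \<inter> T \<subseteq> Gam_arrows \<phi>" using S by blast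
    fix k n assume "0 \<le> k + int n"
    then have "openin (top_of_set (Gam_piece \<phi> k n))
        ((S \<inter> Gam_piece \<phi> k n) \<inter> (T \<inter> Gam_piece \<phi> k n))"
      using S T by blast
    also have "(S \<inter> Gam_piece \<phi> k n) \<inter> (T \<inter> Gam_piece \<phi> k n) = S \<inter> T \<inter> Gam_piece \<phi> k n" by blast
    finally show "openin (top_of_set (Gam_piece \<phi> k n)) (S \<inter> T \<inter> Gam_piece \<phi> k n)" .
  qed
  moreover have "?P (\<Union>\<K>)" if K: "\<forall>K\<in>\<K>. ?P K" for \<K>
  proof (intro conjI allI impI)
    show "\<Union>\<K> \<subseteq> Gam_arrows \<phi>" using K by blast
    fix k n assume "0 \<le> k + int n"
    then have "openin (top_of_set (Gam_piece \<phi> k n)) (\<Union>((\<lambda>K. K \<inter> Gam_piece \<phi> k n) ` \<K>))"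
      using K by (intro openin_Union) blast
    also have "\<Union>((\<lambda>K. K \<inter> Gam_piece \<phi> k n) ` \<K>) = \<Union>\<K> \<inter> Gam_piece \<phi> k n" by blast
    finally show "openin (top_of_set (Gam_piece \<phi> k n)) (\<Union>\<K> \<inter> Gam_piece \<phi> k n)" .
  qed
  ultimately have "istopology ?P" unfolding istopology_def by blast
  then show ?thesis unfolding Gam_top_def by (simp add: topology_inverse')
qed

lemma topspace_Gam_top: "topspace (Gam_top \<phi>) = Gam_arrows \<phi>"
proof
  show "topspace (Gam_top \<phi>) \<subseteq> Gam_arrows \<phi>"
    using openin_topspace[of "Gam_top \<phi>"] unfolding openin_Gam_top by blast
  have "Gam_piece \<phi> k n \<subseteq> Gam_arrows \<phi>" if "0 \<le> k + int n" for k n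
  proof
    fix g assume "g \<in> Gam_piece \<phi> k n"
    then obtain x y where g: "g = (x, k, y)" and "(\<phi> ^^ nat (k + int n)) x = (\<phi> ^^ n) y"
      unfolding Gam_piece_def by auto
    moreover have "k = int (nat (k + int n)) - int n" using that by simp
    ultimately show "g \<in> Gam_arrows \<phi>" unfolding Gam_arrows_def by blast
  qed
  then have "openin (Gam_top \<phi>) (Gam_arrows \<phi>)"
    unfolding openin_Gam_top by (auto simp: Int_absorb1)
  then show "Gam_arrows \<phi> \<subseteq> topspace (Gam_top \<phi>)" by (rule openin_subset)
qed

definition Gam :: "('x::topological_space \<Rightarrow> 'x) \<Rightarrow> ('x \<times> int \<times> 'x, 'x) tgroupoid" where
  "Gam \<phi> = \<lparr>
     arrows = Gam_top \<phi>,
     rng = (\<lambda>(x, k, y). x),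
     src = (\<lambda>(x, k, y). y),
     mul = (\<lambda>(x, k, y) (x', k', y'). (x, k + k', y')),
     ginv = (\<lambda>(x, k, y). (y, - k, x)),
     unit_at = (\<lambda>x. (x, 0, x))\<rparr>"

definition gauge_cocycle :: "'x \<times> int \<times> 'x \<Rightarrow> real" where
  "gauge_cocycle = (\<lambda>(x, k, y). real_of_int k)"

end

theory Submission
  imports Defs "HOL-Complex_Analysis.Complex_Analysis"
begin

text \<open>
  An element \<open>a\<close> of the reduced algebra is determined by the function \<open>jf a\<close> on the groupoid which
  extends the identification of \<open>f\<close> with \<open>lam f\<close> for compactly supported \<open>f\<close>. A measure \<open>m\<close> on the unit
  space defines the measure \<open>\<nu>\<close> on the groupoid which is the counting measure on the fibres of the
  source map, integrated against \<open>m\<close>. Then \<open>\<phi>\<^sub>m(a\<^sup>* a)\<close> is the \<open>\<nu>\<close>-integral of \<open>|jf a|\<^sup>2\<close>,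
  and \<open>m\<close> is conformal iff inversion transforms \<open>\<nu>\<close> by the density \<open>e\<^sup>\<beta>\<^sup>c\<close>. For conformal \<open>m\<close> the
  function of the KMS condition is therefore the Fourier--Laplace integral of
  \<open>g \<mapsto> jf a (g\<^sup>-\<^sup>1) jf b g\<close> along \<open>c\<close>.

  Conversely, let \<open>\<psi>\<close> be a gauge-invariant KMS weight. Compactly supported functions on the unit space
  are fixed by the action. Smearing along the action shows that \<open>\<psi>\<close> is finite on them, and Riesz'
  theorem provides \<open>m\<close>. A compactly supported \<open>f\<close> on the groupoid is a sum of functions living on the
  units, in a degree \<open>k \<noteq> 0\<close>, where \<open>\<psi>\<close> vanishes by gauge invariance, or on a bisection with disjoint
  range and source, where \<open>f = h f\<close> and \<open>f h = 0\<close> for a function \<open>h\<close> on the unit space, so that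
  \<open>\<psi> (f) = \<psi> (h f) = \<psi> (f h) = 0\<close>. Hence \<open>\<psi>\<close> and \<open>\<phi>\<^sub>m\<close> agree on compactly supported functions; for
  \<open>f\<^sup>* f\<close> the uniqueness of holomorphic functions on the strip yields the conformality of \<open>m\<close>. For
  positive \<open>a\<close> and functions \<open>h\<close> on the unit space increasing to 1, \<open>\<psi>\<close> and \<open>\<phi>\<^sub>m\<close> agree on \<open>h a h\<close>.
  Lower semicontinuity and the inequality \<open>\<psi> (h a h) \<le> \<psi> (a)\<close>, a consequence of the KMS condition,
  extend this to \<open>a\<close>.
\<close>

section \<open>Operators on the space of square-summable families\<close>

text \<open>The domain of a KMS weight is only known to be dense, and the KMS condition concerns
  elements lying in \<open>weight_N\<close> together with their adjoints. So nothing can be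
  evaluated on functions before finiteness is known. To get it, an element of finite weight near a
  fixed \<open>h\<close> is smeared; moving the contour to the other edge of the strip trades the
  uncontrolled \<open>sq w\<close> for the controlled \<open>sq (op_adj w)\<close>. Gauge invariance
  is forced by isotropy: an arrow with equal range and source cannot be cut away by functions on the
  unit space. In degree 0 it is a unit; in other degrees the gauge action removes it. Agreement on
  compactly supported functions does not by itself identify two lower semicontinuous weights.
  Compression by \<open>h\<close> turns a weight into a norm-continuous functional, for which such
  functions suffice. But \<open>h a h\<close> need not lie below \<open>a\<close>, so comparing
  their weights needs the commutation of fixed elements under the weight, applied to
  \<open>h\<close> and to a square root \<open>u\<close> of \<open>h - h h\<close>. The ambient
  operators are only real-linear, so identities in the algebra are checked on matrix coefficients of
  complex-linear operators.\<close>

lemma Re_cnj_mult_self: "Re (cnj w * w) = (cmod w)\<^sup>2"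
  by (simp add: cmod_def power2_eq_square)

lemma l2_summable: "(\<lambda>g. (cmod (l2_fun \<xi> g))\<^sup>2) summable_on UNIV"
  using l2_fun[of \<xi>] by simp

lemma l2_norm_sq: "(norm \<xi>)\<^sup>2 = (\<Sum>\<^sub>\<infinity>g. (cmod (l2_fun \<xi> g))\<^sup>2)"
  unfolding power2_norm_eq_inner inner_l2_infsum(1) Re_cnj_mult_self ..

lemma l2_sum_le_norm_sq: "finite F \<Longrightarrow> (\<Sum>g\<in>F. (cmod (l2_fun \<xi> g))\<^sup>2) \<le> (norm \<xi>)\<^sup>2"
  unfolding l2_norm_sq by (rule finite_sum_le_infsum[OF l2_summable]) auto

lemma l2_coord_le_norm: "cmod (l2_fun \<xi> g) \<le> norm \<xi>"
  using l2_sum_le_norm_sq[of "{g}" \<xi>] by (simp add: power2_le_iff_abs_le)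

text \<open>A bound on all finite partial sums yields square-summability and the norm at once.
  Operators given by explicit formulas are controlled this way, since \<open>Abs_l2\<close> is
  meaningful only on square-summable families.\<close>

lemma l2_from_sum_bound:
  assumes "\<And>F. finite F \<Longrightarrow> (\<Sum>g\<in>F. (cmod (f g))\<^sup>2) \<le> C\<^sup>2" "0 \<le> C"
  shows "(\<lambda>g. (cmod (f g))\<^sup>2) summable_on UNIV" "norm (Abs_l2 f) \<le> C"
proof -
  show s: "(\<lambda>g. (cmod (f g))\<^sup>2) summable_on UNIV"
    by (rule nonneg_bdd_above_summable_on) (use assms in \<open>auto intro!: bdd_aboveI[of _ "C\<^sup>2"]\<close>)
  then have "(norm (Abs_l2 f))\<^sup>2 = (\<Sum>\<^sub>\<infinity>g. (cmod (f g))\<^sup>2)"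
    by (simp add: l2_norm_sq Abs_l2_inverse)
  also have "\<dots> \<le> C\<^sup>2" by (rule infsum_le_finite_sums[OF s]) (use assms in auto)
  finally show "norm (Abs_l2 f) \<le> C" using assms(2) by (rule power2_le_imp_le)
qed

text \<open>Completeness passes to the bounded operators, where the limits of the square root
  iteration, of adjoints and of operator-valued integrals are taken.\<close>

instance l2 :: (type) banach
proof
  fix X :: "nat \<Rightarrow> 'a l2" assume "Cauchy X"
  have "Cauchy (\<lambda>n. l2_fun (X n) g)" for g
  proof (rule CauchyI)
    fix e :: real assume "0 < e"
    then obtain M where M: "\<And>m n. m \<ge> M \<Longrightarrow> n \<ge> M \<Longrightarrow> norm (X m - X n) < e"
      using CauchyD[OF \<open>Cauchy X\<close>] by blast
    have "norm (l2_fun (X m) g - l2_fun (X n) g) < e" if "m \<ge> M" "n \<ge> M" for m n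
      using l2_coord_le_norm[of "X m - X n" g] M[OF that] by (simp add: minus_l2.rep_eq)
    then show "\<exists>M. \<forall>m\<ge>M. \<forall>n\<ge>M. norm (l2_fun (X m) g - l2_fun (X n) g) < e" by blast
  qed
  then have "\<exists>y. (\<lambda>n. l2_fun (X n) g) \<longlonglongrightarrow> y" for g
    using Cauchy_convergent_iff convergent_def by blast
  then obtain x where x: "\<And>g. (\<lambda>n. l2_fun (X n) g) \<longlonglongrightarrow> x g" by metis
  \<comment> \<open>The set \<open>F\<close> stays finite while the second index tends to infinity.
    This bounds the distance of \<open>X n\<close> to the pointwise limit before that limit is known
    to be square-summable.\<close>
  have key: "\<exists>M. \<forall>n\<ge>M. (\<lambda>g. (cmod (l2_fun (X n) g - x g))\<^sup>2) summable_on UNIV \<and>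
      norm (Abs_l2 (\<lambda>g. l2_fun (X n) g - x g)) \<le> e" if "0 < e" for e
  proof -
    obtain M where M: "\<And>m n. m \<ge> M \<Longrightarrow> n \<ge> M \<Longrightarrow> norm (X m - X n) < e"
      using CauchyD[OF \<open>Cauchy X\<close> \<open>0 < e\<close>] by blast
    have "(\<Sum>g\<in>F. (cmod (l2_fun (X n) g - x g))\<^sup>2) \<le> e\<^sup>2" if "n \<ge> M" "finite F" for n F
    proof (rule LIMSEQ_le_const2)
      show "(\<lambda>m. \<Sum>g\<in>F. (cmod (l2_fun (X n) g - l2_fun (X m) g))\<^sup>2)
          \<longlonglongrightarrow> (\<Sum>g\<in>F. (cmod (l2_fun (X n) g - x g))\<^sup>2)"
        by (intro tendsto_intros x)
      have "(\<Sum>g\<in>F. (cmod (l2_fun (X n) g - l2_fun (X m) g))\<^sup>2) \<le> e\<^sup>2" if "m \<ge> M" for m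
      proof -
        have "(\<Sum>g\<in>F. (cmod (l2_fun (X n - X m) g))\<^sup>2) \<le> (norm (X n - X m))\<^sup>2"
          using \<open>finite F\<close> by (rule l2_sum_le_norm_sq)
        also have "\<dots> \<le> e\<^sup>2" using M[OF \<open>n \<ge> M\<close> that] by (intro power_mono) auto
        finally show ?thesis by (simp add: minus_l2.rep_eq)
      qed
      then show "\<exists>N. \<forall>m\<ge>N. (\<Sum>g\<in>F. (cmod (l2_fun (X n) g - l2_fun (X m) g))\<^sup>2) \<le> e\<^sup>2" by blast
    qed
    then show ?thesis using l2_from_sum_bound[of _ e] \<open>0 < e\<close> by (metis less_imp_le)
  qed
  obtain M where "(\<lambda>g. (cmod (l2_fun (X M) g - x g))\<^sup>2) summable_on UNIV"
    using key[of 1] by auto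
  from l2_summable_add[OF l2_summable[of "- X M"] this]
  have sx: "(\<lambda>g. (cmod (x g))\<^sup>2) summable_on UNIV"
    by (simp add: uminus_l2.rep_eq)
  have eq: "Abs_l2 (\<lambda>g. l2_fun (X n) g - x g) = X n - Abs_l2 x" for n
    by (rule injD[of l2_fun], simp add: inj_on_def l2_fun_inject)
      (use sx l2_summable_add[OF l2_summable[of "X n"], of "\<lambda>g. - x g"] in
        \<open>simp add: minus_l2.rep_eq Abs_l2_inverse\<close>)
  have "X \<longlonglongrightarrow> Abs_l2 x"
  proof (rule LIMSEQ_I)
    fix r :: real assume "0 < r"
    then obtain M where "\<forall>n\<ge>M. norm (X n - Abs_l2 x) \<le> r / 2"
      using key[of "r / 2"] unfolding eq by auto
    then show "\<exists>no. \<forall>n\<ge>no. norm (X n - Abs_l2 x) < r" using \<open>0 < r\<close> by force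
  qed
  then show "convergent X" by (rule convergentI)
qed

lemma l2_eqI: "(\<And>g. l2_fun \<xi> g = l2_fun \<eta> g) \<Longrightarrow> \<xi> = \<eta>"
  by (simp add: l2_fun_inject[symmetric] fun_eq_iff)

lemmas l2_rep = plus_l2.rep_eq minus_l2.rep_eq zero_l2.rep_eq uminus_l2.rep_eq scaleR_l2.rep_eq
  l2_scale.rep_eq

lemma l2_fun_sum: "l2_fun (\<Sum>k\<in>F. u k) g = (\<Sum>k\<in>F. l2_fun (u k) g)"
  by (induction F rule: infinite_finite_induct) (auto simp: l2_rep)

lemma norm_l2_scale: "norm (l2_scale z \<xi>) = cmod z * norm \<xi>"
proof -
  have "(norm (l2_scale z \<xi>))\<^sup>2 = (cmod z * norm \<xi>)\<^sup>2"
    by (simp add: l2_norm_sq l2_rep norm_mult power_mult_distrib infsum_cmult_right')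
  then show ?thesis by (simp add: power2_eq_iff_nonneg)
qed

lemma bounded_linear_l2_scale: "bounded_linear (l2_scale z)"
  by (rule bounded_linear_intro[of _ "cmod z"])
    (auto simp: norm_l2_scale intro!: l2_eqI simp: l2_rep algebra_simps)

lemma l2_scale_simps:
  "l2_scale 1 \<xi> = \<xi>" "l2_scale z (l2_scale w \<xi>) = l2_scale (z * w) \<xi>"
  "l2_scale z (r *\<^sub>R \<xi>) = r *\<^sub>R l2_scale z \<xi>"
  "l2_scale (complex_of_real r) \<xi> = r *\<^sub>R \<xi>"
  "l2_scale z (\<xi> + \<eta>) = l2_scale z \<xi> + l2_scale z \<eta>"
  "l2_scale z (\<xi> - \<eta>) = l2_scale z \<xi> - l2_scale z \<eta>"
  "l2_scale (z + w) \<xi> = l2_scale z \<xi> + l2_scale w \<xi>"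
  "l2_scale z 0 = 0" "l2_scale 0 \<xi> = 0"
  by (rule l2_eqI; simp add: l2_rep algebra_simps scaleR_conv_of_real)+

lemma l2_scale_decomp: "l2_scale z \<xi> = Re z *\<^sub>R \<xi> + Im z *\<^sub>R l2_scale \<i> \<xi>"
  by (rule l2_eqI) (simp add: l2_rep complex_eq_iff algebra_simps)

lemma inner_l2_scale_ii:
  "inner (l2_scale \<i> \<xi>) \<eta> = - inner \<xi> (l2_scale \<i> \<eta>)"
  unfolding inner_l2_infsum(1) infsum_uminus[symmetric]
  by (intro infsum_cong) (simp add: l2_rep)

lemma l2_cinner_conv_inner: "l2_cinner \<xi> \<eta> = Complex (inner \<xi> \<eta>) (inner (l2_scale \<i> \<xi>) \<eta>)"
proof -
  have "Im (l2_cinner \<xi> \<eta>) = inner (l2_scale \<i> \<xi>) \<eta>"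
    unfolding inner_l2_infsum(1) l2_cinner.rep_eq
    by (subst infsum_Im[symmetric])
      (auto intro!: infsum_cong l2_summable_mult l2_summable simp: l2_rep)
  then show ?thesis by (simp add: complex_eq_iff inner_l2_def)
qed

lemma l2_cinner_commute: "l2_cinner \<xi> \<eta> = cnj (l2_cinner \<eta> \<xi>)"
proof -
  have "inner (l2_scale \<i> \<xi>) \<eta> = - inner (l2_scale \<i> \<eta>) \<xi>"
    by (metis inner_l2_scale_ii inner_commute)
  then show ?thesis by (simp add: l2_cinner_conv_inner inner_commute[of \<eta>] complex_eq_iff)
qed

lift_definition ket :: "'a \<Rightarrow> 'a l2" is "\<lambda>k g. if g = k then 1 else 0"
proof -
  fix k :: 'a
  show "(\<lambda>g. (cmod (if g = k then 1 else 0))\<^sup>2) summable_on UNIV"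
    by (rule finite_nonzero_values_imp_summable_on) (auto simp: finite_subset[of _ "{k}"])
qed

lemma l2_fun_ket: "l2_fun (ket k) g = (if g = k then 1 else 0)"
  by (simp add: ket.rep_eq)

lemma inner_ket:
  "inner (ket g) \<xi> = Re (l2_fun \<xi> g)" "inner (l2_scale \<i> (ket g)) \<xi> = Im (l2_fun \<xi> g)"
proof -
  have *: "(\<Sum>\<^sub>\<infinity>h. Re (cnj (z * (if h = g then 1 else 0)) * l2_fun \<xi> h)) = Re (cnj z * l2_fun \<xi> g)" for z
    by (subst infsum_cong_neutral[where T = "{g}"
        and g = "\<lambda>h. Re (cnj z * l2_fun \<xi> h)"]) auto
  show "inner (ket g) \<xi> = Re (l2_fun \<xi> g)" "inner (l2_scale \<i> (ket g)) \<xi> = Im (l2_fun \<xi> g)"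
    using *[of 1] *[of \<i>] by (simp_all add: inner_l2_infsum(1) l2_rep l2_fun_ket)
qed

lemma l2_cinner_ket: "l2_cinner (ket g) \<xi> = l2_fun \<xi> g"
  by (simp add: l2_cinner_conv_inner inner_ket complex_eq_iff)

lemma norm_ket: "norm (ket g) = 1"
  by (simp add: norm_eq_sqrt_inner inner_ket l2_fun_ket)

lemma l2_finite_approx:
  assumes "0 < e"
  obtains F where "finite F" "norm (\<xi> - (\<Sum>k\<in>F. l2_scale (l2_fun \<xi> k) (ket k))) < e"
proof -
  let ?f = "\<lambda>g. (cmod (l2_fun \<xi> g))\<^sup>2"
  have "(sum ?f \<longlongrightarrow> infsum ?f UNIV) (finite_subsets_at_top UNIV)"
    using has_sum_infsum[OF l2_summable[of \<xi>]] by (simp add: has_sum_def)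
  then have "eventually (\<lambda>F. dist (sum ?f F) (infsum ?f UNIV) < e\<^sup>2) (finite_subsets_at_top UNIV)"
    using assms by (intro tendstoD) auto
  then obtain F where F: "finite F" "dist (sum ?f F) (infsum ?f UNIV) < e\<^sup>2"
    by (auto simp: eventually_finite_subsets_at_top)
  let ?s = "\<Sum>k\<in>F. l2_scale (l2_fun \<xi> k) (ket k)"
  have s: "l2_fun ?s g = (if g \<in> F then l2_fun \<xi> g else 0)" for g
    using F(1) by (simp add: l2_fun_sum l2_rep l2_fun_ket if_distrib sum.delta cong: if_cong)
  have "(norm (\<xi> - ?s))\<^sup>2 = infsum ?f (- F)"
    unfolding l2_norm_sq by (rule infsum_cong_neutral) (auto simp: l2_rep s)
  also have "\<dots> = infsum ?f UNIV - sum ?f F"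
    using infsum_Un_disjoint[of ?f F "- F"] F(1) summable_on_subset_banach[OF l2_summable[of \<xi>], of "- F"]
    by (simp add: summable_on_finite)
  also have "\<dots> < e\<^sup>2" using F(2) by (simp add: dist_real_def)
  finally have "norm (\<xi> - ?s) < e" using assms by (auto dest: power2_less_imp_less)
  with F(1) show thesis by (rule that)
qed

text \<open>Finite complex combinations of kets are dense. As \<open>T\<close> is only real-linear,
  the vectors \<open>\<i>\<close> times a ket have to be tested separately.\<close>

lemma bounded_linear_eq_on_kets:
  fixes T :: "'a l2 \<Rightarrow> 'b::real_normed_vector"
  assumes "bounded_linear T" "\<And>k. T (ket k) = 0" "\<And>k. T (l2_scale \<i> (ket k)) = 0"
  shows "T \<xi> = 0"
proof -
  interpret T: bounded_linear T by fact
  obtain K where K: "K > 0" "\<And>x. norm (T x) \<le> norm x * K" using T.pos_bounded by blast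
  have "norm (T \<xi>) \<le> e" if "0 < e" for e
  proof -
    obtain F where F: "norm (\<xi> - (\<Sum>k\<in>F. l2_scale (l2_fun \<xi> k) (ket k))) < e / K"
      using l2_finite_approx[of "e / K" \<xi>] \<open>0 < e\<close> K(1) by auto
    have "T (l2_scale z (ket k)) = 0" for z k
      by (simp only: l2_scale_decomp[of z "ket k"] T.add T.scaleR assms(2,3)) simp
    then have "T (\<Sum>k\<in>F. l2_scale (l2_fun \<xi> k) (ket k)) = 0" by (simp add: T.sum)
    then have "norm (T \<xi>) \<le> norm (\<xi> - (\<Sum>k\<in>F. l2_scale (l2_fun \<xi> k) (ket k))) * K"
      using K(2)[of "\<xi> - (\<Sum>k\<in>F. l2_scale (l2_fun \<xi> k) (ket k))"] by (simp add: T.diff)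
    also have "\<dots> \<le> e" using F K(1) by (simp add: field_simps)
    finally show ?thesis .
  qed
  then show ?thesis using field_le_epsilon[of "norm (T \<xi>)" 0] by simp
qed

section \<open>Complex linearity, adjoints and matrix coefficients\<close>

definition clin :: "'a l2op \<Rightarrow> bool" where
  "clin a \<longleftrightarrow> (\<forall>z \<xi>. blinfun_apply a (l2_scale z \<xi>) = l2_scale z (blinfun_apply a \<xi>))"

lemma clinI:
  assumes "\<And>\<xi>. blinfun_apply a (l2_scale \<i> \<xi>) = l2_scale \<i> (blinfun_apply a \<xi>)"
  shows "clin a"
  unfolding clin_def
proof (intro allI)
  fix z \<xi>
  have "blinfun_apply a (l2_scale z \<xi>) = blinfun_apply a (Re z *\<^sub>R \<xi> + Im z *\<^sub>R l2_scale \<i> \<xi>)"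
    by (simp only: l2_scale_decomp[of z \<xi>])
  also have "\<dots> = Re z *\<^sub>R blinfun_apply a \<xi> + Im z *\<^sub>R l2_scale \<i> (blinfun_apply a \<xi>)"
    by (simp add: blinfun.bilinear_simps assms)
  also have "\<dots> = l2_scale z (blinfun_apply a \<xi>)" by (rule l2_scale_decomp[symmetric])
  finally show "blinfun_apply a (l2_scale z \<xi>) = l2_scale z (blinfun_apply a \<xi>)" .
qed

text \<open>Adjointness with respect to the real inner product. It is stable under all real-linear
  operations and limits, and for complex-linear operators it coincides with the relation behind
  \<open>op_adj\<close>.\<close>

definition is_adj :: "'a l2op \<Rightarrow> 'a l2op \<Rightarrow> bool" where
  "is_adj a b \<longleftrightarrow> (\<forall>\<xi> \<eta>. inner (blinfun_apply a \<xi>) \<eta> = inner \<xi> (blinfun_apply b \<eta>))"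

lemma is_adjD: "is_adj a b \<Longrightarrow> inner (blinfun_apply a \<xi>) \<eta> = inner \<xi> (blinfun_apply b \<eta>)"
  by (simp add: is_adj_def)

lemma is_adj_sym: "is_adj a b \<Longrightarrow> is_adj b a"
  by (metis is_adj_def inner_commute)

lemma is_adj_unique: "is_adj a b \<Longrightarrow> is_adj a b' \<Longrightarrow> b = b'"
proof (rule blinfun_eqI)
  fix \<eta> assume "is_adj a b" "is_adj a b'"
  then have "inner \<xi> (blinfun_apply b \<eta> - blinfun_apply b' \<eta>) = 0" for \<xi>
    by (simp add: inner_diff_right is_adj_def)
  then show "blinfun_apply b \<eta> = blinfun_apply b' \<eta>" by (metis eq_iff_diff_eq_0 inner_eq_zero_iff)
qed

lemma is_adj_norm_le: assumes "is_adj a b" shows "norm b \<le> norm a"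
proof (rule norm_blinfun_bound)
  fix \<eta>
  have "norm (blinfun_apply b \<eta>) * norm (blinfun_apply b \<eta>) = inner (blinfun_apply a (blinfun_apply b \<eta>)) \<eta>"
    using assms by (simp add: is_adj_def power2_norm_eq_inner[symmetric] power2_eq_square)
  also have "\<dots> \<le> norm a * norm (blinfun_apply b \<eta>) * norm \<eta>"
    by (meson mult_right_mono norm_blinfun norm_cauchy_schwarz norm_ge_zero order_trans)
  finally have "norm (blinfun_apply b \<eta>) * norm (blinfun_apply b \<eta>) \<le> norm (blinfun_apply b \<eta>) * (norm a * norm \<eta>)"
    by (simp add: mult_ac)
  then show "norm (blinfun_apply b \<eta>) \<le> norm a * norm \<eta>"
    by (cases "norm (blinfun_apply b \<eta>) = 0") (auto simp: mult_le_cancel_left)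
qed simp

lemma op_adj_eqI:
  assumes "is_adj a b" "clin a"
  shows "op_adj a = b"
  unfolding op_adj_def
proof (rule the_equality)
  have "inner (l2_scale \<i> (blinfun_apply a \<xi>)) \<eta> = inner (l2_scale \<i> \<xi>) (blinfun_apply b \<eta>)" for \<xi> \<eta>
    using assms by (metis clin_def is_adj_def)
  then show "\<forall>\<xi> \<eta>. l2_cinner (blinfun_apply a \<xi>) \<eta> = l2_cinner \<xi> (blinfun_apply b \<eta>)"
    using assms(1) by (simp add: l2_cinner_conv_inner is_adj_def)
next
  fix b' assume "\<forall>\<xi> \<eta>. l2_cinner (blinfun_apply a \<xi>) \<eta> = l2_cinner \<xi> (blinfun_apply b' \<eta>)"
  then have "is_adj a b'" by (simp add: l2_cinner_conv_inner is_adj_def)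
  with assms(1) show "b' = b" using is_adj_unique by blast
qed

lemma op_scale_apply: "blinfun_apply (op_scale z a) \<xi> = l2_scale z (blinfun_apply a \<xi>)"
  unfolding op_scale_def
  by (subst bounded_linear_Blinfun_apply)
    (auto intro: bounded_linear_compose[OF bounded_linear_l2_scale blinfun.bounded_linear_right])

lemma module_op_scale: "module (op_scale :: complex \<Rightarrow> 'a l2op \<Rightarrow> 'a l2op)"
  by unfold_locales (auto intro!: blinfun_eqI simp: op_scale_apply blinfun.bilinear_simps l2_scale_simps)

lemma norm_op_scale_le: "norm (op_scale z a) \<le> cmod z * norm a"
  by (rule norm_blinfun_bound) (auto simp: op_scale_apply norm_l2_scale mult.assoc intro!: mult_left_mono norm_blinfun)

lemmas op_apply = op_scale_apply blinfun.bilinear_simps blinfun_apply_blinfun_compose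

definition ent :: "'a l2op \<Rightarrow> 'a \<Rightarrow> 'a \<Rightarrow> complex" where
  "ent a g k = l2_fun (blinfun_apply a (ket k)) g"

lemma cmod_ent_le: "cmod (ent a g k) \<le> norm a"
  unfolding ent_def using l2_coord_le_norm norm_blinfun[of a "ket k"] norm_ket[of k]
  by (metis mult.right_neutral order_trans)

lemma ent_simps:
  "ent (a + b) g k = ent a g k + ent b g k" "ent (a - b) g k = ent a g k - ent b g k"
  "ent (op_scale z a) g k = z * ent a g k" "ent (r *\<^sub>R a) g k = of_real r * ent a g k" "ent 0 g k = 0"
  by (auto simp: ent_def op_apply l2_rep scaleR_conv_of_real)

lemma bounded_linear_ent: "bounded_linear (\<lambda>a. ent a g k)"
  by (rule bounded_linear_intro[of _ 1]) (auto simp: ent_simps scaleR_conv_of_real cmod_ent_le)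

lemma op_eqI_ent:
  assumes "clin a" "clin b" "\<And>g k. ent a g k = ent b g k"
  shows "a = b"
proof (rule blinfun_eqI)
  fix \<xi>
  have k: "blinfun_apply a (ket k) = blinfun_apply b (ket k)" for k
    by (rule l2_eqI) (use assms(3) in \<open>simp add: ent_def\<close>)
  have "blinfun_apply (a - b) \<xi> = 0"
    by (rule bounded_linear_eq_on_kets[OF blinfun.bounded_linear_right])
      (use assms(1,2) k in \<open>auto simp: op_apply clin_def\<close>)
  then show "blinfun_apply a \<xi> = blinfun_apply b \<xi>" by (simp add: op_apply)
qed

text \<open>The difference of the two forms is real-linear in each variable. It vanishes on kets, by
  complex linearity on their multiples by \<open>\<i>\<close>, and then everywhere by density in one
  variable after the other.\<close>

lemma is_adjI_ent:
  assumes "clin a" "clin b" "\<And>g k. ent b k g = cnj (ent a g k)"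
  shows "is_adj a b"
proof -
  have 1: "l2_cinner (blinfun_apply a (ket k)) (ket g) = l2_cinner (ket k) (blinfun_apply b (ket g))" for g k
    using assms(3)[of k g] l2_cinner_commute[of "blinfun_apply a (ket k)" "ket g"]
    by (simp only: l2_cinner_ket ent_def)
  have bk: "inner (blinfun_apply a (ket k)) (ket g) = inner (ket k) (blinfun_apply b (ket g))"
    "inner (l2_scale \<i> (blinfun_apply a (ket k))) (ket g) = inner (l2_scale \<i> (ket k)) (blinfun_apply b (ket g))" for g k
    using 1[of k g] by (auto simp add: l2_cinner_conv_inner)
  have bl: "bounded_linear (\<lambda>\<xi>. inner (blinfun_apply a \<xi>) \<eta> - inner \<xi> (blinfun_apply b \<eta>))" for \<eta>
    by (rule bounded_linear_sub[OF bounded_linear_compose[OF bounded_linear_inner_left blinfun.bounded_linear_right]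
        bounded_linear_inner_left])
  have br: "bounded_linear (\<lambda>\<eta>. inner (blinfun_apply a \<xi>) \<eta> - inner \<xi> (blinfun_apply b \<eta>))" for \<xi>
    by (rule bounded_linear_sub[OF bounded_linear_inner_right
        bounded_linear_compose[OF bounded_linear_inner_right blinfun.bounded_linear_right]])
  have i: "blinfun_apply a (l2_scale \<i> \<xi>) = l2_scale \<i> (blinfun_apply a \<xi>)"
    "blinfun_apply b (l2_scale \<i> \<xi>) = l2_scale \<i> (blinfun_apply b \<xi>)" for \<xi>
    using assms(1,2) by (auto simp: clin_def)
  have 2: "inner (blinfun_apply a \<xi>) (ket g) - inner \<xi> (blinfun_apply b (ket g)) = 0" for \<xi> g
    by (rule bounded_linear_eq_on_kets[OF bl]) (auto simp: bk i)
  have 3: "inner (blinfun_apply a \<xi>) (l2_scale \<i> (ket g)) - inner \<xi> (blinfun_apply b (l2_scale \<i> (ket g))) = 0" for \<xi> g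
    using 2[of "l2_scale \<i> \<xi>" g] unfolding i inner_l2_scale_ii by simp
  have "inner (blinfun_apply a \<xi>) \<eta> - inner \<xi> (blinfun_apply b \<eta>) = 0" for \<xi> \<eta>
    by (rule bounded_linear_eq_on_kets[OF br]) (auto simp: 2 3)
  then show ?thesis by (simp add: is_adj_def)
qed

section \<open>Positive elements of C*-algebras of operators\<close>

lemma is_adj_add: "is_adj a b \<Longrightarrow> is_adj c d \<Longrightarrow> is_adj (a + c) (b + d)"
  and is_adj_diff: "is_adj a b \<Longrightarrow> is_adj c d \<Longrightarrow> is_adj (a - c) (b - d)"
  and is_adj_compose: "is_adj a b \<Longrightarrow> is_adj c d \<Longrightarrow> is_adj (a o\<^sub>L c) (d o\<^sub>L b)"
  and is_adj_scaleR: "is_adj a b \<Longrightarrow> is_adj (r *\<^sub>R a) (r *\<^sub>R b)"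
  by (auto simp: is_adj_def op_apply inner_simps)

lemma is_adj_scale: assumes "is_adj a b" "clin a" "clin b" shows "is_adj (op_scale z a) (op_scale (cnj z) b)"
proof -
  have "is_adj (op_scale z a) (op_scale (cnj z) b)" if "clin b" "is_adj a b" "clin a" for z b
  proof -
    have "inner (l2_scale z \<xi>) \<eta> = inner \<xi> (l2_scale (cnj z) \<eta>)" for \<xi> \<eta> :: "'a l2"
      unfolding l2_scale_decomp[of z] l2_scale_decomp[of "cnj z"]
      by (simp add: inner_simps inner_l2_scale_ii)
    then show ?thesis using that by (auto simp: is_adj_def op_apply clin_def)
  qed
  then show ?thesis using assms by blast
qed

lemma is_adj_id: "is_adj id_blinfun id_blinfun"
  by (simp add: is_adj_def)

lemma is_adj_limit:
  assumes "\<And>n::nat. is_adj (a n) (b n)" "a \<longlonglongrightarrow> x" "b \<longlonglongrightarrow> y"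
  shows "is_adj x y"
  unfolding is_adj_def
proof (intro allI)
  fix \<xi> \<eta>
  have "(\<lambda>n. inner (blinfun_apply (a n) \<xi>) \<eta>) \<longlonglongrightarrow> inner (blinfun_apply x \<xi>) \<eta>"
    "(\<lambda>n. inner \<xi> (blinfun_apply (b n) \<eta>)) \<longlonglongrightarrow> inner \<xi> (blinfun_apply y \<eta>)"
    by (intro tendsto_intros assms)+
  then show "inner (blinfun_apply x \<xi>) \<eta> = inner \<xi> (blinfun_apply y \<eta>)"
    using assms(1) by (simp add: is_adj_def LIMSEQ_unique)
qed

lemma clin_limit:
  assumes "\<And>n::nat. clin (a n)" "a \<longlonglongrightarrow> x" shows "clin x"
proof (rule clinI)
  fix \<xi>
  have "(\<lambda>n. l2_scale \<i> (blinfun_apply (a n) \<xi>)) \<longlonglongrightarrow> l2_scale \<i> (blinfun_apply x \<xi>)"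
    by (intro bounded_linear.tendsto[OF bounded_linear_l2_scale] tendsto_intros assms)
  moreover have "(\<lambda>n. blinfun_apply (a n) (l2_scale \<i> \<xi>)) \<longlonglongrightarrow> blinfun_apply x (l2_scale \<i> \<xi>)"
    by (intro tendsto_intros assms)
  ultimately show "blinfun_apply x (l2_scale \<i> \<xi>) = l2_scale \<i> (blinfun_apply x \<xi>)"
    using assms(1) by (simp add: clin_def LIMSEQ_unique)
qed

text \<open>For self-adjoint \<open>S\<close> polarization recovers the bilinear form from the
  quadratic one, and the parallelogram law bounds the outcome.\<close>

lemma norm_le_of_form:
  assumes sa: "is_adj S S" and C: "0 \<le> C" "\<And>\<xi>. \<bar>inner (blinfun_apply S \<xi>) \<xi>\<bar> \<le> C * (norm \<xi>)\<^sup>2"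
  shows "norm S \<le> C"
proof (rule norm_blinfun_bound)
  fix \<xi>
  let ?q = "\<lambda>\<xi>. inner (blinfun_apply S \<xi>) \<xi>"
  have *: "4 * inner (blinfun_apply S \<xi>) \<eta> \<le> C * (2 * (norm \<xi>)\<^sup>2 + 2 * (norm \<eta>)\<^sup>2)" for \<eta>
  proof -
    have "inner (blinfun_apply S \<eta>) \<xi> = inner (blinfun_apply S \<xi>) \<eta>"
      by (metis sa is_adj_def inner_commute)
    then have "4 * inner (blinfun_apply S \<xi>) \<eta> = ?q (\<xi> + \<eta>) - ?q (\<xi> - \<eta>)"
      by (simp add: op_apply inner_simps)
    also have "\<dots> \<le> C * (norm (\<xi> + \<eta>))\<^sup>2 + C * (norm (\<xi> - \<eta>))\<^sup>2"
      using C(2)[of "\<xi> + \<eta>"] C(2)[of "\<xi> - \<eta>"] by linarith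
    also have "\<dots> = C * (2 * (norm \<xi>)\<^sup>2 + 2 * (norm \<eta>)\<^sup>2)"
      by (simp add: power2_norm_eq_inner inner_simps inner_commute[of \<eta> \<xi>] algebra_simps)
    finally show ?thesis .
  qed
  show "norm (blinfun_apply S \<xi>) \<le> C * norm \<xi>"
  proof (cases "blinfun_apply S \<xi> = 0")
    case False
    then have n: "norm \<xi> > 0" "norm (blinfun_apply S \<xi>) > 0" by (auto simp: blinfun.bilinear_simps)
    \<comment> \<open>The test vector is \<open>S \<xi>\<close> rescaled to the length of
      \<open>\<xi>\<close>, so both sides become multiples of \<open>norm \<xi>\<close>.\<close>
    from *[of "(norm \<xi> / norm (blinfun_apply S \<xi>)) *\<^sub>R blinfun_apply S \<xi>"] n
    have "4 * (norm \<xi> * norm (blinfun_apply S \<xi>)) \<le> 4 * (C * (norm \<xi>)\<^sup>2)"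
      by (simp add: power2_norm_eq_inner[symmetric] power2_eq_square)
    then show ?thesis using n by (simp add: power2_eq_square mult.left_commute)
  qed (use C in auto)
qed (use C in auto)

text \<open>A concrete C*-algebra, possibly without unit. Closure under adjoints is phrased with
  \<open>is_adj\<close> because \<open>op_adj\<close> is a definite description, whose value is
  known only after an adjoint has been exhibited.\<close>

locale cstar_ops =
  fixes A :: "'a l2op set"
  assumes closed_A: "closed A"
    and zero_A: "0 \<in> A"
    and add_A: "a \<in> A \<Longrightarrow> b \<in> A \<Longrightarrow> a + b \<in> A"
    and scale_A: "a \<in> A \<Longrightarrow> op_scale z a \<in> A"
    and compose_A: "a \<in> A \<Longrightarrow> b \<in> A \<Longrightarrow> a o\<^sub>L b \<in> A"
    and clin_A: "a \<in> A \<Longrightarrow> clin a"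
    and ex_adj_A: "a \<in> A \<Longrightarrow> \<exists>b\<in>A. is_adj a b"
begin

lemma scaleR_A: "a \<in> A \<Longrightarrow> r *\<^sub>R a \<in> A"
  using scale_A[of a "complex_of_real r"]
  by (simp add: blinfun_eqI[of "op_scale (complex_of_real r) a" "r *\<^sub>R a"] op_apply l2_scale_simps)

lemma uminus_A: "a \<in> A \<Longrightarrow> - a \<in> A"
  using scaleR_A[of a "-1"] by simp

lemma diff_A: "a \<in> A \<Longrightarrow> b \<in> A \<Longrightarrow> a - b \<in> A"
  using add_A[of a "- b"] uminus_A[of b] by simp

lemma sum_A: "(\<And>i. i \<in> I \<Longrightarrow> f i \<in> A) \<Longrightarrow> sum f I \<in> A"
  by (induction I rule: infinite_finite_induct) (auto simp: zero_A add_A)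

lemma limit_A: "(\<And>n::nat. a n \<in> A) \<Longrightarrow> a \<longlonglongrightarrow> x \<Longrightarrow> x \<in> A"
  using closed_A closed_sequential_limits by blast

lemma adj_A: assumes "a \<in> A" shows is_adj_op_adj: "is_adj a (op_adj a)" and op_adj_A: "op_adj a \<in> A"
  using ex_adj_A[OF assms] op_adj_eqI clin_A[OF assms] by blast+

lemma op_adj_eq: "a \<in> A \<Longrightarrow> is_adj a b \<Longrightarrow> op_adj a = b"
  using op_adj_eqI clin_A by blast

lemma op_adj_simps:
  assumes "a \<in> A"
  shows "op_adj (op_adj a) = a" "op_adj (op_scale z a) = op_scale (cnj z) (op_adj a)"
    "op_adj (r *\<^sub>R a) = r *\<^sub>R op_adj a" "op_adj (- a) = - op_adj a"
    "b \<in> A \<Longrightarrow> op_adj (a + b) = op_adj a + op_adj b"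
    "b \<in> A \<Longrightarrow> op_adj (a - b) = op_adj a - op_adj b"
    "b \<in> A \<Longrightarrow> op_adj (a o\<^sub>L b) = op_adj b o\<^sub>L op_adj a"
proof -
  note j = is_adj_op_adj
  show "op_adj (op_adj a) = a" using assms op_adj_A is_adj_sym j op_adj_eq by blast
  show "op_adj (op_scale z a) = op_scale (cnj z) (op_adj a)"
    by (rule op_adj_eq) (use assms in \<open>auto intro!: is_adj_scale j scale_A clin_A op_adj_A\<close>)
  show r: "op_adj (r *\<^sub>R a) = r *\<^sub>R op_adj a" for r
    by (rule op_adj_eq) (use assms in \<open>auto intro!: is_adj_scaleR j scaleR_A\<close>)
  show "op_adj (- a) = - op_adj a" using r[of "-1"] by simp
  show "b \<in> A \<Longrightarrow> op_adj (a + b) = op_adj a + op_adj b"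
    by (rule op_adj_eq) (use assms in \<open>auto intro!: is_adj_add j add_A\<close>)
  show "b \<in> A \<Longrightarrow> op_adj (a - b) = op_adj a - op_adj b"
    by (rule op_adj_eq) (use assms in \<open>auto intro!: is_adj_diff j diff_A\<close>)
  show "b \<in> A \<Longrightarrow> op_adj (a o\<^sub>L b) = op_adj b o\<^sub>L op_adj a"
    by (rule op_adj_eq) (use assms in \<open>auto intro!: is_adj_compose j compose_A\<close>)
qed

lemma norm_op_adj: "a \<in> A \<Longrightarrow> norm (op_adj a) = norm a"
  using is_adj_norm_le is_adj_op_adj is_adj_sym by (metis order_antisym)

lemma op_adj_tendsto:
  assumes "\<And>n::nat. a n \<in> A" "a \<longlonglongrightarrow> x" shows "(\<lambda>n. op_adj (a n)) \<longlonglongrightarrow> op_adj x"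
proof -
  have x: "x \<in> A" by (rule limit_A[OF assms])
  have "(\<lambda>n. norm (a n - x)) \<longlonglongrightarrow> 0" using assms(2) by (simp add: LIM_zero tendsto_norm_zero)
  moreover have "norm (a n - x) = norm (op_adj (a n) - op_adj x)" for n
    using norm_op_adj[OF diff_A[OF assms(1)[of n] x]] by (simp add: op_adj_simps assms x)
  ultimately have "(\<lambda>n. norm (op_adj (a n) - op_adj x)) \<longlonglongrightarrow> 0" by simp
  then show ?thesis by (simp add: LIM_zero_iff tendsto_norm_zero_iff)
qed

text \<open>
  The square root of \<open>T\<close>, \<open>0 \<le> T \<le> 1\<close>, is \<open>1 - y\<close> for the limit \<open>y\<close> of the iteration
  \<open>y \<mapsto> (1 - T + y\<^sup>2) / 2\<close>. The differences of consecutive iterates are dominated by those of the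
  scalar iteration \<open>t \<mapsto> (1 + t\<^sup>2) / 2\<close>, and modulo \<open>A\<close> the iterates are scalars tending to 1.
\<close>

lemma pos_sqrt_contraction:
  assumes T: "T \<in> A" "is_adj T T" "\<And>\<xi>. 0 \<le> inner (blinfun_apply T \<xi>) \<xi>" "norm T \<le> 1"
  shows "\<exists>S\<in>A. is_adj S S \<and> S o\<^sub>L S = T"
proof -
  let ?I = "id_blinfun :: 'a l2op"
  define S where "S = ?I - T"
  have saS: "is_adj S S" unfolding S_def by (intro is_adj_diff is_adj_id T)
  have nS: "norm S \<le> 1"
  proof (rule norm_le_of_form[OF saS])
    fix \<xi>
    have "inner (blinfun_apply T \<xi>) \<xi> \<le> norm T * norm \<xi> * norm \<xi>"
      by (meson mult_right_mono norm_blinfun norm_cauchy_schwarz norm_ge_zero order_trans)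
    also have "\<dots> \<le> (norm \<xi>)\<^sup>2"
      using mult_right_mono[OF T(4), of "(norm \<xi>)\<^sup>2"] by (simp add: power2_eq_square)
    finally show "\<bar>inner (blinfun_apply S \<xi>) \<xi>\<bar> \<le> 1 * (norm \<xi>)\<^sup>2"
      using T(3)[of \<xi>] by (simp add: S_def op_apply inner_simps power2_norm_eq_inner)
  qed simp
  define t :: "nat \<Rightarrow> real" where "t = rec_nat 0 (\<lambda>_ t. (1 + t\<^sup>2) / 2)"
  have t: "t 0 = 0" "t (Suc n) = (1 + (t n)\<^sup>2) / 2" for n by (simp_all add: t_def)
  define y :: "nat \<Rightarrow> 'a l2op" where "y = rec_nat 0 (\<lambda>_ y. (1/2) *\<^sub>R (S + (y o\<^sub>L y)))"
  have y: "y 0 = 0" "y (Suc n) = (1/2) *\<^sub>R (S + (y n o\<^sub>L y n))" for n by (simp_all add: y_def)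
  have t01: "0 \<le> t n \<and> t n \<le> 1" for n
  proof (induction n)
    case (Suc n)
    then have "(t n)\<^sup>2 \<le> 1" by (simp add: power_le_one)
    then show ?case by (simp add: t)
  qed (simp add: t)
  have tinc: "t n \<le> t (Suc n)" for n
    using zero_le_power2[of "1 - t n"] by (simp add: t power2_eq_square algebra_simps)
  obtain l where l: "t \<longlonglongrightarrow> l"
    using incseq_convergent[of t 1] tinc t01 by (metis incseq_SucI)
  have "(\<lambda>n. t (Suc n)) \<longlonglongrightarrow> (1 + l\<^sup>2) / 2" unfolding t by (intro tendsto_intros l) auto
  with LIMSEQ_unique[OF LIMSEQ_Suc[OF l]] have "l = (1 + l\<^sup>2) / 2" by blast
  then have "(l - 1)\<^sup>2 = 0" by (simp add: power2_eq_square algebra_simps)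
  then have t1: "t \<longlonglongrightarrow> 1" using l by simp
  \<comment> \<open>Stated for arbitrary \<open>z\<close> commuting with \<open>S\<close>: a first
    use shows that \<open>S\<close> commutes with the iterates, a second that the iterates commute
    with each other.\<close>
  have comm: "z o\<^sub>L S = S o\<^sub>L z \<Longrightarrow> z o\<^sub>L y n = y n o\<^sub>L z" for n z
  proof (induction n)
    case (Suc n)
    then have "blinfun_apply z (blinfun_apply S \<xi>) = blinfun_apply S (blinfun_apply z \<xi>)"
      "blinfun_apply z (blinfun_apply (y n) \<xi>) = blinfun_apply (y n) (blinfun_apply z \<xi>)" for \<xi>
      by (metis blinfun_apply_blinfun_compose)+
    then show ?case by (auto intro!: blinfun_eqI simp: y op_apply)
  qed (auto intro!: blinfun_eqI simp: y op_apply)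
  have cc: "y n o\<^sub>L y m = y m o\<^sub>L y n" for n m using comm comm[OF refl] by metis
  have yt: "norm (y n) \<le> t n" for n
  proof (induction n)
    case (Suc n)
    have "norm (y (Suc n)) \<le> (1/2) * (norm S + norm (y n) * norm (y n))"
      unfolding y norm_scaleR
      by (intro mult_mono order_trans[OF norm_triangle_ineq] add_mono norm_blinfun_compose) auto
    also have "\<dots> \<le> (1/2) * (1 + t n * t n)"
      using Suc nS t01[of n] by (intro mult_left_mono add_mono mult_mono) auto
    finally show ?case by (simp add: t power2_eq_square)
  qed (simp add: y t)
  \<comment> \<open>Commutation factors the difference of two squares, so the increments obey the
    recursion of the scalar sequence, whose increments add up to at most 1.\<close>
  have dyt: "norm (y (Suc n) - y n) \<le> t (Suc n) - t n" for n
  proof (induction n)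
    case (Suc n)
    have "y (Suc (Suc n)) - y (Suc n) = (1/2) *\<^sub>R ((y (Suc n) + y n) o\<^sub>L (y (Suc n) - y n))"
      unfolding y(2)[of "Suc n"] y(2)[of n, THEN arg_cong[of _ _ "\<lambda>u. v - u" for v]]
      using arg_cong[OF cc[of n "Suc n"], of "\<lambda>u. blinfun_apply u _"]
      by (auto intro!: blinfun_eqI simp: op_apply scaleR_diff_right[symmetric] scaleR_add_right[symmetric])
    then have "norm (y (Suc (Suc n)) - y (Suc n)) \<le> (1/2) * (norm (y (Suc n) + y n) * norm (y (Suc n) - y n))"
      by (simp add: norm_blinfun_compose)
    also have "\<dots> \<le> (1/2) * ((t (Suc n) + t n) * (t (Suc n) - t n))"
      using yt[of n] yt[of "Suc n"] Suc t01[of n] t01[of "Suc n"]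
      by (intro mult_left_mono mult_mono order_trans[OF norm_triangle_ineq]) auto
    also have "\<dots> = t (Suc (Suc n)) - t (Suc n)"
      by (subst (3 4) t(2)) (simp add: power2_eq_square algebra_simps)
    finally show ?case .
  qed (use yt[of 1] in \<open>simp add: y t\<close>)
  have dist: "norm (y (n + k) - y n) \<le> t (n + k) - t n" for n k
  proof (induction k)
    case (Suc k)
    have "norm (y (n + Suc k) - y n) \<le> norm (y (Suc (n + k)) - y (n + k)) + norm (y (n + k) - y n)"
      using norm_triangle_ineq[of "y (Suc (n + k)) - y (n + k)" "y (n + k) - y n"] by simp
    then show ?case using Suc dyt[of "n + k"] by simp
  qed simp
  have "Cauchy y"
  proof (rule CauchyI')
    fix e :: real assume "0 < e"
    then obtain N where N: "\<And>n. n \<ge> N \<Longrightarrow> norm (t n - 1) < e" using LIMSEQ_D[OF t1] by blast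
    have "dist (y m) (y n) < e" if "m \<ge> N" "m < n" for m n
    proof -
      have "dist (y m) (y n) \<le> t n - t m"
        using dist[of m "n - m"] that by (simp add: dist_norm norm_minus_commute)
      also have "\<dots> < e" using N[of m] that t01[of n] t01[of m] by (simp add: abs_if split: if_splits)
      finally show ?thesis .
    qed
    then show "\<exists>M. \<forall>m\<ge>M. \<forall>n>m. dist (y m) (y n) < e" by blast
  qed
  then obtain z where z: "y \<longlonglongrightarrow> z" using Cauchy_convergent_iff convergent_def by blast
  have "(\<lambda>n. y (Suc n)) \<longlonglongrightarrow> (1/2) *\<^sub>R (S + (z o\<^sub>L z))" unfolding y
    by (intro tendsto_intros z bounded_bilinear.tendsto[OF bounded_bilinear_blinfun_compose])
  with LIMSEQ_unique[OF LIMSEQ_Suc[OF z]] have zz: "z = (1/2) *\<^sub>R (S + (z o\<^sub>L z))" by blast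
  \<comment> \<open>The identity need not belong to \<open>A\<close>, so the induction follows
    \<open>q\<close>, the deviation of the iterate from the scalar \<open>t n\<close>. Its recursion
    involves only \<open>T\<close>, \<open>q\<close> and \<open>q q\<close>.\<close>
  have "t n *\<^sub>R ?I - y n \<in> A" for n
  proof (induction n)
    case (Suc n)
    define q where "q = t n *\<^sub>R ?I - y n"
    have "t (Suc n) *\<^sub>R ?I - y (Suc n) = (1/2) *\<^sub>R (T + ((2 * t n) *\<^sub>R q - (q o\<^sub>L q)))"
      by (rule blinfun_eqI)
        (simp add: t y q_def S_def op_apply power2_eq_square algebra_simps add_divide_distrib,
         simp flip: scaleR_add_left)
    then show ?case using Suc T(1) unfolding q_def[symmetric]
      by (auto intro!: scaleR_A add_A diff_A compose_A)
  qed (simp add: t y zero_A)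
  moreover have "(\<lambda>n. t n *\<^sub>R ?I - y n) \<longlonglongrightarrow> 1 *\<^sub>R ?I - z" by (intro tendsto_intros t1 z)
  ultimately have zA: "?I - z \<in> A"
    using limit_A[of "\<lambda>n. t n *\<^sub>R ?I - y n" "?I - z"] by (simp only: scaleR_one)
  have "is_adj (y n) (y n)" for n
    by (induction n) (auto simp: y is_adj_def op_apply inner_simps saS[unfolded is_adj_def])
  then have "is_adj z z" using is_adj_limit z by blast
  then have "is_adj (?I - z) (?I - z)" by (intro is_adj_diff is_adj_id)
  moreover have "(?I - z) o\<^sub>L (?I - z) = T"
  proof (rule blinfun_eqI)
    fix \<xi>
    have "2 *\<^sub>R blinfun_apply z \<xi> = blinfun_apply S \<xi> + blinfun_apply z (blinfun_apply z \<xi>)"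
      by (subst zz) (simp add: op_apply scaleR_add_right[symmetric])
    then show "blinfun_apply ((?I - z) o\<^sub>L (?I - z)) \<xi> = blinfun_apply T \<xi>"
      by (simp add: op_apply S_def scaleR_2 algebra_simps)
  qed
  ultimately show ?thesis using zA by blast
qed

lemma pos_sqrt:
  assumes T: "T \<in> A" "is_adj T T" "\<And>\<xi>. 0 \<le> inner (blinfun_apply T \<xi>) \<xi>"
  obtains S where "S \<in> A" "is_adj S S" "S o\<^sub>L S = T"
proof (cases "T = 0")
  case True
  then show thesis using that[of 0] zero_A by (auto simp: is_adj_def op_apply intro!: blinfun_eqI)
next
  case False
  let ?c = "norm T"
  have "\<exists>S\<in>A. is_adj S S \<and> S o\<^sub>L S = (1 / ?c) *\<^sub>R T"
    using T False by (intro pos_sqrt_contraction) (auto intro: scaleR_A is_adj_scaleR simp: op_apply)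
  then obtain S where S: "S \<in> A" "is_adj S S" "S o\<^sub>L S = (1 / ?c) *\<^sub>R T" by blast
  have "(sqrt ?c *\<^sub>R S) o\<^sub>L (sqrt ?c *\<^sub>R S) = ?c *\<^sub>R (S o\<^sub>L S)"
    by (rule blinfun_eqI) (simp add: op_apply)
  also have "\<dots> = T" using S(3) False by simp
  finally show thesis using that[of "sqrt ?c *\<^sub>R S"] S by (simp add: scaleR_A is_adj_scaleR)
qed

abbreviation "PA \<equiv> pos_cone A"

text \<open>The cone consists of squares by definition, and sums or limits of squares are not
  visibly squares. The square root inside \<open>A\<close> replaces this by a condition on the
  quadratic form, which is stable under both.\<close>

lemma pos_cone_iff:
  "a \<in> PA \<longleftrightarrow> a \<in> A \<and> is_adj a a \<and> (\<forall>\<xi>. 0 \<le> inner (blinfun_apply a \<xi>) \<xi>)"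
proof
  assume "a \<in> PA"
  then obtain b where b: "b \<in> A" "a = op_adj b o\<^sub>L b" by (auto simp: pos_cone_def)
  have "is_adj a a" unfolding b(2)
    using is_adj_compose[OF is_adj_sym[OF is_adj_op_adj] is_adj_op_adj] b(1) by blast
  moreover have "0 \<le> inner (blinfun_apply a \<xi>) \<xi>" for \<xi>
    using is_adjD[OF is_adj_sym[OF is_adj_op_adj[OF b(1)]]] by (simp add: b(2) op_apply)
  ultimately show "a \<in> A \<and> is_adj a a \<and> (\<forall>\<xi>. 0 \<le> inner (blinfun_apply a \<xi>) \<xi>)"
    using b op_adj_A compose_A by auto
next
  assume a: "a \<in> A \<and> is_adj a a \<and> (\<forall>\<xi>. 0 \<le> inner (blinfun_apply a \<xi>) \<xi>)"
  then obtain S where S: "S \<in> A" "is_adj S S" "S o\<^sub>L S = a" using pos_sqrt[of a] by blast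
  then have "op_adj S = S" using op_adj_eq by blast
  then show "a \<in> PA" using S by (auto simp: pos_cone_def intro!: exI[of _ S])
qed

lemma adj_mult_pos: "b \<in> A \<Longrightarrow> op_adj b o\<^sub>L b \<in> PA"
  by (auto simp: pos_cone_def)

lemma inner_adj_mult: "b \<in> A \<Longrightarrow> inner (blinfun_apply (op_adj b o\<^sub>L b) \<xi>) \<xi> = (norm (blinfun_apply b \<xi>))\<^sup>2"
  using is_adjD[OF is_adj_sym[OF is_adj_op_adj]] by (simp add: op_apply power2_norm_eq_inner)

lemma pos_A: "a \<in> PA \<Longrightarrow> a \<in> A" and pos_adj: "a \<in> PA \<Longrightarrow> op_adj a = a"
  using pos_cone_iff op_adj_eq by blast+

lemma pos_zero: "0 \<in> PA" and pos_add: "a \<in> PA \<Longrightarrow> b \<in> PA \<Longrightarrow> a + b \<in> PA"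
  and pos_scale: "a \<in> PA \<Longrightarrow> 0 \<le> r \<Longrightarrow> r *\<^sub>R a \<in> PA"
  by (auto simp: pos_cone_iff zero_A add_A scaleR_A is_adj_add is_adj_scaleR op_apply inner_simps is_adj_def)

lemma pos_limit:
  assumes "\<And>n::nat. a n \<in> PA" "a \<longlonglongrightarrow> x" shows "x \<in> PA"
  unfolding pos_cone_iff
proof (intro conjI allI)
  show "x \<in> A" using limit_A[OF pos_A] assms by blast
  show "is_adj x x" using is_adj_limit[of a a x x] assms pos_cone_iff by blast
  fix \<xi>
  show "0 \<le> inner (blinfun_apply x \<xi>) \<xi>"
    by (rule LIMSEQ_le_const[of "\<lambda>n. inner (blinfun_apply (a n) \<xi>) \<xi>"])
      (use assms pos_cone_iff in \<open>auto intro!: tendsto_intros\<close>)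
qed

text \<open>Domination of the vector norms is exactly the operator inequality between the two
  squares; later estimates of weights rely on this form.\<close>

lemma pos_diff_adj_mult:
  assumes "a \<in> A" "b \<in> A" "\<And>\<xi>. norm (blinfun_apply a \<xi>) \<le> norm (blinfun_apply b \<xi>)"
  shows "(op_adj b o\<^sub>L b) - (op_adj a o\<^sub>L a) \<in> PA"
  using assms adj_mult_pos[of a] adj_mult_pos[of b] inner_adj_mult[of a] inner_adj_mult[of b]
  unfolding pos_cone_iff
  by (auto intro: diff_A is_adj_diff simp: op_apply inner_simps power_mono)

end

section \<open>Proper weights and their linear extensions\<close>

locale cstar_weight = cstar_ops +
  fixes \<psi> :: "'a l2op \<Rightarrow> ennreal"
  assumes proper: "proper_weight A \<psi>"
begin

lemma psi_add: "a \<in> PA \<Longrightarrow> b \<in> PA \<Longrightarrow> \<psi> (a + b) = \<psi> a + \<psi> b"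
  and psi_scale_pos: "a \<in> PA \<Longrightarrow> 0 < r \<Longrightarrow> \<psi> (r *\<^sub>R a) = ennreal r * \<psi> a"
  and psi_dense: "PA \<subseteq> closure {a \<in> PA. \<psi> a < \<infinity>}"
  and psi_closed: "0 \<le> r \<Longrightarrow> closedin (top_of_set PA) {a \<in> PA. \<psi> a \<le> ennreal r}"
  using proper by (auto simp: proper_weight_def weight_def)

lemma psi_lsc:
  assumes "\<And>n::nat. a n \<in> PA" "a \<longlonglongrightarrow> x" "\<And>n. \<psi> (a n) \<le> ennreal r" "0 \<le> r"
  shows "\<psi> x \<le> ennreal r"
proof -
  have "x \<in> PA" using pos_limit assms by blast
  moreover obtain C where "closed C" "{a \<in> PA. \<psi> a \<le> ennreal r} = PA \<inter> C"
    using psi_closed[OF assms(4)] by (auto simp: closedin_closed)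
  moreover have "x \<in> C"
    using \<open>closed C\<close> assms calculation(3) closed_sequentially[of C a x] by blast
  ultimately show ?thesis by blast
qed

text \<open>Homogeneity is demanded for positive scalars only; the value at 0 is reached by lower
  semicontinuity along multiples, tending to 0, of an element of finite weight.\<close>

lemma psi_zero: "\<psi> 0 = 0"
proof -
  obtain a where a: "a \<in> PA" "\<psi> a < \<infinity>"
    using psi_dense pos_zero by (metis (no_types, lifting) Collect_empty_eq closure_empty empty_iff subsetD)
  have "\<psi> 0 \<le> ennreal e" if "0 < e" for e
  proof -
    define k where "k = e / (1 + enn2real (\<psi> a))"
    have k: "0 < k" using that by (simp add: k_def add_pos_nonneg)
    have kv: "k * enn2real (\<psi> a) \<le> e" using that by (simp add: k_def field_simps add_pos_nonneg)
    show ?thesis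
    proof (rule psi_lsc[of "\<lambda>n. (k / real (Suc n)) *\<^sub>R a"])
      show "(k / real (Suc n)) *\<^sub>R a \<in> PA" for n
        using a k by (intro pos_scale) auto
      have "(\<lambda>n. (k / real (Suc n)) *\<^sub>R a) \<longlonglongrightarrow> 0 *\<^sub>R a"
        by (intro tendsto_intros LIMSEQ_Suc[OF lim_const_over_n])
      then show "(\<lambda>n. (k / real (Suc n)) *\<^sub>R a) \<longlonglongrightarrow> 0" by simp
      fix n
      have "\<psi> ((k / real (Suc n)) *\<^sub>R a) = ennreal (k / real (Suc n)) * ennreal (enn2real (\<psi> a))"
        using a k by (subst psi_scale_pos) auto
      also have "\<dots> = ennreal (k / real (Suc n) * enn2real (\<psi> a))"
        using k by (intro ennreal_mult[symmetric]) auto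
      also have "k / real (Suc n) * enn2real (\<psi> a) = k * enn2real (\<psi> a) / real (Suc n)" by simp
      also have "ennreal \<dots> \<le> ennreal e"
        using kv k that by (intro ennreal_leI) (simp add: divide_le_eq distrib_left add_increasing2)
      finally show "\<psi> ((k / real (Suc n)) *\<^sub>R a) \<le> ennreal e" .
    qed (use that in simp)
  qed
  then have "\<psi> 0 \<le> 0" using ennreal_le_epsilon[of 0 "\<psi> 0"] by simp
  then show ?thesis by simp
qed

lemma psi_scale: "a \<in> PA \<Longrightarrow> 0 \<le> r \<Longrightarrow> \<psi> (r *\<^sub>R a) = ennreal r * \<psi> a"
  by (cases "r = 0") (auto simp: psi_scale_pos psi_zero)

lemma psi_mono: assumes "a \<in> PA" "b - a \<in> PA" shows "\<psi> a \<le> \<psi> b"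
  using psi_add[OF assms] by simp

section \<open>The left ideal of a weight and its seminorm\<close>

abbreviation "\<N> \<equiv> weight_N A \<psi>"

text \<open>The square of the GNS seminorm; \<open>weight_N\<close> is the set where it is
  finite.\<close>

definition sq :: "'a l2op \<Rightarrow> ennreal" where "sq b = \<psi> (op_adj b o\<^sub>L b)"

lemma weight_N_iff: "a \<in> \<N> \<longleftrightarrow> a \<in> A \<and> sq a < \<infinity>"
  by (simp add: weight_N_def sq_def)

lemma weight_N_A: "a \<in> \<N> \<Longrightarrow> a \<in> A" by (simp add: weight_N_iff)

lemma sq_mono:
  assumes "a \<in> A" "b \<in> A" "\<And>\<xi>. norm (blinfun_apply a \<xi>) \<le> norm (blinfun_apply b \<xi>)"
  shows "sq a \<le> sq b"
  unfolding sq_def by (intro psi_mono adj_mult_pos pos_diff_adj_mult assms)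

lemma sq_scale: assumes "a \<in> A" shows "sq (op_scale z a) = ennreal ((cmod z)\<^sup>2) * sq a"
proof -
  have "op_adj (op_scale z a) o\<^sub>L op_scale z a = (cmod z)\<^sup>2 *\<^sub>R (op_adj a o\<^sub>L a)"
    by (rule blinfun_eqI)
      (use assms in \<open>simp add: op_adj_simps op_apply l2_scale_simps clin_A[OF op_adj_A, unfolded clin_def]
        complex_norm_square[symmetric] mult.commute[of "cnj z"] flip: of_real_power\<close>)
  then show ?thesis using assms by (simp add: sq_def psi_scale adj_mult_pos)
qed

lemma scaleR_eq_op_scale: "r *\<^sub>R a = op_scale (complex_of_real r) a"
  by (rule blinfun_eqI) (simp add: op_apply l2_scale_simps)

lemma sq_scaleR: "a \<in> A \<Longrightarrow> sq (r *\<^sub>R a) = ennreal (r\<^sup>2) * sq a"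
  unfolding scaleR_eq_op_scale by (simp add: sq_scale)

text \<open>Left multiplication by \<open>y\<close> increases vector norms at most by the factor
  \<open>norm y\<close>. This makes \<open>weight_N\<close> a left ideal.\<close>

lemma sq_left: assumes "y \<in> A" "b \<in> A" shows "sq (y o\<^sub>L b) \<le> ennreal ((norm y)\<^sup>2) * sq b"
proof -
  have "sq (y o\<^sub>L b) \<le> sq (norm y *\<^sub>R b)"
    using assms by (intro sq_mono compose_A scaleR_A) (auto simp: op_apply norm_blinfun)
  then show ?thesis using assms by (simp add: sq_scaleR)
qed

text \<open>The parallelogram law, with the nonnegative term of \<open>a - b\<close>
  dropped.\<close>

lemma sq_add_le: assumes "a \<in> A" "b \<in> A" shows "sq (a + b) \<le> 2 * sq a + 2 * sq b"
proof -
  have "sq (a + b) + sq (a - b) = \<psi> ((op_adj (a + b) o\<^sub>L (a + b)) + (op_adj (a - b) o\<^sub>L (a - b)))"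
    unfolding sq_def by (intro psi_add[symmetric] adj_mult_pos add_A diff_A assms)
  also have "(op_adj (a + b) o\<^sub>L (a + b)) + (op_adj (a - b) o\<^sub>L (a - b)) =
      2 *\<^sub>R (op_adj a o\<^sub>L a) + 2 *\<^sub>R (op_adj b o\<^sub>L b)"
    by (rule blinfun_eqI) (use assms in \<open>simp add: op_adj_simps op_apply scaleR_2\<close>)
  also have "\<psi> \<dots> = 2 * sq a + 2 * sq b"
    using assms by (simp add: psi_add psi_scale pos_scale adj_mult_pos sq_def)
  finally show ?thesis by (metis add.right_neutral add_left_mono zero_le)
qed

lemma weight_N_add: "a \<in> \<N> \<Longrightarrow> b \<in> \<N> \<Longrightarrow> a + b \<in> \<N>"
  using sq_add_le[of a b] by (auto simp: weight_N_iff add_A ennreal_mult_less_top intro: order.strict_trans1)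

lemma weight_N_scale: "a \<in> \<N> \<Longrightarrow> op_scale z a \<in> \<N>"
  by (auto simp: weight_N_iff scale_A sq_scale ennreal_mult_less_top)

lemma weight_N_scaleR: "a \<in> \<N> \<Longrightarrow> r *\<^sub>R a \<in> \<N>"
  by (simp add: scaleR_eq_op_scale weight_N_scale)

lemma weight_N_diff: "a \<in> \<N> \<Longrightarrow> b \<in> \<N> \<Longrightarrow> a - b \<in> \<N>"
  using weight_N_add[of a "(-1) *\<^sub>R b"] weight_N_scaleR[of b "-1"] by simp

lemma weight_N_left: "y \<in> A \<Longrightarrow> b \<in> \<N> \<Longrightarrow> y o\<^sub>L b \<in> \<N>"
  using sq_left[of y b] by (auto simp: weight_N_iff compose_A ennreal_mult_less_top intro: order.strict_trans1)

lemma weight_N_zero: "0 \<in> \<N>"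
proof -
  have "op_adj 0 o\<^sub>L (0 :: 'a l2op) = 0" by (rule blinfun_eqI) (simp add: op_apply)
  then show ?thesis by (simp add: weight_N_iff zero_A sq_def psi_zero)
qed

lemma weight_N_sum: "(\<And>i. i \<in> I \<Longrightarrow> f i \<in> \<N>) \<Longrightarrow> sum f I \<in> \<N>"
  by (induction I rule: infinite_finite_induct) (auto simp: weight_N_zero weight_N_add)

section \<open>The linear extension of a weight\<close>

definition FP :: "'a l2op set" where "FP = {a \<in> PA. \<psi> a < \<infinity>}"
definition val :: "'a l2op \<Rightarrow> real" where "val a = enn2real (\<psi> a)"

lemma FP_D: "a \<in> FP \<Longrightarrow> a \<in> PA" "a \<in> FP \<Longrightarrow> a \<in> A" "a \<in> FP \<Longrightarrow> \<psi> a = ennreal (val a)"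
  by (auto simp: FP_def pos_A val_def)

lemma FP_ops: "0 \<in> FP" "a \<in> FP \<Longrightarrow> b \<in> FP \<Longrightarrow> a + b \<in> FP" "a \<in> FP \<Longrightarrow> 0 \<le> r \<Longrightarrow> r *\<^sub>R a \<in> FP"
  by (auto simp: FP_def pos_zero pos_add pos_scale psi_zero psi_add psi_scale ennreal_mult_less_top)

lemma val_ops: "val 0 = 0" "a \<in> FP \<Longrightarrow> b \<in> FP \<Longrightarrow> val (a + b) = val a + val b"
  "a \<in> FP \<Longrightarrow> 0 \<le> r \<Longrightarrow> val (r *\<^sub>R a) = r * val a" "0 \<le> val a"
  by (auto simp: FP_def val_def psi_zero psi_add psi_scale enn2real_plus enn2real_mult)

lemma FP_adj_mult: "b \<in> \<N> \<Longrightarrow> op_adj b o\<^sub>L b \<in> FP"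
  by (auto simp: FP_def weight_N_def adj_mult_pos)

lemma FP_sqrt: assumes "a \<in> FP" obtains b where "b \<in> \<N>" "a = op_adj b o\<^sub>L b"
  using assms by (auto simp: FP_def weight_N_def pos_cone_def)

text \<open>Four positive elements of finite weight representing the real and imaginary parts of
  \<open>x\<close>. The linear extension is read off from such a decomposition instead of from a
  span.\<close>

definition rep :: "'a l2op \<Rightarrow> 'a l2op \<Rightarrow> 'a l2op \<Rightarrow> 'a l2op \<Rightarrow> 'a l2op \<Rightarrow> bool" where
  "rep x p q r s \<longleftrightarrow> p \<in> FP \<and> q \<in> FP \<and> r \<in> FP \<and> s \<in> FP \<and> x = p - q + op_scale \<i> (r - s)"

text \<open>The differences \<open>h\<close> of the real parts and \<open>k\<close> of the imaginary
  parts are self-adjoint with \<open>h = - \<i> k\<close>. Taking adjoints gives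
  \<open>h = \<i> k\<close>, so both vanish; what remains are equations between sums of positive
  elements, where additivity applies.\<close>

lemma rep_unique:
  assumes "rep x p q r s" "rep x p' q' r' s'"
  shows "val p - val q = val p' - val q'" "val r - val s = val r' - val s'"
proof -
  define h where "h = (p - q) - (p' - q')"
  define k where "k = (r - s) - (r' - s')"
  have fp: "p \<in> FP" "q \<in> FP" "r \<in> FP" "s \<in> FP" "p' \<in> FP" "q' \<in> FP" "r' \<in> FP" "s' \<in> FP"
    using assms by (auto simp: rep_def)
  have hk: "h \<in> A" "k \<in> A" unfolding h_def k_def by (intro diff_A FP_D(2) fp)+
  have adj: "op_adj h = h" "op_adj k = k"
    unfolding h_def k_def using fp by (simp_all add: op_adj_simps diff_A FP_D pos_adj)
  have "p - q + op_scale \<i> (r - s) = p' - q' + op_scale \<i> (r' - s')"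
    using assms by (simp add: rep_def)
  then have "h = op_scale (- \<i>) k"
    unfolding h_def k_def
    by (intro blinfun_eqI, drule_tac arg_cong[where f = "\<lambda>a. blinfun_apply a _"])
      (simp add: op_apply l2_scale_simps algebra_simps l2_scale_decomp[of "- \<i>"])
  moreover from this have "h = op_scale \<i> k"
    using op_adj_simps(2)[OF hk(2), of "- \<i>"] adj by simp
  ultimately have "2 *\<^sub>R h = op_scale (- \<i>) k + op_scale \<i> k" by (simp add: scaleR_2)
  also have "\<dots> = 0" by (rule blinfun_eqI) (simp add: op_apply flip: l2_scale_simps(7), simp add: l2_scale_simps)
  finally have h0: "h = 0" by simp
  have "k = op_scale (- \<i>) (op_scale \<i> k)" by (rule blinfun_eqI) (simp add: op_apply l2_scale_simps)
  also have "op_scale \<i> k = 0" using h0 \<open>h = op_scale \<i> k\<close> by simp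
  also have "op_scale (- \<i>) 0 = 0" by (rule blinfun_eqI) (simp add: op_apply l2_scale_simps)
  finally have "k = 0" .
  with h0 have "p + q' = p' + q" "r + s' = r' + s" by (auto simp: h_def k_def algebra_simps)
  then have "val (p + q') = val (p' + q)" "val (r + s') = val (r' + s)" by simp_all
  then show "val p - val q = val p' - val q'" "val r - val s = val r' - val s'"
    using fp by (simp_all add: val_ops)
qed

definition ext0 :: "'a l2op \<Rightarrow> complex" where
  "ext0 x = (THE z. \<exists>p q r s. rep x p q r s \<and> z = Complex (val p - val q) (val r - val s))"

lemma ext0_eq: assumes "rep x p q r s" shows "ext0 x = Complex (val p - val q) (val r - val s)"
  unfolding ext0_def
proof (rule the_equality)
  show "\<exists>p' q' r' s'. rep x p' q' r' s' \<and>
      Complex (val p - val q) (val r - val s) = Complex (val p' - val q') (val r' - val s')"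
    using assms by blast
qed (use rep_unique[OF assms] in auto)

lemma rep_add: "rep x p q r s \<Longrightarrow> rep x' p' q' r' s' \<Longrightarrow> rep (x + x') (p + p') (q + q') (r + r') (s + s')"
  by (auto simp: rep_def FP_ops intro!: blinfun_eqI simp: op_apply l2_scale_simps)

lemma rep_scale_nonneg: "rep x p q r s \<Longrightarrow> 0 \<le> c \<Longrightarrow> rep (c *\<^sub>R x) (c *\<^sub>R p) (c *\<^sub>R q) (c *\<^sub>R r) (c *\<^sub>R s)"
  by (auto simp: rep_def FP_ops intro!: blinfun_eqI simp: op_apply l2_scale_simps scaleR_diff_right scaleR_add_right)

lemma rep_uminus: "rep x p q r s \<Longrightarrow> rep (- x) q p s r"
  by (auto simp: rep_def FP_ops intro!: blinfun_eqI simp: op_apply l2_scale_simps)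

lemma rep_ii: "rep x p q r s \<Longrightarrow> rep (op_scale \<i> x) s r p q"
  by (auto simp: rep_def FP_ops intro!: blinfun_eqI simp: op_apply l2_scale_simps)
    (simp add: l2_scale_decomp[of "-1"])

definition "repable x \<longleftrightarrow> (\<exists>p q r s. rep x p q r s)"

lemma repable_FP: "p \<in> FP \<Longrightarrow> repable p" "p \<in> FP \<Longrightarrow> ext0 p = complex_of_real (val p)"
proof -
  assume "p \<in> FP"
  then have "rep p p 0 0 0" by (auto simp: rep_def FP_ops intro!: blinfun_eqI simp: op_apply l2_scale_simps)
  then show "repable p" "ext0 p = complex_of_real (val p)"
    by (auto simp: repable_def ext0_eq val_ops complex_eq_iff)
qed

lemma repable_add:
  assumes "repable x" "repable x'"
  shows "repable (x + x')" "ext0 (x + x') = ext0 x + ext0 x'"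
proof -
  from assms obtain p q r s p' q' r' s' where *: "rep x p q r s" "rep x' p' q' r' s'"
    by (auto simp: repable_def)
  then have "p \<in> FP" "q \<in> FP" "r \<in> FP" "s \<in> FP" "p' \<in> FP" "q' \<in> FP" "r' \<in> FP" "s' \<in> FP"
    by (auto simp: rep_def)
  with rep_add[OF *] * show "repable (x + x')" "ext0 (x + x') = ext0 x + ext0 x'"
    by (auto simp: repable_def ext0_eq val_ops complex_eq_iff)
qed

lemma repable_scale:
  assumes "repable x"
  shows "repable (op_scale z x)" "ext0 (op_scale z x) = z * ext0 x"
proof -
  have nonneg: "repable (c *\<^sub>R x) \<and> ext0 (c *\<^sub>R x) = complex_of_real c * ext0 x" if c: "0 \<le> c" and x: "repable x" for c x
  proof -
    obtain p q r s where *: "rep x p q r s" using x by (auto simp: repable_def)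
    then have "p \<in> FP" "q \<in> FP" "r \<in> FP" "s \<in> FP" by (auto simp: rep_def)
    then show ?thesis using rep_scale_nonneg[OF * c] * c
      by (auto simp: repable_def ext0_eq val_ops complex_eq_iff algebra_simps)
  qed
  have um: "repable (- x) \<and> ext0 (- x) = - ext0 x" if "repable x" for x
    using that rep_uminus by (fastforce simp: repable_def ext0_eq complex_eq_iff)
  have ii: "repable (op_scale \<i> x) \<and> ext0 (op_scale \<i> x) = \<i> * ext0 x" if "repable x" for x
    using that rep_ii by (fastforce simp: repable_def ext0_eq complex_eq_iff)
  have re: "repable (c *\<^sub>R x) \<and> ext0 (c *\<^sub>R x) = complex_of_real c * ext0 x" if "repable x" for c x
  proof (cases "0 \<le> c")
    case False
    then have "repable ((-c) *\<^sub>R x) \<and> ext0 ((-c) *\<^sub>R x) = complex_of_real (-c) * ext0 x"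
      using nonneg[of "-c" x] that by simp
    then show ?thesis using um[of "(-c) *\<^sub>R x"] by simp
  qed (use nonneg that in blast)
  have "op_scale z x = Re z *\<^sub>R x + Im z *\<^sub>R op_scale \<i> x"
    by (rule blinfun_eqI) (simp add: op_apply l2_scale_decomp[of z])
  then show "repable (op_scale z x)" "ext0 (op_scale z x) = z * ext0 x"
    using re[OF assms, of "Re z"] re[of "op_scale \<i> x" "Im z"] ii[OF assms]
      repable_add[of "Re z *\<^sub>R x" "Im z *\<^sub>R op_scale \<i> x"]
    by (simp_all add: complex_eq_iff algebra_simps)
qed

text \<open>Written as a sum of scalar multiples of squares, so that closure under addition and
  scaling applies term by term.\<close>

lemma polarization:
  assumes "a \<in> A" "b \<in> A"
  shows "4 *\<^sub>R (op_adj a o\<^sub>L b) = ((op_adj (a + b) o\<^sub>L (a + b)) + op_scale (-1) (op_adj (a - b) o\<^sub>L (a - b))) +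
    (op_scale (- \<i>) (op_adj (a + op_scale \<i> b) o\<^sub>L (a + op_scale \<i> b)) +
     op_scale \<i> (op_adj (a - op_scale \<i> b) o\<^sub>L (a - op_scale \<i> b)))"
proof (rule blinfun_eqI)
  fix \<xi>
  have c: "blinfun_apply (op_adj a) (l2_scale z \<eta>) = l2_scale z (blinfun_apply (op_adj a) \<eta>)"
    "blinfun_apply (op_adj b) (l2_scale z \<eta>) = l2_scale z (blinfun_apply (op_adj b) \<eta>)" for z \<eta>
    using clin_A op_adj_A assms by (auto simp: clin_def)
  show "blinfun_apply (4 *\<^sub>R (op_adj a o\<^sub>L b)) \<xi> = blinfun_apply (((op_adj (a + b) o\<^sub>L (a + b)) + op_scale (-1) (op_adj (a - b) o\<^sub>L (a - b))) +
    (op_scale (- \<i>) (op_adj (a + op_scale \<i> b) o\<^sub>L (a + op_scale \<i> b)) +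
     op_scale \<i> (op_adj (a - op_scale \<i> b) o\<^sub>L (a - op_scale \<i> b)))) \<xi>"
    by (rule l2_eqI) (use assms in \<open>simp add: op_adj_simps scale_A op_apply c l2_rep scaleR_conv_of_real algebra_simps\<close>)
qed

lemma repable_mult: assumes "a \<in> \<N>" "b \<in> \<N>" shows "repable (op_adj a o\<^sub>L b)"
proof -
  have sq: "repable (op_adj c o\<^sub>L c)" if "c \<in> \<N>" for c
    using FP_adj_mult repable_FP(1) that by blast
  have "repable (4 *\<^sub>R (op_adj a o\<^sub>L b))"
    unfolding polarization[OF weight_N_A[OF assms(1)] weight_N_A[OF assms(2)]]
    by (intro repable_add(1) repable_scale(1) sq weight_N_add weight_N_diff weight_N_scale assms)
  from repable_scale(1)[OF this, of "1/4"] show ?thesis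
    by (simp add: scaleR_eq_op_scale module.scale_scale[OF module_op_scale] module.scale_one[OF module_op_scale])
qed

abbreviation "\<M> \<equiv> weight_M A \<psi>"
abbreviation "ext \<equiv> weight_ext A \<psi>"

text \<open>Polarization puts the generators of the span among the four-term combinations;
  conversely an element of finite weight is a square of an element of \<open>weight_N\<close>, hence
  a generator.\<close>

lemma weight_M_iff: "x \<in> \<M> \<longleftrightarrow> repable x"
proof
  have sub: "module.subspace op_scale (Collect repable)"
    unfolding module.subspace_def[OF module_op_scale]
    using repable_add(1) repable_scale(1) repable_FP(1)[OF FP_ops(1)] by auto
  assume "x \<in> \<M>"
  moreover have "{op_adj a o\<^sub>L b |a b. a \<in> \<N> \<and> b \<in> \<N>} \<subseteq> Collect repable"
    using repable_mult by auto
  from module.span_minimal[OF module_op_scale this sub] have "\<M> \<subseteq> Collect repable"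
    unfolding weight_M_def .
  ultimately show "repable x" by blast
next
  assume "repable x"
  then obtain p q r s where *: "rep x p q r s" by (auto simp: repable_def)
  have FP: "p \<in> \<M>" if p: "p \<in> FP" for p
  proof -
    obtain b where "b \<in> \<N>" "p = op_adj b o\<^sub>L b" using FP_sqrt[OF p] .
    then show ?thesis unfolding weight_M_def by (intro module.span_base[OF module_op_scale]) auto
  qed
  show "x \<in> \<M>"
    using * FP unfolding rep_def weight_M_def
    by (auto intro!: module.span_add[OF module_op_scale] module.span_diff[OF module_op_scale] module.span_scale[OF module_op_scale])
qed

text \<open>The description defining \<open>weight_ext\<close> has exactly one solution: linearity
  together with the values on positive elements of finite weight forces \<open>ext0\<close>, and
  \<open>ext0\<close> satisfies the conditions by uniqueness of decompositions.\<close>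

lemma weight_ext_eq: "x \<in> \<M> \<Longrightarrow> ext x = ext0 x"
proof -
  let ?C = "\<lambda>L. L \<in> extensional \<M> \<and>
     (\<forall>a\<in>\<M>. \<forall>b\<in>\<M>. L (a + b) = L a + L b) \<and>
     (\<forall>z. \<forall>a\<in>\<M>. L (op_scale z a) = z * L a) \<and>
     (\<forall>a\<in>PA. \<psi> a < \<infinity> \<longrightarrow> L a = complex_of_real (enn2real (\<psi> a)))"
  let ?L = "restrict ext0 \<M>"
  have "?C ?L"
    using repable_add repable_scale repable_FP
    by (auto simp: weight_M_iff FP_def val_def)
  moreover have "L = ?L" if L: "?C L" for L
  proof (rule extensionalityI[of _ \<M>])
    fix x assume "x \<in> \<M>"
    then obtain p q r s where *: "rep x p q r s" by (auto simp: weight_M_iff repable_def)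
    then have fp: "p \<in> FP" "q \<in> FP" "r \<in> FP" "s \<in> FP" by (auto simp: rep_def)
    have M: "a \<in> FP \<Longrightarrow> a \<in> \<M>" "a \<in> \<M> \<Longrightarrow> b \<in> \<M> \<Longrightarrow> a + b \<in> \<M>" "a \<in> \<M> \<Longrightarrow> op_scale z a \<in> \<M>" for a b z
      using repable_add repable_scale repable_FP by (auto simp: weight_M_iff)
    have Lv: "a \<in> FP \<Longrightarrow> L a = complex_of_real (val a)" for a using L by (auto simp: FP_def val_def)
    have x: "x = (p + op_scale (-1) q) + op_scale \<i> (r + op_scale (-1) s)"
      using * by (auto simp: rep_def intro!: blinfun_eqI simp: op_apply l2_scale_decomp[of "-1"])
    have "L x = complex_of_real (val p) - complex_of_real (val q) + \<i> * (complex_of_real (val r) - complex_of_real (val s))"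
      unfolding x using L fp M Lv by simp
    then show "L x = ?L x" using ext0_eq[OF *] \<open>x \<in> \<M>\<close> by (simp add: complex_eq_iff)
  qed (use L in auto)
  ultimately have "ext = ?L" unfolding weight_ext_def by (rule the_equality)
  then show "x \<in> \<M> \<Longrightarrow> ext x = ext0 x" by simp
qed

lemma weight_M_ops: "a \<in> FP \<Longrightarrow> a \<in> \<M>" "a \<in> \<M> \<Longrightarrow> b \<in> \<M> \<Longrightarrow> a + b \<in> \<M>" "a \<in> \<M> \<Longrightarrow> op_scale z a \<in> \<M>"
  "a \<in> \<M> \<Longrightarrow> b \<in> \<M> \<Longrightarrow> a - b \<in> \<M>" "a \<in> \<N> \<Longrightarrow> b \<in> \<N> \<Longrightarrow> op_adj a o\<^sub>L b \<in> \<M>" "0 \<in> \<M>"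
  "a \<in> \<M> \<Longrightarrow> r *\<^sub>R a \<in> \<M>"
proof -
  show 1: "a \<in> FP \<Longrightarrow> a \<in> \<M>" "a \<in> \<M> \<Longrightarrow> b \<in> \<M> \<Longrightarrow> a + b \<in> \<M>" and 2: "a \<in> \<M> \<Longrightarrow> op_scale z a \<in> \<M>"
   and "a \<in> \<N> \<Longrightarrow> b \<in> \<N> \<Longrightarrow> op_adj a o\<^sub>L b \<in> \<M>" "0 \<in> \<M>" for a b z
    using repable_add repable_scale repable_FP repable_mult FP_ops by (auto simp: weight_M_iff)
  show "a \<in> \<M> \<Longrightarrow> r *\<^sub>R a \<in> \<M>" for a r using 2 by (simp add: scaleR_eq_op_scale)
  from this[of _ "-1"] show "a \<in> \<M> \<Longrightarrow> b \<in> \<M> \<Longrightarrow> a - b \<in> \<M>" for a b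
    using 1(2)[of a "(-1) *\<^sub>R b"] by simp
qed

lemma ext_FP: "a \<in> FP \<Longrightarrow> ext a = complex_of_real (val a)"
  and ext_add: "a \<in> \<M> \<Longrightarrow> b \<in> \<M> \<Longrightarrow> ext (a + b) = ext a + ext b"
  and ext_scale: "a \<in> \<M> \<Longrightarrow> ext (op_scale z a) = z * ext a"
  using weight_ext_eq weight_M_ops repable_add repable_scale repable_FP by (simp_all add: weight_M_iff)

lemma ext_scaleR: "a \<in> \<M> \<Longrightarrow> ext (r *\<^sub>R a) = complex_of_real r * ext a"
  by (simp add: scaleR_eq_op_scale ext_scale)

lemma ext_diff: "a \<in> \<M> \<Longrightarrow> b \<in> \<M> \<Longrightarrow> ext (a - b) = ext a - ext b"
  using ext_add[of a "(-1) *\<^sub>R b"] ext_scaleR[of b "-1"] weight_M_ops(7)[of b "-1"] by simp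

lemma weight_M_sum: "(\<And>i. i \<in> I \<Longrightarrow> f i \<in> \<M>) \<Longrightarrow> sum f I \<in> \<M>"
  by (induction I rule: infinite_finite_induct) (auto simp: weight_M_ops)

lemma ext_zero: "ext 0 = 0" using ext_FP[OF FP_ops(1)] by (simp add: val_ops)

lemma ext_sum: "(\<And>i. i \<in> I \<Longrightarrow> f i \<in> \<M>) \<Longrightarrow> ext (sum f I) = (\<Sum>i\<in>I. ext (f i))"
  by (induction I rule: infinite_finite_induct) (auto simp: ext_zero ext_add weight_M_sum)

lemma weight_M_A: "x \<in> \<M> \<Longrightarrow> x \<in> A"
  by (auto simp: weight_M_iff repable_def rep_def intro!: add_A diff_A scale_A intro: FP_D(2))

lemma weight_M_induct:
  assumes "x \<in> \<M>" "\<And>p. p \<in> FP \<Longrightarrow> P p" "\<And>a b. a \<in> \<M> \<Longrightarrow> b \<in> \<M> \<Longrightarrow> P a \<Longrightarrow> P b \<Longrightarrow> P (a + b)"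
    "\<And>a z. a \<in> \<M> \<Longrightarrow> P a \<Longrightarrow> P (op_scale z a)"
  shows "P x"
proof -
  obtain p q r s where *: "rep x p q r s" using assms(1) by (auto simp: weight_M_iff repable_def)
  have x: "x = (p + op_scale (-1) q) + op_scale \<i> (r + op_scale (-1) s)"
    using * by (auto simp: rep_def intro!: blinfun_eqI simp: op_apply l2_scale_decomp[of "-1"])
  have fp: "p \<in> FP" "q \<in> FP" "r \<in> FP" "s \<in> FP" using * by (auto simp: rep_def)
  note m = fp[THEN weight_M_ops(1)] and P = fp[THEN assms(2)]
  show ?thesis unfolding x
    by (intro assms(3,4) weight_M_ops(2,3) m P)
qed

lemma ext_polar:
  assumes "a \<in> \<N>" "b \<in> \<N>"
  shows "4 * ext (op_adj a o\<^sub>L b) =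
    (complex_of_real (val (op_adj (a + b) o\<^sub>L (a + b))) - val (op_adj (a - b) o\<^sub>L (a - b))) +
    (- \<i> * val (op_adj (a + op_scale \<i> b) o\<^sub>L (a + op_scale \<i> b)) +
     \<i> * val (op_adj (a - op_scale \<i> b) o\<^sub>L (a - op_scale \<i> b)))"
proof -
  have "4 * ext (op_adj a o\<^sub>L b) = ext (4 *\<^sub>R (op_adj a o\<^sub>L b))" using assms by (simp add: ext_scaleR weight_M_ops)
  also have "\<dots> = (complex_of_real (val (op_adj (a + b) o\<^sub>L (a + b))) - val (op_adj (a - b) o\<^sub>L (a - b))) +
    (- \<i> * val (op_adj (a + op_scale \<i> b) o\<^sub>L (a + op_scale \<i> b)) +
     \<i> * val (op_adj (a - op_scale \<i> b) o\<^sub>L (a - op_scale \<i> b)))"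
    using FP_adj_mult assms
    by (simp add: polarization weight_N_A ext_add ext_scale ext_FP weight_M_ops weight_N_add weight_N_diff weight_N_scale)
  finally show ?thesis .
qed

text \<open>Exchanging \<open>a\<close> and \<open>b\<close> permutes the four squares of the
  polarization identity up to unimodular factors, which the weight does not see.\<close>

lemma ext_commute:
  assumes "a \<in> \<N>" "b \<in> \<N>"
  shows "ext (op_adj b o\<^sub>L a) = cnj (ext (op_adj a o\<^sub>L b))"
proof -
  define v where "v c = val (op_adj c o\<^sub>L c)" for c
  have s: "v (op_scale z c) = v c" if "c \<in> \<N>" "cmod z = 1" for z c
    using sq_scale[of c z] that by (simp add: v_def val_def weight_N_A flip: sq_def)
  have "b - a = op_scale (-1) (a - b)" "b + op_scale \<i> a = op_scale \<i> (a - op_scale \<i> b)"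
     "b - op_scale \<i> a = op_scale (- \<i>) (a + op_scale \<i> b)"
    by (rule blinfun_eqI; rule l2_eqI; simp add: op_apply l2_rep algebra_simps)+
  then have "v (b - a) = v (a - b)" "v (b + op_scale \<i> a) = v (a - op_scale \<i> b)"
    "v (b - op_scale \<i> a) = v (a + op_scale \<i> b)"
    using s assms by (simp_all add: weight_N_add weight_N_diff weight_N_scale)
  moreover have "4 * ext (op_adj b o\<^sub>L a) = (complex_of_real (v (b + a)) - v (b - a)) +
      (- \<i> * v (b + op_scale \<i> a) + \<i> * v (b - op_scale \<i> a))"
    "4 * ext (op_adj a o\<^sub>L b) = (complex_of_real (v (a + b)) - v (a - b)) +
      (- \<i> * v (a + op_scale \<i> b) + \<i> * v (a - op_scale \<i> b))"
    unfolding v_def using ext_polar assms by blast+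
  ultimately have "4 * ext (op_adj b o\<^sub>L a) = cnj (4 * ext (op_adj a o\<^sub>L b))"
    by (simp only:) (simp add: add.commute[of b a])
  then show ?thesis by simp
qed

text \<open>Cauchy-Schwarz in its arithmetic mean form, obtained by expanding the nonnegative value
  on the square of \<open>a + u b\<close>. The phase \<open>u\<close> makes the mixed terms equal to
  \<open>- 2 * cmod w\<close>.\<close>

lemma ext_bound: assumes "a \<in> \<N>" "b \<in> \<N>"
  shows "cmod (ext (op_adj a o\<^sub>L b)) \<le> (val (op_adj a o\<^sub>L a) + val (op_adj b o\<^sub>L b)) / 2"
proof -
  define w where "w = ext (op_adj a o\<^sub>L b)"
  obtain u where u: "cmod u = 1" "u * w = - complex_of_real (cmod w)"
  proof (cases "w = 0")
    case False
    have "cnj w * w = complex_of_real (cmod w) * complex_of_real (cmod w)"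
      by (metis complex_norm_square mult.commute power2_eq_square of_real_power)
    then show thesis using False that[of "- cnj w / cmod w"] by (simp add: norm_divide)
  qed (use that[of 1] in auto)
  have A: "a \<in> A" "b \<in> A" using assms weight_N_A by auto
  let ?c = "a + op_scale u b"
  have c: "?c \<in> \<N>" by (intro weight_N_add weight_N_scale assms)
  have M: "op_adj a o\<^sub>L b \<in> \<M>" "op_adj b o\<^sub>L a \<in> \<M>" "op_adj a o\<^sub>L a \<in> FP" "op_adj b o\<^sub>L b \<in> FP"
    using weight_M_ops(5) assms FP_adj_mult by auto
  have "op_adj ?c o\<^sub>L ?c = ((op_adj a o\<^sub>L a) + (op_adj b o\<^sub>L b)) + (op_scale u (op_adj a o\<^sub>L b) + op_scale (cnj u) (op_adj b o\<^sub>L a))"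
  proof (rule blinfun_eqI)
    fix \<xi>
    have "cnj u * u = 1" using u(1) by (metis complex_norm_square mult.commute of_real_1 one_power2)
    then show "blinfun_apply (op_adj ?c o\<^sub>L ?c) \<xi> = blinfun_apply (((op_adj a o\<^sub>L a) + (op_adj b o\<^sub>L b)) + (op_scale u (op_adj a o\<^sub>L b) + op_scale (cnj u) (op_adj b o\<^sub>L a))) \<xi>"
      using A clin_A[OF op_adj_A, unfolded clin_def] by (simp add: op_adj_simps scale_A op_apply l2_scale_simps)
  qed
  then have "ext (op_adj ?c o\<^sub>L ?c) = (val (op_adj a o\<^sub>L a) + val (op_adj b o\<^sub>L b)) + (u * w + cnj u * ext (op_adj b o\<^sub>L a))"
    using M by (simp add: ext_add ext_scale weight_M_ops ext_FP w_def)
  moreover have "ext (op_adj b o\<^sub>L a) = cnj w"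
    using ext_commute[OF assms] by (simp add: w_def)
  moreover have "cnj u * cnj w = - complex_of_real (cmod w)" using u(2) by (metis complex_cnj_complex_of_real complex_cnj_minus complex_cnj_mult)
  moreover have "Re (ext (op_adj ?c o\<^sub>L ?c)) \<ge> 0" using ext_FP[OF FP_adj_mult[OF c]] val_ops(4) by simp
  ultimately have "0 \<le> val (op_adj a o\<^sub>L a) + val (op_adj b o\<^sub>L b) - 2 * cmod w" using u(2) by simp
  then show ?thesis by (simp add: w_def)
qed

end

section \<open>Bounded holomorphic functions on a strip\<close>

lemma strip_real: "complex_of_real t \<in> strip \<beta>" and strip_shift: "complex_of_real t + \<i> * complex_of_real \<beta> \<in> strip \<beta>"
  by (auto simp: strip_def)

lemma convex_strip: "convex (strip \<beta>)" and closed_strip: "closed (strip \<beta>)"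
proof -
  have "strip \<beta> = {z. min 0 \<beta> \<le> Im z} \<inter> {z. Im z \<le> max 0 \<beta>}" by (auto simp: strip_def)
  then show "convex (strip \<beta>)" "closed (strip \<beta>)"
    by (auto intro!: convex_Int closed_Int convex_halfspace_Im_ge convex_halfspace_Im_le
        closed_halfspace_Im_ge closed_halfspace_Im_le)
qed

text \<open>Extension by 0 below the real axis is holomorphic by reflection-free pasting across the
  line; it vanishes on an open set, hence up to the upper edge.\<close>

lemma strip_unique_pos:
  fixes D :: "complex \<Rightarrow> complex"
  assumes "0 < \<beta>" and cont: "continuous_on (strip \<beta>) D" and hol: "D holomorphic_on interior (strip \<beta>)"
    and zero: "\<And>t. D (complex_of_real t) = 0" and z: "z \<in> strip \<beta>"
  shows "D z = 0"
proof -
  define S where "S = {z. Im z < \<beta>}"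
  define H where "H = (\<lambda>z. if 0 \<le> Im z then D z else 0)"
  have S: "open S" "connected S"
    by (auto simp: S_def open_halfspace_Im_lt convex_halfspace_Im_lt convex_connected)
  have "{z. 0 < Im z \<and> Im z < \<beta>} \<subseteq> interior (strip \<beta>)"
    by (rule interior_maximal)
      (auto simp: strip_def Collect_conj_eq open_Int open_halfspace_Im_lt open_halfspace_Im_gt)
  then have holD: "D holomorphic_on {z. 0 < Im z \<and> Im z < \<beta>}" using hol holomorphic_on_subset by blast
  have holH: "H holomorphic_on S"
  proof (rule holomorphic_on_paste_across_line[where d = \<i> and k = 0])
    show "H holomorphic_on S \<inter> {z. \<i> \<bullet> z < 0}"
      by (rule holomorphic_transform[OF holomorphic_on_const[of 0]]) (auto simp: H_def)
    show "H holomorphic_on S \<inter> {z. 0 < \<i> \<bullet> z}"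
      by (rule holomorphic_transform[OF holomorphic_on_subset[OF holD]]) (auto simp: H_def S_def)
    have eq: "S = (S \<inter> {z. 0 \<le> Im z}) \<union> (S \<inter> {z. Im z \<le> 0})" by auto
    show "continuous_on S H" unfolding H_def
    proof (subst eq, rule continuous_on_cases_local)
      show "continuous_on (S \<inter> {z. 0 \<le> Im z}) D"
        by (rule continuous_on_subset[OF cont]) (auto simp: S_def strip_def)
      show "\<And>x. x \<in> S \<inter> {z. 0 \<le> Im z} \<and> \<not> 0 \<le> Im x \<or> x \<in> S \<inter> {z. Im z \<le> 0} \<and> 0 \<le> Im x \<Longrightarrow> D x = 0"
        using zero by (metis Int_Collect antisym complex_is_Real_iff of_real_Re)
    qed (auto simp: closedin_closed_Int closed_halfspace_Im_le closed_halfspace_Im_ge eq[symmetric])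
  qed (use S in auto)
  have neg: "H w = 0" if "w \<in> {z. Im z < 0}" for w using that by (auto simp: H_def)
  have H0: "H w = 0" if "w \<in> S" for w
  proof (rule analytic_continuation_open[of "{z. Im z < 0}" S H "\<lambda>_. 0" w])
    show "{z. Im z < 0} \<noteq> {}" by (auto intro: exI[of _ "- \<i>"])
  qed (use S assms(1) that holH neg in \<open>auto simp: S_def open_halfspace_Im_lt\<close>)
  have D0: "D w = 0" if "0 \<le> Im w" "Im w < \<beta>" for w using H0[of w] that by (simp add: H_def S_def)
  show ?thesis
  proof (cases "Im z < \<beta>")
    case True
    then show ?thesis using D0 z assms(1) by (auto simp: strip_def)
  next
    case False
    then have iz: "Im z = \<beta>" using z assms(1) by (auto simp: strip_def)
    \<comment> \<open>The upper edge lies outside the open half plane of the identity theorem and is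
      reached from below by continuity.\<close>
    define x where "x n = z - \<i> * complex_of_real (\<beta> / real (Suc n))" for n
    have "x \<longlonglongrightarrow> z - \<i> * complex_of_real 0" unfolding x_def
      by (intro tendsto_intros LIMSEQ_Suc[OF lim_const_over_n])
    then have xz: "x \<longlonglongrightarrow> z" by simp
    have im: "Im (x n) = \<beta> - \<beta> / real (Suc n)" for n by (simp add: x_def iz)
    have im': "0 \<le> Im (x n) \<and> Im (x n) < \<beta>" for n
      unfolding im using assms(1) by (simp add: divide_le_eq)
    then have "x n \<in> strip \<beta>" for n using assms(1) by (auto simp: strip_def less_imp_le)
    then have "(\<lambda>n. D (x n)) \<longlonglongrightarrow> D z"
      using cont xz z by (auto simp: continuous_on_sequentially o_def)
    moreover have "D (x n) = 0" for n using D0 im' by blast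
    ultimately show ?thesis by (simp add: LIMSEQ_const_iff)
  qed
qed

text \<open>The exponent has any sign: for 0 the strip is the real axis, and a negative exponent is
  reduced to a positive one by \<open>z \<mapsto> - z\<close>.\<close>

lemma strip_unique:
  fixes F G :: "complex \<Rightarrow> complex"
  assumes F: "continuous_on (strip \<beta>) F" "F holomorphic_on interior (strip \<beta>)"
    and G: "continuous_on (strip \<beta>) G" "G holomorphic_on interior (strip \<beta>)"
    and eq: "\<And>t. F (complex_of_real t) = G (complex_of_real t)" and z: "z \<in> strip \<beta>"
  shows "F z = G z"
proof -
  let ?D = "\<lambda>z. F z - G z"
  have D: "continuous_on (strip \<beta>) ?D" "?D holomorphic_on interior (strip \<beta>)"
    by (intro continuous_intros holomorphic_intros F G)+
  consider "\<beta> = 0" | "0 < \<beta>" | "\<beta> < 0" by linarith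
  then have "?D z = 0"
  proof cases
    case 1
    then have "z = complex_of_real (Re z)" using z by (simp add: strip_def complex_eq_iff)
    then show ?thesis using eq by (metis eq_iff_diff_eq_0)
  next
    case 2
    show ?thesis by (rule strip_unique_pos[OF 2 D _ z]) (simp add: eq)
  next
    case 3
    have s: "uminus ` strip (- \<beta>) = strip \<beta>"
    proof (intro equalityI subsetI)
      fix w assume "w \<in> strip \<beta>"
      then show "w \<in> uminus ` strip (- \<beta>)" using 3 by (intro image_eqI[of _ _ "- w"]) (auto simp: strip_def)
    qed (use 3 in \<open>auto simp: strip_def\<close>)
    have si: "uminus ` interior (strip (- \<beta>)) \<subseteq> interior (strip \<beta>)"
    proof (rule interior_maximal)
      show "uminus ` interior (strip (- \<beta>)) \<subseteq> strip \<beta>"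
        unfolding s[symmetric] by (intro image_mono interior_subset)
    qed (rule open_negations[OF open_interior])
    have "?D (- (- z)) = 0"
    proof (rule strip_unique_pos[of "- \<beta>" "\<lambda>z. ?D (- z)"])
      show "continuous_on (strip (- \<beta>)) (\<lambda>z. ?D (- z))"
        by (rule continuous_on_compose2[OF D(1), of _ uminus])
          (use s in \<open>auto intro!: continuous_intros\<close>)
      show "(\<lambda>z. ?D (- z)) holomorphic_on interior (strip (- \<beta>))"
        using holomorphic_on_compose_gen[OF holomorphic_on_minus[OF holomorphic_on_ident] D(2) si]
        by (simp add: o_def)
      show "?D (- complex_of_real t) = 0" for t using eq[of "- t"] by simp
      show "- z \<in> strip (- \<beta>)" using z 3 by (auto simp: strip_def)
    qed (use 3 in auto)
    then show ?thesis by simp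
  qed
  then show ?thesis by simp
qed

text \<open>An explicit antiderivative gives estimates uniform in the interval, so that only
  integrals over compact intervals occur.\<close>

lemma integral_arctan_bound:
  fixes u :: "real \<Rightarrow> 'b::banach"
  assumes "a \<le> b" "continuous_on {a..b} u" "\<And>t. t \<in> {a..b} \<Longrightarrow> norm (u t) \<le> K / (1 + t\<^sup>2)"
  shows "norm (integral {a..b} u) \<le> K * (arctan b - arctan a)"
proof -
  have p: "1 + t\<^sup>2 \<noteq> 0" for t :: real using zero_le_power2[of t] by linarith
  have "((\<lambda>t. K / (1 + t\<^sup>2)) has_integral (K * arctan b - K * arctan a)) {a..b}"
    by (rule fundamental_theorem_of_calculus[OF assms(1)])
      (auto intro!: derivative_eq_intros simp: p has_real_derivative_iff_has_vector_derivative[symmetric] field_simps)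
  then have i: "(\<lambda>t. K / (1 + t\<^sup>2)) integrable_on {a..b}" "integral {a..b} (\<lambda>t. K / (1 + t\<^sup>2)) = K * (arctan b - arctan a)"
    by (auto simp: integral_unique algebra_simps)
  show ?thesis
    using integral_norm_bound_integral[OF integrable_continuous_interval[OF assms(2)] i(1) assms(3)] i(2) by simp
qed

lemma arctan_bound: "K \<ge> 0 \<Longrightarrow> K * (arctan b - arctan a) \<le> K * pi"
  using arctan_ubound[of b] arctan_lbound[of a] by (intro mult_left_mono) auto

text \<open>A kernel which is integrable and holomorphic on a neighbourhood of the strip.\<close>

definition kern :: "real \<Rightarrow> complex \<Rightarrow> complex" where "kern \<beta> z = 1 / (z\<^sup>2 + complex_of_real (\<beta>\<^sup>2 + 1))"
definition kernr :: "real \<Rightarrow> real \<Rightarrow> real" where "kernr \<beta> t = 1 / (t\<^sup>2 + (\<beta>\<^sup>2 + 1))"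

lemma kern_real: "kern \<beta> (complex_of_real t) = complex_of_real (kernr \<beta> t)"
  by (simp add: kern_def kernr_def)

lemma strip_Im: "z \<in> strip \<beta> \<Longrightarrow> (Im z)\<^sup>2 \<le> \<beta>\<^sup>2"
  by (auto simp: strip_def abs_le_square_iff[symmetric] min_def max_def split: if_splits)

text \<open>The constant \<open>\<beta>\<^sup>2 + 1\<close> compensates the term
  \<open>- (Im z)\<^sup>2\<close> in the real part of \<open>z\<^sup>2\<close>: on the strip the
  denominator keeps real part at least \<open>1 + (Re z)\<^sup>2\<close>.\<close>

lemma kern_bound:
  assumes "z \<in> strip \<beta>"
  shows "z\<^sup>2 + complex_of_real (\<beta>\<^sup>2 + 1) \<noteq> 0" "cmod (kern \<beta> z) \<le> 1 / (1 + (Re z)\<^sup>2)"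
proof -
  let ?w = "z\<^sup>2 + complex_of_real (\<beta>\<^sup>2 + 1)"
  have "1 + (Re z)\<^sup>2 \<le> Re ?w" using strip_Im[OF assms] by (simp add: power2_eq_square)
  also have "\<dots> \<le> cmod ?w" by (rule complex_Re_le_cmod)
  finally have *: "1 + (Re z)\<^sup>2 \<le> cmod ?w" .
  have p: "1 + (Re z)\<^sup>2 > 0" by (simp add: add_pos_nonneg)
  then have "cmod ?w \<noteq> 0" using * by linarith
  then show "?w \<noteq> 0" by auto
  show "cmod (kern \<beta> z) \<le> 1 / (1 + (Re z)\<^sup>2)" unfolding kern_def norm_divide
    using * p by (simp add: frac_le)
qed

lemma kernr_bounds: "0 < kernr \<beta> t" "kernr \<beta> t \<le> 1 / (1 + t\<^sup>2)" "kernr \<beta> t \<le> 1"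
proof -
  have p: "0 < 1 + t\<^sup>2" "0 < t\<^sup>2 + (\<beta>\<^sup>2 + 1)" by (simp_all add: add_pos_nonneg add_nonneg_pos)
  then show "0 < kernr \<beta> t" "kernr \<beta> t \<le> 1 / (1 + t\<^sup>2)" "kernr \<beta> t \<le> 1"
    by (auto simp: kernr_def intro!: divide_left_mono)
qed

lemma continuous_kernr: "continuous_on S (kernr \<beta>)"
  unfolding kernr_def by (intro continuous_intros) (metis add_nonneg_pos less_irrefl zero_le_power2 zero_less_one)

lemma continuous_kern: "continuous_on (strip \<beta>) (kern \<beta>)"
  unfolding kern_def by (intro continuous_intros ballI kern_bound(1))

text \<open>The horizontal line of integration is moved to the other boundary component of the strip.\<close>

lemma strip_shift_bound:
  fixes F :: "complex \<Rightarrow> complex"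
  assumes F: "continuous_on (strip \<beta>) F" "F holomorphic_on interior (strip \<beta>)"
    and B: "\<And>z. z \<in> strip \<beta> \<Longrightarrow> cmod (F z) \<le> B"
    and D: "\<And>t. cmod (F (complex_of_real t + \<i> * complex_of_real \<beta>)) \<le> D"
    and R: "0 \<le> R"
  shows "cmod (integral {-R..R} (\<lambda>t. kernr \<beta> t * F (complex_of_real (t - s)))) \<le> pi * D + 2 * \<bar>\<beta>\<bar> * B / (1 + R\<^sup>2)"
proof -
  define f where "f z = kern \<beta> z * F (z - complex_of_real s)" for z
  have sh: "z - complex_of_real s \<in> strip \<beta> \<longleftrightarrow> z \<in> strip \<beta>" for z by (simp add: strip_def)
  have B0: "0 \<le> B" using B[OF strip_real] norm_ge_zero order_trans by blast
  have D0: "0 \<le> D" using D norm_ge_zero order_trans by blast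
  have contf: "continuous_on (strip \<beta>) f" unfolding f_def
    by (intro continuous_on_mult continuous_kern continuous_on_compose2[OF F(1)] continuous_intros) (auto simp: sh)
  have diff: "f field_differentiable at x" if "x \<in> interior (strip \<beta>) - {}" for x
  proof -
    have "(\<lambda>z. z - complex_of_real s) ` interior (strip \<beta>) \<subseteq> interior (strip \<beta>)"
    proof (rule interior_maximal)
      show "(\<lambda>z. z - complex_of_real s) ` interior (strip \<beta>) \<subseteq> strip \<beta>"
        using interior_subset sh by blast
      show "open ((\<lambda>z. z - complex_of_real s) ` interior (strip \<beta>))"
        by (intro open_translation_subtract open_interior)
    qed
    then have "(\<lambda>z. F (z - complex_of_real s)) holomorphic_on interior (strip \<beta>)"
      using holomorphic_on_compose_gen[OF _ F(2), of "\<lambda>z. z - complex_of_real s" "interior (strip \<beta>)"]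
      by (simp add: o_def holomorphic_intros)
    moreover have "kern \<beta> holomorphic_on interior (strip \<beta>)" unfolding kern_def
      by (intro holomorphic_intros) (use kern_bound interior_subset in blast)
    ultimately have "f holomorphic_on interior (strip \<beta>)" unfolding f_def by (intro holomorphic_intros)
    then show ?thesis using that holomorphic_on_imp_differentiable_at by blast
  qed
  \<comment> \<open>The strip is convex, so \<open>f\<close> has a primitive on it up to the
    boundary. Differences of values of \<open>P\<close> replace the contour integral over a
    rectangle.\<close>
  obtain P where P: "\<And>x. x \<in> strip \<beta> \<Longrightarrow> (P has_field_derivative f x) (at x within strip \<beta>)"
    using holomorphic_convex_primitive[OF convex_strip finite.emptyI contf diff] by blast
  have line: "integral {-R..R} (\<lambda>t. f (complex_of_real t + w)) = P (complex_of_real R + w) - P (complex_of_real (-R) + w)"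
    if w: "w = 0 \<or> w = \<i> * complex_of_real \<beta>" for w
  proof (rule integral_unique[OF fundamental_theorem_of_calculus])
    fix t assume "t \<in> {-R..R}"
    have st: "complex_of_real t + w \<in> strip \<beta>" for t using w strip_real strip_shift by auto
    have "((\<lambda>t. complex_of_real t + w) has_vector_derivative 1) (at t within {-R..R})"
      by (auto intro!: derivative_eq_intros has_vector_derivative_of_real)
    from field_vector_diff_chain_within[OF this has_field_derivative_subset[OF P[OF st]]] st
    show "((\<lambda>t. P (complex_of_real t + w)) has_vector_derivative f (complex_of_real t + w)) (at t within {-R..R})"
      by (auto simp: o_def)
  qed (use R in simp)
  \<comment> \<open>The mean value estimate along a short vertical side of length
    \<open>\<bar>\<beta>\<bar>\<close>, where the kernel is of order
    \<open>1 / r\<^sup>2\<close>.\<close>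
  have vert: "cmod (P (complex_of_real r + \<i> * complex_of_real \<beta>) - P (complex_of_real r)) \<le> B / (1 + r\<^sup>2) * \<bar>\<beta>\<bar>" for r
  proof -
    let ?S = "strip \<beta> \<inter> {z. Re z = r}"
    have "cmod (P (complex_of_real r + \<i> * complex_of_real \<beta>) - P (complex_of_real r))
        \<le> B / (1 + r\<^sup>2) * cmod ((complex_of_real r + \<i> * complex_of_real \<beta>) - complex_of_real r)"
    proof (rule field_differentiable_bound[of ?S])
      show "convex ?S" using convex_hyperplane[of "1::complex" r]
        by (intro convex_Int convex_strip) (simp add: inner_complex_def)
      show "(P has_field_derivative f z) (at z within ?S)" if "z \<in> ?S" for z
        using P that by (auto intro: has_field_derivative_subset)
      show "cmod (f z) \<le> B / (1 + r\<^sup>2)" if "z \<in> ?S" for z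
      proof -
        have "cmod (f z) \<le> 1 / (1 + (Re z)\<^sup>2) * B"
          unfolding f_def norm_mult using that B0
          by (intro mult_mono kern_bound B) (auto simp: sh)
        then show ?thesis using that by simp
      qed
    qed (auto simp: strip_real strip_shift)
    then show ?thesis by (simp add: norm_mult)
  qed
  have top: "cmod (integral {-R..R} (\<lambda>t. f (complex_of_real t + \<i> * complex_of_real \<beta>))) \<le> D * (arctan R - arctan (-R))"
  proof (rule integral_arctan_bound)
    show "continuous_on {-R..R} (\<lambda>t. f (complex_of_real t + \<i> * complex_of_real \<beta>))"
      by (intro continuous_on_compose2[OF contf] continuous_intros) (auto simp: strip_shift)
    fix t
    have e: "complex_of_real t + \<i> * complex_of_real \<beta> - complex_of_real s = complex_of_real (t - s) + \<i> * complex_of_real \<beta>"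
      by simp
    have "cmod (f (complex_of_real t + \<i> * complex_of_real \<beta>)) \<le> 1 / (1 + (Re (complex_of_real t + \<i> * complex_of_real \<beta>))\<^sup>2) * D"
      unfolding f_def norm_mult e by (intro mult_mono kern_bound strip_shift D) auto
    then show "cmod (f (complex_of_real t + \<i> * complex_of_real \<beta>)) \<le> D / (1 + t\<^sup>2)" by simp
  qed (use R in simp)
  have "integral {-R..R} (\<lambda>t. kernr \<beta> t * F (complex_of_real (t - s))) = P (complex_of_real R) - P (complex_of_real (-R))"
    using line[of 0] by (simp add: f_def kern_real)
  also have "\<dots> = integral {-R..R} (\<lambda>t. f (complex_of_real t + \<i> * complex_of_real \<beta>))
      - (P (complex_of_real R + \<i> * complex_of_real \<beta>) - P (complex_of_real R))
      + (P (complex_of_real (-R) + \<i> * complex_of_real \<beta>) - P (complex_of_real (-R)))"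
    using line[of "\<i> * complex_of_real \<beta>"] by simp
  also have "cmod \<dots> \<le> D * (arctan R - arctan (-R)) + B / (1 + R\<^sup>2) * \<bar>\<beta>\<bar> + B / (1 + (-R)\<^sup>2) * \<bar>\<beta>\<bar>"
    by (intro order_trans[OF norm_triangle_ineq] add_mono order_trans[OF norm_triangle_ineq4] top vert)
  also have "\<dots> \<le> D * pi + B / (1 + R\<^sup>2) * \<bar>\<beta>\<bar> + B / (1 + (-R)\<^sup>2) * \<bar>\<beta>\<bar>"
    using arctan_bound[OF D0] by simp
  finally show ?thesis by (simp add: mult_ac)
qed

text \<open>A weight cannot be moved inside an operator-valued integral, as it is not norm
  continuous. Finite sums with the same limit stay in \<open>weight_N\<close>, and there the linear
  extension can be expanded.\<close>

lemma riemann_sum_bound: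
  fixes u :: "real \<Rightarrow> 'b::banach"
  assumes "0 \<le> d" "continuous_on {a..a + real n * d} u"
    "\<And>s t. s \<in> {a..a + real n * d} \<Longrightarrow> t \<in> {a..a + real n * d} \<Longrightarrow> \<bar>s - t\<bar> \<le> d \<Longrightarrow> norm (u s - u t) \<le> \<epsilon>"
  shows "norm ((\<Sum>j<n. d *\<^sub>R u (a + real j * d)) - integral {a..a + real n * d} u) \<le> real n * d * \<epsilon>"
  using assms(2,3)
proof (induction n)
  case (Suc n)
  let ?b = "a + real n * d" and ?c = "a + real (Suc n) * d"
  have bc: "a \<le> ?b" "?b \<le> ?c" "?c = ?b + d" using assms(1) by (auto simp: distrib_right)
  have sub: "{?b..?c} \<subseteq> {a..?c}" using bc by auto
  have IH: "norm ((\<Sum>j<n. d *\<^sub>R u (a + real j * d)) - integral {a..?b} u) \<le> real n * d * \<epsilon>"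
    by (rule Suc.IH) (use Suc.prems bc in \<open>auto intro: continuous_on_subset\<close>)
  have int: "u integrable_on {a..?c}" "u integrable_on {?b..?c}"
    by (intro integrable_continuous_interval Suc.prems(1) continuous_on_subset[OF Suc.prems(1) sub])+
  have split: "integral {a..?c} u = integral {a..?b} u + integral {?b..?c} u"
    using Henstock_Kurzweil_Integration.integral_combine[OF bc(1,2) int(1)] by simp
  have "d *\<^sub>R u ?b - integral {?b..?c} u = integral {?b..?c} (\<lambda>t. u ?b - u t)"
    using int(2) bc(3) assms(1) by (subst Henstock_Kurzweil_Integration.integral_diff) auto
  also have "norm \<dots> \<le> \<epsilon> * (?c - ?b)"
  proof (rule integral_bound[OF bc(2)])
    show "continuous_on {?b..?c} (\<lambda>t. u ?b - u t)"
      by (intro continuous_intros continuous_on_subset[OF Suc.prems(1) sub])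
    show "norm (u ?b - u t) \<le> \<epsilon>" if "t \<in> {?b..?c}" for t
    proof (rule Suc.prems(2))
      show "t \<in> {a..?c}" using that sub by blast
      show "?b \<in> {a..?c}" using bc by simp
      show "\<bar>?b - t\<bar> \<le> d" using that bc(3) by (simp add: abs_le_iff)
    qed
  qed
  finally have "norm (d *\<^sub>R u ?b - integral {?b..?c} u) \<le> d * \<epsilon>" using bc(3) by (simp add: mult.commute)
  with IH have "norm (((\<Sum>j<n. d *\<^sub>R u (a + real j * d)) - integral {a..?b} u) + (d *\<^sub>R u ?b - integral {?b..?c} u))
      \<le> real n * d * \<epsilon> + d * \<epsilon>"
    by (intro order_trans[OF norm_triangle_ineq] add_mono)
  then show ?case unfolding split by (simp add: algebra_simps)
qed simp

section \<open>KMS weights and elements fixed by the action\<close>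

lemma blinfun_compose_assoc: "(a o\<^sub>L b) o\<^sub>L c = a o\<^sub>L (b o\<^sub>L c)"
  by (rule blinfun_eqI) simp

locale cstar_action = cstar_ops +
  fixes \<alpha> :: "real \<Rightarrow> 'a l2op \<Rightarrow> 'a l2op"
  assumes act_A: "a \<in> A \<Longrightarrow> \<alpha> t a \<in> A"
    and act_add: "a \<in> A \<Longrightarrow> b \<in> A \<Longrightarrow> \<alpha> t (a + b) = \<alpha> t a + \<alpha> t b"
    and act_scale: "a \<in> A \<Longrightarrow> \<alpha> t (op_scale z a) = op_scale z (\<alpha> t a)"
    and act_compose: "a \<in> A \<Longrightarrow> b \<in> A \<Longrightarrow> \<alpha> t (a o\<^sub>L b) = \<alpha> t a o\<^sub>L \<alpha> t b"
    and act_adj: "a \<in> A \<Longrightarrow> \<alpha> t (op_adj a) = op_adj (\<alpha> t a)"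
    and act_norm: "a \<in> A \<Longrightarrow> norm (\<alpha> t a) \<le> norm a"
    and act_act: "a \<in> A \<Longrightarrow> \<alpha> s (\<alpha> t a) = \<alpha> (s + t) a"
    and act_zero: "a \<in> A \<Longrightarrow> \<alpha> 0 a = a"
    and act_continuous: "a \<in> A \<Longrightarrow> continuous_on UNIV (\<lambda>t. \<alpha> t a)"
begin

lemma act_scaleR: "a \<in> A \<Longrightarrow> \<alpha> t (r *\<^sub>R a) = r *\<^sub>R \<alpha> t a"
  using act_scale[of a t "complex_of_real r"]
    blinfun_eqI[of "op_scale (complex_of_real r) a" "r *\<^sub>R a"]
    blinfun_eqI[of "op_scale (complex_of_real r) (\<alpha> t a)" "r *\<^sub>R \<alpha> t a"]
  by (simp add: op_apply l2_scale_simps)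

lemma act_diff: "a \<in> A \<Longrightarrow> b \<in> A \<Longrightarrow> \<alpha> t (a - b) = \<alpha> t a - \<alpha> t b"
  using act_add[of a "(-1) *\<^sub>R b" t] act_scaleR[of b t "-1"] uminus_A[of b] by simp

lemma act_pos: assumes "a \<in> PA" shows "\<alpha> t a \<in> PA"
proof -
  obtain b where "b \<in> A" "a = op_adj b o\<^sub>L b" using assms by (auto simp: pos_cone_def)
  then show ?thesis using adj_mult_pos[of "\<alpha> t b"] by (simp add: act_compose op_adj_A act_adj act_A)
qed

end

locale invariant_weight = cstar_action A \<alpha> + cstar_weight A \<psi>
  for A :: "'a l2op set" and \<alpha> :: "real \<Rightarrow> 'a l2op \<Rightarrow> 'a l2op" and \<psi> :: "'a l2op \<Rightarrow> ennreal" +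
  assumes invariant: "weight_invariant A \<alpha> \<psi>"
begin

lemma psi_act: "a \<in> PA \<Longrightarrow> \<psi> (\<alpha> t a) = \<psi> a"
  using invariant by (simp add: weight_invariant_def)

lemma sq_act: "b \<in> A \<Longrightarrow> sq (\<alpha> t b) = sq b"
  using psi_act[OF adj_mult_pos[of b], of t] by (simp add: sq_def act_compose op_adj_A act_adj)

lemma act_N: "b \<in> \<N> \<Longrightarrow> \<alpha> t b \<in> \<N>"
  by (simp add: weight_N_iff act_A sq_act)

lemma act_FP: "p \<in> FP \<Longrightarrow> \<alpha> t p \<in> FP" "p \<in> FP \<Longrightarrow> val (\<alpha> t p) = val p"
  by (auto simp: FP_def act_pos psi_act val_def)

lemma act_ext: assumes "x \<in> \<M>" shows "\<alpha> t x \<in> \<M>" "ext (\<alpha> t x) = ext x"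
proof -
  have "\<alpha> t x \<in> \<M> \<and> ext (\<alpha> t x) = ext x"
    by (rule weight_M_induct[OF assms])
      (auto simp: act_FP ext_FP weight_M_ops act_add act_scale ext_add ext_scale weight_M_A)
  then show "\<alpha> t x \<in> \<M>" "ext (\<alpha> t x) = ext x" by auto
qed

end

locale kms_weight = invariant_weight A \<alpha> \<psi>
  for A :: "'a l2op set" and \<alpha> :: "real \<Rightarrow> 'a l2op \<Rightarrow> 'a l2op" and \<psi> :: "'a l2op \<Rightarrow> ennreal" +
  fixes \<beta> :: real
  assumes kms: "KMS_weight A \<alpha> \<beta> \<psi>"
begin

lemma kms_function:
  assumes "a \<in> \<N>" "op_adj a \<in> \<N>" "b \<in> \<N>" "op_adj b \<in> \<N>"
  obtains F where "continuous_on (strip \<beta>) F" "bounded (F ` strip \<beta>)" "F holomorphic_on interior (strip \<beta>)"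
    "\<And>t. F (complex_of_real t) = ext (a o\<^sub>L \<alpha> t b)"
    "\<And>t. F (complex_of_real t + \<i> * complex_of_real \<beta>) = ext (\<alpha> t b o\<^sub>L a)"
proof -
  have "c \<in> \<N> \<inter> op_adj ` \<N>" if "c \<in> \<N>" "op_adj c \<in> \<N>" for c
    using that op_adj_simps(1)[OF weight_N_A[OF that(1)]] by (auto intro!: image_eqI[of _ _ "op_adj c"])
  then show thesis using that kms assms unfolding KMS_weight_def by meson
qed

text \<open>For fixed \<open>b\<close> the function of the KMS condition is constant.\<close>

lemma fixed_commute:
  assumes "a \<in> \<N>" "op_adj a \<in> \<N>" "b \<in> \<N>" "op_adj b \<in> \<N>" "\<And>t. \<alpha> t b = b"
  shows "ext (a o\<^sub>L b) = ext (b o\<^sub>L a)"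
proof -
  obtain F where F: "continuous_on (strip \<beta>) F" "F holomorphic_on interior (strip \<beta>)"
    "\<And>t. F (complex_of_real t) = ext (a o\<^sub>L \<alpha> t b)"
    "\<And>t. F (complex_of_real t + \<i> * complex_of_real \<beta>) = ext (\<alpha> t b o\<^sub>L a)"
    using kms_function[OF assms(1-4)] by metis
  have "F (complex_of_real 0 + \<i> * complex_of_real \<beta>) = ext (a o\<^sub>L b)"
    by (rule strip_unique[OF F(1,2) continuous_on_const holomorphic_on_const _ strip_shift])
      (simp add: F(3) assms(5))
  then show ?thesis using F(4)[of 0] assms(5) by simp
qed

text \<open>
  With \<open>T = b\<^sup>* b\<close>, the difference of the two sides is the value of the weight on
  \<open>(b - b h)\<^sup>* (b - b h) + 2 u T u\<close>.
\<close>

lemma fixed_compress_le: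
  assumes b: "b \<in> \<N>" "op_adj b \<in> \<N>"
    and h: "h \<in> \<N>" "op_adj h = h" "\<And>t. \<alpha> t h = h"
    and u: "u \<in> \<N>" "op_adj u = u" "\<And>t. \<alpha> t u = u"
    and uh: "u o\<^sub>L u = h - (h o\<^sub>L h)"
  shows "\<psi> (h o\<^sub>L ((op_adj b o\<^sub>L b) o\<^sub>L h)) \<le> \<psi> (op_adj b o\<^sub>L b)"
proof -
  define T where "T = op_adj b o\<^sub>L b"
  have A: "b \<in> A" "h \<in> A" "u \<in> A" using b h u weight_N_A by auto
  have TN: "T \<in> \<N>" "op_adj T = T" unfolding T_def
    using A b by (auto simp: op_adj_simps op_adj_A intro: weight_N_left)
  have TA: "T \<in> A" using TN weight_N_A by auto
  have Tv: "T o\<^sub>L v \<in> \<N>" "op_adj (T o\<^sub>L v) = v o\<^sub>L T" "v o\<^sub>L T \<in> \<N>" if "v \<in> \<N>" "op_adj v = v" for v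
    using that TN TA by (auto simp: op_adj_simps weight_N_A intro: weight_N_left)
  have M: "T o\<^sub>L v \<in> \<M>" "v o\<^sub>L T \<in> \<M>" "(T o\<^sub>L v) o\<^sub>L v \<in> \<M>" "v o\<^sub>L (T o\<^sub>L v) \<in> \<M>"
    if v: "v \<in> \<N>" "op_adj v = v" for v
  proof -
    show "T o\<^sub>L v \<in> \<M>" "v o\<^sub>L T \<in> \<M>" "(T o\<^sub>L v) o\<^sub>L v \<in> \<M>" "v o\<^sub>L (T o\<^sub>L v) \<in> \<M>"
      using weight_M_ops(5)[OF TN(1) v(1)] weight_M_ops(5)[OF v(1) TN(1)]
        weight_M_ops(5)[OF Tv(3)[OF v] v(1)] weight_M_ops(5)[OF v(1) Tv(1)[OF v]]
      by (simp_all add: v TN op_adj_simps weight_N_A TA)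
  qed
  \<comment> \<open>The fixed element \<open>v\<close> commutes under the weight with
    \<open>T\<close> and with \<open>T v\<close>; both belong to \<open>weight_N\<close> together
    with their adjoints.\<close>
  have c1: "ext (v o\<^sub>L T) = ext (T o\<^sub>L v)" and c2: "ext (v o\<^sub>L (T o\<^sub>L v)) = ext ((T o\<^sub>L v) o\<^sub>L v)"
    if v: "v \<in> \<N>" "op_adj v = v" "\<And>t. \<alpha> t v = v" for v
    using fixed_commute[of T v] fixed_commute[of "T o\<^sub>L v" v] v TN Tv[OF v(1,2)] by auto
  have TF: "T \<in> FP" unfolding T_def by (rule FP_adj_mult[OF b(1)])
  have compress: "v o\<^sub>L (T o\<^sub>L v) = op_adj (b o\<^sub>L v) o\<^sub>L (b o\<^sub>L v)" "v o\<^sub>L (T o\<^sub>L v) \<in> FP"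
    if v: "v \<in> \<N>" "op_adj v = v" for v
  proof -
    show e: "v o\<^sub>L (T o\<^sub>L v) = op_adj (b o\<^sub>L v) o\<^sub>L (b o\<^sub>L v)"
      using A by (simp add: T_def op_adj_simps v weight_N_A blinfun_compose_assoc)
    show "v o\<^sub>L (T o\<^sub>L v) \<in> FP" unfolding e by (intro FP_adj_mult weight_N_left A v)
  qed
  define d where "d = b - (b o\<^sub>L h)"
  have dN: "d \<in> \<N>" unfolding d_def by (intro weight_N_diff weight_N_left b h A)
  have dd: "op_adj d o\<^sub>L d = (T - (h o\<^sub>L T)) - ((T o\<^sub>L h) - (h o\<^sub>L (T o\<^sub>L h)))"
    unfolding d_def using A
    by (intro blinfun_eqI) (simp add: op_adj_simps compose_A h T_def op_apply)
  \<comment> \<open>The two mixed terms \<open>h T\<close> and \<open>T h\<close> have the same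
    value by \<open>c1\<close>.\<close>
  have e1: "complex_of_real (val (op_adj d o\<^sub>L d)) = val T - 2 * ext (T o\<^sub>L h) + ext (h o\<^sub>L (T o\<^sub>L h))"
  proof -
    have "complex_of_real (val (op_adj d o\<^sub>L d)) = ext (op_adj d o\<^sub>L d)"
      by (rule ext_FP[OF FP_adj_mult[OF dN], symmetric])
    also have "\<dots> = val T - 2 * ext (T o\<^sub>L h) + ext (h o\<^sub>L (T o\<^sub>L h))"
      unfolding dd by (simp add: ext_diff weight_M_ops(4) M h TF weight_M_ops(1) c1 ext_FP)
    finally show ?thesis .
  qed
  \<comment> \<open>Writing \<open>u u\<close> as \<open>h - h h\<close> turns the mixed value
    \<open>ext (T h)\<close> into a sum of weights of positive elements; in particular it is
    real.\<close>
  have "(T o\<^sub>L u) o\<^sub>L u = (T o\<^sub>L h) - ((T o\<^sub>L h) o\<^sub>L h)"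
    using arg_cong[OF uh, of "\<lambda>x. T o\<^sub>L x"]
    by (simp add: blinfun_compose_assoc bounded_bilinear.diff_right[OF bounded_bilinear_blinfun_compose])
  then have "ext (u o\<^sub>L (T o\<^sub>L u)) = ext (T o\<^sub>L h) - ext (h o\<^sub>L (T o\<^sub>L h))"
    by (simp add: c2 u h M ext_diff)
  then have e2: "ext (T o\<^sub>L h) = val (u o\<^sub>L (T o\<^sub>L u)) + val (h o\<^sub>L (T o\<^sub>L h))"
    using ext_FP[OF compress(2)[OF u(1,2)]] ext_FP[OF compress(2)[OF h(1,2)]] by (simp add: algebra_simps)
  have "complex_of_real (val T) = complex_of_real (val (op_adj d o\<^sub>L d) + 2 * val (u o\<^sub>L (T o\<^sub>L u)) + val (h o\<^sub>L (T o\<^sub>L h)))"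
    using e1 e2 ext_FP[OF compress(2)[OF h(1,2)]] by (simp add: algebra_simps)
  then have "val T = val (op_adj d o\<^sub>L d) + 2 * val (u o\<^sub>L (T o\<^sub>L u)) + val (h o\<^sub>L (T o\<^sub>L h))"
    by (simp only: of_real_eq_iff)
  then have "val (h o\<^sub>L (T o\<^sub>L h)) \<le> val T" using val_ops(4) by (simp add: add_nonneg_nonneg)
  then show ?thesis using FP_D(3)[OF TF] FP_D(3)[OF compress(2)[OF h(1,2)]] by (simp add: T_def ennreal_leI)
qed

lemma sq_lsc:
  assumes "\<And>n::nat. z n \<in> A" "z \<longlonglongrightarrow> x" "\<And>n. sq (z n) \<le> ennreal r" "0 \<le> r"
  shows "sq x \<le> ennreal r"
  unfolding sq_def
proof (rule psi_lsc)
  show "(\<lambda>n. op_adj (z n) o\<^sub>L z n) \<longlonglongrightarrow> (op_adj x o\<^sub>L x)"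
    by (intro bounded_bilinear.tendsto[OF bounded_bilinear_blinfun_compose] op_adj_tendsto assms)
qed (use assms in \<open>auto simp: sq_def adj_mult_pos\<close>)

section \<open>Smearing along the action\<close>

abbreviation "smear R w \<equiv> integral {- R..R} (\<lambda>t. kernr \<beta> t *\<^sub>R \<alpha> t w)"

lemma smear_continuous: "w \<in> A \<Longrightarrow> continuous_on S (\<lambda>t. kernr \<beta> t *\<^sub>R \<alpha> t w)"
  by (intro continuous_intros continuous_kernr continuous_on_subset[OF act_continuous]) auto

lemma smear_norm: assumes "w \<in> A" "a \<le> b"
  shows "norm (integral {a..b} (\<lambda>t. kernr \<beta> t *\<^sub>R \<alpha> t w)) \<le> norm w * (arctan b - arctan a)"
proof (rule integral_arctan_bound[OF assms(2) smear_continuous[OF assms(1)]])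
  fix t
  have "norm (kernr \<beta> t *\<^sub>R \<alpha> t w) \<le> 1 / (1 + t\<^sup>2) * norm w"
    unfolding norm_scaleR using kernr_bounds[of \<beta> t] act_norm[OF assms(1), of t] by (intro mult_mono) auto
  then show "norm (kernr \<beta> t *\<^sub>R \<alpha> t w) \<le> norm w / (1 + t\<^sup>2)" by simp
qed

lemma smear_diff: "w \<in> A \<Longrightarrow> w' \<in> A \<Longrightarrow> smear R (w - w') = smear R w - smear R w'"
  by (subst Henstock_Kurzweil_Integration.integral_diff[symmetric])
    (auto intro!: integrable_continuous_interval smear_continuous simp: act_diff scaleR_diff_right)

lemma smear_compose_fixed:
  assumes "w \<in> A" "x \<in> A" "\<And>t. \<alpha> t x = x" shows "smear R (w o\<^sub>L x) = smear R w o\<^sub>L x"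
proof -
  have bl: "bounded_linear (\<lambda>y. y o\<^sub>L x)"
    by (rule bounded_bilinear.bounded_linear_left[OF bounded_bilinear_blinfun_compose])
  have "kernr \<beta> t *\<^sub>R \<alpha> t (w o\<^sub>L x) = (kernr \<beta> t *\<^sub>R \<alpha> t w) o\<^sub>L x" for t
    using assms by (simp add: act_compose bounded_bilinear.scaleR_left[OF bounded_bilinear_blinfun_compose])
  then show ?thesis
    using integral_linear[OF integrable_continuous_interval[OF smear_continuous[OF assms(1)]] bl, of "-R" R]
    by (simp add: o_def)
qed

text \<open>Let \<open>F\<close> be the KMS function of the pair \<open>op_adj w\<close>,
  \<open>w\<close>. For a Riemann sum \<open>z\<close> with weights \<open>c i\<close> at times
  \<open>t i\<close>, the value on the square of \<open>z\<close> is the double sum of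
  \<open>c i * c j * F (t j - t i)\<close>. Each inner sum approximates an integral over the real
  line, which the shift of the contour bounds by values on the other edge, at most \<open>D\<close>.
  The weights \<open>c i\<close> add up to at most \<open>pi + 1\<close>. The final bound is
  therefore independent of \<open>sq w\<close>.\<close>

lemma smear_riemann_sum:
  assumes w: "w \<in> \<N>" "op_adj w \<in> \<N>" and D: "sq (op_adj w) \<le> ennreal D" "0 \<le> D" and "0 < e"
  shows "\<exists>N\<ge>N0. \<exists>z\<in>A. norm (z - smear (real N) w) \<le> e \<and> sq z \<le> ennreal ((pi + 1) * (pi * D + 2))"
proof -
  have wA: "w \<in> A" "op_adj w \<in> A" using w weight_N_A by auto
  obtain F where F: "continuous_on (strip \<beta>) F" "bounded (F ` strip \<beta>)" "F holomorphic_on interior (strip \<beta>)"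
    "\<And>t. F (complex_of_real t) = ext (op_adj w o\<^sub>L \<alpha> t w)"
    "\<And>t. F (complex_of_real t + \<i> * complex_of_real \<beta>) = ext (\<alpha> t w o\<^sub>L op_adj w)"
    using kms_function[of "op_adj w" w] w op_adj_simps(1)[OF wA(1)] by metis
  obtain B where B: "\<And>z. z \<in> strip \<beta> \<Longrightarrow> cmod (F z) \<le> B" using F(2) by (auto simp: bounded_iff)
  \<comment> \<open>On the far edge the value is a product of \<open>\<alpha> t w\<close> with
    \<open>op_adj w\<close>. Cauchy-Schwarz and invariance bound it by
    \<open>sq (op_adj w)\<close>.\<close>
  have FD: "cmod (F (complex_of_real t + \<i> * complex_of_real \<beta>)) \<le> D" for t
  proof -
    let ?a = "op_adj (\<alpha> t w)"
    have a: "?a \<in> \<N>" using act_N[OF w(2), of t] wA by (simp add: act_adj)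
    have "sq ?a = sq (op_adj w)" using sq_act[OF wA(2), of t] wA by (simp add: act_adj)
    then have v: "val (op_adj ?a o\<^sub>L ?a) \<le> D" "val (op_adj (op_adj w) o\<^sub>L op_adj w) \<le> D"
      using D by (auto simp: val_def sq_def intro!: enn2real_leI)
    show ?thesis using ext_bound[OF a w(2)] v wA by (simp add: F(5) op_adj_simps act_A)
  qed
  \<comment> \<open>\<open>N\<close> is taken so large that the two short sides of the contour
    contribute at most 1. This is the only place where the bound \<open>B\<close>, which is not
    uniform in \<open>w\<close>, is used.\<close>
  have "(\<lambda>N. 2 * \<bar>\<beta>\<bar> * B / (1 + (real N)\<^sup>2)) \<longlonglongrightarrow> 0" by real_asymp
  from order_tendstoD(2)[OF this, of 1]
  have "\<forall>\<^sub>F N in sequentially. 2 * \<bar>\<beta>\<bar> * B / (1 + (real N)\<^sup>2) < 1 \<and> N \<ge> N0 \<and> N \<ge> 1"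
    by (intro eventually_conj eventually_ge_at_top) simp
  from eventually_happens[OF this]
  obtain N where N: "2 * \<bar>\<beta>\<bar> * B / (1 + (real N)\<^sup>2) \<le> 1" "N \<ge> N0" "N \<ge> 1"
    by (auto dest: less_imp_le)
  define R where "R = real N"
  have R: "R \<ge> 1" "R > 0" using N by (auto simp: R_def)
  \<comment> \<open>A Riemann sum over an interval of length \<open>2 * R\<close> errs by at most
    \<open>2 * R * \<epsilon>\<close>, hence by at most \<open>e\<close> and at most 1.\<close>
  define \<epsilon> where "\<epsilon> = min e 1 / (2 * R)"
  have \<epsilon>: "0 < \<epsilon>" "2 * R * \<epsilon> \<le> e" "2 * R * \<epsilon> \<le> 1" using \<open>0 < e\<close> R by (auto simp: \<epsilon>_def)
  define I where "I = {-R..R}"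
  have cI: "compact I" "compact (I \<times> I)" by (auto simp: I_def intro: compact_Times)
  define f1 where "f1 t = kernr \<beta> t *\<^sub>R \<alpha> t w" for t
  define f2 where "f2 = (\<lambda>(s, t). kernr \<beta> t * F (complex_of_real (t - s)))"
  have "uniformly_continuous_on I f1"
    unfolding f1_def by (rule compact_uniformly_continuous[OF smear_continuous[OF wA(1)] cI(1)])
  then obtain d1 where d1: "d1 > 0" "\<And>s t. s \<in> I \<Longrightarrow> t \<in> I \<Longrightarrow> dist t s < d1 \<Longrightarrow> dist (f1 t) (f1 s) < \<epsilon>"
    unfolding uniformly_continuous_on_def using \<epsilon>(1) by meson
  have "continuous_on (I \<times> I) f2"
    unfolding f2_def case_prod_unfold
    by (intro continuous_intros continuous_on_compose2[OF continuous_kernr[of UNIV]] continuous_on_compose2[OF F(1)])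
      (auto simp: strip_def)
  from compact_uniformly_continuous[OF this cI(2)]
  obtain d2 where d2: "d2 > 0" "\<And>p q. p \<in> I \<times> I \<Longrightarrow> q \<in> I \<times> I \<Longrightarrow> dist q p < d2 \<Longrightarrow> dist (f2 q) (f2 p) < \<epsilon>"
    unfolding uniformly_continuous_on_def using \<epsilon>(1) by meson
  have "uniformly_continuous_on I (kernr \<beta>)"
    by (rule compact_uniformly_continuous[OF continuous_kernr cI(1)])
  then obtain d3 where d3: "d3 > 0" "\<And>s t. s \<in> I \<Longrightarrow> t \<in> I \<Longrightarrow> dist t s < d3 \<Longrightarrow> dist (kernr \<beta> t) (kernr \<beta> s) < \<epsilon>"
    unfolding uniformly_continuous_on_def using \<epsilon>(1) by meson
  \<comment> \<open>One mesh serves three integrands: the smeared operator, the translates of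
    \<open>F\<close> uniformly in \<open>s\<close>, and the kernel itself.\<close>
  define \<mu> where "\<mu> = min d1 (min d2 d3)"
  have \<mu>: "0 < \<mu>" "\<mu> \<le> d1" "\<mu> \<le> d2" "\<mu> \<le> d3" using d1(1) d2(1) d3(1) by (auto simp: \<mu>_def)
  obtain n where n: "real n > 2 * R / \<mu>" using reals_Archimedean2 by blast
  have "0 < 2 * R / \<mu>" using R \<mu> by simp
  then have n0: "real n > 0" using n by linarith
  define d where "d = 2 * R / real n"
  have "d < \<mu>" using n n0 \<mu>(1) by (simp add: d_def field_simps)
  then have d: "0 < d" "d < d1" "d < d2" "d < d3" "real n * d = 2 * R" "-R + real n * d = R"
    using n0 R \<mu> by (auto simp: d_def)
  have RR: "- R + 2 * R = R" by simp
  define t where "t j = -R + real j * d" for j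
  have tI: "t j \<in> I" if "j < n" for j
  proof -
    have "real j * d \<le> real n * d" using that d(1) by (intro mult_right_mono) auto
    then show ?thesis using d by (auto simp: t_def I_def)
  qed
  define c where "c j = d * kernr \<beta> (t j)" for j
  have c0: "0 \<le> c j" for j using d kernr_bounds[of \<beta>] by (simp add: c_def less_imp_le)
  define z where "z = (\<Sum>j<n. c j *\<^sub>R \<alpha> (t j) w)"
  have z1: "norm (z - smear R w) \<le> e"
  proof -
    have "norm ((\<Sum>j<n. d *\<^sub>R f1 (-R + real j * d)) - integral {-R..-R + real n * d} f1) \<le> real n * d * \<epsilon>"
    proof (rule riemann_sum_bound)
      show "continuous_on {-R..-R + real n * d} f1" unfolding f1_def by (rule smear_continuous[OF wA(1)])
      show "norm (f1 s - f1 t) \<le> \<epsilon>" if "s \<in> {-R..-R + real n * d}" "t \<in> {-R..-R + real n * d}" "\<bar>s - t\<bar> \<le> d" for s t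
        using d1(2)[of t s] that d by (auto simp: I_def dist_norm)
    qed (use d in simp)
    then have "norm ((\<Sum>j<n. d *\<^sub>R f1 (-R + real j * d)) - smear R w) \<le> 2 * R * \<epsilon>"
      unfolding d(5) RR f1_def .
    moreover have "z = (\<Sum>j<n. d *\<^sub>R f1 (-R + real j * d))" by (simp add: z_def c_def f1_def t_def)
    ultimately show ?thesis using \<epsilon>(2) by simp
  qed
  have csum: "(\<Sum>j<n. c j) \<le> pi + 1"
  proof -
    have "norm ((\<Sum>j<n. d *\<^sub>R kernr \<beta> (-R + real j * d)) - integral {-R..-R + real n * d} (kernr \<beta>)) \<le> real n * d * \<epsilon>"
    proof (rule riemann_sum_bound)
      show "norm (kernr \<beta> s - kernr \<beta> t) \<le> \<epsilon>" if "s \<in> {-R..-R + real n * d}" "t \<in> {-R..-R + real n * d}" "\<bar>s - t\<bar> \<le> d" for s t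
        using d3(2)[of t s] that d by (auto simp: I_def dist_norm)
    qed (use d in \<open>auto intro: continuous_kernr\<close>)
    then have "norm ((\<Sum>j<n. d *\<^sub>R kernr \<beta> (-R + real j * d)) - integral {-R..R} (kernr \<beta>)) \<le> 2 * R * \<epsilon>"
      unfolding d(5) RR .
    moreover have "(\<Sum>j<n. c j) = (\<Sum>j<n. d *\<^sub>R kernr \<beta> (-R + real j * d))" by (simp add: c_def t_def)
    ultimately have "\<bar>(\<Sum>j<n. c j) - integral {-R..R} (kernr \<beta>)\<bar> \<le> 1" using \<epsilon>(3) by simp
    moreover have "norm (integral {-R..R} (kernr \<beta>)) \<le> 1 * (arctan R - arctan (-R))"
      by (rule integral_arctan_bound) (use R kernr_bounds[of \<beta>] in \<open>auto intro: continuous_kernr simp: less_imp_le\<close>)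
    ultimately show ?thesis using arctan_bound[of 1 R "-R"] by (simp add: abs_le_iff)
  qed
  \<comment> \<open>The summand 2 consists of 1 for the Riemann error and 1 for the short
    sides.\<close>
  have row: "cmod (\<Sum>j<n. c j * F (complex_of_real (t j - s))) \<le> pi * D + 2" if s: "s \<in> I" for s
  proof -
    have "norm ((\<Sum>j<n. d *\<^sub>R f2 (s, -R + real j * d)) - integral {-R..-R + real n * d} (\<lambda>t. f2 (s, t))) \<le> real n * d * \<epsilon>"
    proof (rule riemann_sum_bound)
      show "continuous_on {-R..-R + real n * d} (\<lambda>t. f2 (s, t))"
        by (rule continuous_on_compose2[OF \<open>continuous_on (I \<times> I) f2\<close>]) (use d s in \<open>auto simp: I_def intro!: continuous_intros\<close>)
      show "norm (f2 (s, u) - f2 (s, t)) \<le> \<epsilon>" if "u \<in> {-R..-R + real n * d}" "t \<in> {-R..-R + real n * d}" "\<bar>u - t\<bar> \<le> d" for u t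
        using d2(2)[of "(s, t)" "(s, u)"] that d s by (auto simp: I_def dist_norm dist_Pair_Pair)
    qed (use d in simp)
    then have "norm ((\<Sum>j<n. d *\<^sub>R f2 (s, -R + real j * d)) - integral {-R..R} (\<lambda>t. f2 (s, t))) \<le> 2 * R * \<epsilon>"
      unfolding d(5) RR .
    moreover have "(\<Sum>j<n. c j * F (complex_of_real (t j - s))) = (\<Sum>j<n. d *\<^sub>R f2 (s, -R + real j * d))"
      by (simp add: c_def t_def f2_def scaleR_conv_of_real mult.assoc)
    ultimately have "cmod ((\<Sum>j<n. c j * F (complex_of_real (t j - s))) - integral {-R..R} (\<lambda>t. f2 (s, t))) \<le> 1"
      using \<epsilon>(3) by simp
    moreover have "cmod (integral {-R..R} (\<lambda>t. f2 (s, t))) \<le> pi * D + 2 * \<bar>\<beta>\<bar> * B / (1 + R\<^sup>2)"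
      unfolding f2_def prod.case by (rule strip_shift_bound[OF F(1,3) B FD]) (use R in auto)
    ultimately show ?thesis using N(1) norm_triangle_sub[of "\<Sum>j<n. c j * F (complex_of_real (t j - s))" "integral {-R..R} (\<lambda>t. f2 (s, t))"]
      by (simp add: R_def)
  qed
  have zN: "z \<in> \<N>" unfolding z_def by (intro weight_N_sum weight_N_scaleR act_N w)
  have zA: "z \<in> A" using zN weight_N_A by auto
  have M: "op_adj (\<alpha> s w) o\<^sub>L \<alpha> r w \<in> \<M>" for s r by (intro weight_M_ops act_N w)
  have "op_adj z = (\<Sum>i<n. c i *\<^sub>R op_adj (\<alpha> (t i) w))"
  proof -
    have "op_adj (\<Sum>i\<in>J. c i *\<^sub>R \<alpha> (t i) w) = (\<Sum>i\<in>J. c i *\<^sub>R op_adj (\<alpha> (t i) w))" if "finite J" for J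
      using that
    proof induction
      case empty
      show ?case using op_adj_simps(3)[OF zero_A, of 0] by simp
    next
      case (insert i J)
      then show ?case by (simp add: op_adj_simps scaleR_A act_A wA sum_A)
    qed
    then show ?thesis unfolding z_def by simp
  qed
  then have "op_adj z o\<^sub>L z = (\<Sum>i<n. c i *\<^sub>R (\<Sum>j<n. c j *\<^sub>R (op_adj (\<alpha> (t i) w) o\<^sub>L \<alpha> (t j) w)))"
    by (intro blinfun_eqI)
      (simp add: z_def op_apply blinfun.sum_left blinfun.sum_right scaleR_sum_right, subst sum.swap,
        simp add: mult.commute)
  then have "ext (op_adj z o\<^sub>L z) = (\<Sum>i<n. c i * (\<Sum>j<n. c j * ext (op_adj (\<alpha> (t i) w) o\<^sub>L \<alpha> (t j) w)))"
    using M by (simp add: ext_sum ext_scaleR weight_M_ops weight_M_sum)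
  also have "\<dots> = (\<Sum>i<n. c i * (\<Sum>j<n. c j * F (complex_of_real (t j - t i))))"
  proof -
    \<comment> \<open>Invariance under the action removes the common time \<open>s\<close>, leaving
      only the difference.\<close>
    have "ext (op_adj (\<alpha> s w) o\<^sub>L \<alpha> r w) = F (complex_of_real (r - s))" for s r
    proof -
      have "\<alpha> s (op_adj w o\<^sub>L \<alpha> (r - s) w) = op_adj (\<alpha> s w) o\<^sub>L \<alpha> r w"
        using wA by (simp add: act_compose act_A act_adj act_act)
      moreover have "op_adj w o\<^sub>L \<alpha> (r - s) w \<in> \<M>" by (intro weight_M_ops act_N w)
      ultimately show ?thesis using act_ext(2)[of "op_adj w o\<^sub>L \<alpha> (r - s) w" s] by (simp only: F(4))
    qed
    then show ?thesis by simp
  qed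
  also have "cmod \<dots> \<le> (\<Sum>i<n. c i * (pi * D + 2))"
    using row tI c0 by (intro sum_norm_le) (auto simp: norm_mult intro!: mult_left_mono)
  also have "\<dots> \<le> (pi + 1) * (pi * D + 2)"
    unfolding sum_distrib_right[symmetric] using csum D by (intro mult_right_mono) auto
  finally have "val (op_adj z o\<^sub>L z) \<le> (pi + 1) * (pi * D + 2)"
    using ext_FP[OF FP_adj_mult[OF zN]] val_ops(4) by simp
  then have "sq z \<le> ennreal ((pi + 1) * (pi * D + 2))"
    unfolding sq_def using FP_D(3)[OF FP_adj_mult[OF zN]] by (simp add: ennreal_leI)
  then show ?thesis using zA z1 N(2) unfolding R_def by blast
qed

text \<open>
  Smearing with the kernel makes elements analytic for the action. The products \<open>e x e\<^sub>k\<close> below lie in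
  the domain of the weight together with their adjoints, and the values of the weight on their smeared
  versions stay bounded when \<open>e\<^sub>k\<close> tends to \<open>h\<close>.
\<close>

lemma fixed_in_N:
  assumes x: "x \<in> A" "\<And>t. \<alpha> t x = x" and h: "h \<in> PA" "\<And>t. \<alpha> t h = h"
    and xh: "x o\<^sub>L h = x" "h o\<^sub>L x = x"
  shows "x \<in> \<N>"
proof -
  have hA: "h \<in> A" using h(1) pos_A by auto
  have "h \<in> closure FP" using psi_dense h(1) by (auto simp: FP_def)
  then obtain ek where ek: "\<And>k. ek k \<in> FP" "ek \<longlonglongrightarrow> h" using closure_sequential by metis
  \<comment> \<open>With distance 1/2 the smeared \<open>e\<close> differs from the smeared
    \<open>h\<close>, a positive multiple of \<open>h\<close>, by at most half of that
    multiple.\<close>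
  obtain e where e: "e \<in> FP" "norm (e - h) \<le> 1/2"
  proof -
    have "\<forall>\<^sub>F k in sequentially. dist (ek k) h < 1/2" using ek(2) by (intro tendstoD) auto
    then obtain k where "dist (ek k) h < 1/2" by (auto simp: eventually_sequentially)
    then show thesis using that[of "ek k"] ek(1) by (simp add: dist_norm)
  qed
  have FPN: "a \<in> \<N>" "op_adj a = a" "a \<in> A" if "a \<in> FP" for a
  proof -
    obtain b where b: "b \<in> \<N>" "a = op_adj b o\<^sub>L b" using FP_sqrt[OF \<open>a \<in> FP\<close>] .
    show "a \<in> \<N>" unfolding b(2) by (intro weight_N_left op_adj_A weight_N_A b)
    show "op_adj a = a" "a \<in> A" using that FP_D pos_adj by auto
  qed
  obtain K where K: "\<And>k. norm (ek k) \<le> K" "0 \<le> K"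
    using Bseq_def[of ek] convergent_imp_Bseq[of ek] ek(2) convergentI less_imp_le by metis
  \<comment> \<open>The factor \<open>ek k\<close> on the right puts \<open>w k\<close> into the
    left ideal, the factor \<open>e\<close> on the left does so for its adjoint. Only the seminorm
    of the adjoint is bounded uniformly in \<open>k\<close>, by \<open>D\<close>, and only this one
    enters the estimate.\<close>
  define w where "w k = e o\<^sub>L (x o\<^sub>L ek k)" for k
  define D where "D = (K * norm x)\<^sup>2 * val (op_adj e o\<^sub>L e)"
  have D0: "0 \<le> D" by (simp add: D_def val_ops)
  have xeA: "x o\<^sub>L ek k \<in> A" "e \<in> A" "e o\<^sub>L x \<in> A" for k using x FPN e ek by (auto intro: compose_A)
  have adjw: "op_adj (w k) = (ek k o\<^sub>L op_adj x) o\<^sub>L e" for k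
    using x FPN[OF ek(1)] FPN[OF e(1)] by (simp add: w_def op_adj_simps compose_A)
  have "w k \<in> \<N>" "(ek k o\<^sub>L op_adj x) o\<^sub>L e \<in> \<N>" for k
    unfolding w_def using x FPN[OF ek(1)] FPN[OF e(1)] by (auto intro!: weight_N_left compose_A op_adj_A)
  then have wN: "w k \<in> \<N>" "op_adj (w k) \<in> \<N>" for k unfolding adjw by blast+
  have wA: "w k \<in> A" for k using wN weight_N_A by auto
  have wD: "sq (op_adj (w k)) \<le> ennreal D" for k
  proof -
    have "norm (ek k o\<^sub>L op_adj x) \<le> K * norm x"
      using norm_blinfun_compose[of "ek k" "op_adj x"] K norm_op_adj[OF x(1)]
      by (smt (verit) mult_right_mono norm_ge_zero)
    then have "(norm (ek k o\<^sub>L op_adj x))\<^sup>2 \<le> (K * norm x)\<^sup>2" by (intro power_mono) auto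
    then have "ennreal ((norm (ek k o\<^sub>L op_adj x))\<^sup>2) * sq e \<le> ennreal ((K * norm x)\<^sup>2) * sq e"
      by (intro mult_right_mono ennreal_leI) auto
    moreover have "sq (op_adj (w k)) \<le> ennreal ((norm (ek k o\<^sub>L op_adj x))\<^sup>2) * sq e"
      unfolding adjw using x FPN[OF ek(1)] FPN[OF e(1)] by (intro sq_left compose_A op_adj_A) auto
    moreover have "sq e = ennreal (val (op_adj e o\<^sub>L e))"
      unfolding sq_def by (rule FP_D(3)[OF FP_adj_mult[OF FPN(1)[OF e(1)]]])
    ultimately show ?thesis by (simp add: D_def ennreal_mult val_ops)
  qed
  define C where "C = (pi + 1) * (pi * D + 2)"
  have C0: "0 \<le> C" using D0 pi_ge_zero by (simp add: C_def)
  have "\<exists>N\<ge>k. \<exists>z\<in>A. norm (z - smear (real N) (w k)) \<le> 1 / real (Suc k) \<and> sq z \<le> ennreal C" for k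
    unfolding C_def by (rule smear_riemann_sum[OF wN wD D0]) simp
  then have "\<forall>k. \<exists>N z. k \<le> N \<and> z \<in> A \<and> norm (z - smear (real N) (w k)) \<le> 1 / real (Suc k) \<and> sq z \<le> ennreal C"
    by blast
  from choice[OF this] obtain N where
    "\<forall>k. \<exists>z. k \<le> N k \<and> z \<in> A \<and> norm (z - smear (real (N k)) (w k)) \<le> 1 / real (Suc k) \<and> sq z \<le> ennreal C" ..
  from choice[OF this] obtain z where N: "\<And>k. N k \<ge> k" and z: "\<And>k. z k \<in> A"
    "\<And>k. norm (z k - smear (real (N k)) (w k)) \<le> 1 / real (Suc k)" "\<And>k. sq (z k) \<le> ennreal C"
    by blast
  \<comment> \<open>The tails of the integral are controlled by \<open>arctan\<close>, so the
    smeared elements converge in norm as the interval grows.\<close>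
  define E where "E n = smear (real n) e" for n :: nat
  have E_step: "norm (E n - E m) \<le> 2 * norm e * (arctan (real n) - arctan (real m))" if "m \<le> n" for m n
  proof -
    let ?f = "\<lambda>t. kernr \<beta> t *\<^sub>R \<alpha> t e"
    have int: "?f integrable_on {a..b}" for a b
      by (rule integrable_continuous_interval[OF smear_continuous[OF xeA(2)]])
    have "E n = (integral {-real n..-real m} ?f + integral {-real m..real m} ?f) + integral {real m..real n} ?f"
      unfolding E_def using that
      by (simp add: Henstock_Kurzweil_Integration.integral_combine[OF _ _ int])
    then have "norm (E n - E m) \<le> norm (integral {-real n..-real m} ?f) + norm (integral {real m..real n} ?f)"
      unfolding E_def by (simp add: norm_triangle_ineq)
    also have "\<dots> \<le> norm e * (arctan (- real m) - arctan (- real n)) + norm e * (arctan (real n) - arctan (real m))"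
      using that by (intro add_mono smear_norm xeA) auto
    finally show ?thesis by (simp add: arctan_minus algebra_simps)
  qed
  have "Cauchy E"
  proof (rule CauchyI')
    fix r :: real assume "0 < r"
    have "(\<lambda>n. arctan (real n)) \<longlonglongrightarrow> pi / 2"
      using filterlim_compose[OF tendsto_arctan_at_top filterlim_real_sequentially] by (simp add: o_def)
    then have "Cauchy (\<lambda>n. arctan (real n))" using LIMSEQ_imp_Cauchy by blast
    then obtain M where M: "\<And>m n. m \<ge> M \<Longrightarrow> n \<ge> M \<Longrightarrow> dist (arctan (real m)) (arctan (real n)) < r / (2 * norm e + 1)"
      using metric_CauchyD[of _ "r / (2 * norm e + 1)"] \<open>0 < r\<close> by (metis add_nonneg_pos divide_pos_pos mult_nonneg_nonneg norm_ge_zero zero_le_numeral zero_less_one)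
    have "dist (E m) (E n) < r" if "m \<ge> M" "m < n" for m n
    proof -
      have "dist (E m) (E n) \<le> 2 * norm e * (arctan (real n) - arctan (real m))"
        using E_step[of m n] that by (simp add: dist_norm norm_minus_commute)
      also have "\<dots> \<le> 2 * norm e * (r / (2 * norm e + 1))"
        using M[of m n] that by (intro mult_left_mono) (auto simp: dist_real_def)
      also have "\<dots> < r" using \<open>0 < r\<close> by (simp add: field_simps add_pos_nonneg)
      finally show ?thesis .
    qed
    then show "\<exists>M. \<forall>m\<ge>M. \<forall>n>m. dist (E m) (E n) < r" by blast
  qed
  then obtain E' where E': "E \<longlonglongrightarrow> E'" using Cauchy_convergent_iff convergent_def by blast
  have cmp: "bounded_bilinear (o\<^sub>L)" by (rule bounded_bilinear_blinfun_compose)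
  \<comment> \<open>The limit of \<open>ek k\<close> is \<open>h\<close>, which \<open>x\<close>
    absorbs on the right.\<close>
  have wlim: "w \<longlonglongrightarrow> (e o\<^sub>L x)"
    using bounded_bilinear.tendsto[OF cmp tendsto_const bounded_bilinear.tendsto[OF cmp tendsto_const ek(2)], of e x]
    unfolding w_def xh .
  have N_top: "filterlim N sequentially sequentially" using N by (intro filterlim_at_top_mono[OF filterlim_ident]) auto
  have "(\<lambda>k. norm (smear (real (N k)) (w k) - (E (N k) o\<^sub>L x))) \<longlonglongrightarrow> 0"
  proof (rule Lim_null_comparison)
    show "\<forall>\<^sub>F k in sequentially. norm (norm (smear (real (N k)) (w k) - (E (N k) o\<^sub>L x))) \<le> norm (w k - (e o\<^sub>L x)) * pi"
    proof (intro always_eventually allI)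
      fix k
      have "smear (real (N k)) (w k) - (E (N k) o\<^sub>L x) = smear (real (N k)) (w k - (e o\<^sub>L x))"
        unfolding E_def using x xeA wA by (simp add: smear_diff smear_compose_fixed)
      also have "norm \<dots> \<le> norm (w k - (e o\<^sub>L x)) * (arctan (real (N k)) - arctan (- real (N k)))"
        by (intro smear_norm diff_A wA xeA) auto
      also have "\<dots> \<le> norm (w k - (e o\<^sub>L x)) * pi" by (rule arctan_bound) simp
      finally show "norm (norm (smear (real (N k)) (w k) - (E (N k) o\<^sub>L x))) \<le> norm (w k - (e o\<^sub>L x)) * pi" by simp
    qed
    show "(\<lambda>k. norm (w k - (e o\<^sub>L x)) * pi) \<longlonglongrightarrow> 0"
      using tendsto_mult_left_zero[OF tendsto_norm_zero[OF LIM_zero[OF wlim]]] .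
  qed
  moreover have "(\<lambda>k. norm (z k - smear (real (N k)) (w k))) \<longlonglongrightarrow> 0"
    by (rule Lim_null_comparison[OF _ LIMSEQ_Suc[OF lim_1_over_n]]) (use z(2) in \<open>auto intro!: always_eventually\<close>)
  ultimately have "(\<lambda>k. (z k - smear (real (N k)) (w k)) + (smear (real (N k)) (w k) - (E (N k) o\<^sub>L x)) + (E (N k) o\<^sub>L x)) \<longlonglongrightarrow> 0 + 0 + (E' o\<^sub>L x)"
    by (intro tendsto_add bounded_bilinear.tendsto[OF cmp] tendsto_const filterlim_compose[OF E' N_top])
      (simp_all add: tendsto_norm_zero_iff)
  then have zlim: "z \<longlonglongrightarrow> (E' o\<^sub>L x)" by simp
  \<comment> \<open>The approximants \<open>z k\<close> have bounded seminorm and converge to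
    \<open>E' x\<close>, so lower semicontinuity applies although the seminorms of the
    \<open>w k\<close> may be unbounded.\<close>
  have sqE: "sq (E' o\<^sub>L x) \<le> ennreal C" by (rule sq_lsc[OF z(1) zlim z(3) C0])
  define c where "c = integral {-1..1} (kernr \<beta>)"
  have kint: "kernr \<beta> integrable_on {a..b}" for a b by (intro integrable_continuous_interval continuous_kernr)
  have c: "0 < c"
  proof -
    have "integral {-1..1::real} (\<lambda>t. 1 / (\<beta>\<^sup>2 + 2)) \<le> c"
      unfolding c_def
    proof (rule integral_le)
      fix t :: real assume "t \<in> {-1..1}"
      then have "t\<^sup>2 \<le> 1" using abs_le_square_iff[of t 1] by auto
      then show "1 / (\<beta>\<^sup>2 + 2) \<le> kernr \<beta> t" unfolding kernr_def
        by (intro divide_left_mono) (auto intro!: mult_pos_pos add_nonneg_pos)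
    qed (auto intro: kint)
    moreover have "0 < integral {-1..1::real} (\<lambda>t. 1 / (\<beta>\<^sup>2 + 2))" by (simp add: add_nonneg_pos)
    ultimately show ?thesis by linarith
  qed
  \<comment> \<open>Smearing multiplies \<open>h\<close> by the mass of the kernel, at least
    \<open>c\<close>, and \<open>h\<close> acts as the identity on the range of \<open>x\<close>;
    the deviation of \<open>e\<close> from \<open>h\<close> costs half of this. So \<open>x\<close>
    is dominated by a multiple of \<open>E' x\<close>, whose seminorm is finite.\<close>
  have low: "c / 2 * norm (blinfun_apply x \<xi>) \<le> norm (blinfun_apply (E' o\<^sub>L x) \<xi>)" for \<xi>
  proof (rule LIMSEQ_le_const)
    show "(\<lambda>n. norm (blinfun_apply (E n o\<^sub>L x) \<xi>)) \<longlonglongrightarrow> norm (blinfun_apply (E' o\<^sub>L x) \<xi>)"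
      by (intro tendsto_intros bounded_bilinear.tendsto[OF cmp] E')
    have "c / 2 * norm (blinfun_apply x \<xi>) \<le> norm (blinfun_apply (E n o\<^sub>L x) \<xi>)" if "n \<ge> 1" for n
    proof -
      let ?c = "integral {-real n..real n} (kernr \<beta>)"
      have cn: "c \<le> ?c" unfolding c_def
        by (rule integral_subset_le[OF _ kint kint]) (use that kernr_bounds[of \<beta>] in \<open>auto simp: less_imp_le\<close>)
      have sm_h: "smear (real n) h = ?c *\<^sub>R h"
        using h(2) integral_linear[OF kint bounded_linear_scaleR_left[of h], of "-real n" "real n"] by (simp add: o_def)
      have "norm (E n - ?c *\<^sub>R h) \<le> ?c * (1/2)"
      proof -
        have "E n - ?c *\<^sub>R h = smear (real n) (e - h)" unfolding E_def using sm_h xeA hA by (simp add: smear_diff)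
        also have "norm \<dots> \<le> integral {-real n..real n} (\<lambda>t. kernr \<beta> t * (1/2))"
        proof (rule integral_norm_bound_integral)
          show "norm (kernr \<beta> t *\<^sub>R \<alpha> t (e - h)) \<le> kernr \<beta> t * (1/2)" for t
            using act_norm[OF diff_A[OF xeA(2) hA], of t] e(2) kernr_bounds[of \<beta> t] by (simp add: less_imp_le)
        qed (intro integrable_continuous_interval smear_continuous diff_A xeA hA integrable_on_mult_left kint)+
        finally show ?thesis by simp
      qed
      then have "norm (blinfun_apply (E n - ?c *\<^sub>R h) (blinfun_apply x \<xi>)) \<le> ?c * (1/2) * norm (blinfun_apply x \<xi>)"
        by (meson mult_right_mono norm_blinfun norm_ge_zero order_trans)
      moreover have "blinfun_apply h (blinfun_apply x \<xi>) = blinfun_apply x \<xi>"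
        using xh(2) by (metis blinfun_apply_blinfun_compose)
      ultimately have "norm (blinfun_apply (E n o\<^sub>L x) \<xi> - ?c *\<^sub>R blinfun_apply x \<xi>) \<le> ?c * (1/2) * norm (blinfun_apply x \<xi>)"
        by (simp add: op_apply)
      moreover have "norm (?c *\<^sub>R blinfun_apply x \<xi>) \<le> norm (blinfun_apply (E n o\<^sub>L x) \<xi>) + norm (blinfun_apply (E n o\<^sub>L x) \<xi> - ?c *\<^sub>R blinfun_apply x \<xi>)"
        using norm_triangle_sub[of "?c *\<^sub>R blinfun_apply x \<xi>" "blinfun_apply (E n o\<^sub>L x) \<xi>"]
        by (simp add: norm_minus_commute)
      ultimately have "?c * norm (blinfun_apply x \<xi>) \<le> norm (blinfun_apply (E n o\<^sub>L x) \<xi>) + ?c * (1/2) * norm (blinfun_apply x \<xi>)"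
        using cn c by simp
      moreover have "c * norm (blinfun_apply x \<xi>) \<le> ?c * norm (blinfun_apply x \<xi>)" by (intro mult_right_mono cn) simp
      ultimately show ?thesis by simp
    qed
    then show "\<exists>N. \<forall>n\<ge>N. c / 2 * norm (blinfun_apply x \<xi>) \<le> norm (blinfun_apply (E n o\<^sub>L x) \<xi>)" by blast
  qed
  have ExA: "E' o\<^sub>L x \<in> A" by (rule limit_A[OF z(1) zlim])
  have "sq x \<le> sq ((2 / c) *\<^sub>R (E' o\<^sub>L x))"
    using low c by (intro sq_mono x scaleR_A ExA) (simp add: op_apply field_simps)
  also have "\<dots> \<le> ennreal ((2 / c)\<^sup>2) * ennreal C"
    using ExA sqE by (simp add: sq_scaleR mult_left_mono)
  also have "\<dots> < \<infinity>" by (simp add: ennreal_mult_less_top)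
  finally show ?thesis using x(1) by (simp add: weight_N_iff)
qed

end

section \<open>The topology of the groupoid of a local homeomorphism\<close>

lemma Hausdorff_euclidean_t2: "Hausdorff_space (euclidean :: 'a::t2_space topology)"
  unfolding Hausdorff_space_def by (auto simp: disjnt_def) (metis hausdorff)

text \<open>A Urysohn function for \<open>K\<close> and the complement of a relatively compact open
  set, clamped to the unit interval. The compact \<open>L\<close> covers that open set, so it
  carries the function.\<close>

lemma bump_function:
  fixes K U :: "'x::t2_space set"
  assumes lc: "locally_compact_space (euclidean :: 'x topology)"
    and K: "compact K" "open U" "K \<subseteq> U"
  obtains v :: "'x \<Rightarrow> real" and L where "continuous_on UNIV v" "\<And>x. 0 \<le> v x" "\<And>x. v x \<le> 1" "\<And>x. x \<in> K \<Longrightarrow> v x = 1"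
    "compact L" "L \<subseteq> U" "\<And>x. x \<notin> L \<Longrightarrow> v x = 0"
proof -
  have H: "Hausdorff_space (euclidean :: 'x topology)" by (rule Hausdorff_euclidean_t2)
  have nb: "neighbourhood_base_of (compactin euclidean) (euclidean :: 'x topology)"
    using lc locally_compact_space_neighbourhood_base H by blast
  have "\<exists>O' C. open O' \<and> compact C \<and> x \<in> O' \<and> O' \<subseteq> C \<and> C \<subseteq> U" if "x \<in> K" for x
    using nb that K(2,3) unfolding neighbourhood_base_of by (auto simp: subset_iff)
  then obtain O' C where OC: "\<And>x. x \<in> K \<Longrightarrow> open (O' x) \<and> compact (C x) \<and> x \<in> O' x \<and> O' x \<subseteq> C x \<and> C x \<subseteq> U" by metis
  obtain F where F: "F \<subseteq> K" "finite F" "K \<subseteq> (\<Union>x\<in>F. O' x)"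
    by (rule compactE_image[OF K(1), of K O']) (use OC in auto)
  define Ob where "Ob = (\<Union>x\<in>F. O' x)"
  define L where "L = (\<Union>x\<in>F. C x)"
  have "open Ob" "compact L" "L \<subseteq> U" "Ob \<subseteq> L" "K \<subseteq> Ob" using F OC by (auto simp: Ob_def L_def intro!: compact_UN) blast+
  have cr: "completely_regular_space (euclidean :: 'x topology)"
    using locally_compact_regular_imp_completely_regular_space lc H by blast
  obtain f where f: "continuous_map euclidean euclideanreal f" "f ` (- Ob) \<subseteq> {0::real}" "f ` K \<subseteq> {1}"
    by (rule Urysohn_completely_regular_compact_closed_alt[OF cr, of K "- Ob"])
      (use \<open>open Ob\<close> \<open>K \<subseteq> Ob\<close> K(1) in \<open>auto simp: disjnt_def\<close>)
  define v where "v x = min 1 (max 0 (f x))" for x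
  have "continuous_on UNIV v" unfolding v_def using f(1) by (intro continuous_intros) auto
  moreover have "f x = 0" if "x \<notin> L" for x using f(2) \<open>Ob \<subseteq> L\<close> that by blast
  ultimately show thesis
    by (rule_tac that[of v L]) (use f \<open>compact L\<close> \<open>L \<subseteq> U\<close> in \<open>auto simp: v_def image_subset_iff\<close>)
qed

section \<open>Arrows, basic open sets and bisections\<close>

type_synonym 'x arrow = "'x \<times> int \<times> 'x"

abbreviation sg :: "'x arrow \<Rightarrow> 'x" where "sg g \<equiv> snd (snd g)"
abbreviation rg :: "'x arrow \<Rightarrow> 'x" where "rg g \<equiv> fst g"
abbreviation kg :: "'x arrow \<Rightarrow> int" where "kg g \<equiv> fst (snd g)"

definition gmul :: "'x arrow \<Rightarrow> 'x arrow \<Rightarrow> 'x arrow" where "gmul g h = (rg g, kg g + kg h, sg h)"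
definition ginverse :: "'x arrow \<Rightarrow> 'x arrow" where "ginverse g = (sg g, - kg g, rg g)"

lemma gmul_sel [simp]: "rg (gmul g h) = rg g" "sg (gmul g h) = sg h" "kg (gmul g h) = kg g + kg h"
  and ginverse_sel [simp]: "rg (ginverse g) = sg g" "sg (ginverse g) = rg g" "kg (ginverse g) = - kg g"
  by (simp_all add: gmul_def ginverse_def)

lemma arrow_eqI: "rg g = rg h \<Longrightarrow> kg g = kg h \<Longrightarrow> sg g = sg h \<Longrightarrow> g = h"
  by (simp add: prod_eq_iff)

lemma ginverse_ginverse [simp]: "ginverse (ginverse g) = g" by (rule arrow_eqI) auto

lemma Gam_sel [simp]: "arrows (Gam \<phi>) = Gam_top \<phi>" "rng (Gam \<phi>) = fst" "src (Gam \<phi>) = (\<lambda>g. sg g)"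
  "mul (Gam \<phi>) = gmul" "ginv (Gam \<phi>) = ginverse" "unit_at (Gam \<phi>) = (\<lambda>x. (x, 0, x))"
  by (auto simp: Gam_def gmul_def ginverse_def fun_eq_iff split: prod.splits)

declare topspace_Gam_top [simp]

text \<open>These sets form a base of the topology. They are bisections as soon as the two iterates
  of \<open>\<phi>\<close> are injective on \<open>U\<close> and on \<open>V\<close>.\<close>

definition Zset :: "('x \<Rightarrow> 'x) \<Rightarrow> nat \<Rightarrow> nat \<Rightarrow> 'x set \<Rightarrow> 'x set \<Rightarrow> 'x arrow set" where
  "Zset \<phi> m n U V = {(x, int m - int n, y) | x y. x \<in> U \<and> y \<in> V \<and> (\<phi> ^^ m) x = (\<phi> ^^ n) y}"

lemma Zset_iff: "g \<in> Zset \<phi> m n U V \<longleftrightarrow> kg g = int m - int n \<and> rg g \<in> U \<and> sg g \<in> V \<and> (\<phi> ^^ m) (rg g) = (\<phi> ^^ n) (sg g)"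
  by (cases g) (auto simp: Zset_def)

lemma arrows_iff: "g \<in> Gam_arrows \<phi> \<longleftrightarrow> (\<exists>m n. kg g = int m - int n \<and> (\<phi> ^^ m) (rg g) = (\<phi> ^^ n) (sg g))"
  by (cases g) (auto simp: Gam_arrows_def)

lemma gmul_arrows: assumes "g \<in> Gam_arrows \<phi>" "h \<in> Gam_arrows \<phi>" "sg g = rg h" shows "gmul g h \<in> Gam_arrows \<phi>"
proof -
  from assms obtain m n p q where mn: "kg g = int m - int n" "(\<phi> ^^ m) (rg g) = (\<phi> ^^ n) (sg g)"
    and pq: "kg h = int p - int q" "(\<phi> ^^ p) (rg h) = (\<phi> ^^ q) (sg h)" by (auto simp: arrows_iff)
  have "(\<phi> ^^ (p + m)) (rg g) = (\<phi> ^^ p) ((\<phi> ^^ n) (rg h))" using mn assms(3) by (simp add: funpow_add)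
  also have "\<dots> = (\<phi> ^^ n) ((\<phi> ^^ p) (rg h))" by (metis add.commute comp_apply funpow_add)
  also have "\<dots> = (\<phi> ^^ (n + q)) (sg h)" using pq by (simp add: funpow_add)
  finally show ?thesis unfolding arrows_iff using mn(1) pq(1)
    by (intro exI[of _ "p + m"] exI[of _ "n + q"]) simp
qed

lemma ginverse_arrows [simp]: "ginverse g \<in> Gam_arrows \<phi> \<longleftrightarrow> g \<in> Gam_arrows \<phi>"
proof -
  have "ginverse g \<in> Gam_arrows \<phi>" if g: "g \<in> Gam_arrows \<phi>" for g
  proof -
    obtain m n where "kg g = int m - int n" "(\<phi> ^^ m) (rg g) = (\<phi> ^^ n) (sg g)" using g by (auto simp: arrows_iff)
    then show ?thesis unfolding arrows_iff by (intro exI[of _ n] exI[of _ m]) simp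
  qed
  from this[of g] this[of "ginverse g"] show ?thesis by auto
qed

lemma unit_arrows [simp]: "(x, 0, x) \<in> Gam_arrows \<phi>"
  by (auto simp: arrows_iff intro: exI[of _ 0])

locale lh_space =
  fixes \<phi> :: "'x::{t2_space, second_countable_topology} \<Rightarrow> 'x"
  assumes lc: "locally_compact_space (euclidean :: 'x topology)"
    and lh: "local_homeo \<phi>"
begin

abbreviation "\<Gamma> \<equiv> Gam_arrows \<phi>"
abbreviation "T \<equiv> Gam_top \<phi>"
abbreviation "Z \<equiv> Zset \<phi>"

lemma phi_local: obtains U \<theta> where "open U" "x \<in> U" "open (\<phi> ` U)" "homeomorphism U (\<phi> ` U) \<phi> \<theta>"
  using lh unfolding local_homeo_def by blast

lemma continuous_phi: "continuous_on UNIV \<phi>"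
proof -
  have "isCont \<phi> x" for x
  proof -
    obtain U \<theta> where "open U" "x \<in> U" "homeomorphism U (\<phi> ` U) \<phi> \<theta>" using phi_local by metis
    then show ?thesis by (metis continuous_on_eq_continuous_at homeomorphism_cont1)
  qed
  then show ?thesis by (simp add: continuous_at_imp_continuous_on)
qed

lemma open_phi: assumes "open W" shows "open (\<phi> ` W)"
proof (rule Topological_Spaces.openI)
  fix y assume "y \<in> \<phi> ` W"
  then obtain x where x: "x \<in> W" "y = \<phi> x" by auto
  obtain U \<theta> where U: "open U" "x \<in> U" "open (\<phi> ` U)" "homeomorphism U (\<phi> ` U) \<phi> \<theta>" using phi_local .
  have "openin (top_of_set (\<phi> ` U)) (\<phi> ` (U \<inter> W))"
    using homeomorphism_imp_open_map[OF U(4)] U(1) assms by (auto simp: openin_open)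
  then have "open (\<phi> ` (U \<inter> W))" using U(3) openin_open_trans by blast
  then show "\<exists>T. open T \<and> y \<in> T \<and> T \<subseteq> \<phi> ` W" using x U(2) by (intro exI[of _ "\<phi> ` (U \<inter> W)"]) auto
qed

lemma continuous_funpow: "continuous_on S (\<phi> ^^ n)"
proof (induction n arbitrary: S)
  case (Suc n)
  have "continuous_on S (\<phi> \<circ> (\<phi> ^^ n))"
    by (rule continuous_on_compose[OF Suc continuous_on_subset[OF continuous_phi]]) simp
  then show ?case by simp
qed (simp add: continuous_on_id)

lemma open_vimage_funpow: "open U \<Longrightarrow> open ((\<phi> ^^ n) -` U)"
  by (rule open_vimage[OF _ continuous_funpow])

lemma open_funpow: "open W \<Longrightarrow> open ((\<phi> ^^ n) ` W)"
proof (induction n)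
  case (Suc n)
  have "(\<phi> ^^ Suc n) ` W = \<phi> ` (\<phi> ^^ n) ` W" by (auto simp: image_comp)
  then show ?case using open_phi[OF Suc(1)[OF Suc(2)]] by simp
qed simp

lemma funpow_locally_inj: "\<exists>U. open U \<and> x \<in> U \<and> inj_on (\<phi> ^^ n) U"
proof (induction n)
  case (Suc n)
  then obtain U where U: "open U" "x \<in> U" "inj_on (\<phi> ^^ n) U" by blast
  obtain V \<theta> where V: "open V" "(\<phi> ^^ n) x \<in> V" "homeomorphism V (\<phi> ` V) \<phi> \<theta>" using phi_local by metis
  then have "inj_on \<phi> V" by (metis homeomorphism_apply1 inj_on_inverseI)
  then have "inj_on (\<phi> ^^ Suc n) (U \<inter> (\<phi> ^^ n) -` V)" using U(3) by (auto simp: inj_on_def)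
  moreover have "open (U \<inter> (\<phi> ^^ n) -` V)" "x \<in> U \<inter> (\<phi> ^^ n) -` V" using U V open_vimage_funpow by auto
  ultimately show ?case by blast
qed (auto intro: exI[of _ UNIV])

text \<open>The inductive limit topology as a neighbourhood condition. It has to hold for every pair
  of exponents representing the arrow, since every piece containing it imposes a condition.\<close>

lemma openin_T_iff:
  "openin T W \<longleftrightarrow> W \<subseteq> \<Gamma> \<and> (\<forall>g\<in>W. \<forall>m n. kg g = int m - int n \<longrightarrow> (\<phi> ^^ m) (rg g) = (\<phi> ^^ n) (sg g) \<longrightarrow>
     (\<exists>U V. open U \<and> open V \<and> rg g \<in> U \<and> sg g \<in> V \<and> Z m n U V \<subseteq> W))" (is "_ \<longleftrightarrow> _ \<and> ?R")
proof -
  have "?R" if W: "openin T W"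
  proof (intro ballI allI impI)
    fix g m n assume g: "g \<in> W" "kg g = int m - int n" "(\<phi> ^^ m) (rg g) = (\<phi> ^^ n) (sg g)"
    then have k0: "0 \<le> kg g + int n" and nm: "nat (kg g + int n) = m" by auto
    then have "openin (top_of_set (Gam_piece \<phi> (kg g) n)) (W \<inter> Gam_piece \<phi> (kg g) n)"
      using W by (simp add: openin_Gam_top)
    then obtain Ob where Ob: "open Ob" "W \<inter> Gam_piece \<phi> (kg g) n = Gam_piece \<phi> (kg g) n \<inter> Ob"
      by (auto simp: openin_open)
    have "g \<in> Gam_piece \<phi> (kg g) n" using g nm by (cases g) (auto simp: Gam_piece_def)
    then have "(rg g, kg g, sg g) \<in> Ob" using Ob g(1) by auto
    then obtain U Y where UY: "open U" "open Y" "rg g \<in> U" "(kg g, sg g) \<in> Y" "U \<times> Y \<subseteq> Ob"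
      by (rule open_prod_elim[OF Ob(1)]) (metis mem_Sigma_iff)
    obtain I V where IV: "open V" "kg g \<in> I" "sg g \<in> V" "I \<times> V \<subseteq> Y"
      by (rule open_prod_elim[OF UY(2,4)]) (metis mem_Sigma_iff)
    have "Z m n U V \<subseteq> W"
    proof
      fix h assume h: "h \<in> Z m n U V"
      then have "h \<in> Gam_piece \<phi> (kg g) n" using g(2) nm by (cases h) (auto simp: Gam_piece_def Zset_iff)
      moreover have "h \<in> Ob" using h UY(5) IV g(2) by (cases h) (auto simp: Zset_iff)
      ultimately show "h \<in> W" using Ob(2) by blast
    qed
    then show "\<exists>U V. open U \<and> open V \<and> rg g \<in> U \<and> sg g \<in> V \<and> Z m n U V \<subseteq> W" using UY IV by blast
  qed
  moreover have "openin T W" if W: "W \<subseteq> \<Gamma>" and R: ?R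
    unfolding openin_Gam_top
  proof (intro conjI allI impI W)
    fix k n assume kn: "0 \<le> k + int n"
    let ?P = "Gam_piece \<phi> k n"
    show "openin (top_of_set ?P) (W \<inter> ?P)"
    proof (subst openin_subopen, intro ballI)
      fix g assume g: "g \<in> W \<inter> ?P"
      let ?m = "nat (k + int n)"
      have gk: "kg g = k" "(\<phi> ^^ ?m) (rg g) = (\<phi> ^^ n) (sg g)" using g by (cases g; auto simp: Gam_piece_def)+
      have "kg g = int ?m - int n" using gk kn by simp
      from R[rule_format, OF IntD1[OF g] this gk(2)]
      obtain U V where UV: "open U" "open V" "rg g \<in> U" "sg g \<in> V" "Z ?m n U V \<subseteq> W" by blast
      have "open (U \<times> {k} \<times> V)" by (intro open_Times UV open_discrete)
      then have "openin (top_of_set ?P) (?P \<inter> (U \<times> {k} \<times> V))" by (rule openin_open_Int)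
      moreover have "g \<in> ?P \<inter> (U \<times> {k} \<times> V)" using g gk UV by (cases g) auto
      moreover have "?P \<inter> (U \<times> {k} \<times> V) \<subseteq> W \<inter> ?P"
      proof
        fix h assume h: "h \<in> ?P \<inter> (U \<times> {k} \<times> V)"
        then have "h \<in> Z ?m n U V" using kn by (cases h) (auto simp: Gam_piece_def Zset_iff)
        then show "h \<in> W \<inter> ?P" using UV(5) h by blast
      qed
      ultimately show "\<exists>T. openin (top_of_set ?P) T \<and> g \<in> T \<and> T \<subseteq> W \<inter> ?P" by blast
    qed
  qed
  ultimately show ?thesis using openin_subset[of T W] by auto
qed

lemma Z_subset: "Z m n U V \<subseteq> \<Gamma>" unfolding Zset_iff arrows_iff subset_iff by blast

lemma funpow_raise: "(\<phi> ^^ m) x = (\<phi> ^^ n) y \<Longrightarrow> (\<phi> ^^ (j + m)) x = (\<phi> ^^ (j + n)) y"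
  by (simp add: funpow_add)

text \<open>An arrow has many representing pairs of exponents with the same difference. Smaller
  pairs are raised by applying a power of \<open>\<phi>\<close>; for larger pairs the extra power is
  cancelled where it is locally injective.\<close>

lemma openin_Z: assumes "open U" "open V" shows "openin T (Z m n U V)"
  unfolding openin_T_iff
proof (intro conjI Z_subset ballI allI impI)
  fix g m' n' assume g: "g \<in> Z m n U V" "kg g = int m' - int n'" "(\<phi> ^^ m') (rg g) = (\<phi> ^^ n') (sg g)"
  then have mn: "int m - int n = int m' - int n'" by (simp add: Zset_iff)
  show "\<exists>U' V'. open U' \<and> open V' \<and> rg g \<in> U' \<and> sg g \<in> V' \<and> Z m' n' U' V' \<subseteq> Z m n U V"
  proof (cases "m' \<le> m")
    case True
    define j where "j = m - m'"
    have j: "m = j + m'" "n = j + n'" using True mn by (auto simp: j_def)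
    have "Z m' n' U V \<subseteq> Z m n U V"
    proof
      fix h assume h: "h \<in> Z m' n' U V"
      then have "(\<phi> ^^ m) (rg h) = (\<phi> ^^ n) (sg h)"
        unfolding j by (intro funpow_raise) (simp add: Zset_iff)
      then show "h \<in> Z m n U V" using h mn by (simp add: Zset_iff)
    qed
    then show ?thesis using assms g(1) by (auto simp: Zset_iff)
  next
    case False
    define j where "j = m' - m"
    have j: "m' = j + m" and j': "n' = j + n" using False mn by (auto simp: j_def)
    obtain Ob where Ob: "open Ob" "(\<phi> ^^ m) (rg g) \<in> Ob" "inj_on (\<phi> ^^ j) Ob" using funpow_locally_inj by blast
    let ?U = "U \<inter> (\<phi> ^^ m) -` Ob" and ?V = "V \<inter> (\<phi> ^^ n) -` Ob"
    have "Z m' n' ?U ?V \<subseteq> Z m n U V"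
    proof
      fix h assume h: "h \<in> Z m' n' ?U ?V"
      then have "(\<phi> ^^ j) ((\<phi> ^^ m) (rg h)) = (\<phi> ^^ j) ((\<phi> ^^ n) (sg h))"
        by (simp add: Zset_iff j j' funpow_add)
      from inj_onD[OF Ob(3) this] have "(\<phi> ^^ m) (rg h) = (\<phi> ^^ n) (sg h)"
        using h by (auto simp: Zset_iff)
      then show "h \<in> Z m n U V" using h mn by (simp add: Zset_iff)
    qed
    moreover have "open ?U" "open ?V" "rg g \<in> ?U" "sg g \<in> ?V"
      using assms Ob g(1) open_vimage_funpow by (auto simp: Zset_iff)
    ultimately show ?thesis by blast
  qed
qed

text \<open>The topology is finer than that of the product, which yields the Hausdorff property and
  continuity of range, source and degree.\<close>

lemma continuous_map_T_id: "continuous_map T euclidean (\<lambda>g. g)"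
  unfolding continuous_map
proof (intro conjI allI impI)
  fix W :: "'x arrow set" assume "openin euclidean W"
  then have W: "open W" by simp
  have "openin (top_of_set (Gam_piece \<phi> k n)) ({g \<in> \<Gamma>. g \<in> W} \<inter> Gam_piece \<phi> k n)" if "0 \<le> k + int n" for k n
  proof -
    have "Gam_piece \<phi> k n \<subseteq> \<Gamma>"
    proof
      fix g assume g: "g \<in> Gam_piece \<phi> k n"
      then have "kg g = int (nat (k + int n)) - int n" "(\<phi> ^^ nat (k + int n)) (rg g) = (\<phi> ^^ n) (sg g)"
        using that by (cases g; auto simp: Gam_piece_def)+
      then show "g \<in> \<Gamma>" unfolding arrows_iff by blast
    qed
    then have "{g \<in> \<Gamma>. g \<in> W} \<inter> Gam_piece \<phi> k n = Gam_piece \<phi> k n \<inter> W" by blast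
    then show ?thesis using W by (simp add: openin_open_Int)
  qed
  then show "openin T {g \<in> topspace T. g \<in> W}" unfolding openin_Gam_top by auto
qed simp

lemma Hausdorff_T: "Hausdorff_space T"
  by (rule Hausdorff_space_injective_preimage[OF Hausdorff_euclidean_t2 continuous_map_T_id]) auto

lemma continuous_map_T_compose: "continuous_on UNIV f \<Longrightarrow> continuous_map T euclidean (\<lambda>g. f g)"
  using continuous_map_compose[OF continuous_map_T_id, of euclidean f] by (simp add: o_def)

lemma continuous_rg: "continuous_map T euclidean rg" and continuous_sg: "continuous_map T euclidean sg"
  and continuous_kg: "continuous_map T euclidean kg"
  by (rule continuous_map_T_compose; intro continuous_intros)+

lemma T_basis:
  assumes "openin T W" "g \<in> W"
  obtains m n U V where "open U" "open V" "inj_on (\<phi> ^^ m) U" "inj_on (\<phi> ^^ n) V" "g \<in> Z m n U V" "Z m n U V \<subseteq> W"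
proof -
  have "g \<in> \<Gamma>" using openin_subset[OF assms(1)] assms(2) by auto
  then obtain m n where mn: "kg g = int m - int n" "(\<phi> ^^ m) (rg g) = (\<phi> ^^ n) (sg g)"
    unfolding arrows_iff by blast
  then obtain U V where UV: "open U" "open V" "rg g \<in> U" "sg g \<in> V" "Z m n U V \<subseteq> W"
    using assms unfolding openin_T_iff by meson
  obtain U' where U': "open U'" "rg g \<in> U'" "inj_on (\<phi> ^^ m) U'" using funpow_locally_inj by blast
  obtain V' where V': "open V'" "sg g \<in> V'" "inj_on (\<phi> ^^ n) V'" using funpow_locally_inj by blast
  show thesis
    by (rule that[of "U \<inter> U'" "V \<inter> V'" m n])
      (use UV U' V' mn in \<open>auto intro: inj_on_subset simp: Zset_iff\<close>)
qed

abbreviation "bisection \<equiv> open_bisection (Gam \<phi>)"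

lemma bisection_iff: "bisection W \<longleftrightarrow> openin T W \<and> inj_on rg W \<and> inj_on sg W"
  by (simp add: open_bisection_def)

lemma bisection_Z:
  assumes "open U" "open V" "inj_on (\<phi> ^^ m) U" "inj_on (\<phi> ^^ n) V" shows "bisection (Z m n U V)"
  unfolding bisection_iff
proof (intro conjI openin_Z assms inj_onI arrow_eqI)
  fix g h assume gh: "g \<in> Z m n U V" "h \<in> Z m n U V"
  show "rg g = rg h \<Longrightarrow> sg g = sg h" "sg g = sg h \<Longrightarrow> rg g = rg h"
    using gh assms(3,4) by (auto simp: Zset_iff inj_on_def)
  show "kg g = kg h" "kg g = kg h" using gh by (auto simp: Zset_iff)
qed

lemma bisection_subset: "bisection W \<Longrightarrow> openin T W' \<Longrightarrow> W' \<subseteq> W \<Longrightarrow> bisection W'"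
  unfolding bisection_iff by (meson inj_on_subset)

lemma bisection_sub: "bisection W \<Longrightarrow> W \<subseteq> \<Gamma>"
  unfolding bisection_iff using openin_subset by fastforce

lemma open_sg_image: assumes "openin T W" shows "open (sg ` W)"
proof (rule Topological_Spaces.openI)
  fix y assume "y \<in> sg ` W"
  then obtain g where g: "g \<in> W" "y = sg g" by auto
  obtain m n U V where UV: "open U" "open V" "g \<in> Z m n U V" "Z m n U V \<subseteq> W" using T_basis[OF assms g(1)] by metis
  have "sg ` Z m n U V = V \<inter> (\<phi> ^^ n) -` ((\<phi> ^^ m) ` U)" by (force simp: Zset_def)
  then have "open (sg ` Z m n U V)" using UV open_funpow open_vimage_funpow by auto
  then show "\<exists>T. open T \<and> y \<in> T \<and> T \<subseteq> sg ` W" using UV g by (intro exI[of _ "sg ` Z m n U V"]) auto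
qed

lemma openin_ginverse: assumes "openin T W" shows "openin T (ginverse ` W)"
proof (subst openin_subopen, intro ballI)
  fix g assume "g \<in> ginverse ` W"
  then have g: "ginverse g \<in> W" by auto
  obtain m n U V where UV: "open U" "open V" "ginverse g \<in> Z m n U V" "Z m n U V \<subseteq> W" using T_basis[OF assms g] by metis
  have "Z n m V U \<subseteq> ginverse ` W"
  proof
    fix h assume "h \<in> Z n m V U"
    then have "ginverse h \<in> Z m n U V" by (auto simp: Zset_iff)
    then show "h \<in> ginverse ` W" using UV(4) by (metis ginverse_ginverse image_eqI subsetD)
  qed
  moreover have "g \<in> Z n m V U" using UV(3) by (auto simp: Zset_iff)
  moreover have "openin T (Z n m V U)" by (intro openin_Z UV)
  ultimately show "\<exists>S. openin T S \<and> g \<in> S \<and> S \<subseteq> ginverse ` W" by blast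
qed

lemma image_ginverse_iff: "g \<in> ginverse ` W \<longleftrightarrow> ginverse g \<in> W"
  by (metis ginverse_ginverse image_iff)

lemma continuous_ginverse: "continuous_map T T ginverse"
  unfolding continuous_map
proof (intro conjI allI impI)
  fix W assume W: "openin T W"
  have "{g \<in> topspace T. ginverse g \<in> W} = ginverse ` W"
    using openin_subset[OF W] by (force simp: image_ginverse_iff)
  then show "openin T {g \<in> topspace T. ginverse g \<in> W}" using openin_ginverse[OF W] by simp
qed auto

lemma rg_image_ginverse: "rg ` W = sg ` (ginverse ` W)" "sg ` W = rg ` (ginverse ` W)"
  by (auto simp: image_comp)

lemma open_rg_image: "openin T W \<Longrightarrow> open (rg ` W)"
  unfolding rg_image_ginverse(1) by (intro open_sg_image openin_ginverse)

lemma bisection_ginverse: "bisection W \<Longrightarrow> bisection (ginverse ` W)"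
  by (auto simp: bisection_iff openin_ginverse inj_on_def)

section \<open>Products and sections of bisections\<close>

definition prods :: "'x arrow set \<Rightarrow> 'x arrow set \<Rightarrow> 'x arrow set" where
  "prods A B = {gmul g h | g h. g \<in> A \<and> h \<in> B \<and> sg g = rg h}"

lemma prodsI: "g \<in> A \<Longrightarrow> h \<in> B \<Longrightarrow> sg g = rg h \<Longrightarrow> gmul g h \<in> prods A B"
  unfolding prods_def by blast

text \<open>The exponents of both factors are raised until they agree, at \<open>p + n\<close>, on
  the middle point; a basic set around the product can then be chosen.\<close>

lemma openin_prods: assumes "openin T A" "openin T B" shows "openin T (prods A B)"
proof (subst openin_subopen, intro ballI)
  fix gh assume "gh \<in> prods A B"
  then obtain g h where gh: "g \<in> A" "h \<in> B" "sg g = rg h" "gh = gmul g h" by (auto simp: prods_def)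
  have "g \<in> \<Gamma>" "h \<in> \<Gamma>" using gh openin_subset assms by fastforce+
  then obtain m n p q where mn: "kg g = int m - int n" "(\<phi> ^^ m) (rg g) = (\<phi> ^^ n) (sg g)"
    and pq: "kg h = int p - int q" "(\<phi> ^^ p) (rg h) = (\<phi> ^^ q) (sg h)" unfolding arrows_iff by blast
  have "kg g = int (p + m) - int (p + n)" "(\<phi> ^^ (p + m)) (rg g) = (\<phi> ^^ (p + n)) (sg g)"
    using mn(1) funpow_raise[OF mn(2), of p] by simp_all
  then obtain U V where UV: "open U" "open V" "rg g \<in> U" "sg g \<in> V" "Z (p + m) (p + n) U V \<subseteq> A"
    using assms(1) gh(1) unfolding openin_T_iff by meson
  have "kg h = int (p + n) - int (n + q)" "(\<phi> ^^ (p + n)) (rg h) = (\<phi> ^^ (n + q)) (sg h)"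
    using pq(1) funpow_raise[OF pq(2), of n] by (simp_all add: add.commute[of n p])
  then obtain V' W where VW: "open V'" "open W" "rg h \<in> V'" "sg h \<in> W" "Z (p + n) (n + q) V' W \<subseteq> B"
    using assms(2) gh(2) unfolding openin_T_iff by meson
  \<comment> \<open>The preimage condition provides for each arrow near the product a middle point
    lying in both \<open>V\<close> and \<open>V'\<close>.\<close>
  let ?U = "U \<inter> (\<phi> ^^ (p + m)) -` ((\<phi> ^^ (p + n)) ` (V \<inter> V'))"
  let ?S = "Z (p + m) (n + q) ?U W"
  have "?S \<subseteq> prods A B"
  proof
    fix f assume f: "f \<in> ?S"
    then obtain y where y: "y \<in> V" "y \<in> V'" "(\<phi> ^^ (p + m)) (rg f) = (\<phi> ^^ (p + n)) y"
      by (auto simp: Zset_iff)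
    have "(rg f, int (p + m) - int (p + n), y) \<in> A" using UV(5) f y by (auto simp: Zset_iff subset_iff)
    moreover have "(y, int (p + n) - int (n + q), sg f) \<in> B" using VW(5) f y by (auto simp: Zset_iff subset_iff)
    moreover have "f = gmul (rg f, int (p + m) - int (p + n), y) (y, int (p + n) - int (n + q), sg f)"
      using f by (intro arrow_eqI) (auto simp: gmul_def Zset_iff)
    ultimately show "f \<in> prods A B"
      using prodsI[of "(rg f, int (p + m) - int (p + n), y)" A "(y, int (p + n) - int (n + q), sg f)" B] by simp
  qed
  moreover have "openin T ?S" by (intro openin_Z open_Int open_vimage_funpow open_funpow UV VW)
  moreover have "gh \<in> ?S"
  proof -
    have e: "(\<phi> ^^ (p + m)) (rg g) = (\<phi> ^^ (p + n)) (sg g)" "(\<phi> ^^ (p + n)) (rg h) = (\<phi> ^^ (n + q)) (sg h)"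
      by fact+
    have "(\<phi> ^^ (p + n)) (sg g) \<in> (\<phi> ^^ (p + n)) ` (V \<inter> V')" using gh UV VW by auto
    then show ?thesis using gh UV VW mn(1) pq(1) e by (simp add: Zset_iff)
  qed
  ultimately show "\<exists>S. openin T S \<and> gh \<in> S \<and> S \<subseteq> prods A B" by blast
qed

lemma bisection_prods: assumes A: "bisection A" and B: "bisection B" shows "bisection (prods A B)"
  unfolding bisection_iff
proof (intro conjI openin_prods inj_onI)
  fix x y assume "x \<in> prods A B" "y \<in> prods A B"
  then obtain g h g' h' where *: "g \<in> A" "h \<in> B" "sg g = rg h" "x = gmul g h" "g' \<in> A" "h' \<in> B" "sg g' = rg h'" "y = gmul g' h'"
    by (auto simp: prods_def)
  have iA: "rg g = rg g' \<longleftrightarrow> g = g'" "sg g = sg g' \<longleftrightarrow> g = g'" using A * unfolding bisection_iff inj_on_def by metis+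
  have iB: "rg h = rg h' \<longleftrightarrow> h = h'" "sg h = sg h' \<longleftrightarrow> h = h'" using B * unfolding bisection_iff inj_on_def by metis+
  show "rg x = rg y \<Longrightarrow> x = y" "sg x = sg y \<Longrightarrow> x = y" using * iA iB by auto
qed (use A B in \<open>auto simp: bisection_iff\<close>)

definition sec :: "'x arrow set \<Rightarrow> 'x \<Rightarrow> 'x arrow" where "sec W = the_inv_into W sg"
definition rsec :: "'x arrow set \<Rightarrow> 'x \<Rightarrow> 'x arrow" where "rsec W = the_inv_into W rg"

lemma sec: assumes "bisection W" shows "g \<in> W \<Longrightarrow> sec W (sg g) = g" "x \<in> sg ` W \<Longrightarrow> sec W x \<in> W" "x \<in> sg ` W \<Longrightarrow> sg (sec W x) = x"
proof -
  have i: "inj_on sg W" using assms by (simp add: bisection_iff)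
  show "g \<in> W \<Longrightarrow> sec W (sg g) = g" "x \<in> sg ` W \<Longrightarrow> sec W x \<in> W" "x \<in> sg ` W \<Longrightarrow> sg (sec W x) = x"
    unfolding sec_def using the_inv_into_f_f[OF i, of g] the_inv_into_into[OF i, of x W] f_the_inv_into_f[OF i, of x] by simp_all
qed

lemma rsec: assumes "bisection W" shows "g \<in> W \<Longrightarrow> rsec W (rg g) = g" "x \<in> rg ` W \<Longrightarrow> rsec W x \<in> W" "x \<in> rg ` W \<Longrightarrow> rg (rsec W x) = x"
proof -
  have i: "inj_on rg W" using assms by (simp add: bisection_iff)
  show "g \<in> W \<Longrightarrow> rsec W (rg g) = g" "x \<in> rg ` W \<Longrightarrow> rsec W x \<in> W" "x \<in> rg ` W \<Longrightarrow> rg (rsec W x) = x"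
    unfolding rsec_def using the_inv_into_f_f[OF i, of g] the_inv_into_into[OF i, of x W] f_the_inv_into_f[OF i, of x] by simp_all
qed

lemma continuous_sec: assumes W: "bisection W" shows "continuous_map (top_of_set (sg ` W)) T (sec W)"
  unfolding continuous_map
proof (intro conjI allI impI)
  show "sec W ` topspace (top_of_set (sg ` W)) \<subseteq> topspace T" using sec(1)[OF W] bisection_sub[OF W] by (auto simp: image_subset_iff simp del: split_paired_All split_paired_Ex)
  fix Ob assume Ob: "openin T Ob"
  have "{x \<in> topspace (top_of_set (sg ` W)). sec W x \<in> Ob} = sg ` (W \<inter> Ob)"
  proof (intro equalityI subsetI)
    fix x assume "x \<in> {x \<in> topspace (top_of_set (sg ` W)). sec W x \<in> Ob}"
    then show "x \<in> sg ` (W \<inter> Ob)" using sec(2,3)[OF W, of x] by (intro image_eqI[of _ _ "sec W x"]) simp_all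
  next
    fix x assume "x \<in> sg ` (W \<inter> Ob)"
    then obtain g where "g \<in> W" "g \<in> Ob" "x = sg g" by blast
    then show "x \<in> {x \<in> topspace (top_of_set (sg ` W)). sec W x \<in> Ob}" using sec(1)[OF W, of g] by simp
  qed
  moreover have "open (sg ` (W \<inter> Ob))" using W Ob by (intro open_sg_image openin_Int) (auto simp: bisection_iff)
  ultimately show "openin (top_of_set (sg ` W)) {x \<in> topspace (top_of_set (sg ` W)). sec W x \<in> Ob}"
    by (metis (no_types, lifting) image_mono inf_le1 open_subset)
qed

lemma continuous_rsec: assumes W: "bisection W" shows "continuous_map (top_of_set (rg ` W)) T (rsec W)"
proof (rule continuous_map_eq[of _ _ "ginverse \<circ> sec (ginverse ` W)"])
  show "continuous_map (top_of_set (rg ` W)) T (ginverse \<circ> sec (ginverse ` W))"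
    unfolding rg_image_ginverse(1) by (rule continuous_map_compose[OF continuous_sec[OF bisection_ginverse[OF W]] continuous_ginverse])
  fix x assume "x \<in> topspace (top_of_set (rg ` W))"
  then have "rsec W x \<in> W" "rg (rsec W x) = x" using rsec(2,3)[OF W] by simp_all
  then show "(ginverse \<circ> sec (ginverse ` W)) x = rsec W x"
    using sec(1)[OF bisection_ginverse[OF W], of "ginverse (rsec W x)"] by (simp add: image_ginverse_iff)
qed

lemma compactin_sec: assumes "bisection W" "compact L" "L \<subseteq> sg ` W" shows "compactin T (sec W ` L)"
  by (rule image_compactin[OF _ continuous_sec[OF assms(1)]]) (use assms in \<open>auto simp: compactin_subtopology\<close>)

lemma compact_image_T: "compactin T K \<Longrightarrow> continuous_map T euclidean f \<Longrightarrow> compact (f ` K)"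
  using image_compactin by fastforce

lemma closedin_compact_T: "compactin T K \<Longrightarrow> closedin T K"
  using compactin_imp_closedin Hausdorff_T by blast

text \<open>The composable part of \<open>K2\<close> is closed in \<open>K2\<close>. The product set
  is the image of its compact set of sources under the continuous section of the product
  bisection.\<close>

lemma compactin_prods:
  assumes W: "bisection W1" "bisection W2" and K: "compactin T K1" "K1 \<subseteq> W1" "compactin T K2" "K2 \<subseteq> W2"
  shows "compactin T (prods K1 K2)"
proof -
  define K where "K = {g \<in> K2. rg g \<in> sg ` K1}"
  have "closed (sg ` K1)" by (intro compact_imp_closed compact_image_T K continuous_sg)
  then have "closedin T {g \<in> topspace T. rg g \<in> sg ` K1}"
    by (intro closedin_continuous_map_preimage[OF continuous_rg]) simp
  moreover have "K = K2 \<inter> {g \<in> topspace T. rg g \<in> sg ` K1}"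
    using compactin_subset_topspace[OF K(3)] by (auto simp: K_def)
  ultimately have "compactin T K" by (simp only: compact_Int_closedin[OF K(3)])
  then have "compact (sg ` K)" by (rule compact_image_T[OF _ continuous_sg])
  moreover have "sg ` K \<subseteq> sg ` prods W1 W2"
  proof
    fix x assume "x \<in> sg ` K"
    then obtain g h where "x = sg h" "h \<in> K2" "g \<in> K1" "rg h = sg g" by (auto simp: K_def)
    then show "x \<in> sg ` prods W1 W2" using K(2,4) by (intro image_eqI[of _ _ "gmul g h"] prodsI) auto
  qed
  ultimately have "compactin T (sec (prods W1 W2) ` (sg ` K))"
    by (intro compactin_sec bisection_prods W)
  moreover have "sec (prods W1 W2) ` (sg ` K) = prods K1 K2"
  proof -
    have s: "sec (prods W1 W2) (sg h) = gmul g h" if "g \<in> K1" "h \<in> K2" "sg g = rg h" for g h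
      using sec(1)[OF bisection_prods[OF W], of "gmul g h"] prodsI[of g W1 h W2] that K(2,4) by auto
    show ?thesis
    proof (intro equalityI subsetI)
      fix x assume "x \<in> sec (prods W1 W2) ` (sg ` K)"
      then obtain g h where "x = sec (prods W1 W2) (sg h)" "h \<in> K2" "g \<in> K1" "sg g = rg h" by (auto simp: K_def)
      then show "x \<in> prods K1 K2" using s prodsI by metis
    next
      fix x assume "x \<in> prods K1 K2"
      then obtain g h where gh: "g \<in> K1" "h \<in> K2" "sg g = rg h" "x = gmul g h" by (auto simp: prods_def)
      then have "h \<in> K" unfolding K_def by (metis (mono_tags, lifting) image_eqI mem_Collect_eq)
      then show "x \<in> sec (prods W1 W2) ` (sg ` K)" using s[OF gh(1-3)] gh(4) by force
    qed
  qed
  ultimately show ?thesis by simp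
qed

lemma bisection_units: "bisection (Z 0 0 UNIV UNIV)"
  by (rule bisection_Z) auto

lemma units_iff: "g \<in> Z 0 0 UNIV UNIV \<longleftrightarrow> g = (sg g, 0, sg g)"
  by (cases g) (auto simp: Zset_iff)

lemmas bump_X = bump_function[OF lc]

end

section \<open>The reduced groupoid algebra\<close>

declare split_paired_All [simp del] split_paired_Ex [simp del]

lemma continuous_map_mult_algebra:
  fixes f g :: "'a \<Rightarrow> 'b::real_normed_algebra"
  assumes "continuous_map X euclidean f" "continuous_map X euclidean g"
  shows "continuous_map X euclidean (\<lambda>x. f x * g x)"
  using assms by (simp add: continuous_map_atin limitin_canonical_iff tendsto_mult)

lemma continuous_map_plus_normed:
  fixes f g :: "'a \<Rightarrow> 'b::real_normed_vector"
  assumes "continuous_map X euclidean f" "continuous_map X euclidean g"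
  shows "continuous_map X euclidean (\<lambda>x. f x + g x)"
  using assms by (simp add: continuous_map_atin limitin_canonical_iff tendsto_add)

context lh_space
begin

section \<open>Compactly supported functions on the groupoid\<close>

abbreviation "CG \<equiv> Cc (Gam \<phi>)"
abbreviation "lam \<equiv> reg_sum (Gam \<phi>)"

text \<open>Compact sets are closed in the Hausdorff space of arrows, so any compact set off which
  \<open>f\<close> vanishes can stand in for the closed support.\<close>

lemma CG_iff:
  "f \<in> CG \<longleftrightarrow> continuous_map T euclidean f \<and> (\<exists>K. compactin T K \<and> (\<forall>g. g \<notin> K \<longrightarrow> f g = 0))"
proof
  assume f: "f \<in> CG"
  let ?S = "{g \<in> topspace T. f g \<noteq> 0}"
  have "f g = 0" if "g \<notin> T closure_of ?S" for g
    using that f closure_of_subset[of ?S T] unfolding Cc_def by auto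
  moreover have "continuous_map T euclidean f" "compactin T (T closure_of ?S)" using f by (simp_all add: Cc_def)
  ultimately show "continuous_map T euclidean f \<and> (\<exists>K. compactin T K \<and> (\<forall>g. g \<notin> K \<longrightarrow> f g = 0))" by blast
next
  assume "continuous_map T euclidean f \<and> (\<exists>K. compactin T K \<and> (\<forall>g. g \<notin> K \<longrightarrow> f g = 0))"
  then obtain K where f: "continuous_map T euclidean f" and K: "compactin T K" "\<And>g. g \<notin> K \<Longrightarrow> f g = 0" by blast
  have "T closure_of {g \<in> topspace T. f g \<noteq> 0} \<subseteq> K"
    by (rule closure_of_minimal[OF _ closedin_compact_T[OF K(1)]]) (use K(2) in auto)
  then have "compactin T (T closure_of {g \<in> topspace T. f g \<noteq> 0})"
    using closed_compactin[OF K(1)] by auto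
  moreover have "f g = 0" if "g \<notin> \<Gamma>" for g using K(2)[of g] compactin_subset_topspace[OF K(1)] that by auto
  ultimately show "f \<in> CG" using f by (simp add: Cc_def)
qed

definition supp_in :: "('x arrow \<Rightarrow> complex) \<Rightarrow> 'x arrow set \<Rightarrow> bool" where
  "supp_in f W \<longleftrightarrow> continuous_map T euclidean f \<and> (\<exists>K. compactin T K \<and> K \<subseteq> W \<and> (\<forall>g. g \<notin> K \<longrightarrow> f g = 0))"

lemma supp_in_CG: "supp_in f W \<Longrightarrow> f \<in> CG" by (auto simp: supp_in_def CG_iff)

lemma CG_off: "f \<in> CG \<Longrightarrow> g \<notin> \<Gamma> \<Longrightarrow> f g = 0"
  by (simp add: Cc_def)

text \<open>The groupoid is the union of the open sets \<open>W\<close> and the complement of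
  \<open>K\<close>, on each of which the function is continuous.\<close>

lemma glue:
  fixes f :: "'x arrow \<Rightarrow> 'b::{topological_space, zero}"
  assumes W: "openin T W" and f: "continuous_map (subtopology T W) euclidean f"
    and K: "compactin T K" "K \<subseteq> W" and f0: "\<And>g. g \<notin> K \<Longrightarrow> f g = 0"
  shows "continuous_map T euclidean f"
  unfolding continuous_map
proof (intro conjI allI impI)
  fix Ob :: "'b set" assume "openin euclidean Ob"
  then have "openin (subtopology T W) {g \<in> topspace (subtopology T W). f g \<in> Ob}"
    using f unfolding continuous_map by blast
  moreover have "{g \<in> topspace (subtopology T W). f g \<in> Ob} = {g \<in> W. f g \<in> Ob}"
    using openin_subset[OF W] by auto
  ultimately have 1: "openin T {g \<in> W. f g \<in> Ob}"
    using W by (simp add: openin_open_subtopology)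
  have 2: "openin T (topspace T - K)" using closedin_compact_T[OF K(1)] by blast
  show "openin T {g \<in> topspace T. f g \<in> Ob}"
  proof (cases "0 \<in> Ob")
    case True
    have "{g \<in> topspace T. f g \<in> Ob} = {g \<in> W. f g \<in> Ob} \<union> (topspace T - K)"
    proof (rule set_eqI)
      fix g
      show "g \<in> {g \<in> topspace T. f g \<in> Ob} \<longleftrightarrow> g \<in> {g \<in> W. f g \<in> Ob} \<union> (topspace T - K)"
        using f0[of g] K(2) openin_subset[OF W] True by (cases "g \<in> K") auto
    qed
    then show ?thesis using 1 2 by auto
  next
    case False
    have "{g \<in> topspace T. f g \<in> Ob} = {g \<in> W. f g \<in> Ob}"
    proof (rule set_eqI)
      fix g
      show "g \<in> {g \<in> topspace T. f g \<in> Ob} \<longleftrightarrow> g \<in> {g \<in> W. f g \<in> Ob}"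
        using f0[of g] K(2) openin_subset[OF W] False by (cases "g \<in> K") auto
    qed
    then show ?thesis using 1 by simp
  qed
qed simp

lemma supp_inI:
  assumes "openin T W" "continuous_map (subtopology T W) euclidean f" "compactin T K" "K \<subseteq> W" "\<And>g. g \<notin> K \<Longrightarrow> f g = 0"
  shows "supp_in f W"
  unfolding supp_in_def using glue[OF assms] assms(3-5) by blast

lemma lift_function:
  fixes v :: "'x \<Rightarrow> 'b::{topological_space, zero}"
  assumes W: "bisection W" and v: "continuous_on UNIV v" and L: "compact L" "L \<subseteq> sg ` W" "\<And>x. x \<notin> L \<Longrightarrow> v x = 0"
  shows "continuous_map T euclidean (\<lambda>g. if g \<in> W then v (sg g) else 0)"
    "compactin T (sec W ` L)" "sec W ` L \<subseteq> W" "\<And>g. g \<notin> sec W ` L \<Longrightarrow> (if g \<in> W then v (sg g) else 0) = 0"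
proof -
  show c: "compactin T (sec W ` L)" by (rule compactin_sec[OF W L(1,2)])
  show s: "sec W ` L \<subseteq> W" using sec(2)[OF W] L(2) by blast
  show z: "(if g \<in> W then v (sg g) else 0) = 0" if "g \<notin> sec W ` L" for g
    using that sec(1)[OF W, of g] L(3)[of "sg g"] by (metis imageI)
  have vs: "continuous_map T euclidean (\<lambda>g. v (sg g))"
    using continuous_map_compose[OF continuous_sg, of euclidean v] v by (simp add: o_def)
  show "continuous_map T euclidean (\<lambda>g. if g \<in> W then v (sg g) else 0)"
  proof (rule glue[OF _ _ c s z])
    show "continuous_map (subtopology T W) euclidean (\<lambda>g. if g \<in> W then v (sg g) else 0)"
      by (rule continuous_map_eq[OF continuous_map_from_subtopology[OF vs]]) auto
  qed (use W in \<open>simp add: bisection_iff\<close>)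
qed

lemma bump_G:
  assumes W: "bisection W" and g: "g \<in> W"
  obtains q :: "'x arrow \<Rightarrow> real" and K where "continuous_map T euclideanreal q" "\<And>h. 0 \<le> q h" "q g = 1"
    "compactin T K" "K \<subseteq> W" "\<And>h. h \<notin> K \<Longrightarrow> q h = 0"
proof -
  have o: "open (sg ` W)" "{sg g} \<subseteq> sg ` W" using open_sg_image W g by (simp_all add: bisection_iff)
  obtain v :: "'x \<Rightarrow> real" and L where v: "continuous_on UNIV v" "\<And>x. 0 \<le> v x" "\<And>x. v x \<le> 1"
    "\<And>x. x \<in> {sg g} \<Longrightarrow> v x = 1" "compact L" "L \<subseteq> sg ` W" "\<And>x. x \<notin> L \<Longrightarrow> v x = 0"
    by (rule bump_X[OF compact_sing o]) (rule that)
  note l = lift_function[OF W v(1) v(5,6,7)]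
  show thesis
    by (rule that[OF l(1) _ _ l(2,3,4)]) (use v g in auto)
qed

text \<open>A partition of unity subordinate to bisections. The covering family \<open>\<W>\<close>
  is a parameter, because linear extensions are later computed on special kinds of
  bisections.\<close>

lemma Cc_decompose:
  assumes f: "f \<in> CG" and cov: "\<And>g. g \<in> \<Gamma> \<Longrightarrow> \<exists>W\<in>\<W>. bisection W \<and> g \<in> W"
  obtains F :: "'x arrow set" and f' where "finite F" "f = (\<lambda>g. \<Sum>i\<in>F. f' i g)"
    "\<And>i. i \<in> F \<Longrightarrow> \<exists>W\<in>\<W>. bisection W \<and> supp_in (f' i) W"
proof -
  obtain K where cf: "continuous_map T euclidean f" and K: "compactin T K" "\<And>g. g \<notin> K \<Longrightarrow> f g = 0"
    using f unfolding CG_iff by blast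
  have K\<Gamma>: "K \<subseteq> \<Gamma>" using compactin_subset_topspace[OF K(1)] by simp
  let ?P = "\<lambda>g W (q :: 'x arrow \<Rightarrow> real) C. W \<in> \<W> \<and> bisection W \<and> continuous_map T euclideanreal q \<and> (\<forall>h. 0 \<le> q h) \<and> q g = 1 \<and>
      compactin T C \<and> C \<subseteq> W \<and> (\<forall>h. h \<notin> C \<longrightarrow> q h = 0)"
  have "\<forall>g\<in>K. \<exists>W q C. ?P g W q C"
  proof
    fix g assume "g \<in> K"
    then obtain W where W: "W \<in> \<W>" "bisection W" "g \<in> W" using cov K\<Gamma> by blast
    obtain q :: "'x arrow \<Rightarrow> real" and C where "continuous_map T euclideanreal q" "\<And>h. 0 \<le> q h" "q g = 1"
      "compactin T C" "C \<subseteq> W" "\<And>h. h \<notin> C \<Longrightarrow> q h = 0" using bump_G[OF W(2,3)] by blast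
    then show "\<exists>W q C. ?P g W q C" using W by blast
  qed
  from bchoice[OF this] obtain W where "\<forall>g\<in>K. \<exists>q C. ?P g (W g) q C" ..
  from bchoice[OF this] obtain q where "\<forall>g\<in>K. \<exists>C. ?P g (W g) (q g) C" ..
  from bchoice[OF this] obtain C where "\<forall>g\<in>K. ?P g (W g) (q g) (C g)" ..
  then have q: "?P g (W g) (q g) (C g)" if "g \<in> K" for g using that by blast
  define P where "P g = {h \<in> topspace T. q g h \<in> {0<..}}" for g
  have oP: "openin T (P g)" if "g \<in> K" for g
    unfolding P_def using q[OF that] by (intro openin_continuous_map_preimage[of T euclideanreal]) auto
  have KP: "K \<subseteq> \<Union>(P ` K)"
  proof
    fix g assume g: "g \<in> K"
    then have "g \<in> P g" using q[OF g] K\<Gamma> by (auto simp: P_def)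
    then show "g \<in> \<Union>(P ` K)" using g by blast
  qed
  obtain F' where F': "finite F'" "F' \<subseteq> P ` K" "K \<subseteq> \<Union>F'"
    using compactinD[OF K(1) _ KP] oP by blast
  obtain F where F: "F \<subseteq> K" "finite F" "F' = P ` F"
    using finite_subset_image[OF F'(1,2)] by blast
  define Q where "Q h = (\<Sum>i\<in>F. q i h)" for h
  have Qc: "continuous_map T euclideanreal Q" unfolding Q_def using q F by (intro continuous_map_sum) auto
  have q0: "0 \<le> q i h" if "i \<in> F" for i h using q that F by blast
  have Qpos: "0 < Q h" if h: "h \<in> K" for h
  proof -
    obtain i where i: "i \<in> F" "0 < q i h" using F'(3) F(3) h unfolding P_def by blast
    have "q i h \<le> Q h" unfolding Q_def by (rule member_le_sum) (use i q0 F in auto)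
    then show ?thesis using i by linarith
  qed
  \<comment> \<open>The quotient is continuous only where \<open>Q\<close> is positive. That set is
    open and contains \<open>K\<close>, and \<open>f\<close> vanishes off \<open>K\<close>, so the
    product extends continuously by 0.\<close>
  define f' where "f' i h = f h * complex_of_real (q i h / Q h)" for i h
  define V where "V = {h \<in> topspace T. Q h \<in> {0<..}}"
  have V: "openin T V" unfolding V_def by (rule openin_continuous_map_preimage[OF Qc]) auto
  have KV: "K \<subseteq> V" using Qpos K\<Gamma> by (auto simp: V_def)
  have f'0: "f' i h = 0" if "h \<notin> K" for i h using K(2) that by (simp add: f'_def)
  have cont: "continuous_map T euclidean (f' i)" if i: "i \<in> F" for i
  proof (rule glue[OF V _ K(1) KV f'0])
    have "i \<in> K" using i F by blast
    then have "continuous_map T euclideanreal (q i)" using q by blast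
    then have "continuous_map (subtopology T V) euclideanreal (\<lambda>h. q i h / Q h)"
      using Qc by (intro continuous_map_real_divide continuous_map_from_subtopology) (auto simp: V_def)
    then have "continuous_map (subtopology T V) euclidean (\<lambda>h. complex_of_real (q i h / Q h))"
      using continuous_map_compose[of _ euclideanreal "\<lambda>h. q i h / Q h" euclidean complex_of_real]
      by (simp add: o_def continuous_on_of_real_id)
    then show "continuous_map (subtopology T V) euclidean (f' i)" unfolding f'_def
      by (intro continuous_map_mult_algebra[OF continuous_map_from_subtopology[OF cf]])
  qed
  show thesis
  proof (rule that[OF F(2), of f'])
    show "f = (\<lambda>g. \<Sum>i\<in>F. f' i g)"
    proof
      fix g
      have "(\<Sum>i\<in>F. f' i g) = f g * complex_of_real (Q g / Q g)"
      proof -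
        have "(\<Sum>i\<in>F. f' i g) = f g * complex_of_real (\<Sum>i\<in>F. q i g / Q g)"
          unfolding f'_def of_real_sum by (rule sum_distrib_left[symmetric])
        also have "(\<Sum>i\<in>F. q i g / Q g) = Q g / Q g" unfolding sum_divide_distrib[symmetric] by (simp add: Q_def)
        finally show ?thesis .
      qed
      then show "f g = (\<Sum>i\<in>F. f' i g)" using Qpos[of g] K(2)[of g] by (cases "g \<in> K") auto
    qed
    fix i assume i: "i \<in> F"
    then have iK: "i \<in> K" using F by blast
    have "f' i h = 0" if "h \<notin> C i" for h using q[OF iK] that by (simp add: f'_def)
    then show "\<exists>W\<in>\<W>. bisection W \<and> supp_in (f' i) W"
      using q[OF iK] cont[OF i] unfolding supp_in_def by blast
  qed
qed

lemma bisection_exists: "g \<in> \<Gamma> \<Longrightarrow> \<exists>W\<in>UNIV. bisection W \<and> g \<in> W"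
proof -
  assume "g \<in> \<Gamma>"
  have "openin T \<Gamma>" using openin_topspace[of T] by simp
  from T_basis[OF this \<open>g \<in> \<Gamma>\<close>] show ?thesis using bisection_Z by (metis UNIV_I)
qed

lemma CG_mult:
  assumes "f \<in> CG" "continuous_map T euclidean u" shows "(\<lambda>g. u g * f g) \<in> CG"
    and "supp_in f W \<Longrightarrow> supp_in (\<lambda>g. u g * f g) W"
proof -
  have "continuous_map T euclidean (\<lambda>g. u g * f g)"
    using assms by (auto simp: CG_iff intro: continuous_map_mult_algebra)
  then show "(\<lambda>g. u g * f g) \<in> CG" "supp_in f W \<Longrightarrow> supp_in (\<lambda>g. u g * f g) W"
    using assms(1) unfolding CG_iff supp_in_def by (metis mult_zero_right)+
qed

lemma CG_add: assumes "f \<in> CG" "f' \<in> CG" shows "(\<lambda>g. f g + f' g) \<in> CG"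
proof -
  from assms obtain K K' where K: "compactin T K" "\<And>g. g \<notin> K \<Longrightarrow> f g = 0" "compactin T K'" "\<And>g. g \<notin> K' \<Longrightarrow> f' g = 0"
    unfolding CG_iff by blast
  have "continuous_map T euclidean (\<lambda>g. f g + f' g)"
    using assms by (auto simp: CG_iff intro: continuous_map_plus_normed)
  moreover have "compactin T (K \<union> K')" by (intro compactin_Un K)
  moreover have "f g + f' g = 0" if "g \<notin> K \<union> K'" for g using K(2)[of g] K(4)[of g] that by simp
  ultimately show ?thesis unfolding CG_iff by blast
qed

lemma CG_zero: "(\<lambda>g. 0) \<in> CG" unfolding CG_iff by (auto intro: exI[of _ "{}"])

lemma CG_sum: "(\<And>i. i \<in> F \<Longrightarrow> f i \<in> CG) \<Longrightarrow> (\<lambda>g. \<Sum>i\<in>F. f i g) \<in> CG"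
  by (induction F rule: infinite_finite_induct) (auto simp: CG_zero CG_add)

lemma CG_scale: "f \<in> CG \<Longrightarrow> (\<lambda>g. z * f g) \<in> CG" by (rule CG_mult) auto

lemma CG_bounded: assumes "f \<in> CG" obtains M where "0 \<le> M" "\<And>g. cmod (f g) \<le> M"
proof -
  obtain K where K: "continuous_map T euclidean f" "compactin T K" "\<And>g. g \<notin> K \<Longrightarrow> f g = 0" using assms unfolding CG_iff by blast
  then have "bounded (f ` K)" by (intro compact_imp_bounded compact_image_T)
  then obtain M where M: "\<And>g. g \<in> K \<Longrightarrow> cmod (f g) \<le> M" by (auto simp: bounded_iff)
  have "cmod (f g) \<le> max M 0" for g using M[of g] K(3)[of g] by (cases "g \<in> K") auto
  then show thesis using that[of "max M 0"] by auto
qed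

lemma CG_finite_fibre: assumes "f \<in> CG" shows "finite {h. rg h = x \<and> f h \<noteq> 0}"
proof -
  obtain F :: "'x arrow set" and f' where F: "finite F" "f = (\<lambda>g. \<Sum>i\<in>F. f' i g)" "\<And>i. i \<in> F \<Longrightarrow> \<exists>W\<in>UNIV. bisection W \<and> supp_in (f' i) W"
    by (rule Cc_decompose[OF assms bisection_exists]) (assumption, rule that)
  have "finite {h. rg h = x \<and> f' i h \<noteq> 0}" if "i \<in> F" for i
  proof -
    obtain W where W: "bisection W" "supp_in (f' i) W" using F(3) \<open>i \<in> F\<close> by blast
    then have "{h. rg h = x \<and> f' i h \<noteq> 0} \<subseteq> {rsec W x}"
      using rsec(1)[OF W(1)] unfolding supp_in_def by auto
    then show ?thesis using finite_subset by blast
  qed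
  moreover have "{h. rg h = x \<and> f h \<noteq> 0} \<subseteq> (\<Union>i\<in>F. {h. rg h = x \<and> f' i h \<noteq> 0})"
  proof
    fix h assume h: "h \<in> {h. rg h = x \<and> f h \<noteq> 0}"
    then have "(\<Sum>i\<in>F. f' i h) \<noteq> 0" by (simp add: F(2))
    then obtain i where "i \<in> F" "f' i h \<noteq> 0" by (rule sum.not_neutral_contains_not_neutral)
    then show "h \<in> (\<Union>i\<in>F. {h. rg h = x \<and> f' i h \<noteq> 0})" using h by blast
  qed
  ultimately show ?thesis using F(1) by (meson finite_UN_I finite_subset)
qed

section \<open>The regular representation\<close>

definition rep_sum :: "('x arrow \<Rightarrow> complex) \<Rightarrow> ('x arrow \<Rightarrow> complex) \<Rightarrow> 'x arrow \<Rightarrow> complex" where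
  "rep_sum f \<xi> g = (if g \<in> \<Gamma> then \<Sum>\<^sub>\<infinity>h\<in>{h \<in> \<Gamma>. rg h = rg g}. f h * \<xi> (gmul (ginverse h) g) else 0)"

text \<open>The sum defining the convolution at \<open>g\<close> only meets arrows with the source
  of \<open>g\<close>, so the direct sum over the fibres is given by one formula on all
  arrows.\<close>

lemma lam_eq: "lam f = Blinfun (\<lambda>\<xi>. Abs_l2 (rep_sum f (l2_fun \<xi>)))"
proof -
  have "(if g \<in> \<Gamma> then reg_rep (Gam \<phi>) (sg g) f (\<lambda>h. if h \<in> src_fibre (Gam \<phi>) (sg g) then l2_fun \<xi> h else 0) g else 0)
      = rep_sum f (l2_fun \<xi>) g" for \<xi> g
  proof (cases "g \<in> \<Gamma>")
    case True
    have "gmul (ginverse h) g \<in> src_fibre (Gam \<phi>) (sg g)" if "h \<in> \<Gamma>" "rg h = rg g" for h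
      using that True by (auto simp: src_fibre_def intro!: gmul_arrows)
    then show ?thesis using True
      by (auto simp: rep_sum_def reg_rep_def conv_def src_fibre_def intro!: infsum_cong)
  qed (simp add: rep_sum_def)
  then show ?thesis unfolding reg_sum_def Gam_sel topspace_Gam_top by presburger
qed

end

context lh_space
begin

text \<open>\<open>Abs_l2\<close> and \<open>Blinfun\<close> reveal nothing unless summability and
  boundedness are known. This predicate records an operator for which they hold and which acts by
  the expected formula.\<close>

definition is_op :: "('x arrow \<Rightarrow> complex) \<Rightarrow> 'x arrow l2op \<Rightarrow> bool" where
  "is_op f a \<longleftrightarrow> clin a \<and> (\<forall>\<xi> g. l2_fun (blinfun_apply a \<xi>) g = rep_sum f (l2_fun \<xi>) g)"

lemma lam_is_op: "is_op f a \<Longrightarrow> lam f = a"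
proof -
  assume "is_op f a"
  then have "Abs_l2 (rep_sum f (l2_fun \<xi>)) = blinfun_apply a \<xi>" for \<xi>
    by (metis ext is_op_def l2_fun_inverse)
  then show "lam f = a" unfolding lam_eq by (simp add: blinfun_apply_inverse)
qed

lemma rep_sum_bisection:
  assumes W: "bisection W" and f: "\<And>g. g \<notin> W \<Longrightarrow> f g = 0"
  shows "rep_sum f \<xi> g = (if g \<in> \<Gamma> \<and> rg g \<in> rg ` W then f (rsec W (rg g)) * \<xi> (gmul (ginverse (rsec W (rg g))) g) else 0)"
proof (cases "g \<in> \<Gamma> \<and> rg g \<in> rg ` W")
  case True
  let ?h = "rsec W (rg g)"
  have h: "?h \<in> W" "rg ?h = rg g" "?h \<in> \<Gamma>" using rsec(2,3)[OF W] True bisection_sub[OF W] by auto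
  have "(\<Sum>\<^sub>\<infinity>h\<in>{h \<in> \<Gamma>. rg h = rg g}. f h * \<xi> (gmul (ginverse h) g)) = (\<Sum>\<^sub>\<infinity>h\<in>{?h}. f h * \<xi> (gmul (ginverse h) g))"
  proof (rule infsum_cong_neutral)
    fix h assume "h \<in> {h \<in> \<Gamma>. rg h = rg g} - {?h}"
    then have "h \<notin> W" using rsec(1)[OF W, of h] by auto
    then show "f h * \<xi> (gmul (ginverse h) g) = 0" using f by simp
  qed (use h in auto)
  then show ?thesis using True by (simp add: rep_sum_def)
next
  case False
  have "(\<Sum>\<^sub>\<infinity>h\<in>{h \<in> \<Gamma>. rg h = rg g}. f h * \<xi> (gmul (ginverse h) g)) = 0" if "g \<in> \<Gamma>"
  proof (rule infsum_0)
    fix h assume "h \<in> {h \<in> \<Gamma>. rg h = rg g}"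
    then have "h \<notin> W" using False that by (metis (mono_tags, lifting) image_eqI mem_Collect_eq)
    then show "f h * \<xi> (gmul (ginverse h) g) = 0" using f by simp
  qed
  then show ?thesis using False by (auto simp: rep_sum_def)
qed

text \<open>On a bisection each row of the matrix has at most one nonzero entry, at
  \<open>h = rsec W (rg g)\<close>, and \<open>g \<mapsto> h^-1 g\<close> is injective. The operator
  is a weighted partial permutation, bounded by the supremum of \<open>f\<close>.\<close>

lemma is_op_bisection:
  assumes W: "bisection W" and f: "\<And>g. g \<notin> W \<Longrightarrow> f g = 0" and M: "0 \<le> M" "\<And>g. cmod (f g) \<le> M"
  obtains a where "is_op f a" "norm a \<le> M"
proof -
  have sum: "(\<Sum>g\<in>F. (cmod (rep_sum f (l2_fun \<xi>) g))\<^sup>2) \<le> (M * norm \<xi>)\<^sup>2" if F: "finite F" for F \<xi>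
  proof -
    let ?F = "{g \<in> F. g \<in> \<Gamma> \<and> rg g \<in> rg ` W}" and ?t = "\<lambda>g. gmul (ginverse (rsec W (rg g))) g"
    have inj: "inj_on ?t ?F"
    proof (rule inj_onI)
      fix g g' assume g: "g \<in> ?F" "g' \<in> ?F" and e: "?t g = ?t g'"
      let ?h = "rsec W (rg g)" and ?h' = "rsec W (rg g')"
      have h: "?h \<in> W" "?h' \<in> W" "rg ?h = rg g" "rg ?h' = rg g'" using rsec(2,3)[OF W] g by auto
      have "sg ?h = sg ?h'" "sg g = sg g'" "kg g - kg ?h = kg g' - kg ?h'"
        using arg_cong[OF e, of rg] arg_cong[OF e, of sg] arg_cong[OF e, of kg] by simp_all
      moreover from this have "?h = ?h'" using h W unfolding bisection_iff inj_on_def by metis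
      moreover from this have "rg g = rg g'" using h(3,4) by metis
      ultimately show "g = g'" by (metis arrow_eqI diff_add_cancel)
    qed
    have "(\<Sum>g\<in>F. (cmod (rep_sum f (l2_fun \<xi>) g))\<^sup>2) = (\<Sum>g\<in>?F. (cmod (rep_sum f (l2_fun \<xi>) g))\<^sup>2)"
      by (rule sum.mono_neutral_right) (use F in \<open>auto simp: rep_sum_bisection[OF W f]\<close>)
    also have "\<dots> \<le> (\<Sum>g\<in>?F. M\<^sup>2 * (cmod (l2_fun \<xi> (?t g)))\<^sup>2)"
    proof (rule sum_mono)
      fix g assume "g \<in> ?F"
      then have "rep_sum f (l2_fun \<xi>) g = f (rsec W (rg g)) * l2_fun \<xi> (?t g)"
        by (simp add: rep_sum_bisection[OF W f])
      then have "cmod (rep_sum f (l2_fun \<xi>) g) \<le> M * cmod (l2_fun \<xi> (?t g))"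
        using M(2)[of "rsec W (rg g)"] by (simp only: norm_mult) (rule mult_right_mono, simp_all)
      then have "(cmod (rep_sum f (l2_fun \<xi>) g))\<^sup>2 \<le> (M * cmod (l2_fun \<xi> (?t g)))\<^sup>2" by (intro power_mono) auto
      then show "(cmod (rep_sum f (l2_fun \<xi>) g))\<^sup>2 \<le> M\<^sup>2 * (cmod (l2_fun \<xi> (?t g)))\<^sup>2" by (simp add: power_mult_distrib)
    qed
    also have "\<dots> = M\<^sup>2 * (\<Sum>k\<in>?t ` ?F. (cmod (l2_fun \<xi> k))\<^sup>2)"
      by (simp add: sum.reindex[OF inj] sum_distrib_left)
    also have "\<dots> \<le> M\<^sup>2 * (norm \<xi>)\<^sup>2"
      by (intro mult_left_mono l2_sum_le_norm_sq) (use F in auto)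
    finally show ?thesis by (simp add: power_mult_distrib)
  qed
  note b = l2_from_sum_bound[OF sum mult_nonneg_nonneg[OF M(1) norm_ge_zero]]
  let ?a = "\<lambda>\<xi>. Abs_l2 (rep_sum f (l2_fun \<xi>))"
  have fa: "l2_fun (?a \<xi>) = rep_sum f (l2_fun \<xi>)" for \<xi>
    by (rule Abs_l2_inverse) (use b(1)[of \<xi>] in simp)
  have bl: "bounded_linear ?a"
  proof (rule bounded_linear_intro[of _ M])
    have "rep_sum f (l2_fun (\<xi> + \<eta>)) g = rep_sum f (l2_fun \<xi>) g + rep_sum f (l2_fun \<eta>) g"
      "rep_sum f (l2_fun (r *\<^sub>R \<xi>)) g = r *\<^sub>R rep_sum f (l2_fun \<xi>) g" for \<xi> \<eta> r g
      by (simp_all add: l2_rep rep_sum_bisection[OF W f] algebra_simps)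
    then show "?a (\<xi> + \<eta>) = ?a \<xi> + ?a \<eta>" "?a (r *\<^sub>R \<xi>) = r *\<^sub>R ?a \<xi>" for \<xi> \<eta> r
      by (auto intro!: l2_eqI simp only: fa plus_l2.rep_eq[of "?a \<xi>"] scaleR_l2.rep_eq[of _ "?a \<xi>"])
    show "norm (?a \<xi>) \<le> norm \<xi> * M" for \<xi> using b(2)[of \<xi>] by (simp add: mult.commute)
  qed
  have ap: "blinfun_apply (Blinfun ?a) = ?a" by (rule bounded_linear_Blinfun_apply[OF bl])
  have "rep_sum f (l2_fun (l2_scale z \<xi>)) g = z * rep_sum f (l2_fun \<xi>) g" for z \<xi> g
    by (simp add: l2_rep rep_sum_bisection[OF W f])
  then have "?a (l2_scale z \<xi>) = l2_scale z (?a \<xi>)" for z \<xi>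
    by (auto intro!: l2_eqI simp only: fa l2_scale.rep_eq[of _ "?a \<xi>"])
  then have "clin (Blinfun ?a)" unfolding clin_def ap by blast
  then have "is_op f (Blinfun ?a)" by (simp add: is_op_def ap fa)
  moreover have "norm (Blinfun ?a) \<le> M"
    by (rule norm_blinfun_bound[OF M(1)]) (simp add: ap b(2))
  ultimately show thesis by (rule that)
qed

lemma is_op_sum:
  assumes "finite F" "\<And>i. i \<in> F \<Longrightarrow> f i \<in> CG \<and> is_op (f i) (a i)"
  shows "is_op (\<lambda>g. \<Sum>i\<in>F. f i g) (\<Sum>i\<in>F. a i)"
  using assms
proof (induction F)
  case empty
  show ?case by (auto simp: is_op_def rep_sum_def l2_rep clin_def l2_scale_simps)
next
  case (insert i F)
  have IH: "is_op (f i) (a i)" "is_op (\<lambda>g. \<Sum>i\<in>F. f i g) (\<Sum>i\<in>F. a i)" using insert by auto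
  have s: "(\<lambda>h. u h * \<xi> h) summable_on {h \<in> \<Gamma>. rg h = x}" if "u \<in> CG" for u x and \<xi> :: "'x arrow \<Rightarrow> complex"
    by (rule finite_nonzero_values_imp_summable_on, rule finite_subset[OF _ CG_finite_fibre[OF that, of x]]) auto
  have "(\<lambda>g. \<Sum>i\<in>F. f i g) \<in> CG" "f i \<in> CG" using insert by (auto intro: CG_sum)
  then have "rep_sum (\<lambda>g. \<Sum>i\<in>insert i F. f i g) \<xi> g = rep_sum (f i) \<xi> g + rep_sum (\<lambda>g. \<Sum>i\<in>F. f i g) \<xi> g" for \<xi> g
    using insert(1,2) infsum_add[OF s s] by (simp add: rep_sum_def distrib_right)
  then show ?case using IH insert(1,2) by (simp add: is_op_def op_apply l2_rep clin_def l2_scale_simps)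
qed

lemma lam_op: assumes "f \<in> CG" shows "is_op f (lam f)"
proof -
  obtain F :: "'x arrow set" and f' where F: "finite F" "f = (\<lambda>g. \<Sum>i\<in>F. f' i g)" "\<And>i. i \<in> F \<Longrightarrow> \<exists>W\<in>UNIV. bisection W \<and> supp_in (f' i) W"
    by (rule Cc_decompose[OF assms bisection_exists]) (assumption, rule that)
  have "\<exists>a. f' i \<in> CG \<and> is_op (f' i) a" if "i \<in> F" for i
  proof -
    obtain W where W: "bisection W" "supp_in (f' i) W" using F(3) \<open>i \<in> F\<close> by blast
    then have c: "f' i \<in> CG" "\<And>g. g \<notin> W \<Longrightarrow> f' i g = 0" using supp_in_CG unfolding supp_in_def by blast+
    obtain M where M: "0 \<le> M" "\<And>g. cmod (f' i g) \<le> M" by (rule CG_bounded[OF c(1)]) (rule that)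
    obtain a where "is_op (f' i) a" by (rule is_op_bisection[OF W(1) c(2) M])
    then show ?thesis using c(1) by blast
  qed
  then obtain a where "\<And>i. i \<in> F \<Longrightarrow> f' i \<in> CG \<and> is_op (f' i) (a i)" by metis
  from is_op_sum[OF F(1) this] have "is_op f (\<Sum>i\<in>F. a i)" unfolding F(2) .
  then show ?thesis using lam_is_op by metis
qed

lemma norm_lam_le:
  assumes "bisection W" "supp_in f W" "0 \<le> M" "\<And>g. cmod (f g) \<le> M" shows "norm (lam f) \<le> M"
proof -
  have f0: "\<And>g. g \<notin> W \<Longrightarrow> f g = 0" using assms(2) unfolding supp_in_def by blast
  obtain a where "is_op f a" "norm a \<le> M" by (rule is_op_bisection[OF assms(1) f0 assms(3,4)])
  then show ?thesis using lam_is_op by simp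
qed

lemma clin_lam: "f \<in> CG \<Longrightarrow> clin (lam f)" using lam_op is_op_def by blast

text \<open>The regular representation commutes with right translation, so the coefficients depend
  only on \<open>g k^-1\<close>.\<close>

lemma ent_lam: assumes "f \<in> CG"
  shows "ent (lam f) g k = (if g \<in> \<Gamma> \<and> k \<in> \<Gamma> \<and> sg g = sg k then f (gmul g (ginverse k)) else 0)"
proof (cases "g \<in> \<Gamma>")
  case True
  have e: "ent (lam f) g k = (\<Sum>\<^sub>\<infinity>h\<in>{h \<in> \<Gamma>. rg h = rg g}. f h * (if gmul (ginverse h) g = k then 1 else 0))"
    using lam_op[OF assms] True unfolding is_op_def ent_def by (simp add: rep_sum_def l2_fun_ket)
  let ?h = "gmul g (ginverse k)"
  have hk: "gmul (ginverse h) g = k \<Longrightarrow> h = ?h" if "rg h = rg g" for h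
    using that by (intro arrow_eqI) (auto simp: gmul_def ginverse_def)
  show ?thesis
  proof (cases "k \<in> \<Gamma> \<and> sg g = sg k")
    case k: True
    then have h: "?h \<in> \<Gamma>" "gmul (ginverse ?h) g = k"
      using True by (auto intro!: gmul_arrows arrow_eqI)
    have "(\<Sum>\<^sub>\<infinity>h\<in>{h \<in> \<Gamma>. rg h = rg g}. f h * (if gmul (ginverse h) g = k then 1 else 0)) = (\<Sum>\<^sub>\<infinity>h\<in>{?h}. f h)"
      by (rule infsum_cong_neutral) (use h hk in auto)
    then show ?thesis using e k True by simp
  next
    case k: False
    have "gmul (ginverse h) g \<noteq> k" if "h \<in> \<Gamma>" "rg h = rg g" for h
      using k gmul_arrows[of "ginverse h" \<phi> g] that True by auto
    then show ?thesis using e k by (auto intro!: infsum_0)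
  qed
next
  case False
  then show ?thesis using lam_op[OF assms] unfolding is_op_def ent_def by (simp add: rep_sum_def)
qed

lemma lam_simps:
  assumes "f \<in> CG"
  shows "f' \<in> CG \<Longrightarrow> lam (\<lambda>g. f g + f' g) = lam f + lam f'" "lam (\<lambda>g. z * f g) = op_scale z (lam f)"
proof -
  show "f' \<in> CG \<Longrightarrow> lam (\<lambda>g. f g + f' g) = lam f + lam f'"
    by (rule op_eqI_ent)
      (use assms clin_lam in \<open>auto simp: ent_lam CG_add ent_simps op_apply clin_def l2_scale_simps\<close>)
  show "lam (\<lambda>g. z * f g) = op_scale z (lam f)"
    by (rule op_eqI_ent)
      (use assms clin_lam in \<open>auto simp: ent_lam CG_scale ent_simps op_apply clin_def l2_scale_simps mult.commute\<close>)
qed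

lemma lam_zero: "lam (\<lambda>g. 0) = 0"
  by (rule op_eqI_ent[OF clin_lam[OF CG_zero]]) (auto simp: CG_zero ent_lam ent_simps clin_def l2_scale_simps)

lemma lam_sum: "(\<And>i. i \<in> F \<Longrightarrow> f i \<in> CG) \<Longrightarrow> lam (\<lambda>g. \<Sum>i\<in>F. f i g) = (\<Sum>i\<in>F. lam (f i))"
  by (induction F rule: infinite_finite_induct) (auto simp: lam_zero lam_simps CG_sum)

text \<open>
  On \<open>prods W1 W2\<close> the convolution of \<open>f1\<close> and \<open>f2\<close> is \<open>g \<mapsto> f1 (rsec W1 (rg g)) * f2 (sec W2 (sg g))\<close>.
\<close>

lemma lam_compose_bisection:
  assumes W: "bisection W1" "bisection W2" and f: "supp_in f1 W1" "supp_in f2 W2"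
  obtains F where "F \<in> CG" "lam f1 o\<^sub>L lam f2 = lam F"
proof -
  obtain K1 where K1: "continuous_map T euclidean f1" "compactin T K1" "K1 \<subseteq> W1" "\<And>g. g \<notin> K1 \<Longrightarrow> f1 g = 0"
    using f(1) unfolding supp_in_def by blast
  obtain K2 where K2: "continuous_map T euclidean f2" "compactin T K2" "K2 \<subseteq> W2" "\<And>g. g \<notin> K2 \<Longrightarrow> f2 g = 0"
    using f(2) unfolding supp_in_def by blast
  have c: "f1 \<in> CG" "f2 \<in> CG" using f supp_in_CG by auto
  define P where "P = prods W1 W2"
  define F where "F g = (if g \<in> P then f1 (rsec W1 (rg g)) * f2 (sec W2 (sg g)) else 0)" for g
  have F_mul: "F (gmul g h) = f1 g * f2 h" if "g \<in> W1" "h \<in> W2" "sg g = rg h" for g h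
    using that prodsI[of g W1 h W2] rsec(1)[OF W(1)] sec(1)[OF W(2)] by (simp add: F_def P_def)
  have P: "bisection P" unfolding P_def by (rule bisection_prods[OF W])
  have "supp_in F P"
  proof (rule supp_inI)
    show "openin T P" using P by (simp add: bisection_iff)
    show "compactin T (prods K1 K2)" by (rule compactin_prods[OF W K1(2,3) K2(2,3)])
    show "prods K1 K2 \<subseteq> P" using K1(3) K2(3) unfolding P_def prods_def by blast
    show "F g = 0" if "g \<notin> prods K1 K2" for g
    proof (cases "g \<in> P")
      case True
      then obtain a b where ab: "a \<in> W1" "b \<in> W2" "sg a = rg b" "g = gmul a b" unfolding P_def prods_def by blast
      then show ?thesis using that F_mul[OF ab(1-3)] prodsI[of a K1 b K2] K1(4)[of a] K2(4)[of b] by auto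
    qed (simp add: F_def)
    have rP: "rg ` P \<subseteq> rg ` W1" "sg ` P \<subseteq> sg ` W2"
    proof -
      have "rg x \<in> rg ` W1 \<and> sg x \<in> sg ` W2" if x: "x \<in> P" for x
      proof -
        obtain a b where "a \<in> W1" "b \<in> W2" "x = gmul a b" using x unfolding P_def prods_def by blast
        then show ?thesis by (metis gmul_sel(1,2) imageI)
      qed
      then show "rg ` P \<subseteq> rg ` W1" "sg ` P \<subseteq> sg ` W2" by blast+
    qed
    have cr: "continuous_map (subtopology T P) (top_of_set (rg ` W1)) rg"
      and cs: "continuous_map (subtopology T P) (top_of_set (sg ` W2)) sg"
      using rP continuous_map_from_subtopology[OF continuous_rg] continuous_map_from_subtopology[OF continuous_sg]
      by (auto simp: continuous_map_in_subtopology)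
    have "continuous_map (subtopology T P) euclidean (\<lambda>g. f1 (rsec W1 (rg g)) * f2 (sec W2 (sg g)))"
      using continuous_map_mult_algebra[OF
          continuous_map_compose[OF continuous_map_compose[OF cr continuous_rsec[OF W(1)]] K1(1)]
          continuous_map_compose[OF continuous_map_compose[OF cs continuous_sec[OF W(2)]] K2(1)]]
      by (simp add: o_def)
    then show "continuous_map (subtopology T P) euclidean F"
      by (rule continuous_map_eq) (simp add: F_def)
  qed
  then have FC: "F \<in> CG" by (rule supp_in_CG)
  have "ent (lam f1 o\<^sub>L lam f2) g k = ent (lam F) g k" for g k
  proof -
    have f10: "\<And>g. g \<notin> W1 \<Longrightarrow> f1 g = 0" and f20: "\<And>g. g \<notin> W2 \<Longrightarrow> f2 g = 0" using K1 K2 by blast+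
    have "ent (lam f1 o\<^sub>L lam f2) g k = rep_sum f1 (\<lambda>h. ent (lam f2) h k) g"
      using lam_op[OF c(1)] unfolding is_op_def ent_def by simp
    also have "\<dots> = (if g \<in> \<Gamma> \<and> rg g \<in> rg ` W1 then f1 (rsec W1 (rg g)) * ent (lam f2) (gmul (ginverse (rsec W1 (rg g))) g) k else 0)"
      by (rule rep_sum_bisection[OF W(1) f10])
    also have "\<dots> = ent (lam F) g k"
    proof (cases "g \<in> \<Gamma> \<and> k \<in> \<Gamma> \<and> sg g = sg k")
      case True
      let ?x = "gmul g (ginverse k)"
      have e: "ent (lam F) g k = F ?x" using True FC by (simp add: ent_lam)
      show ?thesis
      proof (cases "rg g \<in> rg ` W1")
        case r: True
        let ?h = "rsec W1 (rg g)"
        have h: "?h \<in> W1" "rg ?h = rg g" "?h \<in> \<Gamma>" using rsec(2,3)[OF W(1) r] bisection_sub[OF W(1)] by auto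
        let ?b = "gmul (ginverse ?h) ?x"
        have b: "gmul (gmul (ginverse ?h) g) (ginverse k) = ?b" by (rule arrow_eqI) auto
        have hb: "gmul ?h ?b = ?x" "sg ?h = rg ?b" using h by (auto intro: arrow_eqI)
        have "ent (lam f2) (gmul (ginverse ?h) g) k = f2 ?b"
          using True h c(2) gmul_arrows[of "ginverse ?h" \<phi> g] by (simp add: ent_lam b)
        moreover have "F ?x = f1 ?h * f2 ?b"
        proof (cases "?b \<in> W2")
          case True
          then show ?thesis using F_mul[OF h(1) True hb(2)] hb(1) by simp
        next
          case False
          have "?x \<notin> P"
          proof
            assume "?x \<in> P"
            then obtain a b where ab: "a \<in> W1" "b \<in> W2" "sg a = rg b" "?x = gmul a b" unfolding P_def prods_def by blast
            have "rg a = rg ?h" using arg_cong[OF ab(4), of rg] h by simp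
            then have "a = ?h" using ab(1) h(1) W(1) unfolding bisection_iff inj_on_def by metis
            then have "b = ?b" using ab(3) arg_cong[OF ab(4), of sg] arg_cong[OF ab(4), of kg] by (intro arrow_eqI) auto
            then show False using False ab(2) by simp
          qed
          then show ?thesis using f20[OF False] by (simp add: F_def)
        qed
        ultimately show ?thesis using True r e by simp
      next
        case r: False
        have "?x \<notin> P" using r unfolding P_def prods_def by (auto) (metis gmul_sel(1) image_eqI)
        then show ?thesis using r e by (simp add: F_def)
      qed
    qed (use FC c(2) in \<open>auto simp: ent_lam\<close>)
    finally show ?thesis .
  qed
  then have "lam f1 o\<^sub>L lam f2 = lam F"
    by (intro op_eqI_ent) (use c FC clin_lam in \<open>auto simp: clin_def\<close>)
  then show thesis using FC that by blast
qed

lemma lam_compose: assumes "f \<in> CG" "f' \<in> CG" obtains F where "F \<in> CG" "lam f o\<^sub>L lam f' = lam F"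
proof -
  obtain I :: "'x arrow set" and u where u: "finite I" "f = (\<lambda>g. \<Sum>i\<in>I. u i g)" "\<And>i. i \<in> I \<Longrightarrow> \<exists>W\<in>UNIV. bisection W \<and> supp_in (u i) W"
    by (rule Cc_decompose[OF assms(1) bisection_exists]) (assumption, rule that)
  obtain J :: "'x arrow set" and v where v: "finite J" "f' = (\<lambda>g. \<Sum>i\<in>J. v i g)" "\<And>i. i \<in> J \<Longrightarrow> \<exists>W\<in>UNIV. bisection W \<and> supp_in (v i) W"
    by (rule Cc_decompose[OF assms(2) bisection_exists]) (assumption, rule that)
  have "\<exists>F. F \<in> CG \<and> lam (u i) o\<^sub>L lam (v j) = lam F" if "i \<in> I" "j \<in> J" for i j
    using lam_compose_bisection u(3)[OF that(1)] v(3)[OF that(2)] by metis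
  then obtain F where F: "\<And>i j. i \<in> I \<Longrightarrow> j \<in> J \<Longrightarrow> F i j \<in> CG \<and> lam (u i) o\<^sub>L lam (v j) = lam (F i j)" by metis
  have uv: "u i \<in> CG" "v j \<in> CG" if "i \<in> I" "j \<in> J" for i j using u(3)[OF that(1)] v(3)[OF that(2)] supp_in_CG by blast+
  have "lam f o\<^sub>L lam f' = (\<Sum>i\<in>I. lam (u i)) o\<^sub>L (\<Sum>j\<in>J. lam (v j))"
    using lam_sum[of I u] lam_sum[of J v] u v supp_in_CG by metis
  also have "\<dots> = (\<Sum>i\<in>I. \<Sum>j\<in>J. lam (u i) o\<^sub>L lam (v j))"
    by (rule blinfun_eqI) (simp add: op_apply blinfun.sum_left blinfun.sum_right, rule sum.swap)
  also have "\<dots> = (\<Sum>i\<in>I. \<Sum>j\<in>J. lam (F i j))" using F by simp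
  also have "\<dots> = (\<Sum>i\<in>I. lam (\<lambda>g. \<Sum>j\<in>J. F i j g))" using F by (intro sum.cong) (auto simp: lam_sum)
  also have "\<dots> = lam (\<lambda>g. \<Sum>i\<in>I. \<Sum>j\<in>J. F i j g)" using F by (intro lam_sum[symmetric] CG_sum) auto
  finally show thesis using F by (intro that[of "\<lambda>g. \<Sum>i\<in>I. \<Sum>j\<in>J. F i j g"] CG_sum) auto
qed

lemma CG_star: assumes "f \<in> CG" shows "(\<lambda>g. cnj (f (ginverse g))) \<in> CG"
proof -
  obtain K where K: "continuous_map T euclidean f" "compactin T K" "\<And>g. g \<notin> K \<Longrightarrow> f g = 0" using assms unfolding CG_iff by blast
  have "continuous_map T euclidean (cnj \<circ> (f \<circ> ginverse))"
    using K(1) continuous_ginverse by (intro continuous_map_compose) (auto simp: continuous_on_cnj)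
  moreover have "compactin T (ginverse ` K)" by (rule image_compactin[OF K(2) continuous_ginverse])
  moreover have "cnj (f (ginverse g)) = 0" if "g \<notin> ginverse ` K" for g
    using K(3)[of "ginverse g"] that by (simp add: image_ginverse_iff)
  ultimately show ?thesis unfolding CG_iff o_def by blast
qed

lemma is_adj_lam: assumes "f \<in> CG" shows "is_adj (lam f) (lam (\<lambda>g. cnj (f (ginverse g))))"
proof (rule is_adjI_ent)
  fix g k :: "'x arrow"
  have "ginverse (gmul k (ginverse g)) = gmul g (ginverse k)" by (rule arrow_eqI) auto
  then show "ent (lam (\<lambda>g. cnj (f (ginverse g)))) k g = cnj (ent (lam f) g k)"
    using assms CG_star[OF assms] by (auto simp: ent_lam)
qed (use assms CG_star clin_lam in auto)

section \<open>The reduced algebra as a C*-algebra of operators\<close>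

abbreviation "CA \<equiv> Cred (Gam \<phi>)"

lemma CA_approx: assumes "a \<in> CA" obtains f where "\<And>n::nat. f n \<in> CG" "(\<lambda>n. lam (f n)) \<longlonglongrightarrow> a"
proof -
  obtain b where b: "\<And>n. b n \<in> lam ` CG" "b \<longlonglongrightarrow> a" using assms unfolding Cred_def closure_sequential by blast
  then have "\<forall>n. \<exists>f. f \<in> CG \<and> b n = lam f" by blast
  from choice[OF this] obtain f where f: "\<And>n. f n \<in> CG \<and> b n = lam (f n)" by blast
  then have "b = (\<lambda>n. lam (f n))" by auto
  then show thesis using that[of f] b(2) f by simp
qed

lemma CA_I: "(\<And>n::nat. f n \<in> CG) \<Longrightarrow> (\<lambda>n. lam (f n)) \<longlonglongrightarrow> a \<Longrightarrow> a \<in> CA"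
  unfolding Cred_def closure_sequential by (intro exI[of _ "\<lambda>n. lam (f n)"]) simp

lemma lam_CA: "f \<in> CG \<Longrightarrow> lam f \<in> CA"
  unfolding Cred_def by (rule subsetD[OF closure_subset]) (rule imageI)

lemma cstar_CA: "cstar_ops CA"
proof
  show "closed CA" by (simp add: Cred_def)
  show "0 \<in> CA" using lam_CA[OF CG_zero] by (simp add: lam_zero)
  fix a b z assume a: "a \<in> CA"
  obtain f where f: "\<And>n::nat. f n \<in> CG" "(\<lambda>n. lam (f n)) \<longlonglongrightarrow> a" by (rule CA_approx[OF a]) (rule that)
  show "op_scale z a \<in> CA"
  proof (rule CA_I[of "\<lambda>n g. z * f n g"])
    have "bounded_linear (op_scale z)"
      by (rule bounded_linear_intro[of _ "cmod z"])
        (auto intro!: blinfun_eqI simp: op_apply l2_scale_simps norm_op_scale_le mult.commute[of _ "cmod z"])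
    from bounded_linear.tendsto[OF this f(2)] show "(\<lambda>n. lam (\<lambda>g. z * f n g)) \<longlonglongrightarrow> op_scale z a"
      by (simp add: lam_simps f)
  qed (simp add: CG_scale f)
  show "clin a" by (rule clin_limit[OF clin_lam f(2)]) (rule f)
  let ?f = "\<lambda>n g. cnj (f n (ginverse g))"
  have adj: "is_adj (lam (f n)) (lam (?f n))" "?f n \<in> CG" for n using f is_adj_lam CG_star by auto
  \<comment> \<open>Adjunction does not increase norms, so the adjoints of the approximants
    converge, and their limit is an adjoint of \<open>a\<close>.\<close>
  have "Cauchy (\<lambda>n. lam (?f n))"
  proof (rule metric_CauchyI)
    fix e :: real assume "0 < e"
    then obtain M where M: "\<And>m n. m \<ge> M \<Longrightarrow> n \<ge> M \<Longrightarrow> dist (lam (f m)) (lam (f n)) < e"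
      using metric_CauchyD[OF LIMSEQ_imp_Cauchy[OF f(2)]] by blast
    have "dist (lam (?f m)) (lam (?f n)) \<le> dist (lam (f m)) (lam (f n))" for m n
      unfolding dist_norm using is_adj_norm_le[OF is_adj_diff[OF adj(1)[of m] adj(1)[of n]]] .
    then show "\<exists>M. \<forall>m\<ge>M. \<forall>n\<ge>M. dist (lam (?f m)) (lam (?f n)) < e" using M by (meson le_less_trans)
  qed
  then obtain b where b: "(\<lambda>n. lam (?f n)) \<longlonglongrightarrow> b" using Cauchy_convergent_iff convergent_def by blast
  then have "b \<in> CA" using CA_I[of ?f] adj by blast
  moreover have "is_adj a b" by (rule is_adj_limit[OF adj(1) f(2) b])
  ultimately show "\<exists>b\<in>CA. is_adj a b" by blast
next
  fix a b assume a: "a \<in> CA" and b: "b \<in> CA"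
  obtain f where f: "\<And>n::nat. f n \<in> CG" "(\<lambda>n. lam (f n)) \<longlonglongrightarrow> a" by (rule CA_approx[OF a]) (rule that)
  obtain f' where f': "\<And>n::nat. f' n \<in> CG" "(\<lambda>n. lam (f' n)) \<longlonglongrightarrow> b" by (rule CA_approx[OF b]) (rule that)
  show "a + b \<in> CA"
  proof (rule CA_I[of "\<lambda>n g. f n g + f' n g"])
    show "(\<lambda>n. lam (\<lambda>g. f n g + f' n g)) \<longlonglongrightarrow> a + b"
      using tendsto_add[OF f(2) f'(2)] by (simp add: lam_simps f f')
  qed (simp add: CG_add f f')
  have "\<forall>n. \<exists>F. F \<in> CG \<and> lam (f n) o\<^sub>L lam (f' n) = lam F" using lam_compose f f' by metis
  from choice[OF this] obtain F where F: "\<And>n. F n \<in> CG \<and> lam (f n) o\<^sub>L lam (f' n) = lam (F n)" by blast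
  show "a o\<^sub>L b \<in> CA"
  proof (rule CA_I[of F])
    show "(\<lambda>n. lam (F n)) \<longlonglongrightarrow> (a o\<^sub>L b)"
      using bounded_bilinear.tendsto[OF bounded_bilinear_blinfun_compose f(2) f'(2)] F by simp
  qed (use F in blast)
qed

end

section \<open>Conditional expectation and one-parameter groups\<close>

lemma is_adj_cinner: assumes "is_adj a b" "clin a"
  shows "l2_cinner (blinfun_apply a \<xi>) \<eta> = l2_cinner \<xi> (blinfun_apply b \<eta>)"
proof -
  have "inner (l2_scale \<i> (blinfun_apply a \<xi>)) \<eta> = inner (l2_scale \<i> \<xi>) (blinfun_apply b \<eta>)"
    using assms by (metis clin_def is_adj_def)
  then show ?thesis using assms(1) by (simp add: l2_cinner_conv_inner is_adj_def)
qed

lemma ent_cinner: "ent a g k = l2_cinner (ket g) (blinfun_apply a (ket k))"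
  by (simp add: ent_def l2_cinner_ket)

lemma is_adj_ent: "is_adj a b \<Longrightarrow> clin a \<Longrightarrow> ent b k g = cnj (ent a g k)"
  unfolding ent_cinner by (metis is_adj_cinner l2_cinner_commute)

lemma l2_cinner_self: "l2_cinner \<xi> \<xi> = complex_of_real ((norm \<xi>)\<^sup>2)"
proof -
  have "Im (l2_cinner \<xi> \<xi>) = 0" using arg_cong[OF l2_cinner_commute[of \<xi> \<xi>], of Im] by simp
  then show ?thesis by (simp add: complex_eq_iff l2_cinner_conv_inner power2_norm_eq_inner)
qed

text \<open>A diagonal unitary. Conjugation by it implements the one-parameter group of a
  cocycle.\<close>

definition phase :: "('a \<Rightarrow> real) \<Rightarrow> 'a l2op" where
  "phase u = Blinfun (\<lambda>\<xi>. Abs_l2 (\<lambda>g. cis (u g) * l2_fun \<xi> g))"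

lemma phase_apply: "l2_fun (blinfun_apply (phase u) \<xi>) g = cis (u g) * l2_fun \<xi> g"
  and norm_phase: "norm (phase u) \<le> 1"
proof -
  let ?a = "\<lambda>\<xi>. Abs_l2 (\<lambda>g. cis (u g) * l2_fun \<xi> g)"
  have b: "(\<Sum>g\<in>F. (cmod (cis (u g) * l2_fun \<xi> g))\<^sup>2) \<le> (norm \<xi>)\<^sup>2" if "finite F" for F \<xi>
    using l2_sum_le_norm_sq[OF that, of \<xi>] by (simp add: norm_mult)
  note b' = l2_from_sum_bound[OF b norm_ge_zero]
  have fa: "l2_fun (?a \<xi>) = (\<lambda>g. cis (u g) * l2_fun \<xi> g)" for \<xi>
    by (rule Abs_l2_inverse) (use b'(1)[of \<xi>] in simp)
  have bl: "bounded_linear ?a"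
  proof (rule bounded_linear_intro[of _ 1])
    show "?a (\<xi> + \<eta>) = ?a \<xi> + ?a \<eta>" for \<xi> \<eta>
      by (rule l2_eqI, unfold fa plus_l2.rep_eq[of "?a \<xi>"]) (simp add: l2_rep algebra_simps)
    show "?a (r *\<^sub>R \<xi>) = r *\<^sub>R ?a \<xi>" for \<xi> r
      by (rule l2_eqI, unfold fa scaleR_l2.rep_eq[of _ "?a \<xi>"]) (simp add: l2_rep algebra_simps)
    show "norm (?a \<xi>) \<le> norm \<xi> * 1" for \<xi> using b'(2)[of \<xi>] by simp
  qed
  have ap: "blinfun_apply (phase u) = ?a" unfolding phase_def by (rule bounded_linear_Blinfun_apply[OF bl])
  show "l2_fun (blinfun_apply (phase u) \<xi>) g = cis (u g) * l2_fun \<xi> g" by (simp add: ap fa)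
  show "norm (phase u) \<le> 1" by (rule norm_blinfun_bound) (simp_all add: ap b'(2))
qed

lemma clin_phase: "clin (phase u)"
  unfolding clin_def by (intro allI l2_eqI) (simp add: phase_apply l2_rep)

lemma phase_ket: "blinfun_apply (phase u) (ket k) = l2_scale (cis (u k)) (ket k)"
  by (rule l2_eqI) (simp add: phase_apply l2_rep l2_fun_ket)

lemma phase_compose: "phase u o\<^sub>L phase v = phase (\<lambda>g. u g + v g)"
  by (rule blinfun_eqI, rule l2_eqI) (simp add: phase_apply cis_mult mult.assoc[symmetric])

lemma phase_zero: "phase (\<lambda>g. 0) = id_blinfun"
  by (rule blinfun_eqI, rule l2_eqI) (simp add: phase_apply)

lemma is_adj_phase: "is_adj (phase u) (phase (\<lambda>g. - u g))"
  by (rule is_adjI_ent[OF clin_phase clin_phase])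
    (auto simp: ent_def phase_ket l2_rep l2_fun_ket cis_cnj)

context lh_space
begin

sublocale CA: cstar_ops CA by (rule cstar_CA)

abbreviation "unit_arrow x \<equiv> (x, 0::int, x)"

text \<open>The columns at the units, the known injection of the reduced algebra into functions on
  the groupoid.\<close>

definition jf :: "'x arrow l2op \<Rightarrow> 'x arrow \<Rightarrow> complex" where
  "jf a g = (if g \<in> \<Gamma> then ent a g (unit_arrow (sg g)) else 0)"

lemma jf_simps: "jf (a + b) g = jf a g + jf b g" "jf (a - b) g = jf a g - jf b g" "jf (op_scale z a) g = z * jf a g"
  "jf (r *\<^sub>R a) g = complex_of_real r * jf a g"
  by (simp_all add: jf_def ent_simps)

lemma cmod_jf_le: "cmod (jf a g) \<le> norm a" by (simp add: jf_def cmod_ent_le)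

lemma jf_off: "g \<notin> \<Gamma> \<Longrightarrow> jf a g = 0" by (simp add: jf_def)

lemma jf_tendsto: "(a \<longlongrightarrow> x) F \<Longrightarrow> ((\<lambda>n. jf (a n) g) \<longlongrightarrow> jf x g) F"
  unfolding jf_def using bounded_linear.tendsto[OF bounded_linear_ent] by auto

lemma gmul_unit: "gmul g (ginverse (unit_arrow (sg g))) = g"
  by (rule arrow_eqI) (auto simp: gmul_def ginverse_def)

lemma jf_lam: "f \<in> CG \<Longrightarrow> jf (lam f) g = f g"
  by (simp add: jf_def ent_lam CG_off gmul_unit)

text \<open>Translation invariance survives norm limits, so all matrix coefficients are values of
  \<open>jf\<close>; hence \<open>jf\<close> is injective on the algebra.\<close>

lemma ent_jf: assumes "a \<in> CA"
  shows "ent a g k = (if g \<in> \<Gamma> \<and> k \<in> \<Gamma> \<and> sg g = sg k then jf a (gmul g (ginverse k)) else 0)"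
proof -
  obtain f where f: "\<And>n::nat. f n \<in> CG" "(\<lambda>n. lam (f n)) \<longlonglongrightarrow> a" by (rule CA_approx[OF assms]) (rule that)
  have 1: "(\<lambda>n. ent (lam (f n)) g k) \<longlonglongrightarrow> ent a g k"
    by (rule bounded_linear.tendsto[OF bounded_linear_ent f(2)])
  have 2: "(\<lambda>n. jf (lam (f n)) (gmul g (ginverse k))) \<longlonglongrightarrow> jf a (gmul g (ginverse k))" by (rule jf_tendsto[OF f(2)])
  show ?thesis
  proof (cases "g \<in> \<Gamma> \<and> k \<in> \<Gamma> \<and> sg g = sg k")
    case True
    then have "(\<lambda>n. ent (lam (f n)) g k) = (\<lambda>n. jf (lam (f n)) (gmul g (ginverse k)))"
      by (simp add: ent_lam jf_lam f(1))
    then show ?thesis using True 1 2 LIMSEQ_unique by auto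
  next
    case False
    then have "(\<lambda>n. ent (lam (f n)) g k) = (\<lambda>n. 0)" by (auto simp: ent_lam f(1))
    then have "ent a g k = 0" using 1 by (simp add: LIMSEQ_const_iff)
    then show ?thesis using False by (simp only: if_False)
  qed
qed

lemma jf_adj: assumes "a \<in> CA" shows "jf (op_adj a) g = cnj (jf a (ginverse g))"
proof (cases "g \<in> \<Gamma>")
  case True
  have "gmul (unit_arrow (sg g)) (ginverse g) = ginverse g" by (rule arrow_eqI) (auto simp: gmul_def ginverse_def)
  moreover have "jf (op_adj a) g = cnj (ent a (unit_arrow (sg g)) g)"
    using True is_adj_ent[OF CA.is_adj_op_adj[OF assms] CA.clin_A[OF assms]] by (simp add: jf_def)
  ultimately show ?thesis using True by (simp add: ent_jf[OF assms])
qed (simp add: jf_off)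

lemma jf_adj_mult: assumes "a \<in> CA"
  shows "jf (op_adj a o\<^sub>L b) (unit_arrow x) = l2_cinner (blinfun_apply a (ket (unit_arrow x))) (blinfun_apply b (ket (unit_arrow x)))"
  using is_adj_cinner[OF CA.is_adj_op_adj[OF assms] CA.clin_A[OF assms]]
  by (simp add: jf_def ent_cinner)

lemma ent_unit: assumes "a \<in> CA" shows "ent a g (unit_arrow x) = (if sg g = x then jf a g else 0)"
  using assms by (auto simp: jf_def ent_jf)

text \<open>To identify an extension by continuity it suffices to have a candidate value that is
  approached at least as fast as \<open>a\<close>. The filter is proper because \<open>a\<close> is
  a limit of images of compactly supported functions.\<close>

lemma extend_Cc_eq:
  fixes F :: "('x arrow \<Rightarrow> complex) \<Rightarrow> 'b::metric_space"
  assumes a: "a \<in> CA" and K: "\<And>f. f \<in> CG \<Longrightarrow> dist (F f) l \<le> dist (lam f) a"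
  shows "extend_Cc (Gam \<phi>) F a = l"
  unfolding extend_Cc_def
proof (rule tendsto_Lim)
  let ?F = "inf (filtercomap lam (nhds a)) (principal CG)"
  obtain f where f: "\<And>n::nat. f n \<in> CG" "(\<lambda>n. lam (f n)) \<longlonglongrightarrow> a" by (rule CA_approx[OF a]) (rule that)
  show "?F \<noteq> bot"
  proof
    assume "?F = bot"
    then have "eventually (\<lambda>f. f \<notin> CG) (filtercomap lam (nhds a))"
      using eventually_inf_principal[of "\<lambda>f. False" "filtercomap lam (nhds a)" CG] by simp
    then obtain P where P: "eventually P (nhds a)" "\<And>f. P (lam f) \<Longrightarrow> f \<notin> CG" by (auto simp: eventually_filtercomap)
    have "eventually (\<lambda>n. P (lam (f n))) sequentially" using f(2) P(1) by (auto simp: filterlim_iff)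
    then obtain n where "P (lam (f n))" by (auto simp: eventually_sequentially)
    then show False using P(2) f(1) by blast
  qed
  show "(F \<longlongrightarrow> l) ?F"
  proof (rule tendstoI)
    fix e :: real assume "0 < e"
    then have "eventually (\<lambda>y. dist y a < e) (nhds a)" by (auto simp: eventually_nhds_metric)
    then have "eventually (\<lambda>f. dist (lam f) a < e) (filtercomap lam (nhds a))" by (rule eventually_filtercomapI)
    then show "eventually (\<lambda>f. dist (F f) l < e) ?F"
      unfolding eventually_inf_principal by (rule eventually_mono) (use K in force)
  qed
qed

lemma continuous_unit: "continuous_map euclidean T (\<lambda>x. unit_arrow x)"
proof -
  have u: "unit_arrow x \<in> Z 0 0 UNIV UNIV" for x by (simp add: Zset_iff)
  have "sg ` Z 0 0 UNIV UNIV = UNIV" using u by (metis UNIV_eq_I image_eqI snd_conv)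
  moreover have "sec (Z 0 0 UNIV UNIV) = (\<lambda>x. unit_arrow x)" using sec(1)[OF bisection_units u] by auto
  ultimately show ?thesis using continuous_sec[OF bisection_units] by simp
qed

lemma continuous_on_unit_CG: assumes "f \<in> CG" shows "continuous_on UNIV (\<lambda>x. f (unit_arrow x))"
proof -
  have "continuous_map T euclidean f" using assms by (simp add: CG_iff)
  from continuous_map_compose[OF continuous_unit this] show ?thesis by (simp add: o_def)
qed

lemma continuous_jf_unit: assumes "a \<in> CA" shows "continuous_on UNIV (\<lambda>x. jf a (unit_arrow x))"
proof -
  obtain f where f: "\<And>n::nat. f n \<in> CG" "(\<lambda>n. lam (f n)) \<longlonglongrightarrow> a" by (rule CA_approx[OF assms]) (rule that)
  have "uniform_limit UNIV (\<lambda>n x. f n (unit_arrow x)) (\<lambda>x. jf a (unit_arrow x)) sequentially"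
  proof (rule uniform_limitI)
    fix e :: real assume "0 < e"
    with f(2) have "\<forall>\<^sub>F n in sequentially. dist (lam (f n)) a < e" by (rule tendstoD)
    then show "\<forall>\<^sub>F n in sequentially. \<forall>x\<in>UNIV. dist (f n (unit_arrow x)) (jf a (unit_arrow x)) < e"
    proof (rule eventually_mono, intro ballI)
      fix n x assume "dist (lam (f n)) a < e"
      then show "dist (f n (unit_arrow x)) (jf a (unit_arrow x)) < e"
        using cmod_jf_le[of "lam (f n) - a" "unit_arrow x"] by (simp add: dist_norm jf_simps jf_lam f(1))
    qed
  qed
  then show ?thesis
    by (rule uniform_limit_theorem[rotated]) (auto simp: continuous_on_unit_CG f(1))
qed

lemma bcontfun_jf: "a \<in> CA \<Longrightarrow> (\<lambda>x. jf a (unit_arrow x)) \<in> bcontfun"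
  using cmod_jf_le continuous_jf_unit by (intro bcontfun_normI) auto

lemma cond_exp_eq: assumes "a \<in> CA" shows "apply_bcontfun (cond_exp (Gam \<phi>) a) x = jf a (unit_arrow x)"
proof -
  have "cond_exp (Gam \<phi>) a = Bcontfun (\<lambda>x. jf a (unit_arrow x))"
    unfolding cond_exp_def
  proof (rule extend_Cc_eq[OF assms])
    fix f assume f: "f \<in> CG"
    have b: "(\<lambda>x. f (unit_arrow x)) \<in> bcontfun" using bcontfun_jf[OF lam_CA[OF f]] by (simp add: jf_lam f)
    show "dist (Bcontfun (\<lambda>x. f (unit_at (Gam \<phi>) x))) (Bcontfun (\<lambda>x. jf a (unit_arrow x))) \<le> dist (lam f) a"
    proof (rule dist_bound)
      fix x
      show "dist (apply_bcontfun (Bcontfun (\<lambda>x. f (unit_at (Gam \<phi>) x))) x) (apply_bcontfun (Bcontfun (\<lambda>x. jf a (unit_arrow x))) x) \<le> dist (lam f) a"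
        using cmod_jf_le[of "lam f - a" "unit_arrow x"]
        by (simp add: Bcontfun_inverse b bcontfun_jf assms dist_norm jf_simps jf_lam f)
    qed
  qed
  then show ?thesis by (simp add: Bcontfun_inverse bcontfun_jf assms)
qed

end

lemma cmod_cis_diff_le: "cmod (cis a - cis b) \<le> \<bar>a - b\<bar>"
proof -
  have "cis a - cis b = cis b * (cis (a - b) - 1)" by (simp add: cis_mult algebra_simps)
  then have "cmod (cis a - cis b) = cmod (cis (a - b) - 1)" by (simp only: norm_mult norm_cis mult_1)
  also have "\<dots> = cmod (exp (\<i> * complex_of_real (a - b)) - 1)" by (simp only: cis_conv_exp)
  also have "\<dots> = 2 * \<bar>sin ((a - b) / 2)\<bar>" by (rule dist_exp_i_1)
  also have "\<dots> \<le> \<bar>a - b\<bar>" using abs_sin_x_le_abs_x[of "(a - b) / 2"] by simp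
  finally show ?thesis .
qed

section \<open>The one-parameter group of a cocycle\<close>

locale lh_cocycle = lh_space +
  fixes c :: "'a arrow \<Rightarrow> real"
  assumes cocycle: "continuous_hom (Gam \<phi>) c"
begin

lemma continuous_c: "continuous_map T euclideanreal c"
  and c_mult: "g \<in> \<Gamma> \<Longrightarrow> h \<in> \<Gamma> \<Longrightarrow> sg g = rg h \<Longrightarrow> c (gmul g h) = c g + c h"
  using cocycle by (auto simp: continuous_hom_def)

lemma c_unit [simp]: "c (unit_arrow x) = 0"
proof -
  have "gmul (unit_arrow x) (unit_arrow x) = unit_arrow x" by (rule arrow_eqI) (auto simp: gmul_def)
  then show ?thesis using c_mult[of "unit_arrow x" "unit_arrow x"] by simp
qed

lemma c_ginverse: "g \<in> \<Gamma> \<Longrightarrow> c (ginverse g) = - c g"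
proof -
  assume g: "g \<in> \<Gamma>"
  have "gmul g (ginverse g) = unit_arrow (rg g)" by (rule arrow_eqI) (auto simp: gmul_def ginverse_def)
  then show ?thesis using c_mult[of g "ginverse g"] g by simp
qed

text \<open>The spatial form of the action makes sense for every operator, so the algebraic laws
  hold without passing to limits; on the algebra it agrees with \<open>dyn\<close>.\<close>

definition act :: "real \<Rightarrow> 'a arrow l2op \<Rightarrow> 'a arrow l2op" where
  "act t a = phase (\<lambda>g. t * c g) o\<^sub>L (a o\<^sub>L phase (\<lambda>g. - (t * c g)))"

lemma ent_act: "clin a \<Longrightarrow> ent (act t a) g k = cis (t * c g) * ent a g k * cis (- (t * c k))"
  by (simp add: act_def ent_def phase_apply phase_ket clin_def l2_rep)

lemma clin_act: "clin a \<Longrightarrow> clin (act t a)"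
  using clin_phase[of "\<lambda>g. t * c g"] clin_phase[of "\<lambda>g. - (t * c g)"] unfolding act_def clin_def by (simp add: op_apply)

lemma act_bounded: "norm (act t a) \<le> norm a"
proof -
  have "norm (act t a) \<le> norm (phase (\<lambda>g. t * c g)) * (norm a * norm (phase (\<lambda>g. - (t * c g))))"
    unfolding act_def by (intro order_trans[OF norm_blinfun_compose] mult_left_mono norm_blinfun_compose) auto
  also have "\<dots> \<le> 1 * (norm a * 1)" by (intro mult_mono norm_phase mult_nonneg_nonneg) auto
  finally show ?thesis by simp
qed

lemma act_linear: "act t (a + b) = act t a + act t b" "act t (a - b) = act t a - act t b" "act t (op_scale z a) = op_scale z (act t a)"
  "act t (r *\<^sub>R a) = r *\<^sub>R act t a" "act t 0 = 0"
  using clin_phase[of "\<lambda>g. t * c g"]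
  by (auto intro!: blinfun_eqI simp: act_def op_apply clin_def)

lemma lam_act: assumes "f \<in> CG"
  shows "(\<lambda>g. cis (t * c g) * f g) \<in> CG" "act t (lam f) = lam (\<lambda>g. cis (t * c g) * f g)"
proof -
  have "continuous_map T euclidean (\<lambda>g. cis (t * c g))"
    using continuous_map_compose[OF continuous_c, of euclidean "\<lambda>x. cis (t * x)"]
    by (simp add: o_def continuous_intros)
  from CG_mult(1)[OF assms this] show CG: "(\<lambda>g. cis (t * c g) * f g) \<in> CG" .
  show "act t (lam f) = lam (\<lambda>g. cis (t * c g) * f g)"
  proof (rule op_eqI_ent)
    fix g k :: "'a arrow"
    have "cis (t * c g) * cis (- (t * c k)) = cis (t * c (gmul g (ginverse k)))" if "g \<in> \<Gamma>" "k \<in> \<Gamma>" "sg g = sg k"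
      using that by (simp add: c_mult c_ginverse cis_mult algebra_simps)
    then show "ent (act t (lam f)) g k = ent (lam (\<lambda>g. cis (t * c g) * f g)) g k"
      using assms CG by (auto simp: ent_act clin_lam ent_lam mult_ac)
  qed (use assms CG clin_lam clin_act in auto)
qed

lemma act_CA: assumes "a \<in> CA" shows "act t a \<in> CA"
proof -
  obtain f where f: "\<And>n::nat. f n \<in> CG" "(\<lambda>n. lam (f n)) \<longlonglongrightarrow> a" by (rule CA_approx[OF assms]) (rule that)
  show ?thesis
  proof (rule CA_I)
    show "(\<lambda>g. cis (t * c g) * f n g) \<in> CG" for n by (rule lam_act[OF f(1)])
    have "bounded_linear (act t)"
      by (rule bounded_linear_intro[of _ 1])
        (simp_all add: act_linear act_bounded)
    from bounded_linear.tendsto[OF this f(2)] show "(\<lambda>n. lam (\<lambda>g. cis (t * c g) * f n g)) \<longlonglongrightarrow> act t a"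
      by (simp add: lam_act f(1))
  qed
qed

lemma dyn_eq: assumes "a \<in> CA" shows "dyn (Gam \<phi>) c t a = act t a"
  unfolding dyn_def
proof (rule extend_Cc_eq[OF assms])
  fix f assume f: "f \<in> CG"
  show "dist (lam (\<lambda>g. cis (t * c g) * f g)) (act t a) \<le> dist (lam f) a"
    using act_bounded[of t "lam f - a"] by (simp add: lam_act(2)[OF f, symmetric] dist_norm act_linear)
qed

lemma jf_act: "a \<in> CA \<Longrightarrow> jf (act t a) g = cis (t * c g) * jf a g"
  by (simp add: jf_def ent_act CA.clin_A)

lemma act_compose: "act t (a o\<^sub>L b) = act t a o\<^sub>L act t b"
proof -
  have "phase (\<lambda>g. - (t * c g)) o\<^sub>L phase (\<lambda>g. t * c g) = id_blinfun" by (simp add: phase_compose phase_zero)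
  then have "blinfun_apply (phase (\<lambda>g. - (t * c g))) (blinfun_apply (phase (\<lambda>g. t * c g)) \<xi>) = \<xi>" for \<xi>
    by (metis blinfun_apply_blinfun_compose blinfun_apply_id_blinfun)
  then show ?thesis by (intro blinfun_eqI) (simp add: act_def op_apply)
qed

lemma act_is_adj: "is_adj a b \<Longrightarrow> is_adj (act t a) (act t b)"
proof -
  assume "is_adj a b"
  from is_adj_compose[OF is_adj_phase[of "\<lambda>g. t * c g"] is_adj_compose[OF this is_adj_phase[of "\<lambda>g. - (t * c g)"]]]
  show ?thesis by (simp add: act_def blinfun_compose_assoc)
qed

lemma act_group: "act s (act t a) = act (s + t) a" "act 0 a = a"
proof -
  have p: "blinfun_apply (phase u) (blinfun_apply (phase v) \<xi>) = blinfun_apply (phase (\<lambda>g. u g + v g)) \<xi>" for u v \<xi>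
    by (metis phase_compose blinfun_apply_blinfun_compose)
  show "act s (act t a) = act (s + t) a"
    by (rule blinfun_eqI) (simp add: act_def op_apply p algebra_simps)
  show "act 0 a = a" by (rule blinfun_eqI) (simp add: act_def op_apply phase_zero)
qed

text \<open>On each bisection the reduced norm is bounded by the supremum, and \<open>c\<close> is
  bounded on the compact support. Summing over a decomposition gives a Lipschitz constant for
  \<open>f\<close>.\<close>

lemma act_lipschitz: assumes "f \<in> CG" shows "\<exists>L\<ge>0. \<forall>s t. norm (act t (lam f) - act s (lam f)) \<le> L * \<bar>t - s\<bar>"
proof -
  obtain F :: "'a arrow set" and f' where F: "finite F" "f = (\<lambda>g. \<Sum>i\<in>F. f' i g)" "\<And>i. i \<in> F \<Longrightarrow> \<exists>W\<in>UNIV. bisection W \<and> supp_in (f' i) W"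
    by (rule Cc_decompose[OF assms bisection_exists]) (assumption, rule that)
  have C: "f' i \<in> CG" if "i \<in> F" for i using F(3)[OF that] supp_in_CG by blast
  have "\<exists>L\<ge>0. \<forall>s t. norm (act t (lam (f' i)) - act s (lam (f' i))) \<le> L * \<bar>t - s\<bar>" if i: "i \<in> F" for i
  proof -
    obtain W where W: "bisection W" "supp_in (f' i) W" using F(3)[OF i] by blast
    then obtain K where K: "compactin T K" "K \<subseteq> W" "\<And>g. g \<notin> K \<Longrightarrow> f' i g = 0" unfolding supp_in_def by blast
    obtain M where M: "0 \<le> M" "\<And>g. cmod (f' i g) \<le> M" by (rule CG_bounded[OF C[OF i]]) (rule that)
    have "bounded (c ` K)" by (intro compact_imp_bounded compact_image_T K continuous_c)
    then obtain B where B: "0 < B" "\<And>g. g \<in> K \<Longrightarrow> \<bar>c g\<bar> \<le> B" unfolding bounded_pos by (metis imageI real_norm_def)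
    have "norm (act t (lam (f' i)) - act s (lam (f' i))) \<le> B * M * \<bar>t - s\<bar>" for s t
    proof -
      let ?h = "\<lambda>g. cis (t * c g) * f' i g + (-1) * (cis (s * c g) * f' i g)"
      have CGs: "(\<lambda>g. cis (r * c g) * f' i g) \<in> CG" for r by (rule lam_act(1)[OF C[OF i]])
      have "op_scale (-1) a = - a" for a :: "'a arrow l2op"
        by (rule blinfun_eqI, rule l2_eqI) (simp add: op_apply l2_rep)
      then have eq: "act t (lam (f' i)) - act s (lam (f' i)) = lam ?h"
        using lam_simps(1)[OF CGs CG_scale[OF CGs], of t "-1" s] lam_simps(2)[OF CGs, of "-1" s]
        by (simp add: lam_act(2)[OF C[OF i]])
      have "supp_in ?h W"
        unfolding supp_in_def
      proof (intro conjI exI[of _ K] allI impI K)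
        show "continuous_map T euclidean ?h" using CG_add[OF CGs CG_scale[OF CGs], of t "-1" s] unfolding CG_iff by blast
        show "?h g = 0" if "g \<notin> K" for g using K(3)[OF that] by simp
      qed
      moreover have "cmod (?h g) \<le> B * M * \<bar>t - s\<bar>" for g
      proof (cases "g \<in> K")
        case True
        have "cmod (cis (t * c g) - cis (s * c g)) \<le> \<bar>t * c g - s * c g\<bar>"
          by (rule cmod_cis_diff_le)
        also have "\<dots> = \<bar>t - s\<bar> * \<bar>c g\<bar>" by (simp add: abs_mult[symmetric] algebra_simps)
        also have "\<dots> \<le> \<bar>t - s\<bar> * B" using B(2)[OF True] by (intro mult_left_mono) auto
        finally have "cmod (cis (t * c g) - cis (s * c g)) * cmod (f' i g) \<le> (\<bar>t - s\<bar> * B) * M"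
          using M B by (intro mult_mono) auto
        moreover have "?h g = (cis (t * c g) - cis (s * c g)) * f' i g" by (simp add: algebra_simps)
        ultimately show ?thesis by (simp only: norm_mult) (simp add: mult_ac)
      next
        case False
        then show ?thesis using K(3)[OF False] B M by simp
      qed
      ultimately show ?thesis unfolding eq using W(1) B M by (intro norm_lam_le) auto
    qed
    then show ?thesis using B M by (intro exI[of _ "B * M"]) auto
  qed
  then obtain L where L: "\<And>i. i \<in> F \<Longrightarrow> 0 \<le> L i \<and> (\<forall>s t. norm (act t (lam (f' i)) - act s (lam (f' i))) \<le> L i * \<bar>t - s\<bar>)"
    by metis
  have lf: "lam f = (\<Sum>i\<in>F. lam (f' i))" unfolding F(2) by (rule lam_sum[OF C])
  have as: "act t (\<Sum>i\<in>F. lam (f' i)) = (\<Sum>i\<in>F. act t (lam (f' i)))" for t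
  proof -
    have "act t (\<Sum>i\<in>J. lam (f' i)) = (\<Sum>i\<in>J. act t (lam (f' i)))" if "finite J" for J
      using that by induction (simp_all add: act_linear)
    then show ?thesis using F(1) .
  qed
  have "norm (act t (lam f) - act s (lam f)) \<le> (\<Sum>i\<in>F. L i) * \<bar>t - s\<bar>" for s t
    unfolding lf as sum_subtractf[symmetric] sum_distrib_right using L by (intro sum_norm_le) auto
  then show ?thesis using L by (intro exI[of _ "\<Sum>i\<in>F. L i"] conjI sum_nonneg) auto
qed

lemma act_continuous: assumes "a \<in> CA" shows "continuous_on UNIV (\<lambda>t. act t a)"
  unfolding continuous_on_iff
proof (intro ballI allI impI)
  fix s e :: real assume "0 < e"
  obtain f where f: "\<And>n::nat. f n \<in> CG" "(\<lambda>n. lam (f n)) \<longlonglongrightarrow> a" by (rule CA_approx[OF assms]) (rule that)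
  obtain n where n: "norm (lam (f n) - a) < e / 3" using LIMSEQ_D[OF f(2), of "e / 3"] \<open>0 < e\<close> by auto
  obtain L where L: "0 \<le> L" "\<And>s t. norm (act t (lam (f n)) - act s (lam (f n))) \<le> L * \<bar>t - s\<bar>" using act_lipschitz[OF f(1)] by blast
  have "dist (act t a) (act s a) < e" if "dist t s < e / (3 * (L + 1))" for t
  proof -
    have "norm (act t a - act s a) \<le> norm (act t (a - lam (f n))) + norm (act t (lam (f n)) - act s (lam (f n))) + norm (act s (lam (f n) - a))"
      unfolding act_linear by norm
    also have "\<dots> \<le> norm (a - lam (f n)) + L * \<bar>t - s\<bar> + norm (lam (f n) - a)"
      by (intro add_mono act_bounded L)
    also have "\<dots> < e / 3 + e / 3 + e / 3"
    proof -
      have "L * \<bar>t - s\<bar> \<le> (L + 1) * \<bar>t - s\<bar>" by (intro mult_right_mono) auto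
      also have "\<dots> < e / 3" using that L(1) by (simp add: dist_real_def field_simps)
      finally show ?thesis using n by (simp add: norm_minus_commute)
    qed
    finally show ?thesis by (simp add: dist_norm)
  qed
  then show "\<exists>d>0. \<forall>t\<in>UNIV. dist t s < d \<longrightarrow> dist (act t a) (act s a) < e"
    using \<open>0 < e\<close> L(1) by (intro exI[of _ "e / (3 * (L + 1))"]) auto
qed

lemma cstar_action_dyn: "cstar_action CA (dyn (Gam \<phi>) c)"
proof
  fix a b :: "'a arrow l2op" and s t z
  assume a: "a \<in> CA"
  show "dyn (Gam \<phi>) c t a \<in> CA" by (simp add: dyn_eq act_CA a)
  show "dyn (Gam \<phi>) c t (op_scale z a) = op_scale z (dyn (Gam \<phi>) c t a)" by (simp add: dyn_eq a CA.scale_A act_linear)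
  show "dyn (Gam \<phi>) c t (op_adj a) = op_adj (dyn (Gam \<phi>) c t a)"
    using CA.op_adj_eq[OF act_CA[OF a] act_is_adj[OF CA.is_adj_op_adj[OF a]]] by (simp add: dyn_eq a CA.op_adj_A)
  show "norm (dyn (Gam \<phi>) c t a) \<le> norm a" by (simp add: dyn_eq a act_bounded)
  show "dyn (Gam \<phi>) c s (dyn (Gam \<phi>) c t a) = dyn (Gam \<phi>) c (s + t) a" by (simp add: dyn_eq a act_CA act_group)
  show "dyn (Gam \<phi>) c 0 a = a" by (simp add: dyn_eq a act_group)
  show "continuous_on UNIV (\<lambda>t. dyn (Gam \<phi>) c t a)" using act_continuous[OF a] by (simp add: dyn_eq a)
  assume b: "b \<in> CA"
  show "dyn (Gam \<phi>) c t (a + b) = dyn (Gam \<phi>) c t a + dyn (Gam \<phi>) c t b" by (simp add: dyn_eq a b CA.add_A act_linear)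
  show "dyn (Gam \<phi>) c t (a o\<^sub>L b) = dyn (Gam \<phi>) c t a o\<^sub>L dyn (Gam \<phi>) c t b" by (simp add: dyn_eq a b CA.compose_A act_compose)
qed

end

section \<open>The Riesz representation theorem on locally compact second countable spaces\<close>

text \<open>Second countability provides countably many relatively compact base sets covering
  \<open>U\<close>, and finitely many of them cover a given compact set.\<close>

lemma exhausting_bumps:
  fixes U :: "'x::{t2_space, second_countable_topology} set"
  assumes lc: "locally_compact_space (euclidean :: 'x topology)" and U: "open U"
  obtains h :: "nat \<Rightarrow> 'x \<Rightarrow> real" and L where "\<And>n. continuous_on UNIV (h n)" "\<And>n x. 0 \<le> h n x" "\<And>n x. h n x \<le> 1"
    "\<And>n. compact (L n)" "\<And>n. L n \<subseteq> U" "\<And>n x. x \<notin> L n \<Longrightarrow> h n x = 0" "\<And>n x. h n x \<le> h (Suc n) x"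
    "\<And>K. compact K \<Longrightarrow> K \<subseteq> U \<Longrightarrow> \<exists>n. \<forall>m\<ge>n. \<forall>x\<in>K. h m x = 1"
proof -
  obtain \<B> :: "'x set set" where \<B>: "countable \<B>" "topological_basis \<B>" using ex_countable_basis by blast
  \<comment> \<open>The empty set is added so that the family can be enumerated even when nothing
    else qualifies.\<close>
  define \<C> where "\<C> = insert {} {B \<in> \<B>. \<exists>C. compact C \<and> B \<subseteq> C \<and> C \<subseteq> U}"
  have cC: "countable \<C>" "\<C> \<noteq> {}" using \<B>(1) by (auto simp: \<C>_def)
  have nb: "neighbourhood_base_of (compactin euclidean) (euclidean :: 'x topology)"
    using lc locally_compact_space_neighbourhood_base Hausdorff_euclidean_t2 by blast
  have UC: "U \<subseteq> \<Union>\<C>"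
  proof
    fix x assume "x \<in> U"
    then obtain O' C where OC: "open O'" "compact C" "x \<in> O'" "O' \<subseteq> C" "C \<subseteq> U"
      using nb U unfolding neighbourhood_base_of by (auto simp: subset_iff) metis
    obtain B where "B \<in> \<B>" "x \<in> B" "B \<subseteq> O'" using topological_basisE[OF \<B>(2) OC(1,3)] .
    then have "B \<in> \<C>" using OC by (auto simp: \<C>_def)
    then show "x \<in> \<Union>\<C>" using \<open>x \<in> B\<close> by blast
  qed
  define B where "B = from_nat_into \<C>"
  have rB: "range B = \<C>" unfolding B_def by (rule range_from_nat_into[OF cC(2,1)])
  have "\<exists>C. compact C \<and> B n \<subseteq> C \<and> C \<subseteq> U" for n
  proof -
    have "B n \<in> \<C>" using rB by blast
    then show ?thesis by (auto simp: \<C>_def intro: exI[of _ "{}"])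
  qed
  then obtain C where C: "\<And>n. compact (C n) \<and> B n \<subseteq> C n \<and> C n \<subseteq> U" by metis
  have oB: "open (B n)" for n
  proof -
    have "B n \<in> \<C>" using rB by blast
    then show ?thesis using topological_basis_open[OF \<B>(2)] by (auto simp: \<C>_def)
  qed
  let ?P = "\<lambda>n v L. continuous_on UNIV v \<and> (\<forall>x. 0 \<le> v x) \<and> (\<forall>x. v x \<le> 1) \<and> (\<forall>x\<in>C n. v x = (1::real)) \<and> compact L \<and> L \<subseteq> U \<and> (\<forall>x. x \<notin> L \<longrightarrow> v x = 0)"
  have "\<exists>v L. ?P n v L" for n using bump_function[OF lc _ U, of "C n"] C[of n] by metis
  then have "\<forall>n. \<exists>v L. ?P n v L" by blast
  from choice[OF this] obtain v where "\<forall>n. \<exists>L. ?P n (v n) L" ..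
  from choice[OF this] obtain L where v: "\<And>n. continuous_on UNIV (v n)" "\<And>n x. 0 \<le> v n x" "\<And>n x. v n x \<le> 1"
    "\<And>n x. x \<in> C n \<Longrightarrow> v n x = (1::real)" "\<And>n. compact (L n)" "\<And>n. L n \<subseteq> U" "\<And>n x. x \<notin> L n \<Longrightarrow> v n x = 0" by blast
  \<comment> \<open>Running maxima make the sequence increasing and keep the value 1 once it is
    attained.\<close>
  define h where "h = rec_nat (v 0) (\<lambda>n g x. max (g x) (v (Suc n) x))"
  have h: "h 0 = v 0" "h (Suc n) = (\<lambda>x. max (h n x) (v (Suc n) x))" for n by (simp_all add: h_def)
  have vh: "k \<le> n \<Longrightarrow> v k x \<le> h n x" for n k x
    by (induction n) (auto simp: h le_Suc_eq intro: max.coboundedI1)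
  show thesis
  proof (rule that[of h "\<lambda>n. \<Union>k\<le>n. L k"])
    show "continuous_on UNIV (h n)" for n
    proof (induction n)
      case (Suc n)
      then show ?case unfolding h(2) by (intro continuous_intros v(1))
    qed (simp add: h v)
    show "0 \<le> h n x" "h n x \<le> 1" for n x by (induction n) (auto simp: h v le_max_iff_disj)
    show "compact (\<Union>k\<le>n. L k)" for n by (intro compact_UN v) auto
    show "(\<Union>k\<le>n. L k) \<subseteq> U" for n using v(6) by blast
    show "x \<notin> (\<Union>k\<le>n. L k) \<Longrightarrow> h n x = 0" for n x by (induction n) (auto simp: h v atMost_Suc)
    show "h n x \<le> h (Suc n) x" for n x by (simp add: h)
    fix K assume K: "compact K" "K \<subseteq> U"
    obtain F where F: "finite F" "K \<subseteq> (\<Union>n\<in>F. B n)"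
      by (rule compactE_image[OF K(1), of UNIV B]) (use oB rB UC K(2) in auto)
    obtain N where N: "\<And>n. n \<in> F \<Longrightarrow> n \<le> N" using F(1) by (metis finite_nat_set_iff_bounded_le)
    have "h m x = 1" if mx: "m \<ge> N" "x \<in> K" for m x
    proof -
      obtain n where n: "n \<in> F" "x \<in> B n" using F mx by blast
      then have "1 \<le> h m x" using vh[of n m x] v(4)[of x n] C[of n] N[of n] mx by auto
      moreover have "h m x \<le> 1" by (induction m) (auto simp: h v)
      ultimately show ?thesis by simp
    qed
    then show "\<exists>n. \<forall>m\<ge>n. \<forall>x\<in>K. h m x = 1" by blast
  qed
qed

section \<open>Construction of the Riesz measure\<close>

definition Cpos :: "('x::topological_space \<Rightarrow> real) set" where
  "Cpos = {f. continuous_on UNIV f \<and> (\<forall>x. 0 \<le> f x) \<and> (\<exists>K. compact K \<and> (\<forall>x. x \<notin> K \<longrightarrow> f x = 0))}"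

text \<open>The functional is given on nonnegative functions only. This matches a weight, which is
  defined on the positive cone, and spares a linear extension.\<close>

locale positive_functional =
  fixes \<Lambda> :: "('x::{t2_space, second_countable_topology} \<Rightarrow> real) \<Rightarrow> real"
  assumes lc: "locally_compact_space (euclidean :: 'x topology)"
    and nonneg: "f \<in> Cpos \<Longrightarrow> 0 \<le> \<Lambda> f"
    and add: "f \<in> Cpos \<Longrightarrow> g \<in> Cpos \<Longrightarrow> \<Lambda> (\<lambda>x. f x + g x) = \<Lambda> f + \<Lambda> g"
    and scale: "f \<in> Cpos \<Longrightarrow> 0 \<le> r \<Longrightarrow> \<Lambda> (\<lambda>x. r * f x) = r * \<Lambda> f"
begin

lemma Cpos_ops: "(\<lambda>x. 0) \<in> Cpos" "f \<in> Cpos \<Longrightarrow> g \<in> Cpos \<Longrightarrow> (\<lambda>x. f x + g x) \<in> Cpos"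
  "f \<in> Cpos \<Longrightarrow> 0 \<le> r \<Longrightarrow> (\<lambda>x. r * f x) \<in> Cpos"
proof -
  show "(\<lambda>x. 0) \<in> Cpos" by (auto simp: Cpos_def intro: exI[of _ "{}"])
  show "f \<in> Cpos \<Longrightarrow> 0 \<le> r \<Longrightarrow> (\<lambda>x. r * f x) \<in> Cpos" by (auto simp: Cpos_def intro!: continuous_intros)
  assume "f \<in> Cpos" "g \<in> Cpos"
  then obtain K K' where "continuous_on UNIV f" "continuous_on UNIV g" "\<And>x. 0 \<le> f x" "\<And>x. 0 \<le> g x"
    "compact K" "compact K'" "\<And>x. x \<notin> K \<Longrightarrow> f x = 0" "\<And>x. x \<notin> K' \<Longrightarrow> g x = 0" by (auto simp: Cpos_def)
  then show "(\<lambda>x. f x + g x) \<in> Cpos" unfolding Cpos_def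
    by (intro CollectI conjI continuous_intros allI add_nonneg_nonneg exI[of _ "K \<union> K'"] compact_Un) auto
qed

lemma Cpos_le: "f \<in> Cpos \<Longrightarrow> continuous_on UNIV g \<Longrightarrow> (\<And>x. 0 \<le> g x) \<Longrightarrow> (\<And>x. g x \<le> f x) \<Longrightarrow> g \<in> Cpos"
  unfolding Cpos_def by (auto intro: antisym) (metis antisym)

lemma mono: assumes "f \<in> Cpos" "g \<in> Cpos" "\<And>x. g x \<le> f x" shows "\<Lambda> g \<le> \<Lambda> f"
proof -
  have "(\<lambda>x. f x - g x) \<in> Cpos"
    by (rule Cpos_le[OF assms(1)]) (use assms in \<open>auto simp: Cpos_def intro!: continuous_intros\<close>)
  from add[OF this assms(2)] nonneg[OF this] show ?thesis by simp
qed

lemma Cpos_sum: "(\<And>i. i \<in> I \<Longrightarrow> f i \<in> Cpos) \<Longrightarrow> (\<lambda>x. \<Sum>i\<in>I. f i x) \<in> Cpos"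
  by (induction I rule: infinite_finite_induct) (auto simp: Cpos_ops)

lemma sum: "(\<And>i. i \<in> I \<Longrightarrow> f i \<in> Cpos) \<Longrightarrow> \<Lambda> (\<lambda>x. \<Sum>i\<in>I. f i x) = (\<Sum>i\<in>I. \<Lambda> (f i))"
  using scale[OF Cpos_ops(1), of 0] by (induction I rule: infinite_finite_induct) (auto simp: Cpos_sum add)

definition below :: "('x \<Rightarrow> real) \<Rightarrow> 'x set \<Rightarrow> bool" where
  "below f U \<longleftrightarrow> f \<in> Cpos \<and> (\<forall>x. f x \<le> 1) \<and> (\<exists>K. compact K \<and> K \<subseteq> U \<and> (\<forall>x. x \<notin> K \<longrightarrow> f x = 0))"

text \<open>A content meant for open sets; outer regularity is then built into
  \<open>outer\<close>.\<close>

definition \<mu> :: "'x set \<Rightarrow> ennreal" where "\<mu> U = (SUP f\<in>{f. below f U}. ennreal (\<Lambda> f))"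
definition outer :: "'x set \<Rightarrow> ennreal" where "outer E = (INF U\<in>{U. open U \<and> E \<subseteq> U}. \<mu> U)"

lemma below_zero: "below (\<lambda>x. 0) U" by (auto simp: below_def Cpos_ops)
lemma below_mono: "below f U \<Longrightarrow> U \<subseteq> V \<Longrightarrow> below f V" unfolding below_def by blast
lemma \<mu>_upper: "below f U \<Longrightarrow> ennreal (\<Lambda> f) \<le> \<mu> U" unfolding \<mu>_def by (auto intro: SUP_upper)
lemma \<mu>_mono: "U \<subseteq> V \<Longrightarrow> \<mu> U \<le> \<mu> V" unfolding \<mu>_def by (rule SUP_subset_mono) (auto intro: below_mono)
lemma \<mu>_least: "(\<And>f. below f U \<Longrightarrow> ennreal (\<Lambda> f) \<le> b) \<Longrightarrow> \<mu> U \<le> b" unfolding \<mu>_def by (auto intro: SUP_least)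
lemma outer_open: "open U \<Longrightarrow> outer U = \<mu> U"
  unfolding outer_def by (intro antisym INF_lower INF_greatest) (auto intro: \<mu>_mono)
lemma outer_le: "open U \<Longrightarrow> E \<subseteq> U \<Longrightarrow> outer E \<le> \<mu> U" unfolding outer_def by (auto intro: INF_lower)
lemma outer_mono: "E \<subseteq> E' \<Longrightarrow> outer E \<le> outer E'" unfolding outer_def by (rule INF_superset_mono) auto

text \<open>A function carried by a compact subset of the union is split by a finite partition of
  unity into functions, each below one of the open sets.\<close>

lemma \<mu>_UN: fixes U :: "nat \<Rightarrow> 'x set" assumes U: "\<And>n. open (U n)" shows "\<mu> (\<Union>n. U n) \<le> (\<Sum>n. \<mu> (U n))"
proof (rule \<mu>_least)
  fix f assume f: "below f (\<Union>n. U n)"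
  then obtain K where K: "compact K" "K \<subseteq> (\<Union>n. U n)" "\<And>x. x \<notin> K \<Longrightarrow> f x = 0" and fC: "f \<in> Cpos" and f1: "\<And>x. f x \<le> 1"
    by (auto simp: below_def)
  have f0: "0 \<le> f x" and fc: "continuous_on UNIV f" for x using fC by (auto simp: Cpos_def)
  let ?P = "\<lambda>x n q C. continuous_on UNIV q \<and> (\<forall>y. 0 \<le> q y) \<and> q x = (1::real) \<and> compact C \<and> C \<subseteq> U n \<and> (\<forall>y. y \<notin> C \<longrightarrow> q y = 0)"
  have "\<forall>x\<in>K. \<exists>n q C. ?P x n q C"
  proof
    fix x assume "x \<in> K"
    then obtain n where n: "{x} \<subseteq> U n" using K(2) by blast
    obtain v :: "'x \<Rightarrow> real" and L where "continuous_on UNIV v" "\<And>x. 0 \<le> v x" "\<And>x. v x \<le> 1" "\<And>y. y \<in> {x} \<Longrightarrow> v y = 1"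
      "compact L" "L \<subseteq> U n" "\<And>x. x \<notin> L \<Longrightarrow> v x = 0" by (rule bump_function[OF lc compact_sing U n]) (rule that)
    then show "\<exists>n q C. ?P x n q C" by (intro exI[of _ n] exI[of _ v] exI[of _ L]) auto
  qed
  from bchoice[OF this] obtain N where "\<forall>x\<in>K. \<exists>q C. ?P x (N x) q C" ..
  from bchoice[OF this] obtain q where "\<forall>x\<in>K. \<exists>C. ?P x (N x) (q x) C" ..
  from bchoice[OF this] obtain C where "\<forall>x\<in>K. ?P x (N x) (q x) (C x)" ..
  then have q: "\<And>x. x \<in> K \<Longrightarrow> continuous_on UNIV (q x)" "\<And>x y. x \<in> K \<Longrightarrow> 0 \<le> q x y" "\<And>x. x \<in> K \<Longrightarrow> q x x = 1"
    "\<And>x. x \<in> K \<Longrightarrow> compact (C x)" "\<And>x. x \<in> K \<Longrightarrow> C x \<subseteq> U (N x)" "\<And>x y. x \<in> K \<Longrightarrow> y \<notin> C x \<Longrightarrow> q x y = 0" by blast+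
  have "open {y. 0 < q x y}" if "x \<in> K" for x
    using open_vimage[OF open_greaterThan q(1)[OF that], of 0] by (simp add: vimage_def)
  then obtain F where F: "F \<subseteq> K" "finite F" "K \<subseteq> (\<Union>x\<in>F. {y. 0 < q x y})"
    by (rule_tac compactE_image[OF K(1), of K "\<lambda>x. {y. 0 < q x y}"]) (use q(3) in force)+
  define Q where "Q y = (\<Sum>x\<in>F. q x y)" for y
  have Qpos: "0 < Q y" if y: "y \<in> K" for y
  proof -
    obtain x where x: "x \<in> F" "0 < q x y" using F(3) y by blast
    have "q x y \<le> Q y" unfolding Q_def by (rule member_le_sum) (use x q(2) F in auto)
    then show ?thesis using x by linarith
  qed
  have Q0: "0 \<le> Q y" for y unfolding Q_def using F q(2) by (intro sum_nonneg) auto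
  have Qc: "continuous_on UNIV Q" unfolding Q_def using F q(1) by (intro continuous_intros) auto
  define fx where "fx x y = f y * (q x y / Q y)" for x y
  have fxle: "0 \<le> fx x y" "fx x y \<le> f y" if "x \<in> F" for x y
  proof -
    have "q x y \<le> Q y" "0 \<le> q x y" unfolding Q_def using that q(2) F by (auto intro!: member_le_sum)
    then have "0 \<le> q x y / Q y" "q x y / Q y \<le> 1" using Q0[of y] by (auto simp: divide_le_eq_1)
    then show "0 \<le> fx x y" "fx x y \<le> f y" unfolding fx_def using f0[of y] by (auto intro: mult_nonneg_nonneg mult_left_le simp del: times_divide_eq_right)
  qed
  have fxc: "continuous_on UNIV (fx x)" if "x \<in> F" for x
  proof -
    have o: "open {y. 0 < Q y}" using open_vimage[OF open_greaterThan Qc, of 0] by (simp add: vimage_def)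
    have cK: "open (- K)" using compact_imp_closed[OF K(1)] by (simp add: open_Compl)
    have 1: "continuous_on {y. 0 < Q y} (fx x)" unfolding fx_def
      using that F q(1) by (intro continuous_intros continuous_on_subset[OF fc] continuous_on_subset[OF Qc] continuous_on_subset[OF q(1)]) auto
    have 2: "continuous_on (- K) (fx x)"
      by (rule continuous_on_eq[OF continuous_on_const[of _ 0]]) (use K(3) in \<open>auto simp: fx_def\<close>)
    have "{y. 0 < Q y} \<union> - K = UNIV" using Qpos by auto
    then show ?thesis using continuous_on_open_Un[OF o cK 1 2] by simp
  qed
  have fxC: "fx x \<in> Cpos" if "x \<in> F" for x
    by (rule Cpos_le[OF fC fxc[OF that]]) (use fxle that in auto)
  \<comment> \<open>All pieces assigned to the same \<open>U n\<close> are collected, so that each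
    open set is charged once.\<close>
  define g where "g n y = (\<Sum>x\<in>{x\<in>F. N x = n}. fx x y)" for n y
  have gC: "g n \<in> Cpos" for n unfolding g_def by (rule Cpos_sum) (use fxC in auto)
  have fsum: "f y = (\<Sum>x\<in>F. fx x y)" for y
  proof -
    have "(\<Sum>x\<in>F. fx x y) = f y * (Q y / Q y)" by (simp add: fx_def Q_def sum_distrib_left[symmetric] sum_divide_distrib[symmetric])
    then show ?thesis using Qpos[of y] K(3)[of y] by (cases "y \<in> K") auto
  qed
  have gle: "g n y \<le> 1" for n y
  proof -
    have "g n y \<le> (\<Sum>x\<in>F. fx x y)" unfolding g_def by (rule sum_mono2) (use F fxle in auto)
    then show ?thesis using f1[of y] fsum[of y] by simp
  qed
  have gb: "below (g n) (U n)" for n unfolding below_def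
  proof (intro conjI allI gC gle exI[of _ "\<Union>x\<in>{x\<in>F. N x = n}. C x"])
    show "compact (\<Union>x\<in>{x\<in>F. N x = n}. C x)" by (intro compact_UN) (use F q in auto)
    show "(\<Union>x\<in>{x\<in>F. N x = n}. C x) \<subseteq> U n" using F q(5) by blast
    show "y \<notin> (\<Union>x\<in>{x\<in>F. N x = n}. C x) \<longrightarrow> g n y = 0" for y
      using F q(6) by (auto simp: g_def fx_def subset_iff intro!: sum.neutral)
  qed
  have "f = (\<lambda>y. \<Sum>n\<in>N ` F. g n y)"
    using F(2) by (auto simp: fsum g_def sum.image_gen[of F _ N])
  then have "\<Lambda> f = (\<Sum>n\<in>N ` F. \<Lambda> (g n))" using sum[of "N ` F" g] gC by simp
  then have "ennreal (\<Lambda> f) = (\<Sum>n\<in>N ` F. ennreal (\<Lambda> (g n)))" using nonneg[OF gC] by (simp add: sum_ennreal)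
  also have "\<dots> \<le> (\<Sum>n\<in>N ` F. \<mu> (U n))" by (intro sum_mono \<mu>_upper gb)
  also have "\<dots> \<le> (\<Sum>n. \<mu> (U n))" by (rule sum_le_suminf) (use F in auto)
  finally show "ennreal (\<Lambda> f) \<le> (\<Sum>n. \<mu> (U n))" .
qed

lemma outer_UN: fixes E :: "nat \<Rightarrow> 'x set" shows "outer (\<Union>n. E n) \<le> (\<Sum>n. outer (E n))"
proof (cases "(\<Sum>n. outer (E n)) = \<infinity>")
  case False
  show ?thesis
  proof (rule ennreal_le_epsilon)
    fix e :: real assume e: "0 < e"
    have fin: "outer (E n) \<noteq> \<infinity>" for n
    proof
      assume "outer (E n) = \<infinity>"
      then have "\<infinity> \<le> (\<Sum>n. outer (E n))" using sum_le_suminf[of "\<lambda>n. outer (E n)" "{n}"] by simp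
      then show False using False by (simp add: top_unique)
    qed
    have "\<exists>U. open U \<and> E n \<subseteq> U \<and> \<mu> U \<le> outer (E n) + ennreal (e * (1/2) ^ Suc n)" for n
    proof -
      have "\<exists>U\<in>{U. open U \<and> E n \<subseteq> U}. \<mu> U < outer (E n) + ennreal (e * (1/2) ^ Suc n)"
        by (rule INF_approx_ennreal) (use fin e in \<open>auto simp: outer_def\<close>)
      then show ?thesis by (auto simp: less_imp_le)
    qed
    then obtain U where U: "\<And>n. open (U n)" "\<And>n. E n \<subseteq> U n" "\<And>n. \<mu> (U n) \<le> outer (E n) + ennreal (e * (1/2) ^ Suc n)" by metis
    have "outer (\<Union>n. E n) \<le> \<mu> (\<Union>n. U n)" by (rule outer_le) (use U in auto)
    also have "\<dots> \<le> (\<Sum>n. \<mu> (U n))" by (rule \<mu>_UN[OF U(1)])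
    also have "\<dots> \<le> (\<Sum>n. outer (E n) + ennreal (e * (1/2) ^ Suc n))" by (intro suminf_le U summableI)
    also have "\<dots> = (\<Sum>n. outer (E n)) + (\<Sum>n. ennreal (e * (1/2) ^ Suc n))" by (intro suminf_add[symmetric] summableI)
    also have "(\<Sum>n. ennreal (e * (1/2) ^ Suc n)) = ennreal e"
    proof -
      have "(\<lambda>n. e * (1/2) ^ Suc n) sums (e * 1)" by (intro sums_mult power_half_series)
      then show ?thesis using e by (intro suminf_ennreal_eq) auto
    qed
    finally show "outer (\<Union>n. E n) \<le> (\<Sum>n. outer (E n)) + ennreal e" .
  qed
qed simp

text \<open>If \<open>f\<close> lives in a compact \<open>K\<close> inside
  \<open>V \<inter> U\<close> and \<open>g\<close> in a compact subset of \<open>V - K\<close>, then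
  \<open>f + g\<close> is still at most 1 and lies below \<open>V\<close>. The open set
  \<open>V - K\<close> covers \<open>V - U\<close>, so suprema over \<open>g\<close> and then over
  \<open>f\<close> give the inequality.\<close>

lemma outer_open_split: assumes "open U" shows "outer (E \<inter> U) + outer (E - U) \<le> outer E"
proof -
  have "outer (E \<inter> U) + outer (E - U) \<le> \<mu> V" if V: "open V" "E \<subseteq> V" for V
  proof -
    have "outer (E \<inter> U) + outer (E - U) \<le> \<mu> (V \<inter> U) + outer (V - U)"
      using V assms by (intro add_mono outer_le outer_mono) auto
    also have "\<dots> = (SUP f\<in>{f. below f (V \<inter> U)}. ennreal (\<Lambda> f) + outer (V - U))"
      unfolding \<mu>_def using below_zero[of "V \<inter> U"] by (intro ennreal_SUP_add_left[symmetric]) blast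
    also have "\<dots> \<le> \<mu> V"
    proof (rule SUP_least)
      fix f assume "f \<in> {f. below f (V \<inter> U)}"
      then obtain K where f: "below f (V \<inter> U)" and K: "compact K" "K \<subseteq> V \<inter> U" "\<And>x. x \<notin> K \<Longrightarrow> f x = 0" by (auto simp: below_def)
      have oVK: "open (V - K)" using V(1) compact_imp_closed[OF K(1)] by (rule open_Diff)
      have "ennreal (\<Lambda> f) + outer (V - U) \<le> ennreal (\<Lambda> f) + \<mu> (V - K)"
        using K by (intro add_left_mono outer_le oVK) auto
      also have "\<dots> = (SUP g\<in>{g. below g (V - K)}. ennreal (\<Lambda> f) + ennreal (\<Lambda> g))"
        unfolding \<mu>_def using below_zero[of "V - K"] by (subst ennreal_SUP_add_right) auto
      also have "\<dots> \<le> \<mu> V"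
      proof (rule SUP_least)
        fix g assume "g \<in> {g. below g (V - K)}"
        then obtain K' where g: "below g (V - K)" and K': "compact K'" "K' \<subseteq> V - K" "\<And>x. x \<notin> K' \<Longrightarrow> g x = 0" by (auto simp: below_def)
        have fg: "f \<in> Cpos" "g \<in> Cpos" "\<And>x. f x \<le> 1" "\<And>x. g x \<le> 1" using f g by (auto simp: below_def)
        have "below (\<lambda>x. f x + g x) V" unfolding below_def
        proof (intro conjI allI Cpos_ops fg exI[of _ "K \<union> K'"] impI)
          show "f x + g x \<le> 1" for x
            using fg(3)[of x] fg(4)[of x] K(3)[of x] K'(2) K'(3)[of x] by (cases "x \<in> K"; cases "x \<in> K'") auto
          show "compact (K \<union> K')" by (intro compact_Un K K')
        qed (use K K' in auto)
        from \<mu>_upper[OF this] show "ennreal (\<Lambda> f) + ennreal (\<Lambda> g) \<le> \<mu> V"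
          using add[OF fg(1,2)] nonneg[OF fg(1)] nonneg[OF fg(2)] by (simp add: ennreal_plus)
      qed
      finally show "ennreal (\<Lambda> f) + outer (V - U) \<le> \<mu> V" .
    qed
    finally show ?thesis .
  qed
  then show ?thesis unfolding outer_def[of E] by (auto intro: INF_greatest)
qed

definition riesz :: "'x measure" where "riesz = measure_of UNIV (sets borel) outer"

lemma sets_riesz: "sets riesz = sets borel"
  by (simp add: riesz_def) (metis sets.sigma_sets_eq space_borel)

text \<open>Caratheodory's construction: open sets split every set, so the Borel sets lie in the
  lambda system, where \<open>outer\<close> is countably additive.\<close>

lemma emeasure_riesz: assumes "B \<in> sets borel" shows "emeasure riesz B = outer B"
proof -
  have "outer {} = 0"
  proof -
    have "\<mu> {} \<le> 0"
    proof (rule \<mu>_least)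
      fix f assume "below f {}"
      then have "f = (\<lambda>x. 0)" by (auto simp: below_def)
      then show "ennreal (\<Lambda> f) \<le> 0" using scale[OF Cpos_ops(1), of 0] by simp
    qed
    then show ?thesis using outer_open[of "{}"] by simp
  qed
  then have oms: "outer_measure_space (Pow UNIV) outer"
    unfolding outer_measure_space_def positive_def increasing_def countably_subadditive_def
    using outer_UN outer_mono by auto
  interpret P: sigma_algebra UNIV "Pow UNIV :: 'x set set" by (rule sigma_algebra_Pow)
  define L where "L = lambda_system UNIV (Pow UNIV) outer"
  have ms: "measure_space UNIV L outer" unfolding L_def by (rule P.caratheodory_lemma[OF oms])
  have "U \<in> L" if U: "open U" for U
    unfolding L_def lambda_system_def
  proof (clarsimp simp: Compl_eq_Diff_UNIV[symmetric])
    fix E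
    have "outer E \<le> outer (U \<inter> E) + outer (- U \<inter> E)"
    proof -
      \<comment> \<open>Subadditivity for two sets is the countable version applied to a sequence
        padded with empty sets.\<close>
      have "outer (\<Union>n. (\<lambda>n. if n = 0 then U \<inter> E else if n = 1 then - U \<inter> E else {}) (n::nat)) \<le>
          (\<Sum>n. outer (if n = 0 then U \<inter> E else if n = 1 then - U \<inter> E else {}))" by (rule outer_UN)
      also have "\<dots> = (\<Sum>n\<in>{0,1::nat}. outer (if n = 0 then U \<inter> E else if n = 1 then - U \<inter> E else {}))"
        by (rule suminf_finite) (auto simp: \<open>outer {} = 0\<close>)
      finally have "outer (\<Union>n. (\<lambda>n. if n = 0 then U \<inter> E else if n = 1 then - U \<inter> E else {}) (n::nat)) \<le> outer (U \<inter> E) + outer (- U \<inter> E)"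
        by simp
      moreover have "E \<subseteq> (\<Union>n. (\<lambda>n. if n = 0 then U \<inter> E else if n = 1 then - U \<inter> E else {}) (n::nat))"
      proof
        fix x assume "x \<in> E"
        then show "x \<in> (\<Union>n. (\<lambda>n. if n = 0 then U \<inter> E else if n = 1 then - U \<inter> E else {}) (n::nat))"
          by (cases "x \<in> U") (auto intro: UN_I[of 0] UN_I[of 1])
      qed
      ultimately show ?thesis using order_trans[OF outer_mono] by blast
    qed
    moreover have "outer (U \<inter> E) + outer (- U \<inter> E) \<le> outer E"
      using outer_open_split[OF U, of E] by (simp add: Int_commute Diff_eq)
    ultimately show "outer (U \<inter> E) + outer (- U \<inter> E) = outer E" by simp
  qed
  moreover have "sigma_algebra UNIV L" using ms by (simp add: measure_space_def)
  ultimately have "sigma_sets UNIV {U. open U} \<subseteq> L"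
    by (intro sigma_algebra.sigma_sets_subset) blast+
  then have sub: "sets borel \<subseteq> L" by (simp add: borel_def)
  show ?thesis
  proof (rule emeasure_measure_of[OF riesz_def])
    show "positive (sets riesz) outer" using \<open>outer {} = 0\<close> by (simp add: positive_def)
    show "countably_additive (sets riesz) outer"
    proof -
      have "countably_additive L outer" using ms by (simp add: measure_space_def)
      moreover have "sets riesz \<subseteq> L" using sub sets_riesz by simp
      ultimately show ?thesis unfolding countably_additive_def using order_trans[of _ "sets riesz" L] subsetD[of "sets riesz" L] by simp
    qed
  qed (use assms in \<open>auto simp: sets_riesz\<close>)
qed

lemma \<mu>_le_of_ge_1:
  assumes f: "f \<in> Cpos" "\<And>x. x \<in> U \<Longrightarrow> 1 \<le> f x" shows "\<mu> U \<le> ennreal (\<Lambda> f)"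
proof (rule \<mu>_least, rule ennreal_leI, rule mono[OF f(1)])
  fix u x assume u: "below u U"
  then show "u \<in> Cpos" by (simp add: below_def)
  show "u x \<le> f x" using u f by (cases "x \<in> U") (auto simp: below_def Cpos_def intro: order_trans)
qed

lemma compact_finite_nbhd: assumes "compact K" obtains U where "open U" "K \<subseteq> U" "\<mu> U < \<infinity>"
proof -
  obtain v :: "'x \<Rightarrow> real" and L where v: "continuous_on UNIV v" "\<And>x. 0 \<le> v x" "\<And>x. v x \<le> 1" "\<And>x. x \<in> K \<Longrightarrow> v x = 1"
    "compact L" "L \<subseteq> UNIV" "\<And>x. x \<notin> L \<Longrightarrow> v x = 0" by (rule bump_function[OF lc assms open_UNIV subset_UNIV]) (rule that)
  have vC: "v \<in> Cpos" using v by (auto simp: Cpos_def)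
  have "\<mu> {x. 1/2 < v x} \<le> ennreal (\<Lambda> (\<lambda>x. 2 * v x))" by (rule \<mu>_le_of_ge_1) (auto intro: Cpos_ops vC)
  then have "\<mu> {x. 1/2 < v x} < \<infinity>" by (simp add: order.strict_trans1)
  moreover have "open {x. 1/2 < v x}" using open_vimage[OF open_greaterThan v(1), of "1/2"] by (simp add: vimage_def)
  ultimately show thesis using that v(4) by force
qed

text \<open>Both \<open>\<Lambda>\<close> and the integral are compared on the slices \<open>min 1 (max 0 (n f - k))\<close> of \<open>n f\<close>.\<close>

lemma integral_riesz: assumes f: "f \<in> Cpos" shows "(\<integral>\<^sup>+x. ennreal (f x) \<partial>riesz) = ennreal (\<Lambda> f)"
proof -
  obtain K where K: "compact K" "\<And>x. x \<notin> K \<Longrightarrow> f x = 0" and fc: "continuous_on UNIV f" and f0: "\<And>x. 0 \<le> f x"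
    using f by (auto simp: Cpos_def)
  obtain V where V: "open V" "K \<subseteq> V" "\<mu> V < \<infinity>" using compact_finite_nbhd[OF K(1)] .
  obtain M where M: "\<And>x. f x \<le> real M"
  proof -
    have "bounded (f ` K)" by (intro compact_imp_bounded compact_continuous_image continuous_on_subset[OF fc] K) auto
    then obtain B where "\<And>x. x \<in> K \<Longrightarrow> f x \<le> B" unfolding bounded_iff by (metis abs_le_iff imageI real_norm_def)
    moreover obtain M where "B \<le> real M" using real_arch_simple by blast
    ultimately have "f x \<le> real M" for x using K(2)[of x] by (cases "x \<in> K") force+
    then show thesis by (rule that)
  qed
  have fm: "f \<in> borel_measurable riesz" by (simp add: measurable_cong_sets[OF sets_riesz refl] borel_measurable_continuous_onI fc)
  define I where "I = (\<integral>\<^sup>+x. ennreal (f x) \<partial>riesz)"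
  \<comment> \<open>The errors do not depend on \<open>n\<close>, so they disappear after division
    by \<open>n\<close>.\<close>
  have main: "of_nat n * ennreal (\<Lambda> f) \<le> 2 * \<mu> V + of_nat n * I \<and> of_nat n * I \<le> \<mu> V + of_nat n * ennreal (\<Lambda> f)" if n: "n > 0" for n
  proof -
    define g where "g k x = min 1 (max 0 (real n * f x - real k))" for k x
    have gC: "g k \<in> Cpos" for k
    proof (rule Cpos_le[OF Cpos_ops(3)[OF f, of "real n"]])
      show "g k x \<le> real n * f x" for x using mult_nonneg_nonneg[of "real n" "f x"] f0[of x] by (simp add: g_def min_def max_def)
    qed (auto simp: g_def intro!: continuous_intros fc)
    have g1: "g k x \<le> 1" "0 \<le> g k x" for k x by (auto simp: g_def)
    have op: "open {x. real k < real n * f x}" for k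
      using open_vimage[OF open_greaterThan, of "\<lambda>x. real n * f x" "real k"] fc by (simp add: vimage_def continuous_intros)
    define a where "a k = \<mu> {x. real k < real n * f x}" for k
    define N where "N = n * M"
    \<comment> \<open>Each slice takes the part of \<open>n f\<close> between \<open>k\<close> and
      \<open>k + 1\<close>, and \<open>N = n * M\<close> slices exhaust the function.\<close>
    have sumg: "(\<Sum>k<N. g k x) = real n * f x" for x
    proof -
      have "(\<Sum>k<m. g k x) = min (real m) (real n * f x)" for m
        using f0[of x] by (induction m) (auto simp: g_def min_def max_def split: if_splits)
      moreover have "real n * f x \<le> real N" using M[of x] by (simp add: N_def mult_left_mono)
      ultimately show ?thesis by simp
    qed
    have b1: "a (Suc k) \<le> ennreal (\<Lambda> (g k))" for k unfolding a_def
      by (rule \<mu>_le_of_ge_1[OF gC]) (auto simp: g_def)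
    have b2: "ennreal (\<Lambda> (g (Suc k))) \<le> a k" for k unfolding a_def
    proof (rule \<mu>_upper)
      have "compact (K \<inter> {x. real (Suc k) \<le> real n * f x})"
        by (intro compact_Int_closed K closed_Collect_le continuous_intros fc)
      moreover have "K \<inter> {x. real (Suc k) \<le> real n * f x} \<subseteq> {x. real k < real n * f x}" by auto
      moreover have "g (Suc k) x = 0" if "x \<notin> K \<inter> {x. real (Suc k) \<le> real n * f x}" for x
        using that K(2)[of x] by (auto simp: g_def)
      ultimately show "below (g (Suc k)) {x. real k < real n * f x}" unfolding below_def using gC g1 by blast
    qed
    have bV: "ennreal (\<Lambda> (g k)) \<le> \<mu> V" for k
    proof (rule \<mu>_upper)
      have "g k x = 0" if "x \<notin> K" for x using K(2)[OF that] by (simp add: g_def)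
      then show "below (g k) V" unfolding below_def using gC g1 K(1) V(2) by blast
    qed
    have aV: "a k \<le> \<mu> V" for k unfolding a_def
    proof (rule \<mu>_mono, rule subsetI)
      fix x assume "x \<in> {x. real k < real n * f x}"
      then have "f x \<noteq> 0" by auto
      then show "x \<in> V" using K(2)[of x] V(2) by blast
    qed
    have em: "emeasure riesz {x. real k < real n * f x} = a k" "{x. real k < real n * f x} \<in> sets riesz" for k
      using op by (simp_all add: emeasure_riesz a_def outer_open sets_riesz)
    have i1: "a (Suc k) \<le> (\<integral>\<^sup>+x. ennreal (g k x) \<partial>riesz)" for k
    proof -
      have "a (Suc k) = (\<integral>\<^sup>+x. indicator {x. real (Suc k) < real n * f x} x \<partial>riesz)" using em[of "Suc k"] by (simp only: nn_integral_indicator)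
      also have "\<dots> \<le> (\<integral>\<^sup>+x. ennreal (g k x) \<partial>riesz)"
        by (intro nn_integral_mono) (auto simp: g_def indicator_def)
      finally show ?thesis .
    qed
    have i2: "(\<integral>\<^sup>+x. ennreal (g k x) \<partial>riesz) \<le> a k" for k
    proof -
      have "(\<integral>\<^sup>+x. ennreal (g k x) \<partial>riesz) \<le> (\<integral>\<^sup>+x. indicator {x. real k < real n * f x} x \<partial>riesz)"
        by (intro nn_integral_mono) (auto simp: g_def indicator_def ennreal_le_1)
      then show ?thesis using em by simp
    qed
    have gm: "(\<lambda>x. ennreal (g k x)) \<in> borel_measurable riesz" for k using fm by (simp add: g_def)
    let ?L = "\<Sum>k<N. ennreal (\<Lambda> (g k))" and ?I = "\<Sum>k<N. \<integral>\<^sup>+x. ennreal (g k x) \<partial>riesz"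
    have "\<Lambda> (\<lambda>x. real n * f x) = (\<Sum>k<N. \<Lambda> (g k))" unfolding sumg[symmetric] by (rule sum) (rule gC)
    then have "real n * \<Lambda> f = (\<Sum>k<N. \<Lambda> (g k))" using scale[OF f, of "real n"] by simp
    then have L: "of_nat n * ennreal (\<Lambda> f) = ?L"
      using nonneg[OF f] nonneg[OF gC] by (simp add: sum_ennreal ennreal_mult[symmetric] ennreal_of_nat_eq_real_of_nat)
    have "of_nat n * I = (\<integral>\<^sup>+x. ennreal (real n * f x) \<partial>riesz)"
      unfolding I_def using fm f0 by (simp add: ennreal_mult ennreal_of_nat_eq_real_of_nat nn_integral_cmult)
    also have "\<dots> = (\<integral>\<^sup>+x. (\<Sum>k<N. ennreal (g k x)) \<partial>riesz)"
      unfolding sumg[symmetric] using g1 by (simp add: sum_ennreal)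
    also have "\<dots> = ?I" by (rule nn_integral_sum) (rule gm)
    finally have I: "of_nat n * I = ?I" .
    \<comment> \<open>\<open>\<Lambda>\<close> of slice \<open>k + 2\<close> is at most the integral
      of slice \<open>k\<close>: one index is lost to place the support inside an open superlevel
      set, one to dominate its indicator. The two slices left over cost \<open>\<mu> V\<close> each.
      In the reverse comparison only one index is lost.\<close>
    have "?L \<le> (\<Sum>k<Suc (Suc N). ennreal (\<Lambda> (g k)))" by (intro sum_mono2) auto
    also have "\<dots> = ennreal (\<Lambda> (g 0)) + (ennreal (\<Lambda> (g 1)) + (\<Sum>k<N. ennreal (\<Lambda> (g (Suc (Suc k))))))"
      by (simp add: sum.lessThan_Suc_shift del: sum.lessThan_Suc)
    also have "\<dots> \<le> \<mu> V + (\<mu> V + ?I)"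
      by (intro add_mono bV sum_mono order_trans[OF b2 i1])
    finally have 1: "?L \<le> 2 * \<mu> V + ?I" by (simp add: mult_2 add.assoc)
    have "?I \<le> (\<Sum>k<Suc N. \<integral>\<^sup>+x. ennreal (g k x) \<partial>riesz)" by (intro sum_mono2) auto
    also have "\<dots> = (\<integral>\<^sup>+x. ennreal (g 0 x) \<partial>riesz) + (\<Sum>k<N. \<integral>\<^sup>+x. ennreal (g (Suc k) x) \<partial>riesz)"
      by (simp add: sum.lessThan_Suc_shift del: sum.lessThan_Suc)
    also have "\<dots> \<le> \<mu> V + ?L" by (intro add_mono sum_mono order_trans[OF i2 aV] order_trans[OF i2 b1])
    finally have 2: "?I \<le> \<mu> V + ?L" .
    show ?thesis using 1 2 L I by simp
  qed
  define C where "C = enn2real (\<mu> V)"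
  have C: "\<mu> V = ennreal C" "0 \<le> C" using V(3) by (simp_all add: C_def)
  have "I \<le> \<mu> V + ennreal (\<Lambda> f)" using main[of 1] by simp
  then have "I < \<infinity>" using V(3) by (simp add: order.strict_trans1)
  define J where "J = enn2real I"
  have J: "I = ennreal J" "0 \<le> J" using \<open>I < \<infinity>\<close> by (simp_all add: J_def)
  have l0: "0 \<le> \<Lambda> f" by (rule nonneg[OF f])
  have main': "real n * \<Lambda> f \<le> 2 * C + real n * J" "real n * J \<le> C + real n * \<Lambda> f" if "n > 0" for n
  proof -
    have "ennreal (real n * \<Lambda> f) \<le> ennreal (2 * C + real n * J)" "ennreal (real n * J) \<le> ennreal (C + real n * \<Lambda> f)"
      using main[OF that] C J l0 by (simp_all add: ennreal_mult ennreal_plus ennreal_of_nat_eq_real_of_nat)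
    moreover have "0 \<le> 2 * C + real n * J" "0 \<le> C + real n * \<Lambda> f" using C J l0 by simp_all
    ultimately show "real n * \<Lambda> f \<le> 2 * C + real n * J" "real n * J \<le> C + real n * \<Lambda> f"
      by (simp_all only: ennreal_le_iff)
  qed
  have "\<Lambda> f \<le> J"
  proof (rule field_le_epsilon)
    fix e :: real assume "0 < e"
    then obtain n where n: "2 * C / e < real n" using reals_Archimedean2 by blast
    moreover have "0 \<le> 2 * C / e" using C \<open>0 < e\<close> by simp
    ultimately have n0: "0 < real n" by linarith
    have "real n * \<Lambda> f \<le> real n * (J + e)" using main'(1)[of n] n n0 \<open>0 < e\<close> by (simp add: field_simps)
    then show "\<Lambda> f \<le> J + e" using n0 by simp
  qed
  moreover have "J \<le> \<Lambda> f"
  proof (rule field_le_epsilon)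
    fix e :: real assume "0 < e"
    then obtain n where n: "C / e < real n" using reals_Archimedean2 by blast
    moreover have "0 \<le> C / e" using C \<open>0 < e\<close> by simp
    ultimately have n0: "0 < real n" by linarith
    have "real n * J \<le> real n * (\<Lambda> f + e)" using main'(2)[of n] n n0 \<open>0 < e\<close> by (simp add: field_simps)
    then show "J \<le> \<Lambda> f + e" using n0 by simp
  qed
  ultimately show ?thesis using J by (simp add: I_def)
qed

text \<open>Outer regularity is built in. Inner regularity is first shown inside a compact set, by
  outer approximation of the complement there, and then along a compact exhaustion.\<close>

lemma regular_riesz: "regular_measure riesz"
  unfolding regular_measure_def sets_riesz
proof (intro conjI allI impI ballI)
  show "emeasure riesz K < \<infinity>" if K: "compact K" for K
  proof -
    obtain U where U: "open U" "K \<subseteq> U" "\<mu> U < \<infinity>" using compact_finite_nbhd[OF K] .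
    have "emeasure riesz K = outer K" using compact_imp_closed[OF K] by (intro emeasure_riesz) simp
    also have "\<dots> \<le> \<mu> U" by (rule outer_le[OF U(1,2)])
    finally show ?thesis using U(3) by simp
  qed
  note fin = this
  show outer_reg: "emeasure riesz B = (INF U\<in>{U. open U \<and> B \<subseteq> U}. emeasure riesz U)" if B: "B \<in> sets borel" for B
    unfolding emeasure_riesz[OF B] outer_def by (intro INF_cong) (auto simp: emeasure_riesz outer_open)
  fix B :: "'x set" assume B: "B \<in> sets borel"
  let ?S = "SUP K\<in>{K. compact K \<and> K \<subseteq> B}. emeasure riesz K"
  \<comment> \<open>An open \<open>U\<close> slightly larger than \<open>C - B\<close> in measure
    leaves the compact \<open>C - U\<close>, which lies in \<open>B\<close> and misses little of
    \<open>B \<inter> C\<close>.\<close>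
  have inner_compact: "emeasure riesz (B \<inter> C) \<le> ?S" if C: "compact C" for C
  proof (rule ennreal_le_epsilon)
    fix e :: real assume "0 < e"
    have cC: "closed C" "C \<in> sets borel" using compact_imp_closed[OF C] by auto
    have CB: "C - B \<in> sets borel" using cC B by auto
    have "emeasure riesz (C - B) \<le> emeasure riesz C" by (rule emeasure_mono) (use cC sets_riesz in auto)
    then have f: "emeasure riesz (C - B) \<noteq> \<infinity>" using fin[OF C] by auto
    have "\<exists>U\<in>{U. open U \<and> C - B \<subseteq> U}. emeasure riesz U < emeasure riesz (C - B) + ennreal e"
      by (rule INF_approx_ennreal[OF _ outer_reg[OF CB] f]) (use \<open>0 < e\<close> in simp)
    then obtain U where U: "open U" "C - B \<subseteq> U" "emeasure riesz U \<le> emeasure riesz (C - B) + ennreal e" by (auto simp: less_imp_le)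
    have UB: "U \<in> sets borel" using U(1) by simp
    have cK: "compact (C - U)" using C U(1) by (rule compact_diff)
    have "emeasure riesz U = emeasure riesz (C - B) + emeasure riesz (U - (C - B))"
      using plus_emeasure[of "C - B" riesz "U - (C - B)"] CB UB U(2) sets_riesz by (simp add: Un_absorb1)
    then have "emeasure riesz (C - B) + emeasure riesz (U - (C - B)) \<le> emeasure riesz (C - B) + ennreal e" using U(3) by simp
    then have small: "emeasure riesz (U - (C - B)) \<le> ennreal e" using f by (simp add: ennreal_add_left_cancel_le)
    have "emeasure riesz (B \<inter> C) \<le> emeasure riesz ((C - U) \<union> (U - (C - B)))"
      by (rule emeasure_mono) (use cC CB UB sets_riesz in auto)
    also have "\<dots> \<le> emeasure riesz (C - U) + emeasure riesz (U - (C - B))"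
      by (rule emeasure_subadditive) (use cC CB UB sets_riesz in auto)
    also have "\<dots> \<le> ?S + ennreal e"
      using small cK U(2) by (intro add_mono SUP_upper) auto
    finally show "emeasure riesz (B \<inter> C) \<le> ?S + ennreal e" .
  qed
  obtain h :: "nat \<Rightarrow> 'x \<Rightarrow> real" and L where h: "\<And>n. continuous_on UNIV (h n)" "\<And>n x. 0 \<le> h n x" "\<And>n x. h n x \<le> 1"
    "\<And>n. compact (L n)" "\<And>n. L n \<subseteq> UNIV" "\<And>n x. x \<notin> L n \<Longrightarrow> h n x = 0" "\<And>n x. h n x \<le> h (Suc n) x"
    "\<And>K. compact K \<Longrightarrow> K \<subseteq> UNIV \<Longrightarrow> \<exists>n. \<forall>m\<ge>n. \<forall>x\<in>K. h m x = 1" by (rule exhausting_bumps[OF lc open_UNIV]) (rule that)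
  define C where "C n = (\<Union>k\<le>n. L k)" for n
  have C: "compact (C n)" for n unfolding C_def by (intro compact_UN h) auto
  have "x \<in> (\<Union>n. C n)" for x
  proof -
    obtain n where "h n x = 1" using h(8)[of "{x}"] by auto
    then have "x \<in> L n" using h(6)[of x n] by force
    then show ?thesis by (auto simp: C_def)
  qed
  then have "B = (\<Union>n. B \<inter> C n)" by auto
  moreover have "emeasure riesz (\<Union>n. B \<inter> C n) = (SUP n. emeasure riesz (B \<inter> C n))"
  proof (rule SUP_emeasure_incseq[symmetric])
    show "range (\<lambda>n. B \<inter> C n) \<subseteq> sets riesz" using B compact_imp_closed[OF C] sets_riesz by auto
    show "incseq (\<lambda>n. B \<inter> C n)" unfolding incseq_def C_def by (auto intro: order_trans)
  qed
  ultimately have "emeasure riesz B = (SUP n. emeasure riesz (B \<inter> C n))" by simp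
  also have "\<dots> \<le> ?S" by (intro SUP_least inner_compact C)
  finally show "emeasure riesz B = ?S"
    using B compact_imp_closed sets_riesz by (intro antisym SUP_least emeasure_mono) auto
qed simp

end

section \<open>The measure on the groupoid induced by a measure on the unit space\<close>

context lh_space
begin

lemma precompact_nbhd: obtains O' K where "open O'" "(x::'x) \<in> O'" "O' \<subseteq> K" "compact K"
proof -
  obtain v :: "'x \<Rightarrow> real" and L where v: "continuous_on UNIV v" "\<And>x. 0 \<le> v x" "\<And>x. v x \<le> 1" "\<And>y. y \<in> {x} \<Longrightarrow> v y = 1"
    "compact L" "L \<subseteq> UNIV" "\<And>x. x \<notin> L \<Longrightarrow> v x = 0" by (rule bump_X[OF compact_sing open_UNIV subset_UNIV]) (rule that)
  have "open {y. 0 < v y}" using open_vimage[OF open_greaterThan v(1), of 0] by (simp add: vimage_def)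
  moreover have "{y. 0 < v y} \<subseteq> L" using v(7) by force
  ultimately show thesis using that v(4,5) by force
qed

text \<open>Basic sets with sides from a countable base of the space. The relatively compact second
  side keeps the sources in a compact set, so these bisections have finite measure later.\<close>

lemma countable_bisections:
  "\<exists>W :: nat \<Rightarrow> 'x arrow set. (\<forall>i. bisection (W i)) \<and> (\<forall>i. \<exists>K. compact K \<and> sg ` W i \<subseteq> K) \<and>
     (\<forall>U. openin T U \<longrightarrow> (\<exists>I. U = (\<Union>i\<in>I. W i)))"
proof -
  obtain \<B> :: "'x set set" where \<B>: "countable \<B>" "topological_basis \<B>" using ex_countable_basis by blast
  define S where "S = {(i, j, U, V). U \<in> \<B> \<and> V \<in> \<B> \<and> inj_on (\<phi> ^^ i) U \<and> inj_on (\<phi> ^^ j) V \<and> (\<exists>K. compact K \<and> V \<subseteq> K)}"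
  define \<C> where "\<C> = insert {} ((\<lambda>(i, j, U, V). Z i j U V) ` S)"
  have "countable S" by (rule countable_subset[of _ "UNIV \<times> UNIV \<times> \<B> \<times> \<B>"]) (use \<B> in \<open>auto simp: S_def\<close>)
  then have cC: "countable \<C>" "\<C> \<noteq> {}" by (auto simp: \<C>_def)
  define W where "W = from_nat_into \<C>"
  have rW: "range W = \<C>" unfolding W_def by (rule range_from_nat_into[OF cC(2,1)])
  have empty: "bisection {}" by (simp add: bisection_iff)
  have 1: "bisection A \<and> (\<exists>K. compact K \<and> sg ` A \<subseteq> K)" if A: "A \<in> \<C>" for A
  proof (cases "A = {}")
    case True
    then show ?thesis using empty by blast
  next
    case False
    then have "A \<in> (\<lambda>(i, j, U, V). Z i j U V) ` S" using A by (simp add: \<C>_def)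
    then obtain i j U V where "A = Z i j U V" "(i, j, U, V) \<in> S" by force
    moreover from this(2) obtain K where "U \<in> \<B>" "V \<in> \<B>" "inj_on (\<phi> ^^ i) U" "inj_on (\<phi> ^^ j) V" "compact K" "V \<subseteq> K"
      unfolding S_def by blast
    ultimately have *: "A = Z i j U V" "U \<in> \<B>" "V \<in> \<B>" "inj_on (\<phi> ^^ i) U" "inj_on (\<phi> ^^ j) V" "compact K" "V \<subseteq> K" by blast+
    have "sg ` A \<subseteq> K" using * by (auto simp: Zset_def)
    moreover have "bisection A" unfolding *(1) by (rule bisection_Z) (use * topological_basis_open[OF \<B>(2)] in auto)
    ultimately show ?thesis using *(6) by blast
  qed
  have 2: "\<exists>I. U = (\<Union>i\<in>I. W i)" if U: "openin T U" for U
  proof (intro exI[of _ "{i. W i \<subseteq> U}"] antisym subsetI)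
    fix g assume "g \<in> U"
    then obtain i j U1 V1 where Z: "open U1" "open V1" "inj_on (\<phi> ^^ i) U1" "inj_on (\<phi> ^^ j) V1" "g \<in> Z i j U1 V1" "Z i j U1 V1 \<subseteq> U"
      by (rule T_basis[OF U]) (rule that)
    obtain O' K where O: "open O'" "sg g \<in> O'" "O' \<subseteq> K" "compact K" by (rule precompact_nbhd)
    have "open (V1 \<inter> O')" "sg g \<in> V1 \<inter> O'" "rg g \<in> U1" using Z O by (auto simp: Zset_iff)
    obtain B1 where B1: "B1 \<in> \<B>" "rg g \<in> B1" "B1 \<subseteq> U1" using topological_basisE[OF \<B>(2) Z(1) \<open>rg g \<in> U1\<close>] .
    obtain B2 where B2: "B2 \<in> \<B>" "sg g \<in> B2" "B2 \<subseteq> V1 \<inter> O'"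
      using topological_basisE[OF \<B>(2) \<open>open (V1 \<inter> O')\<close> \<open>sg g \<in> V1 \<inter> O'\<close>] .
    have "(i, j, B1, B2) \<in> S" unfolding S_def using B1 B2 Z O inj_on_subset by fastforce
    then have "Z i j B1 B2 \<in> \<C>" by (force simp: \<C>_def)
    then obtain k where k: "W k = Z i j B1 B2" using rW by (metis imageE)
    have gk: "g \<in> W k" unfolding k using Z(5) B1 B2 by (simp add: Zset_iff)
    have "W k \<subseteq> Z i j U1 V1" unfolding k using B1 B2 by (auto simp: Zset_def)
    then show "g \<in> (\<Union>i\<in>{i. W i \<subseteq> U}. W i)" using gk Z(6) by blast
  qed auto
  have WC: "W i \<in> \<C>" for i using rW by blast
  show ?thesis by (intro exI[of _ W] conjI allI impI 2) (use 1 WC in blast)+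
qed

definition bis :: "nat \<Rightarrow> 'x arrow set" where
  "bis = (SOME W. (\<forall>i. bisection (W i)) \<and> (\<forall>i. \<exists>K. compact K \<and> sg ` W i \<subseteq> K) \<and>
     (\<forall>U. openin T U \<longrightarrow> (\<exists>I. U = (\<Union>i\<in>I. W i))))"

lemma bis: "bisection (bis i)" "\<exists>K. compact K \<and> sg ` bis i \<subseteq> K" "openin T U \<Longrightarrow> \<exists>I. U = (\<Union>i\<in>I. bis i)"
  using someI_ex[OF countable_bisections, folded bis_def] by blast+

lemma openin_bis: "openin T (bis i)" using bis(1) bisection_iff by blast

lemma bis_cover: "(\<Union>i. bis i) = \<Gamma>"
proof -
  have "openin T \<Gamma>" using openin_topspace[of T] by (simp add: topspace_Gam_top)
  then show ?thesis using bis(3)[of \<Gamma>] bisection_sub[OF bis(1)] by blast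
qed

section \<open>Borel structure of the groupoid\<close>

definition MG :: "'x arrow measure" where "MG = sigma \<Gamma> {U. openin T U}"

lemma open_subset_Pow: "{U. openin T U} \<subseteq> Pow \<Gamma>"
  using openin_subset[of T] by (auto simp: topspace_Gam_top)

lemma space_MG [simp]: "space MG = \<Gamma>" and sets_MG: "sets MG = sigma_sets \<Gamma> {U. openin T U}"
  unfolding MG_def using open_subset_Pow by (simp_all add: space_measure_of sets_measure_of)

lemma open_MG: "openin T U \<Longrightarrow> U \<in> sets MG" by (simp add: sets_MG sigma_sets.Basic)

lemma measurable_MG: fixes f :: "'x arrow \<Rightarrow> 'b::topological_space" assumes "continuous_map T euclidean f" shows "f \<in> borel_measurable MG"
proof (rule borel_measurableI)
  fix S :: "'b set" assume "open S"
  then have "openin T {g \<in> \<Gamma>. f g \<in> S}"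
    using assms openin_continuous_map_preimage[of T euclidean f S] by (simp add: topspace_Gam_top)
  moreover have "f -` S \<inter> space MG = {g \<in> \<Gamma>. f g \<in> S}" by auto
  ultimately show "f -` S \<inter> space MG \<in> sets MG" by (simp add: open_MG)
qed

lemma measurable_into_MG:
  assumes "f \<in> space N \<rightarrow> \<Gamma>" "\<And>U. openin T U \<Longrightarrow> f -` U \<inter> space N \<in> sets N" shows "f \<in> measurable N MG"
  unfolding MG_def by (rule measurable_measure_of[OF open_subset_Pow assms(1)]) (use assms(2) in auto)

lemma ginverse_MG: "ginverse \<in> measurable MG MG"
proof (rule measurable_into_MG)
  fix U assume U: "openin T U"
  have "ginverse -` U \<inter> space MG = ginverse ` U"
    using openin_subset[OF U] by (auto simp: topspace_Gam_top image_ginverse_iff)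
  then show "ginverse -` U \<inter> space MG \<in> sets MG" using openin_ginverse[OF U] by (simp add: open_MG)
qed auto

lemma jf_MG: assumes "a \<in> CA" shows "jf a \<in> borel_measurable MG"
proof -
  obtain f where f: "\<And>n::nat. f n \<in> CG" "(\<lambda>n. lam (f n)) \<longlonglongrightarrow> a" by (rule CA_approx[OF assms]) (rule that)
  show ?thesis
  proof (rule borel_measurable_LIMSEQ_metric[of f])
    show "f n \<in> borel_measurable MG" for n using f(1)[of n] by (intro measurable_MG) (simp add: CG_iff)
    show "(\<lambda>n. f n g) \<longlonglongrightarrow> jf a g" for g using jf_tendsto[OF f(2), of g] jf_lam[OF f(1)] by simp
  qed
qed

text \<open>
  The sets \<open>first i\<close> partition the groupoid, and \<open>sg\<close> is injective on each of them with the Borel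
  section \<open>sect i\<close>; this makes the summation over the fibres of \<open>sg\<close> measurable.
\<close>

definition fib :: "'x \<Rightarrow> 'x arrow set" where "fib x = {g \<in> \<Gamma>. sg g = x}"
definition first :: "nat \<Rightarrow> 'x arrow set" where "first i = bis i - (\<Union>j<i. bis j)"
definition piece :: "nat \<Rightarrow> 'x set" where "piece i = sg ` first i"
definition sect :: "nat \<Rightarrow> 'x \<Rightarrow> 'x arrow" where "sect i x = (if x \<in> piece i then sec (bis i) x else unit_arrow x)"

text \<open>Images do not respect differences in general, but \<open>sg\<close> is injective on
  \<open>bis i\<close>; so the image is a difference of two open sets.\<close>

lemma image_first_borel: assumes U: "openin T U" shows "sg ` (U \<inter> first i) \<in> sets borel"
proof -
  have inj: "inj_on sg (bis i)" using bis(1)[of i] bisection_iff by blast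
  have "U \<inter> first i = (U \<inter> bis i) - (U \<inter> bis i \<inter> (\<Union>j<i. bis j))" by (auto simp: first_def)
  then have "sg ` (U \<inter> first i) = sg ` (U \<inter> bis i) - sg ` (U \<inter> bis i \<inter> (\<Union>j<i. bis j))"
    using inj_on_image_set_diff[OF inj, of "U \<inter> bis i" "U \<inter> bis i \<inter> (\<Union>j<i. bis j)"] by auto
  moreover have "open (sg ` (U \<inter> bis i))" "open (sg ` (U \<inter> bis i \<inter> (\<Union>j<i. bis j)))"
    by (intro open_sg_image openin_Int U openin_bis openin_Union; use openin_bis in auto)+
  ultimately show ?thesis by auto
qed

lemma first_subset: "first i \<subseteq> \<Gamma>" using bisection_sub[OF bis(1), of i] by (auto simp: first_def)

lemma piece_borel: "piece i \<in> sets borel"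
proof -
  have "openin T \<Gamma>" using openin_topspace[of T] by (simp add: topspace_Gam_top)
  from image_first_borel[OF this, of i] show ?thesis using first_subset by (simp add: piece_def Int_absorb1)
qed

lemma sect_first: "x \<in> piece i \<Longrightarrow> sect i x \<in> first i" and sg_sect: "sg (sect i x) = x"
  and sect_sg: "g \<in> first i \<Longrightarrow> sect i (sg g) = g" and sect_arrow: "sect i x \<in> \<Gamma>"
proof -
  have *: "g \<in> first i \<Longrightarrow> sec (bis i) (sg g) = g" for g using sec(1)[OF bis(1)] by (auto simp: first_def)
  show 1: "x \<in> piece i \<Longrightarrow> sect i x \<in> first i" using * by (auto simp: sect_def piece_def)
  show "g \<in> first i \<Longrightarrow> sect i (sg g) = g" using * by (auto simp: sect_def piece_def)
  show "sg (sect i x) = x" using * by (auto simp: sect_def piece_def)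
  show "sect i x \<in> \<Gamma>" using 1 first_subset by (cases "x \<in> piece i") (auto simp: sect_def)
qed

lemma sect_measurable: "sect i \<in> measurable borel MG"
proof (rule measurable_into_MG)
  fix U assume U: "openin T U"
  have "sect i -` U = sg ` (U \<inter> first i) \<union> ({x. unit_arrow x \<in> U} - piece i)"
  proof (intro set_eqI iffI)
    fix x assume x: "x \<in> sect i -` U"
    show "x \<in> sg ` (U \<inter> first i) \<union> ({x. unit_arrow x \<in> U} - piece i)"
    proof (cases "x \<in> piece i")
      case True
      then have "sect i x \<in> U \<inter> first i" using x sect_first by simp
      moreover have "x = sg (sect i x)" by (rule sg_sect[symmetric])
      ultimately show ?thesis by blast
    next
      case False
      then show ?thesis using x by (simp add: sect_def)
    qed
  next
    fix x assume "x \<in> sg ` (U \<inter> first i) \<union> ({x. unit_arrow x \<in> U} - piece i)"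
    then show "x \<in> sect i -` U"
    proof
      assume "x \<in> sg ` (U \<inter> first i)"
      then obtain g where "g \<in> U" "g \<in> first i" "x = sg g" by blast
      then show ?thesis using sect_sg[of g i] by simp
    next
      assume "x \<in> {x. unit_arrow x \<in> U} - piece i"
      then show ?thesis by (simp add: sect_def)
    qed
  qed
  moreover have "open {x. unit_arrow x \<in> U}"
    using openin_continuous_map_preimage[OF continuous_unit U] by simp
  ultimately show "sect i -` U \<inter> space borel \<in> sets borel" using image_first_borel[OF U, of i] piece_borel[of i] by auto
qed (use sect_arrow in blast)

text \<open>Each arrow over \<open>x\<close> lies in exactly one of the sets \<open>first i\<close>
  and is the value of the section there. This turns the sum over a fibre into a series of measurable
  functions.\<close>

lemma fibre_sum:
  fixes F :: "'x arrow \<Rightarrow> ennreal"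
  shows "(\<Sum>i. F (sect i x) * indicator (piece i) x) = (\<integral>\<^sup>+g. F g \<partial>count_space (fib x))"
proof -
  have dis: "i = j" if "g \<in> first i" "g \<in> first j" for i j g
    using that by (cases i j rule: linorder_cases) (auto simp: first_def)
  have bij: "bij_betw (\<lambda>i. sect i x) {i. x \<in> piece i} (fib x)"
  proof (rule bij_betwI')
    show "(sect i x = sect j x) = (i = j)" if "i \<in> {i. x \<in> piece i}" "j \<in> {i. x \<in> piece i}" for i j
      using that dis[of "sect i x" i j] sect_first[of x i] sect_first[of x j] by auto
    show "sect i x \<in> fib x" if "i \<in> {i. x \<in> piece i}" for i using sg_sect sect_arrow by (simp add: fib_def)
    show "\<exists>i\<in>{i. x \<in> piece i}. g = sect i x" if g: "g \<in> fib x" for g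
    proof -
      define i where "i = (LEAST i. g \<in> bis i)"
      have "\<exists>i. g \<in> bis i" using g bis_cover by (auto simp: fib_def)
      then have "g \<in> bis i" unfolding i_def by (rule LeastI_ex)
      moreover have "g \<notin> bis j" if "j < i" for j using that unfolding i_def by (rule not_less_Least)
      ultimately have gi: "g \<in> first i" by (auto simp: first_def)
      have "sg g = x" using g by (simp add: fib_def)
      then have "x \<in> piece i" "g = sect i x" using gi sect_sg[OF gi] by (auto simp: piece_def)
      then show ?thesis by blast
    qed
  qed
  have "(\<integral>\<^sup>+g. F g \<partial>count_space (fib x)) = (\<integral>\<^sup>+i. F (sect i x) \<partial>count_space {i. x \<in> piece i})"
    by (rule nn_integral_bij_count_space[OF bij, symmetric])
  also have "\<dots> = (\<integral>\<^sup>+i. F (sect i x) * indicator {i. x \<in> piece i} i \<partial>count_space UNIV)"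
    by (subst nn_integral_count_space_indicator) auto
  also have "\<dots> = (\<Sum>i. F (sect i x) * indicator {i. x \<in> piece i} i)" by (rule nn_integral_count_space_nat)
  also have "\<dots> = (\<Sum>i. F (sect i x) * indicator (piece i) x)" by (simp add: indicator_def)
  finally show ?thesis by simp
qed

end

section \<open>The measure on arrows with counting measure on source fibres\<close>

locale lh_measure = lh_space \<phi> for \<phi> :: "'x::{t2_space, second_countable_topology} \<Rightarrow> 'x" +
  fixes m :: "'x measure"
  assumes regular: "regular_measure m"
begin

lemma sets_m [measurable_cong, simp]: "sets m = sets borel" and emeasure_compact: "compact K \<Longrightarrow> emeasure m K < \<infinity>"
  using regular by (simp_all add: regular_measure_def)

lemma space_m [simp]: "space m = UNIV" using sets_eq_imp_space_eq[OF sets_m] by simp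

lemma measurable_m: "measurable m N = measurable borel N" by (rule measurable_cong_sets) simp_all

sublocale sf: sigma_finite_measure m
proof
  have "\<forall>i. \<exists>K. compact K \<and> sg ` bis i \<subseteq> K" using bis(2) by blast
  from choice[OF this] obtain K where K: "\<And>i. compact (K i)" "\<And>i. sg ` bis i \<subseteq> K i" by blast
  have "x \<in> (\<Union>i. K i)" for x
  proof -
    have "unit_arrow x \<in> (\<Union>i. bis i)" unfolding bis_cover by simp
    then show ?thesis using K(2) by force
  qed
  then have "\<Union>(range K) = UNIV" by blast
  moreover have "K i \<in> sets m" for i using compact_imp_closed[OF K(1)] by simp
  ultimately show "\<exists>A. countable A \<and> A \<subseteq> sets m \<and> \<Union>A = space m \<and> (\<forall>a\<in>A. emeasure m a \<noteq> \<infinity>)"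
    using emeasure_compact[OF K(1)] by (intro exI[of _ "range K"]) (auto simp: less_top)
qed

text \<open>Built as an image measure of a restricted product, so that countable additivity comes
  for free; the integral over the fibres is recovered by Tonelli's theorem and
  \<open>fibre_sum\<close>.\<close>

definition \<nu> :: "'x arrow measure" where
  "\<nu> = distr (density (count_space UNIV \<Otimes>\<^sub>M m) (\<lambda>p. indicator (piece (fst p)) (snd p))) MG (\<lambda>p. sect (fst p) (snd p))"

lemma sets_nu [measurable_cong, simp]: "sets \<nu> = sets MG" and space_nu [simp]: "space \<nu> = \<Gamma>"
  by (simp_all add: \<nu>_def)

lemma measurable_nu: "measurable \<nu> N = measurable MG N" by (rule measurable_cong_sets) simp_all

lemma nn_integral_nu:
  assumes F: "F \<in> borel_measurable MG"
  shows "(\<integral>\<^sup>+g. F g \<partial>\<nu>) = (\<integral>\<^sup>+x. (\<integral>\<^sup>+g. F g \<partial>count_space (fib x)) \<partial>m)"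
proof -
  let ?P = "count_space UNIV \<Otimes>\<^sub>M m"
  have ind: "(\<lambda>p. indicator (piece (fst p)) (snd p) :: ennreal) \<in> borel_measurable ?P"
    by (rule measurable_pair_measure_countable1) (auto simp: measurable_m intro: borel_measurable_indicator piece_borel)
  have s: "(\<lambda>p. sect (fst p) (snd p)) \<in> measurable ?P MG"
    by (rule measurable_pair_measure_countable1) (auto simp: measurable_m sect_measurable)
  have Fs: "(\<lambda>p. F (sect (fst p) (snd p))) \<in> borel_measurable ?P" using measurable_compose[OF s F] .
  have "(\<integral>\<^sup>+g. F g \<partial>\<nu>) = (\<integral>\<^sup>+p. indicator (piece (fst p)) (snd p) * F (sect (fst p) (snd p)) \<partial>?P)"
    unfolding \<nu>_def using F s ind Fs by (simp add: nn_integral_distr nn_integral_density)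
  also have "\<dots> = (\<integral>\<^sup>+i. \<integral>\<^sup>+x. indicator (piece i) x * F (sect i x) \<partial>m \<partial>count_space UNIV)"
    using sf.nn_integral_fst[OF borel_measurable_times_ennreal[OF ind Fs]] by simp
  also have "\<dots> = (\<Sum>i. \<integral>\<^sup>+x. indicator (piece i) x * F (sect i x) \<partial>m)" by (rule nn_integral_count_space_nat)
  also have "\<dots> = (\<integral>\<^sup>+x. (\<Sum>i. indicator (piece i) x * F (sect i x)) \<partial>m)"
  proof (rule nn_integral_suminf[symmetric])
    show "(\<lambda>x. indicator (piece i) x * F (sect i x)) \<in> borel_measurable m" for i
      unfolding measurable_m
      by (intro borel_measurable_times_ennreal borel_measurable_indicator piece_borel measurable_compose[OF sect_measurable F])
  qed
  finally show ?thesis by (simp add: fibre_sum[symmetric] mult.commute)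
qed

lemma nn_integral_fib_bisection:
  fixes F :: "'x arrow \<Rightarrow> ennreal"
  assumes W: "bisection W"
  shows "(\<integral>\<^sup>+g. F g * indicator W g \<partial>count_space (fib x)) = F (sec W x) * indicator (sg ` W) x"
proof (cases "x \<in> sg ` W")
  case True
  have s: "sec W x \<in> fib x" using sec[OF W] True bisection_sub[OF W] by (auto simp: fib_def)
  have "(\<integral>\<^sup>+g. F g * indicator W g \<partial>count_space (fib x)) = (\<Sum>g\<in>{sec W x}. F g * indicator W g)"
  proof (rule nn_integral_count_space'[where A = "{sec W x}"])
    fix g assume g: "g \<in> fib x" "g \<notin> {sec W x}"
    then have "g \<notin> W" using sec(1)[OF W, of g] by (auto simp: fib_def)
    then show "F g * indicator W g = 0" by simp
  qed (use s in auto)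
  then show ?thesis using True sec(2)[OF W True] by simp
next
  case False
  then have "g \<notin> W" if "g \<in> fib x" for g using that by (auto simp: fib_def)
  then have "(\<integral>\<^sup>+g. F g * indicator W g \<partial>count_space (fib x)) = (\<integral>\<^sup>+g. 0 \<partial>count_space (fib x))"
    by (intro nn_integral_cong) simp
  then show ?thesis using False by simp
qed

lemma emeasure_nu_bisection: assumes W: "bisection W" shows "emeasure \<nu> W = emeasure m (sg ` W)"
proof -
  have o: "openin T W" using W bisection_iff by blast
  have "emeasure \<nu> W = (\<integral>\<^sup>+g. 1 * indicator W g \<partial>\<nu>)" using open_MG[OF o] by simp
  also have "\<dots> = (\<integral>\<^sup>+x. indicator (sg ` W) x \<partial>m)"
    using open_MG[OF o] by (subst nn_integral_nu) (simp_all add: nn_integral_fib_bisection[OF W, where F = "\<lambda>_. 1", simplified])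
  also have "\<dots> = emeasure m (sg ` W)" using open_sg_image[OF o] by simp
  finally show ?thesis .
qed

text \<open>An open subset of a bisection is a bisection, so bisections are stable under
  intersections. They generate the Borel sets, and the sets \<open>bis i\<close> have finite measure
  and cover the groupoid.\<close>

lemma measure_eq_bisections:
  assumes N: "sets N = sets MG" and eq: "\<And>W. bisection W \<Longrightarrow> emeasure \<nu> W = emeasure N W"
  shows "\<nu> = N"
proof (rule measure_eqI_generator_eq[where E = "Collect bisection" and \<Omega> = \<Gamma> and A = bis])
  show "Int_stable (Collect bisection)"
    unfolding Int_stable_def using bisection_subset bisection_iff by (metis Int_lower1 mem_Collect_eq openin_Int)
  show "Collect bisection \<subseteq> Pow \<Gamma>" using bisection_sub by blast
  have "U \<in> sigma_sets \<Gamma> (Collect bisection)" if U: "openin T U" for U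
  proof -
    obtain I where I: "U = (\<Union>i\<in>I. bis i)" using bis(3)[OF U] by blast
    show ?thesis unfolding I by (rule sigma_sets_UNION) (use bis(1) in auto)
  qed
  then have "sigma_sets \<Gamma> {U. openin T U} \<subseteq> sigma_sets \<Gamma> (Collect bisection)" by (intro sigma_algebra.sigma_sets_subset[OF sigma_algebra_sigma_sets]) (use bisection_sub in auto)
  moreover have "sigma_sets \<Gamma> (Collect bisection) \<subseteq> sigma_sets \<Gamma> {U. openin T U}"
    by (rule sigma_sets_mono') (auto simp: bisection_iff)
  ultimately show "sets \<nu> = sigma_sets \<Gamma> (Collect bisection)" "sets N = sigma_sets \<Gamma> (Collect bisection)"
    using N by (auto simp: sets_MG)
  show "emeasure \<nu> W = emeasure N W" if "W \<in> Collect bisection" for W using that eq by simp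
  show "range bis \<subseteq> Collect bisection" using bis(1) by auto
  show "(\<Union>i. bis i) = \<Gamma>" by (rule bis_cover)
  show "emeasure \<nu> (bis i) \<noteq> \<infinity>" for i
  proof -
    obtain K where K: "compact K" "sg ` bis i \<subseteq> K" using bis(2) by blast
    have "emeasure \<nu> (bis i) \<le> emeasure m K"
      unfolding emeasure_nu_bisection[OF bis(1)] using K(2) compact_imp_closed[OF K(1)] by (intro emeasure_mono) auto
    then show ?thesis using emeasure_compact[OF K(1)] by auto
  qed
qed

end

section \<open>Multiplication by functions on the unit space\<close>

context lh_space
begin

definition Cu :: "('x \<Rightarrow> real) set" where
  "Cu = {v. continuous_on UNIV v \<and> (\<exists>K. compact K \<and> (\<forall>x. x \<notin> K \<longrightarrow> v x = 0))}"

abbreviation "U0 \<equiv> Z 0 0 UNIV UNIV"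

text \<open>Real functions on the unit space as functions on the groupoid living on the units. The
  corresponding operators multiply by \<open>v\<close> of the range, and on the right by
  \<open>v\<close> of the source.\<close>

definition uf :: "('x \<Rightarrow> real) \<Rightarrow> 'x arrow \<Rightarrow> complex" where
  "uf v g = (if g \<in> U0 then complex_of_real (v (sg g)) else 0)"

abbreviation "mop v \<equiv> lam (uf v)"

lemma uf_unit [simp]: "uf v (unit_arrow x) = complex_of_real (v x)" by (simp add: uf_def Zset_def)

lemma Cpos_Cu: "v \<in> Cpos \<Longrightarrow> v \<in> Cu" by (auto simp: Cpos_def Cu_def)

lemma supp_in_uf: assumes "v \<in> Cu" shows "supp_in (uf v) U0"
proof -
  obtain K where K: "compact K" "\<And>x. x \<notin> K \<Longrightarrow> v x = 0" and v: "continuous_on UNIV v" using assms by (auto simp: Cu_def)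
  have s: "sg ` U0 = UNIV" by (force simp: Zset_def)
  have eq: "uf v = (\<lambda>g. if g \<in> U0 then (\<lambda>x. complex_of_real (v x)) (sg g) else 0)" by (auto simp: uf_def fun_eq_iff)
  have c: "continuous_on UNIV (\<lambda>x. complex_of_real (v x))" by (intro continuous_intros v)
  have *: "K \<subseteq> sg ` U0" "\<And>x. x \<notin> K \<Longrightarrow> complex_of_real (v x) = 0" using s K by auto
  show ?thesis unfolding supp_in_def eq using lift_function[OF bisection_units c K(1) *] by blast
qed

lemma uf_CG: "v \<in> Cu \<Longrightarrow> uf v \<in> CG" using supp_in_uf supp_in_CG by blast

lemma mop_CA: "v \<in> Cu \<Longrightarrow> mop v \<in> CA" by (intro lam_CA uf_CG)

lemma mop_apply: assumes "v \<in> Cu"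
  shows "l2_fun (blinfun_apply (mop v) \<xi>) g = (if g \<in> \<Gamma> then complex_of_real (v (rg g)) * l2_fun \<xi> g else 0)"
proof -
  have r: "rsec U0 x = unit_arrow x" for x using rsec(1)[OF bisection_units, of "unit_arrow x"] by (simp add: Zset_def)
  have u: "rg g \<in> rg ` U0" by (rule image_eqI[of _ _ "unit_arrow (rg g)"]) (simp_all add: Zset_def)
  have g: "gmul (ginverse (unit_arrow (rg g))) g = g" by (rule arrow_eqI) auto
  have "l2_fun (blinfun_apply (mop v) \<xi>) g = rep_sum (uf v) (l2_fun \<xi>) g" using lam_op[OF uf_CG[OF assms]] by (simp add: is_op_def)
  also have "\<dots> = (if g \<in> \<Gamma> \<and> rg g \<in> rg ` U0 then uf v (rsec U0 (rg g)) * l2_fun \<xi> (gmul (ginverse (rsec U0 (rg g))) g) else 0)"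
    by (rule rep_sum_bisection[OF bisection_units]) (simp add: uf_def)
  finally show ?thesis using u by (simp add: r g del: ginverse_sel)
qed

lemma ent_mop_left: assumes "v \<in> Cu" "a \<in> CA" shows "ent (mop v o\<^sub>L a) g k = complex_of_real (v (rg g)) * ent a g k"
  using mop_apply[OF assms(1)] ent_jf[OF assms(2), of g k] by (simp add: ent_def)

lemma jf_mop_left: assumes "v \<in> Cu" "a \<in> CA" shows "jf (mop v o\<^sub>L a) g = complex_of_real (v (rg g)) * jf a g"
  using ent_mop_left[OF assms] by (simp add: jf_def)

lemma mop_adj: assumes "v \<in> Cu" shows "op_adj (mop v) = mop v"
proof (rule CA.op_adj_eq[OF mop_CA[OF assms]], rule is_adjI_ent)
  show "ent (mop v) k g = cnj (ent (mop v) g k)" for g k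
    by (auto simp: ent_def mop_apply[OF assms] l2_fun_ket)
qed (auto intro: clin_lam uf_CG assms)

lemma jf_mop_right: assumes "v \<in> Cu" "a \<in> CA" shows "jf (a o\<^sub>L mop v) g = jf a g * complex_of_real (v (sg g))"
proof -
  have c: "a o\<^sub>L mop v \<in> CA" "op_adj a \<in> CA" using assms by (auto intro: CA.compose_A mop_CA CA.op_adj_A)
  have "jf (a o\<^sub>L mop v) g = cnj (jf (op_adj (a o\<^sub>L mop v)) (ginverse g))" using jf_adj[OF c(1), of "ginverse g"] by simp
  also have "op_adj (a o\<^sub>L mop v) = mop v o\<^sub>L op_adj a" using CA.op_adj_simps(7)[OF assms(2) mop_CA[OF assms(1)]] mop_adj[OF assms(1)] by simp
  also have "cnj (jf (mop v o\<^sub>L op_adj a) (ginverse g)) = jf a g * complex_of_real (v (sg g))"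
    unfolding jf_mop_left[OF assms(1) c(2)] by (simp add: jf_adj[OF assms(2)])
  finally show ?thesis .
qed

lemma jf_eqI: assumes "a \<in> CA" "b \<in> CA" "\<And>g. g \<in> \<Gamma> \<Longrightarrow> jf a g = jf b g" shows "a = b"
proof (rule op_eqI_ent)
  have "jf a g = jf b g" for g using assms(3)[of g] by (cases "g \<in> \<Gamma>") (simp_all add: jf_off)
  then show "ent a g k = ent b g k" for g k using ent_jf[OF assms(1)] ent_jf[OF assms(2)] by simp
qed (use assms CA.clin_A in auto)

lemma jf_mop: "v \<in> Cu \<Longrightarrow> jf (mop v) g = uf v g" by (simp add: jf_lam uf_CG)

lemma mop_compose: assumes "v \<in> Cu" "w \<in> Cu" shows "mop v o\<^sub>L mop w = mop (\<lambda>x. v x * w x)"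
  and Cu_mult: "(\<lambda>x. v x * w x) \<in> Cu"
proof -
  show 1: "(\<lambda>x. v x * w x) \<in> Cu" using assms by (auto simp: Cu_def intro!: continuous_intros)
  show "mop v o\<^sub>L mop w = mop (\<lambda>x. v x * w x)"
  proof (rule jf_eqI)
    fix g assume "g \<in> \<Gamma>"
    have "g \<in> U0 \<Longrightarrow> rg g = sg g" by (simp add: Zset_iff)
    then show "jf (mop v o\<^sub>L mop w) g = jf (mop (\<lambda>x. v x * w x)) g"
      unfolding jf_mop_left[OF assms(1) mop_CA[OF assms(2)]] jf_mop[OF 1] jf_mop[OF assms(2)] by (simp add: uf_def)
  qed (use assms 1 in \<open>auto intro: mop_CA CA.compose_A\<close>)
qed

lemma mop_diff: assumes "v \<in> Cu" "w \<in> Cu" shows "mop v - mop w = mop (\<lambda>x. v x - w x)" and Cu_diff: "(\<lambda>x. v x - w x) \<in> Cu"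
proof -
  obtain K K' where "continuous_on UNIV v" "continuous_on UNIV w" "compact K" "compact K'" "\<And>x. x \<notin> K \<Longrightarrow> v x = 0" "\<And>x. x \<notin> K' \<Longrightarrow> w x = 0"
    using assms by (auto simp: Cu_def)
  then show 1: "(\<lambda>x. v x - w x) \<in> Cu" unfolding Cu_def
    by (intro CollectI conjI continuous_intros exI[of _ "K \<union> K'"] compact_Un) auto
  show "mop v - mop w = mop (\<lambda>x. v x - w x)"
    by (rule jf_eqI) (use assms 1 in \<open>auto intro: mop_CA CA.diff_A simp: jf_simps jf_mop uf_def\<close>)
qed

lemma norm_mop: assumes "v \<in> Cu" "\<And>x. \<bar>v x\<bar> \<le> 1" shows "norm (mop v) \<le> 1"
  by (rule norm_lam_le[OF bisection_units supp_in_uf[OF assms(1)]]) (use assms(2) in \<open>auto simp: uf_def\<close>)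

lemma Cu_sqrt: assumes "v \<in> Cpos" shows "(\<lambda>x. sqrt (v x)) \<in> Cpos" "mop (\<lambda>x. sqrt (v x)) o\<^sub>L mop (\<lambda>x. sqrt (v x)) = mop v"
proof -
  show 1: "(\<lambda>x. sqrt (v x)) \<in> Cpos" using assms by (auto simp: Cpos_def intro!: continuous_intros)
  show "mop (\<lambda>x. sqrt (v x)) o\<^sub>L mop (\<lambda>x. sqrt (v x)) = mop v"
    using mop_compose(1)[OF Cpos_Cu[OF 1] Cpos_Cu[OF 1]] assms by (simp add: Cpos_def)
qed

lemma mop_pos: assumes "v \<in> Cpos" shows "mop v \<in> pos_cone CA"
  using CA.adj_mult_pos[OF mop_CA[OF Cpos_Cu[OF Cu_sqrt(1)[OF assms]]]] Cu_sqrt(2)[OF assms]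
    mop_adj[OF Cpos_Cu[OF Cu_sqrt(1)[OF assms]]] by simp

lemma Re_jf_pos: assumes "a \<in> pos_cone CA" shows "0 \<le> Re (jf a (unit_arrow x))"
proof -
  obtain b where b: "a = op_adj b o\<^sub>L b" "b \<in> CA" using assms by (auto simp: pos_cone_def)
  show ?thesis unfolding b(1) jf_adj_mult[OF b(2)] by (simp add: l2_cinner_self)
qed

text \<open>An approximate unit made of functions on the unit space. On a compactly supported
  function it acts as the identity from some index on; contractivity carries this to limits, and
  adjoints give the right-hand version.\<close>

lemma exhausting_mops:
  obtains h :: "nat \<Rightarrow> 'x \<Rightarrow> real" where "\<And>n. h n \<in> Cpos" "\<And>n x. 0 \<le> h n x" "\<And>n x. h n x \<le> 1"
    "\<And>a. a \<in> CA \<Longrightarrow> (\<lambda>n. mop (h n) o\<^sub>L a) \<longlonglongrightarrow> a" "\<And>a. a \<in> CA \<Longrightarrow> (\<lambda>n. a o\<^sub>L mop (h n)) \<longlonglongrightarrow> a"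
proof -
  obtain h :: "nat \<Rightarrow> 'x \<Rightarrow> real" and L where h: "\<And>n. continuous_on UNIV (h n)" "\<And>n x. 0 \<le> h n x" "\<And>n x. h n x \<le> 1"
    "\<And>n. compact (L n)" "\<And>n. L n \<subseteq> UNIV" "\<And>n x. x \<notin> L n \<Longrightarrow> h n x = 0" "\<And>n x. h n x \<le> h (Suc n) x"
    "\<And>K. compact K \<Longrightarrow> K \<subseteq> UNIV \<Longrightarrow> \<exists>n. \<forall>m\<ge>n. \<forall>x\<in>K. h m x = 1" by (rule exhausting_bumps[OF lc open_UNIV]) (rule that)
  have hC: "h n \<in> Cpos" for n unfolding Cpos_def by (intro CollectI conjI allI exI[of _ "L n"] impI h(1,2,4,6))
  have hCu: "h n \<in> Cu" for n by (rule Cpos_Cu[OF hC])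
  have nh: "norm (mop (h n)) \<le> 1" for n by (rule norm_mop[OF hCu]) (use h in auto)
  have left: "(\<lambda>n. mop (h n) o\<^sub>L a) \<longlonglongrightarrow> a" if a: "a \<in> CA" for a
  proof (rule LIMSEQ_I)
    fix e :: real assume e: "0 < e"
    obtain f where f: "\<And>n::nat. f n \<in> CG" "(\<lambda>n. lam (f n)) \<longlonglongrightarrow> a" by (rule CA_approx[OF a]) (rule that)
    obtain N where N: "norm (lam (f N) - a) < e / 2" using LIMSEQ_D[OF f(2), of "e / 2"] e by auto
    obtain K where K: "compactin T K" "\<And>g. g \<notin> K \<Longrightarrow> f N g = 0" using f(1)[of N] by (auto simp: CG_iff)
    obtain n0 where n0: "\<And>m x. m \<ge> n0 \<Longrightarrow> x \<in> rg ` K \<Longrightarrow> h m x = 1" using h(8)[OF compact_image_T[OF K(1) continuous_rg]] by blast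
    have "norm ((mop (h m) o\<^sub>L a) - a) < e" if m: "m \<ge> n0" for m
    proof -
      have eq: "mop (h m) o\<^sub>L lam (f N) = lam (f N)"
      proof (rule jf_eqI)
        show "jf (mop (h m) o\<^sub>L lam (f N)) g = jf (lam (f N)) g" for g
          unfolding jf_mop_left[OF hCu lam_CA[OF f(1)]] using n0[OF m, of "rg g"] K(2)[of g] by (cases "g \<in> K") (auto simp: jf_lam f(1))
      qed (auto intro: CA.compose_A mop_CA lam_CA f hCu)
      have "(mop (h m) o\<^sub>L a) - a = (lam (f N) - a) - (mop (h m) o\<^sub>L (lam (f N) - a))"
        by (simp add: eq bounded_bilinear.diff_right[OF bounded_bilinear_blinfun_compose])
      also have "norm \<dots> \<le> norm (lam (f N) - a) + norm (mop (h m) o\<^sub>L (lam (f N) - a))" by (rule norm_triangle_ineq4)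
      also have "norm (mop (h m) o\<^sub>L (lam (f N) - a)) \<le> norm (mop (h m)) * norm (lam (f N) - a)" by (rule norm_blinfun_compose)
      also have "\<dots> \<le> 1 * norm (lam (f N) - a)" by (rule mult_right_mono[OF nh]) simp
      finally show ?thesis using N by simp
    qed
    then show "\<exists>no. \<forall>n\<ge>no. norm ((mop (h n) o\<^sub>L a) - a) < e" by blast
  qed
  have right: "(\<lambda>n. a o\<^sub>L mop (h n)) \<longlonglongrightarrow> a" if a: "a \<in> CA" for a
  proof -
    have oa: "op_adj a \<in> CA" by (rule CA.op_adj_A[OF a])
    have "(\<lambda>n. op_adj (mop (h n) o\<^sub>L op_adj a)) \<longlonglongrightarrow> op_adj (op_adj a)"
      by (rule CA.op_adj_tendsto[OF _ left[OF oa]]) (auto intro: CA.compose_A mop_CA hCu oa)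
    moreover have "op_adj (mop (h n) o\<^sub>L op_adj a) = a o\<^sub>L mop (h n)" for n
      using CA.op_adj_simps(7)[OF mop_CA[OF hCu] oa] CA.op_adj_simps(1)[OF a] mop_adj[OF hCu] by simp
    ultimately show ?thesis using CA.op_adj_simps(1)[OF a] by simp
  qed
  show thesis by (rule that[OF hC h(2,3) left right])
qed

end

section \<open>The weight defined by a measure\<close>

lemma nn_integral_count_space_infsum:
  fixes f :: "'i \<Rightarrow> real"
  assumes "f summable_on UNIV" "\<And>i. 0 \<le> f i" shows "(\<integral>\<^sup>+i. ennreal (f i) \<partial>count_space UNIV) = ennreal (infsum f UNIV)"
proof -
  have "Infinite_Set_Sum.abs_summable_on f UNIV" using abs_summable_equivalent[of f UNIV] assms by simp
  then show ?thesis using nn_integral_conv_infsetsum[of f UNIV] infsetsum_infsum[of f UNIV] assms by simp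
qed

context lh_space
begin

text \<open>The image of the ket at the unit of \<open>x\<close> is the restriction of
  \<open>jf b\<close> to the source fibre of \<open>x\<close>.\<close>

lemma norm_fibre: assumes b: "b \<in> CA"
  shows "ennreal ((norm (blinfun_apply b (ket (unit_arrow x))))\<^sup>2) = (\<integral>\<^sup>+g. ennreal ((cmod (jf b g))\<^sup>2) \<partial>count_space (fib x))"
proof -
  let ?\<xi> = "blinfun_apply b (ket (unit_arrow x))"
  have "ennreal ((norm ?\<xi>)\<^sup>2) = (\<integral>\<^sup>+g. ennreal ((cmod (l2_fun ?\<xi> g))\<^sup>2) \<partial>count_space UNIV)"
    unfolding l2_norm_sq by (rule nn_integral_count_space_infsum[symmetric, OF l2_summable]) simp
  also have "\<dots> = (\<integral>\<^sup>+g. ennreal ((cmod (jf b g))\<^sup>2) * indicator (fib x) g \<partial>count_space UNIV)"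
    by (intro nn_integral_cong) (auto simp: ent_unit[OF b, unfolded ent_def] fib_def indicator_def jf_off)
  finally show ?thesis by (subst nn_integral_count_space_indicator) auto
qed

end

context lh_measure
begin

definition mw :: "'x arrow l2op \<Rightarrow> ennreal" where
  "mw = (\<lambda>a\<in>pos_cone CA. \<integral>\<^sup>+x. ennreal (Re (jf a (unit_arrow x))) \<partial>m)"

lemma mw_eq: "mw = (\<lambda>a\<in>pos_cone CA. \<integral>\<^sup>+x. ennreal (Re (apply_bcontfun (cond_exp (Gam \<phi>) a) x)) \<partial>m)"
  unfolding mw_def by (intro restrict_ext) (simp add: cond_exp_eq CA.pos_A)

lemma jf_unit_measurable: assumes "a \<in> CA" shows "(\<lambda>x. ennreal (Re (jf a (unit_arrow x)))) \<in> borel_measurable m"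
proof -
  have "continuous_on UNIV (\<lambda>x. Re (jf a (unit_arrow x)))" by (intro continuous_intros continuous_jf_unit assms)
  from measurable_compose[OF borel_measurable_continuous_onI[OF this] measurable_ennreal]
  show ?thesis unfolding measurable_m .
qed

text \<open>A Plancherel formula: \<open>jf\<close> embeds the GNS space of the weight isometrically
  into the square-integrable functions for \<open>\<nu>\<close>.\<close>

lemma mw_sq: assumes b: "b \<in> CA" shows "mw (op_adj b o\<^sub>L b) = (\<integral>\<^sup>+g. ennreal ((cmod (jf b g))\<^sup>2) \<partial>\<nu>)"
proof -
  have "mw (op_adj b o\<^sub>L b) = (\<integral>\<^sup>+x. ennreal ((norm (blinfun_apply b (ket (unit_arrow x))))\<^sup>2) \<partial>m)"
    using CA.adj_mult_pos[OF b] by (simp add: mw_def jf_adj_mult[OF b] l2_cinner_self)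
  also have "\<dots> = (\<integral>\<^sup>+g. ennreal ((cmod (jf b g))\<^sup>2) \<partial>\<nu>)"
    unfolding norm_fibre[OF b] by (rule nn_integral_nu[symmetric]) (use jf_MG[OF b] in measurable)
  finally show ?thesis .
qed

lemma mw_mop: assumes "v \<in> Cpos" shows "mw (mop v) = (\<integral>\<^sup>+x. ennreal (v x) \<partial>m)"
  using mop_pos[OF assms] by (simp add: mw_def jf_mop Cpos_Cu assms)

lemma CG_square_finite: assumes f: "f \<in> CG" shows "(\<integral>\<^sup>+g. ennreal ((cmod (f g))\<^sup>2) \<partial>\<nu>) < \<infinity>"
proof -
  obtain M where M: "0 \<le> M" "\<And>g. cmod (f g) \<le> M" by (rule CG_bounded[OF f]) (rule that)
  obtain K where K: "compactin T K" "\<And>g. g \<notin> K \<Longrightarrow> f g = 0" using f by (auto simp: CG_iff)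
  have "K \<subseteq> \<Gamma>" using compactin_subset_topspace[OF K(1)] by (simp add: topspace_Gam_top)
  then have "K \<subseteq> \<Union>(range bis)" using bis_cover by auto
  then obtain \<F> where \<F>: "finite \<F>" "\<F> \<subseteq> range bis" "K \<subseteq> \<Union>\<F>"
    using compactinD[OF K(1), of "range bis"] openin_bis by blast
  have fin: "emeasure \<nu> W < \<infinity>" if "W \<in> \<F>" for W
  proof -
    obtain i where i: "W = bis i" using \<F>(2) \<open>W \<in> \<F>\<close> by blast
    obtain C where C: "compact C" "sg ` bis i \<subseteq> C" using bis(2) by blast
    have "emeasure \<nu> W \<le> emeasure m C"
      unfolding i emeasure_nu_bisection[OF bis(1)] using C(2) compact_imp_closed[OF C(1)] by (intro emeasure_mono) auto
    then show ?thesis using emeasure_compact[OF C(1)] by (rule le_less_trans)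
  qed
  have oF: "openin T W" if "W \<in> \<F>" for W using that \<F>(2) openin_bis by blast
  have "(\<integral>\<^sup>+g. ennreal ((cmod (f g))\<^sup>2) \<partial>\<nu>) \<le> (\<integral>\<^sup>+g. ennreal (M\<^sup>2) * indicator (\<Union>\<F>) g \<partial>\<nu>)"
  proof (rule nn_integral_mono)
    fix g
    show "ennreal ((cmod (f g))\<^sup>2) \<le> ennreal (M\<^sup>2) * indicator (\<Union>\<F>) g"
    proof (cases "g \<in> \<Union>\<F>")
      case True
      then show ?thesis using power_mono[OF M(2)[of g], of 2] by (simp add: indicator_def ennreal_leI)
    next
      case False
      then have "f g = 0" using K(2)[of g] \<F>(3) by blast
      then show ?thesis by simp
    qed
  qed
  also have "\<dots> = ennreal (M\<^sup>2) * emeasure \<nu> (\<Union>\<F>)"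
    using oF by (intro nn_integral_cmult_indicator) (simp add: open_MG openin_Union)
  also have "\<dots> \<le> ennreal (M\<^sup>2) * (\<Sum>W\<in>\<F>. emeasure \<nu> W)"
  proof (rule mult_left_mono)
    have "\<F> \<subseteq> sets MG" using oF open_MG by blast
    then show "emeasure \<nu> (\<Union>\<F>) \<le> (\<Sum>W\<in>\<F>. emeasure \<nu> W)"
      using emeasure_subadditive_finite[OF \<F>(1), of "\<lambda>W. W" \<nu>] by simp
  qed simp
  also have "\<dots> < \<infinity>" using fin by (simp add: ennreal_mult_less_top \<F>(1))
  finally show ?thesis .
qed

lemma mw_add: assumes "a \<in> pos_cone CA" "b \<in> pos_cone CA" shows "mw (a + b) = mw a + mw b"
proof -
  have "mw (a + b) = (\<integral>\<^sup>+x. ennreal (Re (jf a (unit_arrow x))) + ennreal (Re (jf b (unit_arrow x))) \<partial>m)"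
    using CA.pos_add[OF assms] Re_jf_pos[OF assms(1)] Re_jf_pos[OF assms(2)] by (simp add: mw_def jf_simps ennreal_plus)
  also have "\<dots> = mw a + mw b"
    using assms by (simp add: mw_def nn_integral_add jf_unit_measurable CA.pos_A)
  finally show ?thesis .
qed

lemma mw_scale: assumes "a \<in> pos_cone CA" "0 < r" shows "mw (r *\<^sub>R a) = ennreal r * mw a"
proof -
  have "mw (r *\<^sub>R a) = (\<integral>\<^sup>+x. ennreal r * ennreal (Re (jf a (unit_arrow x))) \<partial>m)"
    using CA.pos_scale[OF assms(1)] Re_jf_pos[OF assms(1)] assms(2) by (simp add: mw_def jf_simps ennreal_mult)
  also have "\<dots> = ennreal r * mw a"
    using assms by (simp add: mw_def nn_integral_cmult jf_unit_measurable CA.pos_A)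
  finally show ?thesis .
qed

text \<open>Fatou's lemma, since the values of \<open>jf\<close> at units depend continuously on the
  operator.\<close>

lemma mw_lsc: assumes a: "\<And>n::nat. a n \<in> pos_cone CA" "a \<longlonglongrightarrow> x" and r: "\<And>n. mw (a n) \<le> r" shows "mw x \<le> r"
proof -
  have x: "x \<in> pos_cone CA" by (rule CA.pos_limit[OF a])
  have lim: "(\<lambda>n. ennreal (Re (jf (a n) (unit_arrow y)))) \<longlonglongrightarrow> ennreal (Re (jf x (unit_arrow y)))" for y
    by (intro tendsto_ennrealI tendsto_Re jf_tendsto a(2))
  have "mw x = (\<integral>\<^sup>+y. liminf (\<lambda>n. ennreal (Re (jf (a n) (unit_arrow y)))) \<partial>m)"
    using x lim_imp_Liminf[OF _ lim] by (simp add: mw_def)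
  also have "\<dots> \<le> liminf (\<lambda>n. \<integral>\<^sup>+y. ennreal (Re (jf (a n) (unit_arrow y))) \<partial>m)"
    by (rule nn_integral_liminf) (use a in \<open>auto intro: jf_unit_measurable CA.pos_A\<close>)
  also have "\<dots> = liminf (\<lambda>n. mw (a n))" using a by (simp add: mw_def)
  also have "\<dots> \<le> liminf (\<lambda>n::nat. r)" by (rule Liminf_mono) (use r in auto)
  finally show ?thesis by (simp add: Liminf_const)
qed

text \<open>A positive element is a square; approximating its root by compactly supported functions
  gives squares of finite weight.\<close>

lemma mw_dense: "pos_cone CA \<subseteq> closure {a \<in> pos_cone CA. mw a < \<infinity>}"
proof
  fix a assume "a \<in> pos_cone CA"
  then obtain b where b: "a = op_adj b o\<^sub>L b" "b \<in> CA" by (auto simp: pos_cone_def)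
  obtain f where f: "\<And>n::nat. f n \<in> CG" "(\<lambda>n. lam (f n)) \<longlonglongrightarrow> b" by (rule CA_approx[OF b(2)]) (rule that)
  have l: "lam (f n) \<in> CA" for n by (rule lam_CA[OF f(1)])
  have "(\<lambda>n. op_adj (lam (f n)) o\<^sub>L lam (f n)) \<longlonglongrightarrow> a" unfolding b(1)
    by (intro bounded_bilinear.tendsto[OF bounded_bilinear_blinfun_compose] CA.op_adj_tendsto l f(2))
  moreover have "op_adj (lam (f n)) o\<^sub>L lam (f n) \<in> {a \<in> pos_cone CA. mw a < \<infinity>}" for n
    using CG_square_finite[OF f(1)] by (simp add: CA.adj_mult_pos[OF l] mw_sq[OF l] jf_lam[OF f(1)])
  ultimately show "a \<in> closure {a \<in> pos_cone CA. mw a < \<infinity>}" unfolding closure_sequential by (intro exI conjI allI)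
qed

lemma outer_regular: assumes "B \<in> sets borel" shows "emeasure m B = (INF U\<in>{U. open U \<and> B \<subseteq> U}. emeasure m U)"
  and inner_regular: "emeasure m B = (SUP K\<in>{K. compact K \<and> K \<subseteq> B}. emeasure m K)"
proof -
  have B: "B \<in> sets m" using assms by simp
  have "\<forall>B\<in>sets m. emeasure m B = (INF U\<in>{U. open U \<and> B \<subseteq> U}. emeasure m U)"
    and "\<forall>B\<in>sets m. emeasure m B = (SUP K\<in>{K. compact K \<and> K \<subseteq> B}. emeasure m K)"
    using regular unfolding regular_measure_def by blast+
  from this[THEN bspec, OF B] show "emeasure m B = (INF U\<in>{U. open U \<and> B \<subseteq> U}. emeasure m U)"
    "emeasure m B = (SUP K\<in>{K. compact K \<and> K \<subseteq> B}. emeasure m K)" .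
qed

lemma mw_nonzero: assumes "emeasure m UNIV \<noteq> 0" shows "\<exists>a\<in>pos_cone CA. mw a \<noteq> 0"
proof -
  have "emeasure m UNIV = (SUP K\<in>{K. compact K \<and> K \<subseteq> UNIV}. emeasure m K)"
    by (rule inner_regular) simp
  then obtain K where K: "compact K" "emeasure m K \<noteq> 0" using assms by (auto simp: bot_ennreal[symmetric])
  obtain v :: "'x \<Rightarrow> real" and L where v: "continuous_on UNIV v" "\<And>x. 0 \<le> v x" "\<And>x. v x \<le> 1" "\<And>x. x \<in> K \<Longrightarrow> v x = 1"
    "compact L" "L \<subseteq> UNIV" "\<And>x. x \<notin> L \<Longrightarrow> v x = 0" by (rule bump_X[OF K(1) open_UNIV subset_UNIV]) (rule that)
  have vC: "v \<in> Cpos" using v by (auto simp: Cpos_def)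
  have "emeasure m K = (\<integral>\<^sup>+x. indicator K x \<partial>m)" using compact_imp_closed[OF K(1)] by simp
  also have "\<dots> \<le> (\<integral>\<^sup>+x. ennreal (v x) \<partial>m)" by (intro nn_integral_mono) (auto simp: indicator_def v)
  also have "\<dots> = mw (mop v)" by (rule mw_mop[OF vC, symmetric])
  finally have "mw (mop v) \<noteq> 0" using K(2) by auto
  then show ?thesis using mop_pos[OF vC] by blast
qed

lemma proper_mw: assumes "emeasure m UNIV \<noteq> 0" shows "proper_weight CA mw"
  unfolding proper_weight_def weight_def
proof (intro conjI ballI allI impI mw_nonzero assms mw_dense mw_add mw_scale)
  show "mw \<in> extensional (pos_cone CA)" by (simp add: mw_def)
  fix r :: real
  let ?S = "{a \<in> pos_cone CA. mw a \<le> ennreal r}"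
  have "?S = pos_cone CA \<inter> closure ?S"
  proof (intro antisym subsetI IntI)
    fix x assume x: "x \<in> pos_cone CA \<inter> closure ?S"
    then have "\<exists>a. (\<forall>n::nat. a n \<in> ?S) \<and> a \<longlonglongrightarrow> x" using closure_sequential[of x ?S] by blast
    then obtain a where a: "\<forall>n::nat. a n \<in> ?S" "a \<longlonglongrightarrow> x" by (elim exE conjE)
    have "mw x \<le> ennreal r" by (rule mw_lsc[OF _ a(2)]) (use a(1) in auto)
    then show "x \<in> ?S" using x by simp
  qed (auto intro: closure_subset[THEN subsetD])
  then show "closedin (top_of_set (pos_cone CA)) ?S" unfolding closedin_closed using closed_closure by blast
qed auto

end

text \<open>The weight only sees the coefficients at units, where every cocycle vanishes.\<close>

lemma (in lh_cocycle) mw_invariant: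
  assumes "lh_measure \<phi> m" shows "weight_invariant CA (dyn (Gam \<phi>) c) (lh_measure.mw \<phi> m)"
proof -
  interpret lh_measure \<phi> m by (rule assms)
  interpret A: cstar_action CA "dyn (Gam \<phi>) c" by (rule cstar_action_dyn)
  show ?thesis unfolding weight_invariant_def
  proof (intro allI ballI)
    fix t a assume a: "a \<in> pos_cone CA"
    then show "mw (dyn (Gam \<phi>) c t a) = mw a"
      using A.act_pos[OF a] CA.pos_A[OF a] by (simp add: mw_def dyn_eq jf_act)
  qed
qed

lemma (in lh_space) gauge_hom: "continuous_hom (Gam \<phi>) gauge_cocycle"
proof -
  have "continuous_map T euclideanreal (of_int \<circ> kg)"
    by (rule continuous_map_compose[OF continuous_kg]) simp
  moreover have "(gauge_cocycle :: 'x arrow \<Rightarrow> real) = of_int \<circ> kg" by (auto simp: gauge_cocycle_def fun_eq_iff)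
  moreover have "gauge_cocycle (gmul g h) = gauge_cocycle g + gauge_cocycle h" for g h :: "'x arrow"
    by (simp add: gauge_cocycle_def gmul_def case_prod_beta)
  ultimately show ?thesis unfolding continuous_hom_def by simp
qed

section \<open>Fourier--Laplace integrals on a strip\<close>

lemma exp_minus_one_bound: "cmod (exp u - 1) \<le> cmod u * exp (cmod u)"
proof -
  have "cmod (exp u - exp 0) \<le> exp (cmod u) * cmod (u - 0)"
  proof (rule field_differentiable_bound[of "cball 0 (cmod u)"])
    show "(exp has_field_derivative exp z) (at z within cball 0 (cmod u))" for z :: complex
      by (rule has_field_derivative_at_within[OF DERIV_exp])
    fix z :: complex assume "z \<in> cball 0 (cmod u)"
    then show "cmod (exp z) \<le> exp (cmod u)" using norm_exp[of z] by (simp add: order_trans[OF _ exp_le_cancel_iff[THEN iffD2]])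
  qed auto
  then show ?thesis by (simp add: mult.commute)
qed

text \<open>The exponent \<open>- y * t\<close> lies between 0 and \<open>- \<beta> * t\<close>
  whatever the signs, so the exponential is at most the sum of the two extreme values.\<close>

lemma exp_strip_bound: assumes "min 0 \<beta> \<le> y" "y \<le> max 0 \<beta>" shows "exp (- y * t) \<le> 1 + exp (- \<beta> * (t::real))"
proof -
  have "- y * t \<le> 0 \<or> - y * t \<le> - \<beta> * t"
  proof (cases "0 \<le> \<beta>")
    case True
    then show ?thesis using assms mult_nonneg_nonneg[of y t] mult_right_mono_neg[of y \<beta> t] by (cases "0 \<le> t") auto
  next
    case False
    then show ?thesis using assms mult_nonpos_nonpos[of y t] mult_right_mono[of \<beta> y t] by (cases "0 \<le> t") auto
  qed
  then show ?thesis
  proof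
    assume "- y * t \<le> 0"
    then have "exp (- y * t) \<le> 1" using exp_le_one_iff by blast
    then show ?thesis using exp_gt_zero[of "- \<beta> * t"] by linarith
  next
    assume "- y * t \<le> - \<beta> * t"
    then have "exp (- y * t) \<le> exp (- \<beta> * t)" by simp
    then show ?thesis by linarith
  qed
qed

text \<open>Integrability on the two edges of the strip yields, with the majorant \<open>D\<close>,
  dominated convergence on all of it.\<close>

locale strip_integrand =
  fixes M :: "'g measure" and h :: "'g \<Rightarrow> complex" and c :: "'g \<Rightarrow> real" and \<beta> :: real
  assumes cm: "c \<in> borel_measurable M" and h: "integrable M h" and hb: "integrable M (\<lambda>g. exp (- \<beta> * c g) *\<^sub>R h g)"
begin

definition F :: "complex \<Rightarrow> complex" where "F z = (\<integral>g. h g * exp (\<i> * z * c g) \<partial>M)"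
definition D :: "'g \<Rightarrow> real" where "D g = (1 + exp (- \<beta> * c g)) * cmod (h g)"

lemma D: "integrable M D"
proof -
  have "integrable M (\<lambda>g. cmod (h g) + cmod (exp (- \<beta> * c g) *\<^sub>R h g))"
    by (intro Bochner_Integration.integrable_add integrable_norm h hb)
  then show ?thesis by (simp add: D_def[abs_def] distrib_right)
qed

lemma meas: "(\<lambda>g. h g * exp (\<i> * z * c g)) \<in> borel_measurable M"
proof -
  have [measurable]: "c \<in> borel_measurable M" "h \<in> borel_measurable M" using cm h by auto
  have "(\<lambda>g. \<i> * z * complex_of_real (c g)) \<in> borel_measurable M" by measurable
  then have "(\<lambda>g. exp (\<i> * z * complex_of_real (c g))) \<in> borel_measurable M"
    by (rule measurable_compose[OF _ borel_measurable_continuous_onI]) (intro continuous_intros)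
  then show ?thesis by measurable
qed

lemma bound: assumes "z \<in> strip \<beta>" shows "norm (h g * exp (\<i> * z * c g)) \<le> D g"
proof -
  have "exp (- Im z * c g) \<le> 1 + exp (- \<beta> * c g)" by (rule exp_strip_bound) (use assms in \<open>auto simp: strip_def\<close>)
  from mult_right_mono[OF this norm_ge_zero[of "h g"]] show ?thesis by (simp add: D_def norm_mult mult.commute)
qed

lemma integrable: assumes "z \<in> strip \<beta>" shows "integrable M (\<lambda>g. h g * exp (\<i> * z * c g))"
  by (rule Bochner_Integration.integrable_bound[OF D meas]) (use bound[OF assms] order_trans[OF _ abs_ge_self] in auto)

lemma continuous: "continuous_on (strip \<beta>) F"
proof (rule continuous_on_sequentiallyI)
  fix u a assume u: "\<forall>n. u n \<in> strip \<beta>" "a \<in> strip \<beta>" "u \<longlonglongrightarrow> a"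
  show "(\<lambda>n. F (u n)) \<longlonglongrightarrow> F a" unfolding F_def
  proof (rule integral_dominated_convergence[OF meas meas D])
    show "AE g in M. (\<lambda>n. h g * exp (\<i> * u n * c g)) \<longlonglongrightarrow> h g * exp (\<i> * a * c g)"
      by (intro AE_I2 tendsto_intros u(3))
    show "AE g in M. norm (h g * exp (\<i> * u n * c g)) \<le> D g" for n using bound u(1) by auto
  qed
qed

lemma bounded: "bounded (F ` strip \<beta>)"
proof (rule boundedI)
  fix w assume "w \<in> F ` strip \<beta>"
  then obtain z where z: "z \<in> strip \<beta>" "w = F z" by blast
  have "norm (F z) \<le> (\<integral>g. norm (h g * exp (\<i> * z * c g)) \<partial>M)" unfolding F_def by (rule integral_norm_bound)
  also have "\<dots> \<le> (\<integral>g. D g \<partial>M)" by (intro integral_mono integrable_norm integrable z D bound)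
  finally show "norm w \<le> (\<integral>g. D g \<partial>M)" using z by simp
qed

text \<open>The difference quotient brings a factor \<open>\<bar>c g\<bar>\<close>, which is
  absorbed in \<open>exp (\<delta> * \<bar>c g\<bar>) / \<delta>\<close>; moving from
  \<open>z\<close> to \<open>w\<close> costs another such exponential. Together they shift the
  imaginary part by at most \<open>2 * \<delta>\<close>, still inside the strip.\<close>

lemma quotient_bound:
  assumes \<delta>: "0 < \<delta>" "min 0 \<beta> \<le> Im z - 2 * \<delta>" "Im z + 2 * \<delta> \<le> max 0 \<beta>" and w: "w \<noteq> z" "cmod (w - z) \<le> \<delta>"
  shows "norm (h g * ((exp (\<i> * w * c g) - exp (\<i> * z * c g)) / (w - z))) \<le> 1 / \<delta> * D g"
proof -
  define u where "u = \<i> * (w - z) * c g"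
  have u: "cmod u = cmod (w - z) * \<bar>c g\<bar>" by (simp add: u_def norm_mult)
  have w0: "0 < cmod (w - z)" using w by simp
  have "exp (\<i> * w * c g) - exp (\<i> * z * c g) = (exp u - 1) * exp (\<i> * z * c g)"
    by (simp add: u_def algebra_simps exp_add[symmetric])
  then have "cmod (exp (\<i> * w * c g) - exp (\<i> * z * c g)) = cmod (exp u - 1) * exp (- Im z * c g)"
    by (simp add: norm_mult)
  also have "\<dots> \<le> (cmod u * exp (cmod u)) * exp (- Im z * c g)" by (rule mult_right_mono[OF exp_minus_one_bound]) simp
  also have "\<dots> \<le> (cmod u * exp (\<delta> * \<bar>c g\<bar>)) * exp (- Im z * c g)"
    unfolding u using w by (intro mult_right_mono mult_left_mono) (auto intro: mult_right_mono)
  also have "\<dots> = cmod (w - z) * (\<bar>c g\<bar> * exp (\<delta> * \<bar>c g\<bar>) * exp (- Im z * c g))" by (simp add: u)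
  finally have 1: "cmod (exp (\<i> * w * c g) - exp (\<i> * z * c g)) / cmod (w - z) \<le> \<bar>c g\<bar> * exp (\<delta> * \<bar>c g\<bar>) * exp (- Im z * c g)"
    using w0 by (simp add: divide_le_eq mult.commute)
  have "\<delta> * \<bar>c g\<bar> \<le> exp (\<delta> * \<bar>c g\<bar>)" using exp_ge_add_one_self[of "\<delta> * \<bar>c g\<bar>"] by linarith
  then have "\<bar>c g\<bar> \<le> 1 / \<delta> * exp (\<delta> * \<bar>c g\<bar>)" using \<delta>(1) by (simp add: field_simps)
  then have "\<bar>c g\<bar> * (exp (\<delta> * \<bar>c g\<bar>) * exp (- Im z * c g)) \<le> 1 / \<delta> * exp (\<delta> * \<bar>c g\<bar>) * (exp (\<delta> * \<bar>c g\<bar>) * exp (- Im z * c g))"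
    by (rule mult_right_mono) simp
  also have "\<dots> = 1 / \<delta> * exp (2 * \<delta> * \<bar>c g\<bar> - Im z * c g)" by (simp add: exp_add[symmetric] algebra_simps)
  also have "exp (2 * \<delta> * \<bar>c g\<bar> - Im z * c g) \<le> 1 + exp (- \<beta> * c g)"
  proof (cases "0 \<le> c g")
    case True
    have "exp (- (Im z - 2 * \<delta>) * c g) \<le> 1 + exp (- \<beta> * c g)" by (rule exp_strip_bound) (use \<delta> in auto)
    then show ?thesis using True by (simp add: algebra_simps)
  next
    case False
    have "exp (- (Im z + 2 * \<delta>) * c g) \<le> 1 + exp (- \<beta> * c g)" by (rule exp_strip_bound) (use \<delta> in auto)
    moreover have "2 * \<delta> * \<bar>c g\<bar> - Im z * c g = - (Im z + 2 * \<delta>) * c g" using False by (simp add: algebra_simps)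
    ultimately show ?thesis by simp
  qed
  finally have "\<bar>c g\<bar> * exp (\<delta> * \<bar>c g\<bar>) * exp (- Im z * c g) \<le> 1 / \<delta> * (1 + exp (- \<beta> * c g))"
    using \<delta>(1) by (simp add: mult.assoc divide_right_mono)
  with 1 have "cmod (exp (\<i> * w * c g) - exp (\<i> * z * c g)) / cmod (w - z) \<le> 1 / \<delta> * (1 + exp (- \<beta> * c g))" by linarith
  from mult_right_mono[OF this norm_ge_zero[of "h g"]] show ?thesis
    by (simp add: D_def norm_mult norm_divide mult.commute)
qed

lemma holomorphic: "F holomorphic_on interior (strip \<beta>)"
  unfolding holomorphic_on_open[OF open_interior]
proof
  fix z assume "z \<in> interior (strip \<beta>)"
  then obtain e where e: "0 < e" "cball z e \<subseteq> strip \<beta>" by (meson mem_interior_cball)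
  \<comment> \<open>Half the radius, because \<open>quotient_bound\<close> needs room
    \<open>2 * \<delta>\<close> on both sides.\<close>
  define \<delta> where "\<delta> = e / 2"
  have pm: "z - \<i> * e \<in> strip \<beta>" "z + \<i> * e \<in> strip \<beta>"
    using e by (auto intro!: subsetD[OF e(2)] simp: dist_norm norm_mult)
  have z: "z \<in> strip \<beta>" using e by auto
  have \<delta>: "0 < \<delta>" "min 0 \<beta> \<le> Im z - 2 * \<delta>" "Im z + 2 * \<delta> \<le> max 0 \<beta>" using pm e by (auto simp: strip_def \<delta>_def)
  let ?q = "\<lambda>w g. h g * ((exp (\<i> * w * c g) - exp (\<i> * z * c g)) / (w - z))"
  let ?G = "\<integral>g. h g * (\<i> * c g * exp (\<i> * z * c g)) \<partial>M"
  have "((\<lambda>w. (F w - F z) / (w - z)) \<longlongrightarrow> ?G) (at z)"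
    unfolding tendsto_at_iff_sequentially
  proof (intro allI impI)
    fix X :: "nat \<Rightarrow> complex" assume X: "\<forall>i. X i \<in> UNIV - {z}" "X \<longlonglongrightarrow> z"
    obtain N where N: "\<And>i. i \<ge> N \<Longrightarrow> cmod (X i - z) < \<delta>" using LIMSEQ_D[OF X(2) \<delta>(1)] by blast
    define Y where "Y i = X (i + N)" for i
    have Y: "Y i \<noteq> z" "cmod (Y i - z) \<le> \<delta>" for i using X(1) N[of "i + N"] by (auto simp: Y_def)
    have Yl: "Y \<longlonglongrightarrow> z" unfolding Y_def by (rule LIMSEQ_ignore_initial_segment[OF X(2)])
    have Ys: "Y i \<in> strip \<beta>" for i
      by (rule subsetD[OF e(2)]) (use Y(2)[of i] \<delta>(1) in \<open>auto simp: dist_norm norm_minus_commute \<delta>_def\<close>)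
    have eq: "(F (Y i) - F z) / (Y i - z) = (\<integral>g. ?q (Y i) g \<partial>M)" for i
    proof -
      have "F (Y i) - F z = (\<integral>g. h g * exp (\<i> * Y i * c g) - h g * exp (\<i> * z * c g) \<partial>M)"
        unfolding F_def by (rule Bochner_Integration.integral_diff[OF integrable[OF Ys] integrable[OF z], symmetric])
      then have "(F (Y i) - F z) / (Y i - z) = (\<integral>g. (h g * exp (\<i> * Y i * c g) - h g * exp (\<i> * z * c g)) / (Y i - z) \<partial>M)"
        by simp
      then show ?thesis by (simp add: right_diff_distrib diff_divide_distrib)
    qed
    have [measurable]: "c \<in> borel_measurable M" "h \<in> borel_measurable M" using cm h by auto
    have em: "(\<lambda>g. exp (\<i> * w * c g)) \<in> borel_measurable M" for w
    proof -
      have "(\<lambda>g. \<i> * w * complex_of_real (c g)) \<in> borel_measurable M" by measurable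
      then show ?thesis by (rule measurable_compose[OF _ borel_measurable_continuous_onI]) (intro continuous_intros)
    qed
    have "(\<lambda>i. \<integral>g. ?q (Y i) g \<partial>M) \<longlonglongrightarrow> ?G"
    proof (rule integral_dominated_convergence[where w = "\<lambda>g. 1 / \<delta> * D g"])
      show "(\<lambda>g. h g * (\<i> * c g * exp (\<i> * z * c g))) \<in> borel_measurable M" using em[of z] by measurable
      show "?q (Y i) \<in> borel_measurable M" for i using em[of z] em[of "Y i"] by measurable
      show "integrable M (\<lambda>g. 1 / \<delta> * D g)" by (rule integrable_mult_right[OF D])
      show "AE g in M. norm (?q (Y i) g) \<le> 1 / \<delta> * D g" for i using quotient_bound[OF \<delta> Y(1,2)] by auto
      show "AE g in M. (\<lambda>i. ?q (Y i) g) \<longlonglongrightarrow> h g * (\<i> * c g * exp (\<i> * z * c g))"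
      proof (intro AE_I2 tendsto_mult tendsto_const)
        fix g
        have "((\<lambda>w. exp (\<i> * w * c g)) has_field_derivative \<i> * c g * exp (\<i> * z * c g)) (at z)"
          by (auto intro!: derivative_eq_intros)
        then have "((\<lambda>w. (exp (\<i> * w * c g) - exp (\<i> * z * c g)) / (w - z)) \<longlongrightarrow> \<i> * c g * exp (\<i> * z * c g)) (at z)"
          by (simp add: has_field_derivative_iff)
        then show "(\<lambda>i. (exp (\<i> * Y i * c g) - exp (\<i> * z * c g)) / (Y i - z)) \<longlonglongrightarrow> \<i> * c g * exp (\<i> * z * c g)"
          unfolding tendsto_at_iff_sequentially comp_def using Y(1) Yl by auto
      qed
    qed
    then have "(\<lambda>i. (F (X (i + N)) - F z) / (X (i + N) - z)) \<longlonglongrightarrow> ?G" by (simp add: eq[unfolded Y_def] Y_def)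
    then show "((\<lambda>w. (F w - F z) / (w - z)) \<circ> X) \<longlonglongrightarrow> ?G" unfolding comp_def by (rule LIMSEQ_offset)
  qed
  then show "\<exists>f'. (F has_field_derivative f') (at z)" by (auto simp: has_field_derivative_iff)
qed

end

section \<open>Conformal measures define KMS weights\<close>

locale lh_cocycle_measure = lh_cocycle \<phi> c + lh_measure \<phi> m
  for \<phi> :: "'x::{t2_space, second_countable_topology} \<Rightarrow> 'x" and c :: "'x arrow \<Rightarrow> real" and m :: "'x measure"
begin

lemma c_MG: "c \<in> borel_measurable MG" by (rule measurable_MG[OF continuous_c])

text \<open>The image of \<open>\<nu>\<close> under inversion, weighted by what becomes its
  Radon-Nikodym cocycle in the conformal case.\<close>

definition inv_nu :: "real \<Rightarrow> 'x arrow measure" where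
  "inv_nu \<beta> = density (distr \<nu> MG ginverse) (\<lambda>g. ennreal (exp (\<beta> * c g)))"

lemma ginverse_nu: "ginverse \<in> measurable \<nu> MG" using ginverse_MG by (simp add: measurable_nu)

lemma exp_c_MG: "(\<lambda>g. exp (r * c g)) \<in> borel_measurable MG" using c_MG by measurable

lemma nn_integral_inv:
  assumes F: "F \<in> borel_measurable MG"
  shows "(\<integral>\<^sup>+g. F g \<partial>inv_nu \<beta>) = (\<integral>\<^sup>+g. ennreal (exp (- \<beta> * c g)) * F (ginverse g) \<partial>\<nu>)"
proof -
  have e: "(\<lambda>g. ennreal (exp (\<beta> * c g))) \<in> borel_measurable MG" using exp_c_MG by measurable
  have "(\<integral>\<^sup>+g. F g \<partial>inv_nu \<beta>) = (\<integral>\<^sup>+g. ennreal (exp (\<beta> * c g)) * F g \<partial>distr \<nu> MG ginverse)"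
    unfolding inv_nu_def by (rule nn_integral_density) (use e F in simp_all)
  also have "\<dots> = (\<integral>\<^sup>+g. ennreal (exp (\<beta> * c (ginverse g))) * F (ginverse g) \<partial>\<nu>)"
    by (rule nn_integral_distr[OF ginverse_nu]) (use e F in simp)
  also have "\<dots> = (\<integral>\<^sup>+g. ennreal (exp (- \<beta> * c g)) * F (ginverse g) \<partial>\<nu>)"
    by (rule nn_integral_cong) (simp add: c_ginverse)
  finally show ?thesis .
qed

text \<open>Inversion carries \<open>W\<close> to a bisection whose sources are the ranges of
  \<open>W\<close>, and it changes the sign of \<open>c\<close>.\<close>

lemma emeasure_inv_bisection:
  assumes W: "bisection W"
  shows "emeasure (inv_nu \<beta>) W = (\<integral>\<^sup>+x\<in>rg ` W. ennreal (exp (\<beta> * c (rsec W x))) \<partial>m)"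
proof -
  have o: "openin T W" using W bisection_iff by blast
  have W': "bisection (ginverse ` W)" by (rule bisection_ginverse[OF W])
  have s: "W \<in> sets MG" "ginverse ` W \<in> sets MG" using o openin_ginverse[OF o] by (auto intro: open_MG)
  have "emeasure (inv_nu \<beta>) W = (\<integral>\<^sup>+g. indicator W g \<partial>inv_nu \<beta>)" using s by (simp add: inv_nu_def)
  also have "\<dots> = (\<integral>\<^sup>+g. ennreal (exp (- \<beta> * c g)) * indicator W (ginverse g) \<partial>\<nu>)"
    by (rule nn_integral_inv) (use s in simp)
  also have "\<dots> = (\<integral>\<^sup>+g. ennreal (exp (- \<beta> * c g)) * indicator (ginverse ` W) g \<partial>\<nu>)"
    by (intro nn_integral_cong) (simp add: indicator_def image_ginverse_iff)
  also have "\<dots> = (\<integral>\<^sup>+x. ennreal (exp (- \<beta> * c (sec (ginverse ` W) x))) * indicator (sg ` ginverse ` W) x \<partial>m)"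
  proof (subst nn_integral_nu)
    show "(\<lambda>g. ennreal (exp (- \<beta> * c g)) * indicator (ginverse ` W) g) \<in> borel_measurable MG"
      using exp_c_MG[of "- \<beta>"] s by measurable
  qed (simp only: nn_integral_fib_bisection[OF W', where F = "\<lambda>g. ennreal (exp (- \<beta> * c g))"])
  also have "\<dots> = (\<integral>\<^sup>+x\<in>rg ` W. ennreal (exp (\<beta> * c (rsec W x))) \<partial>m)"
  proof (rule nn_integral_cong)
    fix x
    have "sec (ginverse ` W) x = ginverse (rsec W x) \<and> rsec W x \<in> \<Gamma>" if "x \<in> rg ` W"
      using sec(1)[OF W', of "ginverse (rsec W x)"] rsec(2,3)[OF W that] bisection_sub[OF W] by (auto simp: image_ginverse_iff)
    then show "ennreal (exp (- \<beta> * c (sec (ginverse ` W) x))) * indicator (sg ` ginverse ` W) x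
        = ennreal (exp (\<beta> * c (rsec W x))) * indicator (rg ` W) x"
      by (cases "x \<in> rg ` W") (auto simp: rg_image_ginverse(1)[symmetric] c_ginverse)
  qed
  finally show ?thesis .
qed

text \<open>On a bisection the two sides of the conformality equation are the masses under
  \<open>\<nu>\<close> and \<open>inv_nu\<close>, and bisections determine measures.\<close>

lemma conformal_iff: "conformal_measure (Gam \<phi>) c \<beta> m \<longleftrightarrow> emeasure m UNIV \<noteq> 0 \<and> \<nu> = inv_nu \<beta>"
proof -
  have "(\<forall>W. bisection W \<longrightarrow> emeasure m (src (Gam \<phi>) ` W) =
      (\<integral>\<^sup>+x\<in>rng (Gam \<phi>) ` W. ennreal (exp (\<beta> * c (the_inv_into W (rng (Gam \<phi>)) x))) \<partial>m)) \<longleftrightarrow>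
    (\<forall>W. bisection W \<longrightarrow> emeasure \<nu> W = emeasure (inv_nu \<beta>) W)"
    by (simp add: emeasure_inv_bisection emeasure_nu_bisection rsec_def)
  also have "\<dots> \<longleftrightarrow> \<nu> = inv_nu \<beta>"
    using measure_eq_bisections[of "inv_nu \<beta>"] by (auto simp: inv_nu_def)
  finally show ?thesis using regular unfolding conformal_measure_def by blast
qed

end

section \<open>The linear extension as an inner product of coefficient functions\<close>

lemma integrable_cnj_mult:
  fixes p q :: "'g \<Rightarrow> complex"
  assumes [measurable]: "p \<in> borel_measurable M" "q \<in> borel_measurable M"
    and i: "integrable M (\<lambda>g. (cmod (p g))\<^sup>2)" "integrable M (\<lambda>g. (cmod (q g))\<^sup>2)"
  shows "integrable M (\<lambda>g. cnj (p g) * q g)"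
proof (rule Bochner_Integration.integrable_bound[OF Bochner_Integration.integrable_add[OF i]])
  have "(\<lambda>g. cnj (p g)) \<in> borel_measurable M"
    by (rule measurable_compose[OF assms(1) borel_measurable_continuous_onI]) (intro continuous_intros)
  then show "(\<lambda>g. cnj (p g) * q g) \<in> borel_measurable M" by measurable
  show "AE g in M. norm (cnj (p g) * q g) \<le> norm ((cmod (p g))\<^sup>2 + (cmod (q g))\<^sup>2)"
  proof (rule AE_I2)
    fix g
    have "0 \<le> (cmod (p g) - cmod (q g))\<^sup>2" by simp
    then have "2 * (cmod (p g) * cmod (q g)) \<le> (cmod (p g))\<^sup>2 + (cmod (q g))\<^sup>2" by (simp add: power2_diff)
    moreover have "0 \<le> cmod (p g) * cmod (q g)" by simp
    ultimately show "norm (cnj (p g) * q g) \<le> norm ((cmod (p g))\<^sup>2 + (cmod (q g))\<^sup>2)"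
      unfolding norm_mult complex_mod_cnj real_norm_def by linarith
  qed
qed

lemma cnj_mult_polar:
  "4 * (cnj p * q) = complex_of_real ((cmod (p + q))\<^sup>2) - complex_of_real ((cmod (p - q))\<^sup>2) +
    (- \<i> * complex_of_real ((cmod (p + \<i> * q))\<^sup>2) + \<i> * complex_of_real ((cmod (p - \<i> * q))\<^sup>2))"
  unfolding complex_norm_square by (simp add: algebra_simps)

locale lh_weight = lh_measure +
  assumes nonzero: "emeasure m UNIV \<noteq> 0"
begin

sublocale W: cstar_weight CA mw by unfold_locales (rule proper_mw[OF nonzero])

lemma jf_nu: "a \<in> CA \<Longrightarrow> jf a \<in> borel_measurable \<nu>" using jf_MG by (simp add: measurable_nu)

lemma square_nu: "a \<in> CA \<Longrightarrow> (\<lambda>g. (cmod (jf a g))\<^sup>2) \<in> borel_measurable \<nu>" using jf_nu by measurable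

lemma N_iff: "a \<in> W.\<N> \<longleftrightarrow> a \<in> CA \<and> integrable \<nu> (\<lambda>g. (cmod (jf a g))\<^sup>2)"
  unfolding W.weight_N_iff W.sq_def using mw_sq square_nu by (auto simp: integrable_iff_bounded)

lemma val_sq: assumes "a \<in> W.\<N>" shows "W.val (op_adj a o\<^sub>L a) = (\<integral>g. (cmod (jf a g))\<^sup>2 \<partial>\<nu>)"
proof -
  have a: "a \<in> CA" "integrable \<nu> (\<lambda>g. (cmod (jf a g))\<^sup>2)" using assms by (auto simp: N_iff)
  show ?thesis unfolding W.val_def mw_sq[OF a(1)] by (rule integral_eq_nn_integral[symmetric]) (use square_nu a in auto)
qed

text \<open>Both sides are sesquilinear and agree on squares by \<open>val_sq\<close>, so
  polarization on either side identifies them.\<close>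

lemma ext_eq: assumes a: "a \<in> W.\<N>" and b: "b \<in> W.\<N>"
  shows "W.ext (op_adj a o\<^sub>L b) = (\<integral>g. cnj (jf a g) * jf b g \<partial>\<nu>)" "integrable \<nu> (\<lambda>g. cnj (jf a g) * jf b g)"
proof -
  have aN: "a \<in> CA" "integrable \<nu> (\<lambda>g. (cmod (jf a g))\<^sup>2)" "b \<in> CA" "integrable \<nu> (\<lambda>g. (cmod (jf b g))\<^sup>2)"
    using a b by (auto simp: N_iff)
  show int: "integrable \<nu> (\<lambda>g. cnj (jf a g) * jf b g)" by (rule integrable_cnj_mult) (use aN jf_nu in auto)
  have i: "\<And>x. x \<in> W.\<N> \<Longrightarrow> integrable \<nu> (\<lambda>g. complex_of_real ((cmod (jf x g))\<^sup>2))"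
    using N_iff by (intro integrable_of_real) blast
  have v: "complex_of_real (W.val (op_adj x o\<^sub>L x)) = (\<integral>g. complex_of_real ((cmod (jf x g))\<^sup>2) \<partial>\<nu>)" if x: "x \<in> W.\<N>" for x
  proof -
    have "integrable \<nu> (\<lambda>g. (cmod (jf x g))\<^sup>2)" using x N_iff by blast
    from integral_of_real[OF this, where 'a = complex] show ?thesis unfolding val_sq[OF x] by (rule sym)
  qed
  have ib: "op_scale \<i> b \<in> W.\<N>" by (rule W.weight_N_scale[OF b])
  note N = W.weight_N_add[OF a b] W.weight_N_diff[OF a b] W.weight_N_add[OF a ib] W.weight_N_diff[OF a ib]
  have "4 * W.ext (op_adj a o\<^sub>L b) = (\<integral>g. 4 * (cnj (jf a g) * jf b g) \<partial>\<nu>)"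
    unfolding W.ext_polar[OF a b] cnj_mult_polar v[OF N(1)] v[OF N(2)] v[OF N(3)] v[OF N(4)]
    using i[OF N(1)] i[OF N(2)] i[OF N(3)] i[OF N(4)] by (simp add: jf_simps)
  also have "\<dots> = 4 * (\<integral>g. cnj (jf a g) * jf b g \<partial>\<nu>)" by simp
  finally show "W.ext (op_adj a o\<^sub>L b) = (\<integral>g. cnj (jf a g) * jf b g \<partial>\<nu>)" by simp
qed

end

locale lh_conformal = lh_cocycle_measure +
  fixes \<beta> :: real
  assumes conformal: "conformal_measure (Gam \<phi>) c \<beta> m"
begin

sublocale lh_weight \<phi> m using conformal by unfold_locales (simp add: conformal_measure_def)

lemma nu_inv: "\<nu> = inv_nu \<beta>" using conformal conformal_iff by blast

lemma change_of_variables: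
  fixes f :: "'a arrow \<Rightarrow> complex"
  assumes f: "f \<in> borel_measurable MG"
  shows "integrable \<nu> f \<longleftrightarrow> integrable \<nu> (\<lambda>g. exp (- \<beta> * c g) *\<^sub>R f (ginverse g))"
    "(\<integral>g. f g \<partial>\<nu>) = (\<integral>g. exp (- \<beta> * c g) *\<^sub>R f (ginverse g) \<partial>\<nu>)"
proof -
  have e: "(\<lambda>g. exp (\<beta> * c g)) \<in> borel_measurable MG" by (rule exp_c_MG)
  have ef: "(\<lambda>g. exp (\<beta> * c g) *\<^sub>R f g) \<in> borel_measurable MG" using e f by measurable
  have cong1: "integrable \<nu> (\<lambda>g. exp (\<beta> * c (ginverse g)) *\<^sub>R f (ginverse g)) \<longleftrightarrow> integrable \<nu> (\<lambda>g. exp (- \<beta> * c g) *\<^sub>R f (ginverse g))"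
    by (rule Bochner_Integration.integrable_cong[OF refl]) (simp add: c_ginverse)
  have cong2: "(\<integral>g. exp (\<beta> * c (ginverse g)) *\<^sub>R f (ginverse g) \<partial>\<nu>) = (\<integral>g. exp (- \<beta> * c g) *\<^sub>R f (ginverse g) \<partial>\<nu>)"
    by (rule Bochner_Integration.integral_cong[OF refl]) (simp add: c_ginverse)
  have "integrable \<nu> f \<longleftrightarrow> integrable (inv_nu \<beta>) f" using nu_inv by simp
  also have "\<dots> \<longleftrightarrow> integrable (distr \<nu> MG ginverse) (\<lambda>g. exp (\<beta> * c g) *\<^sub>R f g)"
    unfolding inv_nu_def by (rule integrable_density) (use e f in auto)
  also have "\<dots> \<longleftrightarrow> integrable \<nu> (\<lambda>g. exp (\<beta> * c (ginverse g)) *\<^sub>R f (ginverse g))"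
    by (rule integrable_distr_eq[OF ginverse_nu ef])
  also note cong1
  finally show "integrable \<nu> f \<longleftrightarrow> integrable \<nu> (\<lambda>g. exp (- \<beta> * c g) *\<^sub>R f (ginverse g))" .
  have "(\<integral>g. f g \<partial>\<nu>) = (\<integral>g. f g \<partial>inv_nu \<beta>)" using nu_inv by simp
  also have "\<dots> = (\<integral>g. exp (\<beta> * c g) *\<^sub>R f g \<partial>distr \<nu> MG ginverse)"
    unfolding inv_nu_def by (rule integral_density) (use e f in auto)
  also have "\<dots> = (\<integral>g. exp (\<beta> * c (ginverse g)) *\<^sub>R f (ginverse g) \<partial>\<nu>)"
    by (rule integral_distr[OF ginverse_nu ef])
  also note cong2
  finally show "(\<integral>g. f g \<partial>\<nu>) = (\<integral>g. exp (- \<beta> * c g) *\<^sub>R f (ginverse g) \<partial>\<nu>)" .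
qed

lemma act_N: assumes "b \<in> W.\<N>" shows "act t b \<in> W.\<N>"
  using assms by (auto simp: N_iff act_CA jf_act norm_mult)

lemma op_adj_act: assumes "b \<in> CA" shows "op_adj (act t b) = act t (op_adj b)"
  by (rule CA.op_adj_eq[OF act_CA[OF assms] act_is_adj[OF CA.is_adj_op_adj[OF assms]]])

text \<open>The integrand \<open>h\<close> is integrable because \<open>jf (op_adj a)\<close> and
  \<open>jf b\<close> are square-integrable. For the other edge, the product in reverse order is
  integrable for the same reason, and inversion turns it into \<open>h\<close> times the factor
  \<open>exp (- \<beta> * c g)\<close>.\<close>

lemma KMS_condition:
  assumes a: "a \<in> W.\<N>" "a \<in> op_adj ` W.\<N>" and b: "b \<in> W.\<N>" "b \<in> op_adj ` W.\<N>"
  shows "\<exists>F :: complex \<Rightarrow> complex. continuous_on (strip \<beta>) F \<and> bounded (F ` strip \<beta>) \<and> F holomorphic_on interior (strip \<beta>) \<and>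
    (\<forall>t::real. F (complex_of_real t) = W.ext (a o\<^sub>L dyn (Gam \<phi>) c t b)) \<and>
    (\<forall>t::real. F (complex_of_real t + \<i> * complex_of_real \<beta>) = W.ext (dyn (Gam \<phi>) c t b o\<^sub>L a))"
proof -
  have A: "a \<in> CA" "b \<in> CA" using a b W.weight_N_A by auto
  have as: "op_adj a \<in> W.\<N>" "op_adj b \<in> W.\<N>"
    using a(2) b(2) CA.op_adj_simps(1)[OF W.weight_N_A] by auto
  define h where "h g = jf a (ginverse g) * jf b g" for g
  have adj: "cnj (jf (op_adj x) g) = jf x (ginverse g)" if "x \<in> CA" for x g using jf_adj[OF that] by simp
  have left: "W.ext (a o\<^sub>L act t b) = (\<integral>g. h g * cis (t * c g) \<partial>\<nu>)" "integrable \<nu> h" for t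
    using ext_eq(1)[OF as(1) act_N[OF b(1)], of t] ext_eq(2)[OF as(1) b(1)]
    by (simp_all add: CA.op_adj_simps(1)[OF A(1)] adj[OF A(1)] jf_act A h_def[abs_def] mult.assoc mult.commute[of "cis _"])
  let ?k = "\<lambda>t g. jf b (ginverse g) * cis (- (t * c g)) * jf a g"
  have right: "W.ext (act t b o\<^sub>L a) = (\<integral>g. ?k t g \<partial>\<nu>)" "integrable \<nu> (?k t)" for t
  proof -
    have N: "op_adj (act t b) \<in> W.\<N>" unfolding op_adj_act[OF A(2)] by (rule act_N[OF as(2)])
    have eq: "cnj (jf (op_adj (act t b)) g) * jf a g = ?k t g" if "g \<in> space \<nu>" for g
      using that by (simp add: adj[OF act_CA[OF A(2)]] jf_act A c_ginverse)
    show "W.ext (act t b o\<^sub>L a) = (\<integral>g. ?k t g \<partial>\<nu>)"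
    proof -
      have "(\<integral>g. cnj (jf (op_adj (act t b)) g) * jf a g \<partial>\<nu>) = (\<integral>g. ?k t g \<partial>\<nu>)"
        by (rule Bochner_Integration.integral_cong[OF refl]) (rule eq)
      then show ?thesis using ext_eq(1)[OF N a(1)] by (simp add: CA.op_adj_simps(1)[OF act_CA[OF A(2)]])
    qed
    have "integrable \<nu> (\<lambda>g. cnj (jf (op_adj (act t b)) g) * jf a g) \<longleftrightarrow> integrable \<nu> (?k t)"
      by (rule Bochner_Integration.integrable_cong[OF refl]) (rule eq)
    then show "integrable \<nu> (?k t)" using ext_eq(2)[OF N a(1)] by blast
  qed
  have km: "?k t \<in> borel_measurable MG" for t using right(2)[of t] by (auto simp: measurable_nu[symmetric])
  \<comment> \<open>After inversion the integrand is that of the Fourier-Laplace integral at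
    \<open>t + \<i> * \<beta>\<close>.\<close>
  have cv: "exp (- \<beta> * c g) *\<^sub>R ?k t (ginverse g) = exp (- \<beta> * c g) *\<^sub>R (h g * cis (t * c g))" if "g \<in> space \<nu>" for t g
    using that by (simp add: h_def c_ginverse mult.commute mult.left_commute)
  have right': "W.ext (act t b o\<^sub>L a) = (\<integral>g. exp (- \<beta> * c g) *\<^sub>R (h g * cis (t * c g)) \<partial>\<nu>)" for t
    unfolding right(1) change_of_variables(2)[OF km] by (rule Bochner_Integration.integral_cong[OF refl]) (rule cv)
  have hb: "integrable \<nu> (\<lambda>g. exp (- \<beta> * c g) *\<^sub>R h g)"
  proof -
    have "integrable \<nu> (\<lambda>g. exp (- \<beta> * c g) *\<^sub>R ?k 0 (ginverse g)) \<longleftrightarrow> integrable \<nu> (\<lambda>g. exp (- \<beta> * c g) *\<^sub>R (h g * cis (0 * c g)))"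
      by (rule Bochner_Integration.integrable_cong[OF refl]) (rule cv)
    then have "integrable \<nu> (\<lambda>g. exp (- \<beta> * c g) *\<^sub>R (h g * cis (0 * c g)))"
      using change_of_variables(1)[OF km, THEN iffD1, OF right(2)] by blast
    then show ?thesis by simp
  qed
  interpret S: strip_integrand \<nu> h c \<beta>
    by unfold_locales (use c_MG left(2) hb in \<open>simp_all add: measurable_nu\<close>)
  show ?thesis
  proof (intro exI[of _ S.F] conjI allI S.continuous S.bounded S.holomorphic)
    show "S.F (complex_of_real t) = W.ext (a o\<^sub>L dyn (Gam \<phi>) c t b)" for t
      unfolding dyn_eq[OF A(2)] left(1) S.F_def by (simp add: cis_conv_exp mult.assoc)
    have "exp (\<i> * (complex_of_real t + \<i> * complex_of_real \<beta>) * complex_of_real (c g)) = exp (- \<beta> * c g) *\<^sub>R cis (t * c g)" for t g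
    proof -
      have "\<i> * (complex_of_real t + \<i> * complex_of_real \<beta>) * complex_of_real (c g) = complex_of_real (- \<beta> * c g) + \<i> * complex_of_real (t * c g)"
        by (simp add: algebra_simps)
      then show ?thesis by (simp only: exp_add cis_conv_exp exp_of_real[symmetric] scaleR_conv_of_real)
    qed
    then show "S.F (complex_of_real t + \<i> * complex_of_real \<beta>) = W.ext (dyn (Gam \<phi>) c t b o\<^sub>L a)" for t
      unfolding dyn_eq[OF A(2)] right' S.F_def by simp
  qed
qed

lemma KMS_mw: "KMS_weight CA (dyn (Gam \<phi>) c) \<beta> mw"
  unfolding KMS_weight_def
proof (intro conjI ballI)
  show "weight_invariant CA (dyn (Gam \<phi>) c) mw" by (rule mw_invariant[OF lh_measure_axioms])
qed (use proper_mw[OF nonzero] KMS_condition in auto)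

lemma gauge_invariant_mw: "weight_invariant CA (dyn (Gam \<phi>) gauge_cocycle) mw"
proof -
  interpret G: lh_cocycle \<phi> gauge_cocycle by unfold_locales (rule gauge_hom)
  show ?thesis by (rule G.mw_invariant[OF lh_measure_axioms])
qed

end

section \<open>From KMS weights to conformal measures\<close>

text \<open>The linear extension is not norm continuous, but compression by an element of
  \<open>weight_N\<close> makes it so: Cauchy-Schwarz for \<open>h\<close> and \<open>z h\<close>
  with \<open>z\<close> normalized.\<close>

lemma (in cstar_weight) ext_compress_bound:
  assumes h: "h \<in> \<N>" and y: "y \<in> A"
  shows "cmod (ext (op_adj h o\<^sub>L (y o\<^sub>L h))) \<le> norm y * val (op_adj h o\<^sub>L h)"
proof (cases "norm y = 0")
  case True
  then have "op_adj h o\<^sub>L (y o\<^sub>L h) = 0"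
    by (simp add: bounded_bilinear.zero_left[OF bounded_bilinear_blinfun_compose] bounded_bilinear.zero_right[OF bounded_bilinear_blinfun_compose])
  then show ?thesis using True by (simp add: ext_zero)
next
  case False
  define z where "z = inverse (norm y) *\<^sub>R y"
  have z: "z \<in> A" "norm z = 1" "y = norm y *\<^sub>R z" using False y by (auto simp: z_def scaleR_A)
  have zh: "z o\<^sub>L h \<in> \<N>" by (rule weight_N_left[OF z(1) h])
  have "sq (z o\<^sub>L h) \<le> sq h" using sq_left[OF z(1) weight_N_A[OF h]] z(2) by simp
  then have "val (op_adj (z o\<^sub>L h) o\<^sub>L (z o\<^sub>L h)) \<le> val (op_adj h o\<^sub>L h)"
    using h unfolding weight_N_iff sq_def val_def by (intro enn2real_mono) auto
  then have 1: "cmod (ext (op_adj h o\<^sub>L (z o\<^sub>L h))) \<le> val (op_adj h o\<^sub>L h)" using ext_bound[OF h zh] by simp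
  have "op_adj h o\<^sub>L (y o\<^sub>L h) = norm y *\<^sub>R (op_adj h o\<^sub>L (z o\<^sub>L h))"
    by (subst z(3)) (simp add: bounded_bilinear.scaleR_left[OF bounded_bilinear_blinfun_compose] bounded_bilinear.scaleR_right[OF bounded_bilinear_blinfun_compose])
  then have "ext (op_adj h o\<^sub>L (y o\<^sub>L h)) = norm y * ext (op_adj h o\<^sub>L (z o\<^sub>L h))"
    using ext_scaleR[OF weight_M_ops(5)[OF h zh], of "norm y"] by simp
  then show ?thesis using mult_left_mono[OF 1 norm_ge_zero[of y]] by (simp add: norm_mult)
qed

lemma (in cstar_weight) ext_compress_tendsto:
  assumes h: "h \<in> \<N>" and y: "\<And>n::nat. y n \<in> A" "y \<longlonglongrightarrow> x"
  shows "(\<lambda>n. ext (op_adj h o\<^sub>L (y n o\<^sub>L h))) \<longlonglongrightarrow> ext (op_adj h o\<^sub>L (x o\<^sub>L h))"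
proof -
  have x: "x \<in> A" by (rule limit_A[OF y])
  have M: "w \<in> A \<Longrightarrow> op_adj h o\<^sub>L (w o\<^sub>L h) \<in> \<M>" for w by (rule weight_M_ops(5)[OF h weight_N_left[OF _ h]])
  have lim: "(\<lambda>n. norm (y n - x) * val (op_adj h o\<^sub>L h)) \<longlonglongrightarrow> 0"
    using tendsto_mult_left_zero[OF tendsto_norm_zero[OF y(2)[THEN LIM_zero]]] by blast
  have bd: "norm (ext (op_adj h o\<^sub>L (y n o\<^sub>L h)) - ext (op_adj h o\<^sub>L (x o\<^sub>L h))) \<le> norm (y n - x) * val (op_adj h o\<^sub>L h)" for n
    using ext_compress_bound[OF h diff_A[OF y(1)[of n] x]] ext_diff[OF M[OF y(1)[of n]] M[OF x]]
    by (simp add: bounded_bilinear.diff_left[OF bounded_bilinear_blinfun_compose] bounded_bilinear.diff_right[OF bounded_bilinear_blinfun_compose])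
  have "(\<lambda>n. ext (op_adj h o\<^sub>L (y n o\<^sub>L h)) - ext (op_adj h o\<^sub>L (x o\<^sub>L h))) \<longlonglongrightarrow> 0"
    by (rule Lim_null_comparison[OF _ lim]) (use bd in simp)
  then show ?thesis by (rule LIM_zero_cancel)
qed

text \<open>A bump function equal to 1 on the ranges and sources of the support acts as a two-sided
  unit for \<open>f\<close>.\<close>

lemma (in lh_space) CG_cut:
  assumes f: "f \<in> CG"
  obtains v where "v \<in> Cpos" "mop v o\<^sub>L lam f = lam f" "lam f o\<^sub>L mop v = lam f"
proof -
  obtain K where K: "compactin T K" "\<And>g. g \<notin> K \<Longrightarrow> f g = 0" using f by (auto simp: CG_iff)
  have cK: "compact (rg ` K \<union> sg ` K)"
    by (intro compact_Un compact_image_T[OF K(1)] continuous_rg continuous_sg)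
  obtain v :: "'x \<Rightarrow> real" and L where v: "continuous_on UNIV v" "\<And>x. 0 \<le> v x" "\<And>x. v x \<le> 1" "\<And>x. x \<in> rg ` K \<union> sg ` K \<Longrightarrow> v x = 1"
    "compact L" "L \<subseteq> UNIV" "\<And>x. x \<notin> L \<Longrightarrow> v x = 0" by (rule bump_X[OF cK open_UNIV subset_UNIV]) (rule that)
  have vC: "v \<in> Cpos" using v by (auto simp: Cpos_def)
  have l: "lam f \<in> CA" "v \<in> Cu" by (auto intro: lam_CA f Cpos_Cu vC)
  have e: "v (rg g) = 1 \<and> v (sg g) = 1 \<or> f g = 0" for g using v(4) K(2)[of g] by blast
  show thesis
  proof (rule that[OF vC])
    show "mop v o\<^sub>L lam f = lam f"
      by (rule jf_eqI) (use l e in \<open>auto intro: CA.compose_A mop_CA simp: jf_mop_left jf_lam f simp del: split_paired_All\<close>)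
    show "lam f o\<^sub>L mop v = lam f"
      by (rule jf_eqI) (use l e in \<open>auto intro: CA.compose_A mop_CA simp: jf_mop_right jf_lam f simp del: split_paired_All\<close>)
  qed
qed

section \<open>The measure of a KMS weight\<close>

locale lh_kms = lh_cocycle \<phi> c
  for \<phi> :: "'x::{t2_space, second_countable_topology} \<Rightarrow> 'x" and c :: "'x arrow \<Rightarrow> real" +
  fixes \<psi> :: "'x arrow l2op \<Rightarrow> ennreal" and \<beta> :: real
  assumes kms: "KMS_weight CA (dyn (Gam \<phi>) c) \<beta> \<psi>"
    and gauge: "weight_invariant CA (dyn (Gam \<phi>) gauge_cocycle) \<psi>"
begin

sublocale K: kms_weight CA "dyn (Gam \<phi>) c" \<psi> \<beta>
proof -
  interpret A: cstar_action CA "dyn (Gam \<phi>) c" by (rule cstar_action_dyn)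
  show "kms_weight CA (dyn (Gam \<phi>) c) \<psi> \<beta>"
    by unfold_locales (use kms in \<open>auto simp: KMS_weight_def\<close>)
qed

sublocale G: lh_cocycle \<phi> gauge_cocycle by unfold_locales (rule gauge_hom)

sublocale GW: invariant_weight CA "dyn (Gam \<phi>) gauge_cocycle" \<psi>
proof -
  interpret A: cstar_action CA "dyn (Gam \<phi>) gauge_cocycle" by (rule G.cstar_action_dyn)
  show "invariant_weight CA (dyn (Gam \<phi>) gauge_cocycle) \<psi>" by unfold_locales (rule gauge)
qed

text \<open>The cocycle vanishes on the units, where these functions live.\<close>

lemma mop_fixed: assumes "v \<in> Cu" shows "dyn (Gam \<phi>) c t (mop v) = mop v"
  unfolding dyn_eq[OF mop_CA[OF assms]]
proof (rule jf_eqI)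
  fix g
  have "c g = 0" if "g \<in> U0" using that units_iff[of g] c_unit by metis
  then show "jf (act t (mop v)) g = jf (mop v) g"
    unfolding jf_act[OF mop_CA[OF assms]] jf_mop[OF assms] by (auto simp: uf_def)
qed (auto intro: act_CA mop_CA assms)

text \<open>A second bump function that is 1 on the support of \<open>v\<close> plays the part of
  \<open>h\<close> in the smearing argument.\<close>

lemma mop_N: assumes v: "v \<in> Cu" shows "mop v \<in> K.\<N>"
proof -
  obtain w where w: "w \<in> Cpos" "mop w o\<^sub>L mop v = mop v" "mop v o\<^sub>L mop w = mop v" by (rule CG_cut[OF uf_CG[OF v]]) (rule that)
  show ?thesis
    by (rule K.fixed_in_N[OF mop_CA[OF v] mop_fixed[OF v] mop_pos[OF w(1)] mop_fixed[OF Cpos_Cu[OF w(1)]] w(3,2)])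
qed

lemma mop_FP: assumes "v \<in> Cpos" shows "mop v \<in> K.FP"
  using K.FP_adj_mult[OF mop_N[OF Cpos_Cu[OF Cu_sqrt(1)[OF assms]]]] Cu_sqrt(2)[OF assms] mop_adj[OF Cpos_Cu[OF Cu_sqrt(1)[OF assms]]]
  by simp

lemma lam_N: assumes "f \<in> CG" shows "lam f \<in> K.\<N>" "op_adj (lam f) \<in> K.\<N>" "lam f \<in> K.\<M>"
proof -
  have *: "lam f \<in> K.\<N> \<and> lam f \<in> K.\<M>" if f: "f \<in> CG" for f
  proof -
    obtain w where w: "w \<in> Cpos" "mop w o\<^sub>L lam f = lam f" "lam f o\<^sub>L mop w = lam f" by (rule CG_cut[OF f]) (rule that)
    have wN: "mop w \<in> K.\<N>" by (rule mop_N[OF Cpos_Cu[OF w(1)]])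
    have lN: "lam f \<in> K.\<N>" using K.weight_N_left[OF lam_CA[OF f] wN] w(3) by simp
    show ?thesis using lN K.weight_M_ops(5)[OF wN lN] w(2) mop_adj[OF Cpos_Cu[OF w(1)]] by simp
  qed
  show "lam f \<in> K.\<N>" "lam f \<in> K.\<M>" using *[OF assms] by auto
  have "op_adj (lam f) = lam (\<lambda>g. cnj (f (ginverse g)))" by (rule CA.op_adj_eq[OF lam_CA[OF assms] is_adj_lam[OF assms]])
  then show "op_adj (lam f) \<in> K.\<N>" using *[OF CG_star[OF assms]] by simp
qed

definition \<Lambda> :: "('x \<Rightarrow> real) \<Rightarrow> real" where "\<Lambda> v = K.val (mop v)"

sublocale R: positive_functional \<Lambda>
proof unfold_locales
  show "locally_compact_space (euclidean :: 'x topology)" by (rule lc)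
  show "0 \<le> \<Lambda> f" for f by (simp add: \<Lambda>_def K.val_ops)
  show "\<Lambda> (\<lambda>x. f x + g x) = \<Lambda> f + \<Lambda> g" if fg: "f \<in> Cpos" "g \<in> Cpos" for f g
  proof -
    have "uf (\<lambda>x. f x + g x) = (\<lambda>x. uf f x + uf g x)" by (auto simp: uf_def)
    then have "mop (\<lambda>x. f x + g x) = mop f + mop g"
      using lam_simps(1)[OF uf_CG[OF Cpos_Cu[OF fg(1)]] uf_CG[OF Cpos_Cu[OF fg(2)]]] by simp
    then show ?thesis using K.val_ops(2)[OF mop_FP[OF fg(1)] mop_FP[OF fg(2)]] by (simp add: \<Lambda>_def)
  qed
  show "\<Lambda> (\<lambda>x. r * f x) = r * \<Lambda> f" if f: "f \<in> Cpos" "0 \<le> r" for f r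
  proof -
    have "uf (\<lambda>x. r * f x) = (\<lambda>g. complex_of_real r * uf f g)" by (auto simp: uf_def)
    then have "mop (\<lambda>x. r * f x) = r *\<^sub>R mop f"
      using lam_simps(2)[OF uf_CG[OF Cpos_Cu[OF f(1)]], of "complex_of_real r"] by (simp add: K.scaleR_eq_op_scale)
    then show ?thesis using K.val_ops(3)[OF mop_FP[OF f(1)] f(2)] by (simp add: \<Lambda>_def)
  qed
qed

abbreviation "mu \<equiv> R.riesz"

sublocale lh_cocycle_measure \<phi> c mu by unfold_locales (rule R.regular_riesz)

text \<open>The property that the linear extension only depends on the restriction to the units. It
  passes to finite sums, hence can be verified on the pieces of a decomposition.\<close>

definition Punit :: "('x arrow \<Rightarrow> complex) \<Rightarrow> bool" where
  "Punit f \<longleftrightarrow> f \<in> CG \<and> K.ext (lam f) = (\<integral>x. f (unit_arrow x) \<partial>mu)"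

lemma integrable_unit: assumes f: "f \<in> CG" shows "integrable mu (\<lambda>x. f (unit_arrow x))"
proof -
  obtain M where M: "0 \<le> M" "\<And>g. cmod (f g) \<le> M" by (rule CG_bounded[OF f]) (rule that)
  obtain K where K: "compactin T K" "\<And>g. g \<notin> K \<Longrightarrow> f g = 0" using f by (auto simp: CG_iff)
  have C: "compact (sg ` K)" by (rule compact_image_T[OF K(1) continuous_sg])
  have 0: "f (unit_arrow x) = 0" if "x \<notin> sg ` K" for x using that K(2)[of "unit_arrow x"] by force
  have s: "sg ` K \<in> sets mu" using compact_imp_closed[OF C] by simp
  show ?thesis
  proof (rule Bochner_Integration.integrable_bound)
    show "integrable mu (\<lambda>x. M * indicator (sg ` K) x)"
      using s emeasure_compact[OF C] by (intro integrable_mult_right integrable_real_indicator) auto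
    show "(\<lambda>x. f (unit_arrow x)) \<in> borel_measurable mu"
      using continuous_on_unit_CG[OF f] by (simp add: measurable_m borel_measurable_continuous_onI)
    show "AE x in mu. norm (f (unit_arrow x)) \<le> norm (M * indicator (sg ` K) x)"
    proof (rule AE_I2)
      fix x show "norm (f (unit_arrow x)) \<le> norm (M * indicator (sg ` K) x)"
        using 0[of x] M by (cases "x \<in> sg ` K") auto
    qed
  qed
qed

lemma Punit_sum: assumes "\<And>i. i \<in> I \<Longrightarrow> Punit (f i)" shows "Punit (\<lambda>g. \<Sum>i\<in>I. f i g)"
proof -
  have f: "f i \<in> CG" "K.ext (lam (f i)) = (\<integral>x. f i (unit_arrow x) \<partial>mu)" if "i \<in> I" for i
    using assms[OF that] by (auto simp: Punit_def)
  have "K.ext (lam (\<lambda>g. \<Sum>i\<in>I. f i g)) = (\<Sum>i\<in>I. K.ext (lam (f i)))"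
    using lam_sum[of I f] K.ext_sum[of I "\<lambda>i. lam (f i)"] f lam_N(3) by simp
  also have "\<dots> = (\<integral>x. (\<Sum>i\<in>I. f i (unit_arrow x)) \<partial>mu)"
    using f integrable_unit by (simp add: Bochner_Integration.integral_sum)
  finally show ?thesis using CG_sum[of I f] f by (simp add: Punit_def)
qed

lemma Punit_lin: assumes "Punit f" "Punit g" shows "Punit (\<lambda>x. f x + z * g x)"
proof -
  have fg: "f \<in> CG" "g \<in> CG" "(\<lambda>x. z * g x) \<in> CG" using assms by (auto simp: Punit_def CG_scale)
  have "K.ext (lam (\<lambda>x. f x + z * g x)) = K.ext (lam f) + z * K.ext (lam g)"
    using lam_simps(1)[OF fg(1,3)] lam_simps(2)[OF fg(2), of z] K.ext_add[OF lam_N(3)[OF fg(1)] lam_N(3)[OF fg(3)]] K.ext_scale[OF lam_N(3)[OF fg(2)], of z]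
    by simp
  then show ?thesis using assms CG_add[OF fg(1,3)] integrable_unit[OF fg(1)] integrable_unit[OF fg(2)] by (simp add: Punit_def)
qed

lemma Punit_Cpos: assumes v: "v \<in> Cpos" shows "Punit (uf v)"
proof -
  have v0: "\<And>x. 0 \<le> v x" "continuous_on UNIV v" using v by (auto simp: Cpos_def)
  have "(\<integral>x. v x \<partial>mu) = enn2real (\<integral>\<^sup>+x. ennreal (v x) \<partial>mu)"
    by (rule integral_eq_nn_integral) (use v0 in \<open>auto simp: measurable_m intro: borel_measurable_continuous_onI\<close>)
  then have 1: "(\<integral>x. v x \<partial>mu) = \<Lambda> v" using R.integral_riesz[OF v] R.nonneg[OF v] by simp
  have i: "integrable mu v"
    using integrable_Re[OF integrable_unit[OF uf_CG[OF Cpos_Cu[OF v]]]] by simp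
  have "(\<integral>x. complex_of_real (v x) \<partial>mu) = complex_of_real (\<Lambda> v)" unfolding 1[symmetric] by (rule integral_of_real[OF i])
  then show ?thesis using K.ext_FP[OF mop_FP[OF v]] uf_CG[OF Cpos_Cu[OF v]] by (simp add: Punit_def \<Lambda>_def)
qed

lemma Punit_Cu: assumes v: "v \<in> Cu" shows "Punit (uf v)"
proof -
  obtain K where K: "compact K" "\<And>x. x \<notin> K \<Longrightarrow> v x = 0" and c: "continuous_on UNIV v" using v by (auto simp: Cu_def)
  have p: "(\<lambda>x. max 0 (v x)) \<in> Cpos" "(\<lambda>x. max 0 (- v x)) \<in> Cpos"
    unfolding Cpos_def using K c by (auto intro!: continuous_intros exI[of _ K])
  have "uf v = (\<lambda>g. uf (\<lambda>x. max 0 (v x)) g + (- 1) * uf (\<lambda>x. max 0 (- v x)) g)" by (auto simp: uf_def fun_eq_iff max_def)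
  then show ?thesis using Punit_lin[OF Punit_Cpos[OF p(1)] Punit_Cpos[OF p(2)], of "- 1"] by simp
qed

lemma Punit_units: assumes f: "supp_in f U0" shows "Punit f"
proof -
  have fC: "f \<in> CG" by (rule supp_in_CG[OF f])
  obtain K where K: "compactin T K" "K \<subseteq> U0" "\<And>g. g \<notin> K \<Longrightarrow> f g = 0" using f by (auto simp: supp_in_def)
  have C: "compact (sg ` K)" by (rule compact_image_T[OF K(1) continuous_sg])
  have 0: "f (unit_arrow x) = 0" if "x \<notin> sg ` K" for x using that K(3)[of "unit_arrow x"] by force
  define v w where "v x = Re (f (unit_arrow x))" and "w x = Im (f (unit_arrow x))" for x
  have vw: "v \<in> Cu" "w \<in> Cu" unfolding Cu_def v_def w_def
    using 0 C continuous_on_unit_CG[OF fC] by (auto intro!: continuous_intros exI[of _ "sg ` K"])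
  have "f g = uf v g + \<i> * uf w g" for g
  proof (cases "g \<in> U0")
    case True
    then have "g = unit_arrow (sg g)" by (simp only: units_iff)
    then have "f g = f (unit_arrow (sg g))" by simp
    then show ?thesis using True by (simp add: uf_def v_def w_def complex_eq)
  next
    case False
    then have "g \<notin> K" using K(2) by blast
    then show ?thesis using K(3)[of g] False by (simp add: uf_def)
  qed
  then have "f = (\<lambda>g. uf v g + \<i> * uf w g)" by blast
  then show ?thesis using Punit_lin[OF Punit_Cu[OF vw(1)] Punit_Cu[OF vw(2)], of \<i>] by simp
qed

text \<open>The gauge action at time \<open>\<pi> / k\<close> changes the sign of a function living in degree \<open>k\<close>.\<close>

lemma Punit_degree: assumes f: "f \<in> CG" and k: "k \<noteq> 0" "\<And>g. f g \<noteq> 0 \<Longrightarrow> kg g = k" shows "Punit f"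
proof -
  let ?t = "pi / real_of_int k"
  have "cis (?t * gauge_cocycle g) * f g = - 1 * f g" for g
    using k(2)[of g] k(1) by (cases "f g = 0") (auto simp: gauge_cocycle_def case_prod_beta)
  then have "(\<lambda>g. cis (?t * gauge_cocycle g) * f g) = (\<lambda>g. - 1 * f g)" by blast
  then have "dyn (Gam \<phi>) gauge_cocycle ?t (lam f) = op_scale (- 1) (lam f)"
    using G.dyn_eq[OF lam_CA[OF f], of ?t] G.lam_act(2)[OF f, of ?t] lam_simps(2)[OF f, of "- 1"] by simp
  then have "K.ext (lam f) = - K.ext (lam f)"
    using GW.act_ext(2)[OF lam_N(3)[OF f], of ?t] K.ext_scale[OF lam_N(3)[OF f], of "- 1"] by simp
  then have "K.ext (lam f) = 0" by simp
  moreover have "f (unit_arrow x) = 0" for x using k(1) k(2)[of "unit_arrow x"] by auto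
  ultimately show ?thesis using f by (simp add: Punit_def)
qed

lemma Punit_disjoint: assumes W: "bisection W" "rg ` W \<inter> sg ` W = {}" and f: "supp_in f W" shows "Punit f"
proof -
  have fC: "f \<in> CG" by (rule supp_in_CG[OF f])
  obtain K where K: "compactin T K" "K \<subseteq> W" "\<And>g. g \<notin> K \<Longrightarrow> f g = 0" using f by (auto simp: supp_in_def)
  have C: "compact (rg ` K)" by (rule compact_image_T[OF K(1) continuous_rg])
  have o: "open (rg ` W)" using W(1) bisection_iff open_rg_image by blast
  obtain v :: "'x \<Rightarrow> real" and L where v: "continuous_on UNIV v" "\<And>x. 0 \<le> v x" "\<And>x. v x \<le> 1" "\<And>x. x \<in> rg ` K \<Longrightarrow> v x = 1"
    "compact L" "L \<subseteq> rg ` W" "\<And>x. x \<notin> L \<Longrightarrow> v x = 0" by (rule bump_X[OF C o image_mono[OF K(2)]]) (rule that)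
  have vC: "v \<in> Cu" unfolding Cu_def using v(1,5,7) by blast
  have l: "lam f \<in> CA" by (rule lam_CA[OF fC])
  have left: "mop v o\<^sub>L lam f = lam f"
  proof (rule jf_eqI)
    show "jf (mop v o\<^sub>L lam f) g = jf (lam f) g" for g
      unfolding jf_mop_left[OF vC l] jf_lam[OF fC] using v(4)[of "rg g"] K(3)[of g] by (cases "g \<in> K") auto
  qed (intro CA.compose_A mop_CA vC l)+
  have right: "lam f o\<^sub>L mop v = 0"
  proof (rule jf_eqI)
    show "jf (lam f o\<^sub>L mop v) g = jf 0 g" for g
    proof (cases "g \<in> K")
      case True
      \<comment> \<open>The bump function \<open>v\<close> is carried by ranges of \<open>W\<close>,
        which no source of \<open>W\<close> meets.\<close>
      then have "sg g \<notin> L" using K(2) v(6) W(2) by blast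
      then show ?thesis unfolding jf_mop_right[OF vC l] using v(7) by (simp add: jf_def ent_simps)
    next
      case False
      then show ?thesis unfolding jf_mop_right[OF vC l] jf_lam[OF fC] using K(3) by (simp add: jf_def ent_simps)
    qed
  qed (intro CA.compose_A mop_CA vC l CA.zero_A)+
  have "K.ext (lam f o\<^sub>L mop v) = K.ext (mop v o\<^sub>L lam f)"
    by (rule K.fixed_commute) (use mop_adj[OF vC] in \<open>simp_all add: lam_N fC mop_N vC mop_fixed\<close>)
  then have "K.ext (lam f) = 0" by (simp add: left right K.ext_zero)
  moreover have "f (unit_arrow x) = 0" for x
  proof (rule ccontr)
    assume "f (unit_arrow x) \<noteq> 0"
    then have "unit_arrow x \<in> W" using K(2,3) by blast
    then show False using W(2) by force
  qed
  ultimately show ?thesis using fC by (simp add: Punit_def)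
qed

definition \<W> :: "'x arrow set set" where
  "\<W> = {W. W \<subseteq> U0 \<or> (\<exists>k. k \<noteq> 0 \<and> (\<forall>g\<in>W. kg g = k)) \<or> rg ` W \<inter> sg ` W = {}}"

text \<open>The three cases are exhaustive because an arrow of degree 0 with equal range and source
  is a unit; distinct range and source are separated by the Hausdorff property.\<close>

lemma cover: assumes g: "g \<in> \<Gamma>" shows "\<exists>W\<in>\<W>. bisection W \<and> g \<in> W"
proof -
  obtain W where W: "bisection W" "g \<in> W" using bisection_exists[OF g] by blast
  have oW: "openin T W" using W bisection_iff by blast
  have top: "topspace T = \<Gamma>" by (rule topspace_Gam_top)
  consider "kg g \<noteq> 0" | "kg g = 0" "rg g = sg g" | "rg g \<noteq> sg g" by blast
  then show ?thesis
  proof cases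
    case 1
    have "openin T {h \<in> \<Gamma>. kg h \<in> {kg g}}"
      using openin_continuous_map_preimage[OF continuous_kg, of "{kg g}"] by (simp add: top open_discrete)
    then have "openin T (W \<inter> {h \<in> \<Gamma>. kg h \<in> {kg g}})" using oW by (intro openin_Int)
    then have "bisection (W \<inter> {h \<in> \<Gamma>. kg h \<in> {kg g}})" using W bisection_subset by blast
    moreover have "W \<inter> {h \<in> \<Gamma>. kg h \<in> {kg g}} \<in> \<W>" using 1 by (auto simp: \<W>_def)
    ultimately show ?thesis using W g by blast
  next
    case 2
    then have "g = unit_arrow (sg g)" by (intro arrow_eqI) auto
    then have "g \<in> U0" by (simp only: units_iff)
    then show ?thesis using bisection_units by (intro bexI[of _ U0]) (auto simp: \<W>_def)
  next
    case 3
    from hausdorff[OF this] obtain A B where AB: "open A" "open B" "rg g \<in> A" "sg g \<in> B" "A \<inter> B = {}" by (elim exE conjE)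
    have "openin T {h \<in> \<Gamma>. rg h \<in> A}" "openin T {h \<in> \<Gamma>. sg h \<in> B}"
      using openin_continuous_map_preimage[OF continuous_rg, of A] openin_continuous_map_preimage[OF continuous_sg, of B] AB by (simp_all add: top)
    then have "openin T (W \<inter> ({h \<in> \<Gamma>. rg h \<in> A} \<inter> {h \<in> \<Gamma>. sg h \<in> B}))" using oW by (intro openin_Int)
    then have bV: "bisection (W \<inter> ({h \<in> \<Gamma>. rg h \<in> A} \<inter> {h \<in> \<Gamma>. sg h \<in> B}))" using W bisection_subset by blast
    have "V \<in> \<W>" if V: "V = W \<inter> ({h \<in> \<Gamma>. rg h \<in> A} \<inter> {h \<in> \<Gamma>. sg h \<in> B})" for V
    proof -
      have "rg ` V \<subseteq> A" "sg ` V \<subseteq> B" unfolding V by auto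
      then have "rg ` V \<inter> sg ` V = {}" using AB(5) by blast
      then show ?thesis by (simp add: \<W>_def)
    qed
    from this[OF refl] have "W \<inter> ({h \<in> \<Gamma>. rg h \<in> A} \<inter> {h \<in> \<Gamma>. sg h \<in> B}) \<in> \<W>" .
    moreover have "g \<in> W \<inter> ({h \<in> \<Gamma>. rg h \<in> A} \<inter> {h \<in> \<Gamma>. sg h \<in> B})" using W(2) g AB(3,4) by simp
    ultimately show ?thesis using bV by (intro bexI conjI)
  qed
qed

lemma ext_lam: assumes f: "f \<in> CG" shows "K.ext (lam f) = (\<integral>x. f (unit_arrow x) \<partial>mu)"
proof -
  obtain F :: "'x arrow set" and f' where F: "finite F" "f = (\<lambda>g. \<Sum>i\<in>F. f' i g)"
    "\<And>i. i \<in> F \<Longrightarrow> \<exists>W\<in>\<W>. bisection W \<and> supp_in (f' i) W" by (rule Cc_decompose[OF f cover]) (assumption, rule that)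
  have "Punit (f' i)" if i: "i \<in> F" for i
  proof -
    obtain W where W: "W \<in> \<W>" "bisection W" "supp_in (f' i) W" using F(3)[OF i] by blast
    have off: "f' i g \<noteq> 0 \<Longrightarrow> g \<in> W" for g using W(3) unfolding supp_in_def by blast
    consider "W \<subseteq> U0" | k where "k \<noteq> 0" "\<forall>g\<in>W. kg g = k" | "rg ` W \<inter> sg ` W = {}" using W(1) by (auto simp: \<W>_def)
    then show ?thesis
    proof cases
      case 1
      then have "supp_in (f' i) U0" using W(3) unfolding supp_in_def by blast
      then show ?thesis by (rule Punit_units)
    next
      case 2
      show ?thesis by (rule Punit_degree[OF supp_in_CG[OF W(3)] 2(1)]) (use 2(2) off in blast)
    next
      case 3
      then show ?thesis by (rule Punit_disjoint[OF W(2) _ W(3)])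
    qed
  qed
  then have "Punit f" unfolding F(2) by (rule Punit_sum)
  then show ?thesis by (simp add: Punit_def)
qed

text \<open>Knowing the linear extension on \<open>lam F\<close> does not show that the weight
  itself is finite there. Once it is, the extension agrees with the weight and
  \<open>ext_lam\<close> applies.\<close>

lemma psi_lam: assumes F: "F \<in> CG" "lam F \<in> pos_cone CA" shows "\<psi> (lam F) = mw (lam F)"
proof -
  have fin: "\<psi> (lam F) < \<infinity>"
  proof -
    obtain v where v: "v \<in> Cpos" "mop v o\<^sub>L lam F = lam F" "lam F o\<^sub>L mop v = lam F" by (rule CG_cut[OF F(1)]) (rule that)
    obtain b where b: "lam F = op_adj b o\<^sub>L b" "b \<in> CA" using F(2) by (auto simp: pos_cone_def)
    have vN: "mop v \<in> K.\<N>" "mop v \<in> CA" using mop_N[OF Cpos_Cu[OF v(1)]] mop_CA[OF Cpos_Cu[OF v(1)]] .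
    have bv: "b o\<^sub>L mop v \<in> K.\<N>" by (rule K.weight_N_left[OF b(2) vN(1)])
    \<comment> \<open>With \<open>v\<close> equal to 1 on ranges and sources of the support,
      \<open>lam F\<close> is the square of \<open>b v\<close>, and \<open>b v\<close> lies in the
      left ideal since \<open>mop v\<close> does.\<close>
    have "op_adj (b o\<^sub>L mop v) o\<^sub>L (b o\<^sub>L mop v) = mop v o\<^sub>L ((op_adj b o\<^sub>L b) o\<^sub>L mop v)"
      using CA.op_adj_simps(7)[OF b(2) vN(2)] mop_adj[OF Cpos_Cu[OF v(1)]] by (simp add: blinfun_compose_assoc)
    also have "\<dots> = lam F" unfolding b(1)[symmetric] v(3) v(2) ..
    finally show ?thesis using bv by (simp add: weight_N_def)
  qed
  then have FP: "lam F \<in> K.FP" using F(2) by (simp add: K.FP_def)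
  have i: "integrable mu (\<lambda>x. Re (F (unit_arrow x)))" by (rule integrable_Re[OF integrable_unit[OF F(1)]])
  have nn: "0 \<le> Re (F (unit_arrow x))" for x using Re_jf_pos[OF F(2), of x] by (simp add: jf_lam F(1))
  have "K.val (lam F) = Re (\<integral>x. F (unit_arrow x) \<partial>mu)" using ext_lam[OF F(1)] K.ext_FP[OF FP] Re_complex_of_real[of "K.val (lam F)"] by simp
  also have "\<dots> = (\<integral>x. Re (F (unit_arrow x)) \<partial>mu)" by (rule integral_Re[OF integrable_unit[OF F(1)], symmetric])
  finally have "ennreal (K.val (lam F)) = (\<integral>\<^sup>+x. ennreal (Re (F (unit_arrow x))) \<partial>mu)"
    using nn_integral_eq_integral[OF i] nn by simp
  then show ?thesis using K.FP_D(3)[OF FP] F by (simp add: mw_def jf_lam)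
qed

lemma lam_square: assumes "f \<in> CG" obtains F where "F \<in> CG" "op_adj (lam f) o\<^sub>L lam f = lam F" "lam F \<in> pos_cone CA"
proof -
  have a: "op_adj (lam f) = lam (\<lambda>g. cnj (f (ginverse g)))" by (rule CA.op_adj_eq[OF lam_CA[OF assms] is_adj_lam[OF assms]])
  obtain F where F: "F \<in> CG" "lam (\<lambda>g. cnj (f (ginverse g))) o\<^sub>L lam f = lam F"
    by (rule lam_compose[OF CG_star[OF assms] assms]) (rule that)
  then show thesis using that[OF F(1)] CA.adj_mult_pos[OF lam_CA[OF assms]] by (simp add: a)
qed

lemma psi_square: assumes "f \<in> CG" shows "\<psi> (op_adj (lam f) o\<^sub>L lam f) = mw (op_adj (lam f) o\<^sub>L lam f)"
proof -
  obtain F where "F \<in> CG" "op_adj (lam f) o\<^sub>L lam f = lam F" "lam F \<in> pos_cone CA" by (rule lam_square[OF assms]) (rule that)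
  then show ?thesis using psi_lam by simp
qed

text \<open>If the measure were zero, \<open>\<psi>\<close> would vanish on squares of compactly
  supported functions, and by lower semicontinuity on all squares, contrary to properness.\<close>

lemma mu_nonzero: "emeasure mu UNIV \<noteq> 0"
proof
  assume 0: "emeasure mu UNIV = 0"
  have z: "K.sq (lam f) = 0" if "f \<in> CG" for f
  proof -
    have "AE x in mu. False" by (rule AE_I[of _ _ UNIV]) (use 0 in auto)
    then have "mw (op_adj (lam f) o\<^sub>L lam f) = 0"
      using CA.adj_mult_pos[OF lam_CA[OF that]] nn_integral_cong_AE[of _ "\<lambda>_. 0" mu]
      by (simp add: mw_def) (metis (mono_tags, lifting) eventually_mono nn_integral_0_iff_AE)
    then show ?thesis using psi_square[OF that] by (simp add: K.sq_def)
  qed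
  have "\<psi> a = 0" if a: "a \<in> pos_cone CA" for a
  proof -
    obtain b where b: "a = op_adj b o\<^sub>L b" "b \<in> CA" using a by (auto simp: pos_cone_def)
    obtain f where f: "\<And>n::nat. f n \<in> CG" "(\<lambda>n. lam (f n)) \<longlonglongrightarrow> b" by (rule CA_approx[OF b(2)]) (rule that)
    have "K.sq b \<le> ennreal 0" by (rule K.sq_lsc[OF lam_CA[OF f(1)] f(2)]) (use z f in auto)
    then show ?thesis by (simp add: K.sq_def b(1))
  qed
  moreover have "\<exists>a\<in>pos_cone CA. \<psi> a \<noteq> 0" using K.proper by (simp add: proper_weight_def)
  ultimately show False by blast
qed

sublocale lh_weight \<phi> mu by unfold_locales (rule mu_nonzero)

end

section \<open>Conformality of the measure and recovery of the weight\<close>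

context lh_kms
begin

lemma lam_N_mw: assumes "f \<in> CG" shows "lam f \<in> W.\<N>"
  using CG_square_finite[OF assms] mw_sq[OF lam_CA[OF assms]] lam_CA[OF assms]
  by (simp add: weight_N_def jf_lam assms)

lemma val_agree: assumes "f \<in> CG" shows "W.val (op_adj (lam f) o\<^sub>L lam f) = K.val (op_adj (lam f) o\<^sub>L lam f)"
  using psi_square[OF assms] by (simp add: W.val_def K.val_def)

text \<open>The two weights agree on squares of compactly supported functions, which form a linear
  space; polarization gives their products.\<close>

lemma ext_agree_prod:
  assumes f: "f \<in> CG" "f' \<in> CG"
  shows "W.ext (op_adj (lam f) o\<^sub>L lam f') = K.ext (op_adj (lam f) o\<^sub>L lam f')"
proof -
  have lin: "\<exists>q\<in>CG. lam f + op_scale z (lam f') = lam q" for z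
    using lam_simps(1)[OF f(1) CG_scale[OF f(2)], of z] lam_simps(2)[OF f(2), of z] CG_add[OF f(1) CG_scale[OF f(2)], of z] by metis
  have "W.val (op_adj (lam f + op_scale z (lam f')) o\<^sub>L (lam f + op_scale z (lam f'))) =
      K.val (op_adj (lam f + op_scale z (lam f')) o\<^sub>L (lam f + op_scale z (lam f')))" for z
    using lin[of z] val_agree by auto
  note v = this[of 1] this[of "- 1"] this[of \<i>] this[of "- \<i>"]
  have s: "op_scale 1 (lam f') = lam f'" "lam f + op_scale (- 1) (lam f') = lam f - lam f'"
    "lam f + op_scale (- \<i>) (lam f') = lam f - op_scale \<i> (lam f')"
    by (auto intro!: blinfun_eqI l2_eqI simp: op_apply l2_rep)
  have "4 * W.ext (op_adj (lam f) o\<^sub>L lam f') = 4 * K.ext (op_adj (lam f) o\<^sub>L lam f')"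
    unfolding W.ext_polar[OF lam_N_mw[OF f(1)] lam_N_mw[OF f(2)]] K.ext_polar[OF lam_N(1)[OF f(1)] lam_N(1)[OF f(2)]]
    by (simp only: v[unfolded s])
  then show ?thesis by simp
qed

lemma ext_prod:
  assumes f: "f \<in> CG" "f' \<in> CG"
  shows "K.ext (op_adj (lam f) o\<^sub>L lam f') = (\<integral>g. cnj (f g) * f' g \<partial>\<nu>)" "integrable \<nu> (\<lambda>g. cnj (f g) * f' g)"
  using ext_eq[OF lam_N_mw[OF f(1)] lam_N_mw[OF f(2)]] by (simp_all add: ext_agree_prod[OF f] jf_lam f)

lemma square_integrable: assumes "f \<in> CG" shows "integrable \<nu> (\<lambda>g. (cmod (f g))\<^sup>2)"
  using lam_N_mw[OF assms] by (simp add: N_iff jf_lam assms)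

lemma star_adj: "f \<in> CG \<Longrightarrow> op_adj (lam f) = lam (\<lambda>g. cnj (f (ginverse g)))"
  by (rule CA.op_adj_eq[OF lam_CA is_adj_lam])

text \<open>On the real axis the KMS function of \<open>op_adj (lam f)\<close> and
  \<open>lam f\<close> is an explicit Fourier-Laplace integral. Both are continuous on the strip and
  holomorphic inside, so they also agree at \<open>\<i> * \<beta>\<close>, where one is the value in
  reverse order and the other carries the factor \<open>exp (- \<beta> * c g)\<close>.\<close>

lemma kms_square:
  assumes f: "f \<in> CG"
  shows "integrable \<nu> (\<lambda>g. exp (- \<beta> * c g) * (cmod (f g))\<^sup>2)"
    "(\<integral>g. exp (- \<beta> * c g) * (cmod (f g))\<^sup>2 \<partial>\<nu>) = (\<integral>g. (cmod (f (ginverse g)))\<^sup>2 \<partial>\<nu>)"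
proof -
  \<comment> \<open>Multiplication by the square root of the exponential factor preserves compact
    support, so integrability on the far edge is the square-integrability of another compactly
    supported function.\<close>
  have "continuous_map T euclidean (\<lambda>g. complex_of_real (exp (- \<beta> * c g / 2)))"
    by (rule continuous_map_compose[OF continuous_c, of euclidean "\<lambda>y. complex_of_real (exp (- \<beta> * y / 2))", unfolded comp_def])
      (auto intro!: continuous_intros)
  from CG_mult(1)[OF f this] have "integrable \<nu> (\<lambda>g. (cmod (complex_of_real (exp (- \<beta> * c g / 2)) * f g))\<^sup>2)"
    by (rule square_integrable)
  moreover have "(cmod (complex_of_real (exp (- \<beta> * c g / 2)) * f g))\<^sup>2 = exp (- \<beta> * c g) * (cmod (f g))\<^sup>2" for g
    by (simp add: norm_mult power_mult_distrib exp_double[symmetric])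
  ultimately show i: "integrable \<nu> (\<lambda>g. exp (- \<beta> * c g) * (cmod (f g))\<^sup>2)" by simp
  let ?h = "\<lambda>g. complex_of_real ((cmod (f g))\<^sup>2)"
  interpret S: strip_integrand \<nu> ?h c \<beta>
  proof
    show "c \<in> borel_measurable \<nu>" using c_MG by (simp add: measurable_nu)
    show "integrable \<nu> ?h" by (rule integrable_of_real[OF square_integrable[OF f]])
    show "integrable \<nu> (\<lambda>g. exp (- \<beta> * c g) *\<^sub>R ?h g)"
      using integrable_of_real[OF i, where 'a = complex] by (simp add: scaleR_conv_of_real)
  qed
  have fs: "(\<lambda>g. cnj (f (ginverse g))) \<in> CG" by (rule CG_star[OF f])
  obtain F where F: "continuous_on (strip \<beta>) F" "bounded (F ` strip \<beta>)" "F holomorphic_on interior (strip \<beta>)"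
    "\<And>t. F (complex_of_real t) = K.ext (op_adj (lam f) o\<^sub>L dyn (Gam \<phi>) c t (lam f))"
    "\<And>t. F (complex_of_real t + \<i> * complex_of_real \<beta>) = K.ext (dyn (Gam \<phi>) c t (lam f) o\<^sub>L op_adj (lam f))"
    by (rule K.kms_function[of "op_adj (lam f)" "lam f"])
      (use lam_N[OF f] CA.op_adj_simps(1)[OF lam_CA[OF f]] that in auto)
  have "F (complex_of_real t) = S.F (complex_of_real t)" for t
  proof -
    have "F (complex_of_real t) = K.ext (op_adj (lam f) o\<^sub>L lam (\<lambda>g. cis (t * c g) * f g))"
      unfolding F(4) dyn_eq[OF lam_CA[OF f]] lam_act(2)[OF f] ..
    also have "\<dots> = (\<integral>g. cnj (f g) * (cis (t * c g) * f g) \<partial>\<nu>)" by (rule ext_prod(1)[OF f lam_act(1)[OF f]])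
    also have "\<dots> = S.F (complex_of_real t)" unfolding S.F_def
      by (rule Bochner_Integration.integral_cong[OF refl])
        (simp add: cis_conv_exp complex_norm_square mult.assoc mult.commute mult.left_commute del: of_real_power)
    finally show ?thesis .
  qed
  then have "F (complex_of_real 0 + \<i> * complex_of_real \<beta>) = S.F (complex_of_real 0 + \<i> * complex_of_real \<beta>)"
    by (rule strip_unique[OF F(1,3) S.continuous S.holomorphic _ strip_shift])
  also have "S.F (complex_of_real 0 + \<i> * complex_of_real \<beta>) = (\<integral>g. complex_of_real (exp (- \<beta> * c g) * (cmod (f g))\<^sup>2) \<partial>\<nu>)"
    unfolding S.F_def
  proof (rule Bochner_Integration.integral_cong[OF refl])
    fix g
    have "\<i> * (complex_of_real 0 + \<i> * complex_of_real \<beta>) * complex_of_real (c g) = complex_of_real (- \<beta> * c g)"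
      by (simp add: algebra_simps)
    then show "complex_of_real ((cmod (f g))\<^sup>2) * exp (\<i> * (complex_of_real 0 + \<i> * complex_of_real \<beta>) * complex_of_real (c g))
        = complex_of_real (exp (- \<beta> * c g) * (cmod (f g))\<^sup>2)"
      by (simp only: exp_of_real) simp
  qed
  also have "\<dots> = complex_of_real (\<integral>g. exp (- \<beta> * c g) * (cmod (f g))\<^sup>2 \<partial>\<nu>)" by (rule integral_of_real[OF i])
  finally have 1: "F (complex_of_real 0 + \<i> * complex_of_real \<beta>) = complex_of_real (\<integral>g. exp (- \<beta> * c g) * (cmod (f g))\<^sup>2 \<partial>\<nu>)" .
  have "F (complex_of_real 0 + \<i> * complex_of_real \<beta>) = K.ext (lam f o\<^sub>L op_adj (lam f))"
    unfolding F(5) using lam_act(2)[OF f, of 0] dyn_eq[OF lam_CA[OF f], of 0] by simp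
  also have "lam f o\<^sub>L op_adj (lam f) = op_adj (lam (\<lambda>g. cnj (f (ginverse g)))) o\<^sub>L lam (\<lambda>g. cnj (f (ginverse g)))"
    unfolding star_adj[OF f, symmetric] CA.op_adj_simps(1)[OF lam_CA[OF f]] ..
  also have "K.ext \<dots> = (\<integral>g. cnj (cnj (f (ginverse g))) * cnj (f (ginverse g)) \<partial>\<nu>)" by (rule ext_prod(1)[OF fs fs])
  also have "\<dots> = (\<integral>g. complex_of_real ((cmod (f (ginverse g)))\<^sup>2) \<partial>\<nu>)"
    by (simp add: complex_norm_square del: of_real_power)
  also have "\<dots> = complex_of_real (\<integral>g. (cmod (f (ginverse g)))\<^sup>2 \<partial>\<nu>)"
    using integral_of_real[OF square_integrable[OF fs], where 'a = complex] by simp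
  finally show "(\<integral>g. exp (- \<beta> * c g) * (cmod (f g))\<^sup>2 \<partial>\<nu>) = (\<integral>g. (cmod (f (ginverse g)))\<^sup>2 \<partial>\<nu>)"
    unfolding 1 of_real_eq_iff .
qed

lemma inv_nu_square:
  assumes f: "f \<in> CG"
  shows "(\<integral>\<^sup>+g. ennreal ((cmod (f g))\<^sup>2) \<partial>inv_nu \<beta>) = (\<integral>\<^sup>+g. ennreal ((cmod (f g))\<^sup>2) \<partial>\<nu>)"
proof -
  have fs: "(\<lambda>g. cnj (f (ginverse g))) \<in> CG" by (rule CG_star[OF f])
  have m: "(\<lambda>g. ennreal ((cmod (f g))\<^sup>2)) \<in> borel_measurable MG"
    using square_integrable[OF f] by (auto simp: measurable_nu[symmetric] dest!: borel_measurable_integrable)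
  have "(\<integral>\<^sup>+g. ennreal ((cmod (f g))\<^sup>2) \<partial>inv_nu \<beta>) = (\<integral>\<^sup>+g. ennreal (exp (- \<beta> * c g) * (cmod (cnj (f (ginverse g))))\<^sup>2) \<partial>\<nu>)"
    unfolding nn_integral_inv[OF m] by (simp add: ennreal_mult)
  also have "\<dots> = ennreal (\<integral>g. exp (- \<beta> * c g) * (cmod (cnj (f (ginverse g))))\<^sup>2 \<partial>\<nu>)"
    by (rule nn_integral_eq_integral[OF kms_square(1)[OF fs]]) simp
  also have "\<dots> = ennreal (\<integral>g. (cmod (f g))\<^sup>2 \<partial>\<nu>)" unfolding kms_square(2)[OF fs] by simp
  also have "\<dots> = (\<integral>\<^sup>+g. ennreal ((cmod (f g))\<^sup>2) \<partial>\<nu>)"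
    by (rule nn_integral_eq_integral[OF square_integrable[OF f], symmetric]) simp
  finally show ?thesis .
qed

text \<open>Lifted bump functions on a bisection have squares increasing to its indicator, so the
  equality for squares passes to masses by monotone convergence.\<close>

lemma nu_eq_inv_nu: "\<nu> = inv_nu \<beta>"
proof (rule measure_eq_bisections)
  show "sets (inv_nu \<beta>) = sets MG" by (simp add: inv_nu_def)
  fix W assume W: "bisection W"
  then have o: "openin T W" using bisection_iff by blast
  have oW: "open (sg ` W)" by (rule open_sg_image[OF o])
  obtain h :: "nat \<Rightarrow> 'x \<Rightarrow> real" and L where h: "\<And>n. continuous_on UNIV (h n)" "\<And>n x. 0 \<le> h n x" "\<And>n x. h n x \<le> 1"
    "\<And>n. compact (L n)" "\<And>n. L n \<subseteq> sg ` W" "\<And>n x. x \<notin> L n \<Longrightarrow> h n x = 0" "\<And>n x. h n x \<le> h (Suc n) x"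
    "\<And>K. compact K \<Longrightarrow> K \<subseteq> sg ` W \<Longrightarrow> \<exists>n. \<forall>m\<ge>n. \<forall>x\<in>K. h m x = 1" by (rule exhausting_bumps[OF lc oW]) (rule that)
  define f where "f n g = (if g \<in> W then complex_of_real (h n (sg g)) else 0)" for n g
  have fC: "f n \<in> CG" for n
  proof -
    have c: "continuous_on UNIV (\<lambda>x. complex_of_real (h n x))" by (intro continuous_intros h(1))
    have z: "\<And>x. x \<notin> L n \<Longrightarrow> complex_of_real (h n x) = 0" using h(6) by simp
    show ?thesis unfolding CG_iff f_def[abs_def]
      using lift_function[OF W c h(4) h(5) z] by blast
  qed
  have m: "(\<lambda>g. ennreal ((cmod (f n g))\<^sup>2)) \<in> borel_measurable MG" for n
    using square_integrable[OF fC] by (auto simp: measurable_nu[symmetric] dest!: borel_measurable_integrable)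
  have inc: "incseq (\<lambda>n g. ennreal ((cmod (f n g))\<^sup>2))"
    by (rule incseq_SucI) (auto simp: le_fun_def f_def h(2,7) intro!: ennreal_leI power_mono)
  have sup: "(SUP n. ennreal ((cmod (f n g))\<^sup>2)) = indicator W g" for g
  proof (cases "g \<in> W")
    case True
    obtain n where n: "h n (sg g) = 1" using h(8)[of "{sg g}"] True by auto
    have "ennreal ((cmod (f k g))\<^sup>2) \<le> 1" for k
      using True h(2,3) by (simp add: f_def power_le_one ennreal_le_1 abs_square_le_1)
    moreover have "ennreal ((cmod (f n g))\<^sup>2) = 1" using True n by (simp add: f_def)
    ultimately have "(SUP n. ennreal ((cmod (f n g))\<^sup>2)) = 1" by (intro antisym SUP_least SUP_upper2[of n]) auto
    then show ?thesis using True by simp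
  qed (simp add: f_def)
  have conv: "(SUP n. \<integral>\<^sup>+g. ennreal ((cmod (f n g))\<^sup>2) \<partial>M) = emeasure M W" if M: "sets M = sets MG" for M
  proof -
    have mm: "(\<lambda>g. ennreal ((cmod (f n g))\<^sup>2)) \<in> borel_measurable M" for n using m measurable_cong_sets[OF M refl] by blast
    have "emeasure M W = (\<integral>\<^sup>+g. indicator W g \<partial>M)" using open_MG[OF o] M by simp
    also have "\<dots> = (\<integral>\<^sup>+g. (SUP n. ennreal ((cmod (f n g))\<^sup>2)) \<partial>M)" by (simp only: sup)
    also have "\<dots> = (SUP n. \<integral>\<^sup>+g. ennreal ((cmod (f n g))\<^sup>2) \<partial>M)" by (rule nn_integral_monotone_convergence_SUP[OF inc mm])
    finally show ?thesis by simp
  qed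
  have "emeasure \<nu> W = (SUP n. \<integral>\<^sup>+g. ennreal ((cmod (f n g))\<^sup>2) \<partial>\<nu>)" by (rule conv[symmetric]) simp
  also have "\<dots> = (SUP n. \<integral>\<^sup>+g. ennreal ((cmod (f n g))\<^sup>2) \<partial>inv_nu \<beta>)" by (simp only: inv_nu_square[OF fC])
  also have "\<dots> = emeasure (inv_nu \<beta>) W" by (rule conv) (simp add: inv_nu_def)
  finally show "emeasure \<nu> W = emeasure (inv_nu \<beta>) W" .
qed

lemma conformal_mu: "conformal_measure (Gam \<phi>) c \<beta> mu"
  using conformal_iff mu_nonzero nu_eq_inv_nu by blast

text \<open>Both sides are norm continuous in \<open>y\<close> thanks to the compression, and they
  agree on compactly supported functions.\<close>

lemma ext_compress_agree:
  assumes v: "v \<in> Cu" and y: "y \<in> CA"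
  shows "W.ext (op_adj (mop v) o\<^sub>L (y o\<^sub>L mop v)) = K.ext (op_adj (mop v) o\<^sub>L (y o\<^sub>L mop v))"
proof -
  obtain f where f: "\<And>n::nat. f n \<in> CG" "(\<lambda>n. lam (f n)) \<longlonglongrightarrow> y" by (rule CA_approx[OF y]) (rule that)
  have lC: "lam (f n) \<in> CA" for n by (rule lam_CA[OF f(1)])
  have "W.ext (op_adj (mop v) o\<^sub>L (lam (f n) o\<^sub>L mop v)) = K.ext (op_adj (mop v) o\<^sub>L (lam (f n) o\<^sub>L mop v))" for n
  proof -
    obtain F where "F \<in> CG" "lam (f n) o\<^sub>L mop v = lam F" by (rule lam_compose[OF f(1) uf_CG[OF v]]) (rule that)
    then show ?thesis using ext_agree_prod[OF uf_CG[OF v]] by simp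
  qed
  then have "(\<lambda>n. K.ext (op_adj (mop v) o\<^sub>L (lam (f n) o\<^sub>L mop v))) \<longlonglongrightarrow> W.ext (op_adj (mop v) o\<^sub>L (y o\<^sub>L mop v))"
    using W.ext_compress_tendsto[OF lam_N_mw[OF uf_CG[OF v]] lC f(2)] by simp
  then show ?thesis using K.ext_compress_tendsto[OF mop_N[OF v] lC f(2)] LIMSEQ_unique by blast
qed

lemma compress_square:
  assumes "v \<in> Cu" "b \<in> CA"
  shows "op_adj (b o\<^sub>L mop v) o\<^sub>L (b o\<^sub>L mop v) = op_adj (mop v) o\<^sub>L ((op_adj b o\<^sub>L b) o\<^sub>L mop v)"
  using CA.op_adj_simps(7)[OF assms(2) mop_CA[OF assms(1)]] by (simp add: blinfun_compose_assoc)

text \<open>The compressed element is a square of an element in the left ideals of both weights, so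
  both values are finite and are given by the linear extensions.\<close>

lemma psi_compress:
  assumes v: "v \<in> Cu" and a: "a \<in> pos_cone CA"
  shows "op_adj (mop v) o\<^sub>L (a o\<^sub>L mop v) \<in> pos_cone CA" "\<psi> (op_adj (mop v) o\<^sub>L (a o\<^sub>L mop v)) = mw (op_adj (mop v) o\<^sub>L (a o\<^sub>L mop v))"
proof -
  obtain b where b: "a = op_adj b o\<^sub>L b" "b \<in> CA" using a by (auto simp: pos_cone_def)
  let ?x = "op_adj (mop v) o\<^sub>L (a o\<^sub>L mop v)"
  have x: "?x = op_adj (b o\<^sub>L mop v) o\<^sub>L (b o\<^sub>L mop v)" unfolding compress_square[OF v b(2)] b(1) ..
  show "?x \<in> pos_cone CA" unfolding x by (rule CA.adj_mult_pos[OF CA.compose_A[OF b(2) mop_CA[OF v]]])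
  have KF: "?x \<in> K.FP" unfolding x by (rule K.FP_adj_mult[OF K.weight_N_left[OF b(2) mop_N[OF v]]])
  have WF: "?x \<in> W.FP" unfolding x by (rule W.FP_adj_mult[OF W.weight_N_left[OF b(2) lam_N_mw[OF uf_CG[OF v]]]])
  have "complex_of_real (K.val ?x) = complex_of_real (W.val ?x)"
    using K.ext_FP[OF KF] W.ext_FP[OF WF] ext_compress_agree[OF v CA.pos_A[OF a]] by simp
  then have "K.val ?x = W.val ?x" by (simp only: of_real_eq_iff)
  then show "\<psi> ?x = mw ?x" unfolding K.FP_D(3)[OF KF] W.FP_D(3)[OF WF] by simp
qed

text \<open>At a unit, compression multiplies the coefficient by the square of \<open>v\<close>,
  which is at most 1.\<close>

lemma mw_compress_le:
  assumes v: "v \<in> Cu" "\<And>x. \<bar>v x\<bar> \<le> 1" and a: "a \<in> pos_cone CA"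
  shows "mw (op_adj (mop v) o\<^sub>L (a o\<^sub>L mop v)) \<le> mw a"
proof -
  have aC: "a \<in> CA" by (rule CA.pos_A[OF a])
  have am: "a o\<^sub>L mop v \<in> CA" by (rule CA.compose_A[OF aC mop_CA[OF v(1)]])
  have "Re (jf (op_adj (mop v) o\<^sub>L (a o\<^sub>L mop v)) (unit_arrow x)) \<le> Re (jf a (unit_arrow x))" for x
  proof -
    have "Re (jf (op_adj (mop v) o\<^sub>L (a o\<^sub>L mop v)) (unit_arrow x)) = (v x)\<^sup>2 * Re (jf a (unit_arrow x))"
      unfolding mop_adj[OF v(1)] jf_mop_left[OF v(1) am] jf_mop_right[OF v(1) aC] by (simp add: power2_eq_square)
    also have "\<dots> \<le> 1 * Re (jf a (unit_arrow x))"
      by (rule mult_right_mono) (use v(2)[of x] Re_jf_pos[OF a] in \<open>simp_all add: abs_square_le_1\<close>)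
    finally show ?thesis by simp
  qed
  then show ?thesis using psi_compress(1)[OF v(1) a] a by (auto simp: mw_def intro!: nn_integral_mono ennreal_leI)
qed

text \<open>The compression inequality concerns roots whose adjoint also has finite seminorm. The
  root \<open>b\<close> need not be of this kind, but \<open>mop (h n) b\<close> is; lower
  semicontinuity removes \<open>h n\<close> afterwards.\<close>

lemma psi_compress_le:
  assumes v: "v \<in> Cpos" "\<And>x. v x \<le> 1" and a: "a \<in> pos_cone CA" "\<psi> a < \<infinity>"
  shows "\<psi> (op_adj (mop v) o\<^sub>L (a o\<^sub>L mop v)) \<le> \<psi> a"
proof -
  obtain b where b: "a = op_adj b o\<^sub>L b" "b \<in> CA" using a(1) by (auto simp: pos_cone_def)
  have bN: "b \<in> K.\<N>" using a(2) b by (simp add: weight_N_def)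
  have v0: "0 \<le> v x" for x using v(1) by (simp add: Cpos_def)
  have vC: "v \<in> Cu" by (rule Cpos_Cu[OF v(1)])
  have v2: "v x * v x \<le> v x" for x using mult_left_le[of "v x" "v x"] v(2) v0 by simp
  \<comment> \<open>As \<open>v\<close> takes values in the unit interval, \<open>v - v * v\<close>
    is nonnegative; its root provides the fixed element required by
    \<open>fixed_compress_le\<close>.\<close>
  define u where "u x = sqrt (v x - v x * v x)" for x
  have d: "(\<lambda>x. v x - v x * v x) \<in> Cpos"
    using Cu_diff[OF vC Cu_mult[OF vC vC]] v2 by (simp add: Cu_def Cpos_def)
  have uC: "u \<in> Cu" "mop u o\<^sub>L mop u = mop v - (mop v o\<^sub>L mop v)"
    using Cpos_Cu[OF Cu_sqrt(1)[OF d]] Cu_sqrt(2)[OF d]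
    unfolding u_def[abs_def] mop_compose[OF vC vC] mop_diff[OF vC Cu_mult[OF vC vC]] .
  obtain h :: "nat \<Rightarrow> 'x \<Rightarrow> real" where h: "\<And>n. h n \<in> Cpos" "\<And>n x. 0 \<le> h n x" "\<And>n x. h n x \<le> 1"
    "\<And>a. a \<in> CA \<Longrightarrow> (\<lambda>n. mop (h n) o\<^sub>L a) \<longlonglongrightarrow> a" "\<And>a. a \<in> CA \<Longrightarrow> (\<lambda>n. a o\<^sub>L mop (h n)) \<longlonglongrightarrow> a"
    by (rule exhausting_mops) (rule that)
  have hC: "h n \<in> Cu" "mop (h n) \<in> CA" for n using Cpos_Cu[OF h(1)] mop_CA[OF Cpos_Cu[OF h(1)]] .
  let ?b = "\<lambda>n. mop (h n) o\<^sub>L b"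
  have bA: "?b n \<in> CA" for n by (rule CA.compose_A[OF hC(2) b(2)])
  have bound: "K.sq (?b n o\<^sub>L mop v) \<le> \<psi> a" for n
  proof -
    have 1: "?b n \<in> K.\<N>" by (rule K.weight_N_left[OF hC(2) bN])
    have "op_adj (?b n) = op_adj b o\<^sub>L mop (h n)" using CA.op_adj_simps(7)[OF hC(2) b(2)] mop_adj[OF hC(1)] by simp
    then have 2: "op_adj (?b n) \<in> K.\<N>" using K.weight_N_left[OF CA.op_adj_A[OF b(2)] mop_N[OF hC(1)]] by simp
    have "\<psi> (mop v o\<^sub>L ((op_adj (?b n) o\<^sub>L ?b n) o\<^sub>L mop v)) \<le> \<psi> (op_adj (?b n) o\<^sub>L ?b n)"
      by (rule K.fixed_compress_le[OF 1 2 mop_N[OF vC] mop_adj[OF vC] mop_fixed[OF vC] mop_N[OF uC(1)] mop_adj[OF uC(1)] mop_fixed[OF uC(1)] uC(2)])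
    then have "K.sq (?b n o\<^sub>L mop v) \<le> K.sq (?b n)"
      unfolding K.sq_def compress_square[OF vC bA] mop_adj[OF vC] .
    also have "\<dots> \<le> ennreal ((norm (mop (h n)))\<^sup>2) * K.sq b" by (rule K.sq_left[OF hC(2) b(2)])
    also have "\<dots> \<le> 1 * K.sq b"
      using norm_mop[OF hC(1)] h(2,3) by (intro mult_right_mono) (auto simp: ennreal_le_1 power_le_one)
    finally show ?thesis by (simp add: K.sq_def b(1))
  qed
  have "K.sq (b o\<^sub>L mop v) \<le> ennreal (enn2real (\<psi> a))"
  proof (rule K.sq_lsc[of "\<lambda>n. ?b n o\<^sub>L mop v"])
    show "(\<lambda>n. ?b n o\<^sub>L mop v) \<longlonglongrightarrow> (b o\<^sub>L mop v)"
      by (rule bounded_bilinear.tendsto[OF bounded_bilinear_blinfun_compose h(4)[OF b(2)] tendsto_const])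
  qed (use bound a(2) CA.compose_A[OF bA mop_CA[OF vC]] in auto)
  then show ?thesis using a(2) unfolding K.sq_def compress_square[OF vC b(2)] b(1)[symmetric] by simp
qed

lemma psi_eq_mw: "\<psi> = mw"
proof (rule extensionalityI[of _ "pos_cone CA"])
  show "\<psi> \<in> extensional (pos_cone CA)" using K.proper by (simp add: proper_weight_def weight_def)
  show "mw \<in> extensional (pos_cone CA)" by (simp add: mw_def)
  fix a assume a: "a \<in> pos_cone CA"
  obtain h :: "nat \<Rightarrow> 'x \<Rightarrow> real" where h: "\<And>n. h n \<in> Cpos" "\<And>n x. 0 \<le> h n x" "\<And>n x. h n x \<le> 1"
    "\<And>a. a \<in> CA \<Longrightarrow> (\<lambda>n. mop (h n) o\<^sub>L a) \<longlonglongrightarrow> a" "\<And>a. a \<in> CA \<Longrightarrow> (\<lambda>n. a o\<^sub>L mop (h n)) \<longlonglongrightarrow> a"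
    by (rule exhausting_mops) (rule that)
  have hC: "h n \<in> Cu" for n by (rule Cpos_Cu[OF h(1)])
  obtain b where b: "a = op_adj b o\<^sub>L b" "b \<in> CA" using a by (auto simp: pos_cone_def)
  let ?a = "\<lambda>n. op_adj (mop (h n)) o\<^sub>L (a o\<^sub>L mop (h n))"
  have P: "?a n \<in> pos_cone CA" for n by (rule psi_compress(1)[OF hC a])
  have lim: "?a \<longlonglongrightarrow> a"
  proof -
    have x: "(\<lambda>n. b o\<^sub>L mop (h n)) \<longlonglongrightarrow> b" by (rule h(5)[OF b(2)])
    have "(\<lambda>n. op_adj (b o\<^sub>L mop (h n)) o\<^sub>L (b o\<^sub>L mop (h n))) \<longlonglongrightarrow> (op_adj b o\<^sub>L b)"
      by (rule bounded_bilinear.tendsto[OF bounded_bilinear_blinfun_compose CA.op_adj_tendsto[OF _ x] x])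
        (rule CA.compose_A[OF b(2) mop_CA[OF hC]])
    then show ?thesis unfolding compress_square[OF hC b(2)] b(1)[symmetric] .
  qed
  show "\<psi> a = mw a"
  proof (rule antisym)
    \<comment> \<open>Lower semicontinuity of \<open>\<psi>\<close> along the compressions, whose
      weights are bounded by \<open>mw a\<close>.\<close>
    show "\<psi> a \<le> mw a"
    proof (cases "mw a = \<infinity>")
      case False
      then have r: "mw a = ennreal (enn2real (mw a))" by (simp add: less_top)
      have bd: "\<psi> (?a n) \<le> ennreal (enn2real (mw a))" for n
        unfolding psi_compress(2)[OF hC a] r[symmetric] by (rule mw_compress_le[OF hC _ a]) (use h(2,3) in simp)
      have "\<psi> a \<le> ennreal (enn2real (mw a))" by (rule K.psi_lsc[OF P lim bd]) simp
      then show ?thesis using r by simp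
    qed simp
    \<comment> \<open>The same with the roles exchanged: Fatou's lemma for \<open>mw\<close>, and
      the inequality coming from the KMS condition.\<close>
    show "mw a \<le> \<psi> a"
    proof (cases "\<psi> a = \<infinity>")
      case False
      have "mw (?a n) \<le> \<psi> a" for n
        unfolding psi_compress(2)[OF hC a, symmetric] by (rule psi_compress_le[OF h(1,3) a]) (use False in \<open>simp add: less_top\<close>)
      then show ?thesis by (rule mw_lsc[OF P lim])
    qed simp
  qed
qed

end

section \<open>The bijection\<close>

text \<open>The weight determines the integrals of compactly supported functions; an increasing
  exhaustion gives the measures of open sets, and outer regularity those of all Borel sets.\<close>

lemma (in lh_space) mw_inject:
  assumes m1: "lh_measure \<phi> m1" and m2: "lh_measure \<phi> m2" and eq: "lh_measure.mw \<phi> m1 = lh_measure.mw \<phi> m2"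
  shows "m1 = m2"
proof -
  interpret M1: lh_measure \<phi> m1 by (rule m1)
  interpret M2: lh_measure \<phi> m2 by (rule m2)
  have int: "(\<integral>\<^sup>+x. ennreal (v x) \<partial>m1) = (\<integral>\<^sup>+x. ennreal (v x) \<partial>m2)" if "v \<in> Cpos" for v
    using M1.mw_mop[OF that] M2.mw_mop[OF that] eq by simp
  have op: "emeasure m1 U = emeasure m2 U" if U: "open U" for U
  proof -
    obtain h :: "nat \<Rightarrow> 'x \<Rightarrow> real" and L where h: "\<And>n. continuous_on UNIV (h n)" "\<And>n x. 0 \<le> h n x" "\<And>n x. h n x \<le> 1"
      "\<And>n. compact (L n)" "\<And>n. L n \<subseteq> U" "\<And>n x. x \<notin> L n \<Longrightarrow> h n x = 0" "\<And>n x. h n x \<le> h (Suc n) x"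
      "\<And>K. compact K \<Longrightarrow> K \<subseteq> U \<Longrightarrow> \<exists>n. \<forall>m\<ge>n. \<forall>x\<in>K. h m x = 1" by (rule exhausting_bumps[OF lc U]) (rule that)
    have hC: "h n \<in> Cpos" for n unfolding Cpos_def by (intro CollectI conjI allI exI[of _ "L n"] impI h(1,2,4,6))
    have inc: "incseq (\<lambda>n x. ennreal (h n x))" by (rule incseq_SucI) (auto simp: le_fun_def h(7) intro!: ennreal_leI)
    have sup: "(SUP n. ennreal (h n x)) = indicator U x" for x
    proof (cases "x \<in> U")
      case True
      obtain n where n: "h n x = 1" using h(8)[of "{x}"] True by auto
      have "(SUP n. ennreal (h n x)) = 1"
        using h(3)[of _ x] n by (intro antisym SUP_least SUP_upper2[of n]) (auto simp: ennreal_le_1)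
      then show ?thesis using True by simp
    next
      case False
      then have "h n x = 0" for n using h(5,6) by blast
      then show ?thesis using False by simp
    qed
    have conv: "(SUP n. \<integral>\<^sup>+x. ennreal (h n x) \<partial>M) = emeasure M U" if M: "sets M = sets borel" for M
    proof -
      have "(\<lambda>x. ennreal (h n x)) \<in> borel_measurable borel" for n
        using borel_measurable_continuous_onI[OF h(1)] by measurable
      then have mm: "(\<lambda>x. ennreal (h n x)) \<in> borel_measurable M" for n using measurable_cong_sets[OF M refl] by blast
      have "emeasure M U = (\<integral>\<^sup>+x. indicator U x \<partial>M)" using U M by simp
      also have "\<dots> = (\<integral>\<^sup>+x. (SUP n. ennreal (h n x)) \<partial>M)" by (simp only: sup)
      also have "\<dots> = (SUP n. \<integral>\<^sup>+x. ennreal (h n x) \<partial>M)" by (rule nn_integral_monotone_convergence_SUP[OF inc mm])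
      finally show ?thesis by simp
    qed
    show ?thesis unfolding conv[OF M1.sets_m, symmetric] conv[OF M2.sets_m, symmetric] int[OF hC] ..
  qed
  show ?thesis
  proof (rule measure_eqI)
    fix B assume "B \<in> sets m1"
    then have B: "B \<in> sets borel" by simp
    show "emeasure m1 B = emeasure m2 B"
      unfolding M1.outer_regular[OF B] M2.outer_regular[OF B] by (intro INF_cong refl) (simp add: op)
  qed simp
qed

theorem proposition3p1:
  fixes \<phi> :: "'x::{t2_space, second_countable_topology} \<Rightarrow> 'x"
    and c :: "'x \<times> int \<times> 'x \<Rightarrow> real" and \<beta> :: real
  assumes "locally_compact_space (euclidean :: 'x topology)"
    and "local_homeo \<phi>"
    and "continuous_hom (Gam \<phi>) c"
  shows "bij_betw
    (\<lambda>m. \<lambda>a\<in>pos_cone (Cred (Gam \<phi>)). \<integral>\<^sup>+x. ennreal (Re (apply_bcontfun (cond_exp (Gam \<phi>) a) x)) \<partial>m)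
    {m. conformal_measure (Gam \<phi>) c \<beta> m}
    {\<psi>. KMS_weight (Cred (Gam \<phi>)) (dyn (Gam \<phi>) c) \<beta> \<psi> \<and>
        weight_invariant (Cred (Gam \<phi>)) (dyn (Gam \<phi>) gauge_cocycle) \<psi>}"
    (is "bij_betw ?\<Phi> ?C ?K")
proof -
  interpret lh_cocycle \<phi> c by unfold_locales (use assms in auto)
  have mu: "lh_measure \<phi> m" if "m \<in> ?C" for m
    by unfold_locales (use that in \<open>simp add: conformal_measure_def\<close>)
  have \<Phi>: "?\<Phi> m = lh_measure.mw \<phi> m" if "m \<in> ?C" for m
    by (rule lh_measure.mw_eq[OF mu[OF that], symmetric])
  show ?thesis
  proof (rule bij_betw_imageI)
    show "inj_on ?\<Phi> ?C"
      by (rule inj_onI) (use mw_inject mu \<Phi> in metis)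
    show "?\<Phi> ` ?C = ?K"
    proof (intro antisym subsetI)
      fix \<psi> assume "\<psi> \<in> ?\<Phi> ` ?C"
      then obtain m where m: "m \<in> ?C" "\<psi> = ?\<Phi> m" by blast
      interpret M: lh_conformal \<phi> c m \<beta>
        using mu[OF m(1)] m(1) by (simp add: lh_conformal_def lh_cocycle_measure_def lh_conformal_axioms_def lh_cocycle_axioms)
      show "\<psi> \<in> ?K" unfolding m(2) \<Phi>[OF m(1)] using M.KMS_mw M.gauge_invariant_mw by simp
    next
      fix \<psi> assume "\<psi> \<in> ?K"
      then interpret K: lh_kms \<phi> c \<psi> \<beta> by unfold_locales auto
      have C: "K.mu \<in> ?C" using K.conformal_mu by simp
      have "\<psi> = ?\<Phi> K.mu" unfolding \<Phi>[OF C] by (rule K.psi_eq_mw)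
      then show "\<psi> \<in> ?\<Phi> ` ?C" using C by (rule image_eqI)
    qed
  qed
qed

end
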